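(* Let $\mathcal{B}_{s}$ be the state-space system $\mathcal{B}_{s} = \lbrace (\mathbf{u}, \mathbf{y}, \mathbf{x}) \in \mathcal{L}_{2}^{\text{loc}}(\mathbb{R}, \mathbb{R}^{n}) \times \mathcal{L}_{2}^{\text{loc}}(\mathbb{R}, \mathbb{R}^{m}) \times \mathcal{L}_{2}^{\text{loc}}(\mathbb{R}, \mathbb{R}^{d}) \text{ such that } \tfrac{d\mathbf{x}}{dt} = A\mathbf{x} + B\mathbf{u} \text{ and } \mathbf{y} = C\mathbf{x} + D\mathbf{u}\rbrace$ with $A \in \mathbb{R}^{d \times d}$, $B \in \mathbb{R}^{d \times n}$, $C \in \mathbb{R}^{m \times d}$, $D \in \mathbb{R}^{m \times n}$, and let $\mathcal{B}_{s}^{(\mathbf{u},\mathbf{y})} \coloneqq \lbrace (\mathbf{u}, \mathbf{y}) \mid \exists \mathbf{x} \text{ such that } (\mathbf{u},\mathbf{y},\mathbf{x}) \in \mathcal{B}_{s}\rbrace$. For $\mathbf{x}_{0} \in \mathbb{R}^{d}$ let $S_{a}^{\sigma_{g}}(\mathbf{x}_{0})$ be the available storage, i.e., the supremum of $\int_{t_{0}}^{t_{1}}(\mathbf{y}^{T}\mathbf{y}-\mathbf{u}^{T}\mathbf{u})(t)dt$ over all $t_{1} \geq t_{0}$ and $(\mathbf{u}, \mathbf{y}, \mathbf{x}) \in \mathcal{B}_{s}$ with $\mathbf{x}(t_{0}) = \mathbf{x}_{0}$ (equal to $\infty$ if this set is unbounded above). Let $V_{o} \coloneqq \text{col}(C,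 CA, \ldots, CA^{d-1})$ and $\Lambda(X) \coloneqq \begin{bmatrix}-A^{T}X - XA-C^{T}C& -C^{T}D-XB\\ -D^{T}C-B^{T}X& I - D^{T}D\end{bmatrix}$. The following are equivalent: 1. $S_{a}^{\sigma_{g}}(\mathbf{x}_{0}) < \infty$ for all $\mathbf{x}_{0} \in \mathbb{R}^{d}$ (i.e., $\mathcal{B}_{s}$ is non-expansive). 2. The external behavior $\mathcal{B}_{s}^{(\mathbf{u}, \mathbf{y})}$ takes the form $\lbrace (\mathbf{u}, \mathbf{y}) \in \mathcal{L}_{2}^{\text{loc}}(\mathbb{R}, \mathbb{R}^{n}) \times \mathcal{L}_{2}^{\text{loc}}(\mathbb{R}, \mathbb{R}^{m}) \mid P(\tfrac{d}{dt})\mathbf{u} = Q(\tfrac{d}{dt})\mathbf{y} \rbrace$ for polynomial matrices $P \in \mathbb{R}^{m \times n}[\xi]$, $Q \in \mathbb{R}^{m \times m}[\xi]$, where $(P, Q)$ is a bounded-real pair. 3. There exists $X \in \mathbb{R}^{d \times d}_{s}$ such that $X \geq 0$ and $\Lambda(X) \geq 0$. 4. $S_{a}^{\sigma_{g}}(\mathbf{x}_{0}) = \mathbf{x}_{0}^{T}X_{-}\mathbf{x}_{0}$, where $X_{-} \in \mathbb{R}^{d \times d}_{s}$ satisfies (i) $X_{-} \geq 0$; (ii) $\Lambda(X_{-}) \geq 0$; (iii) if $\mathbf{z} \in \mathbb{R}^{d}$, then $V_{o}\mathbf{z} = 0 \iff X_{-}\mathbf{z} = 0$; and (iv) if $X \in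 \mathbb{R}^{d \times d}_{s}$ satisfies $X \geq 0$ and $\Lambda(X) \geq 0$, then $X_{-} \leq X$. Moreover, if $(C,A)$ is observable and conditions 1–4 hold, then (i) $\text{spec}(A) \in \mathbb{C}_{-}$; and (ii) if $X \in \mathbb{R}_{s}^{d \times d}$ satisfies $\Lambda(X) \geq 0$, then $X_{-} \leq X$.
   Context: $(P,Q)$ with $P \in \mathbb{R}^{m \times n}[\xi]$, $Q \in \mathbb{R}^{m \times m}[\xi]$ is a bounded-real pair if (a) $Q(\lambda)Q(\bar{\lambda})^{T} - P(\lambda)P(\bar{\lambda})^{T} \geq 0$ for all $\lambda \in \overline{\mathbb{C}}_{+}$; (b) $\text{rank}([P \;\; -Q](\lambda)) = m$ for all $\lambda \in \overline{\mathbb{C}}_{+}$; (c) if $\mathbf{p} \in \mathbb{R}^{m}[\xi]$ and $\lambda \in \mathbb{C}$ satisfy $\mathbf{p}^{T}(QQ^{\star} - PP^{\star}) = 0$ and $\mathbf{p}(\lambda)^{T}[P \;\; -Q](\lambda) = 0$, then $\mathbf{p}(\lambda) = 0$, where $Q^{\star}(\xi) \coloneqq Q(-\xi)^{T}$. $\mathbb{R}^{d\times d}_{s}$ denotes real symmetric matrices; $\mathbb{C}_{-}$ is the open left half-plane; $(C,A)$ observable means $\text{rank}(V_{o}) = d$. No controllability or observability assumptions are made in the equivalence. *)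

theory Defs
  imports "HOL-Analysis.Analysis" "HOL-Computational_Algebra.Polynomial"
begin

primrec matpow :: "'a::semiring_1^'n^'n \<Rightarrow> nat \<Rightarrow> 'a^'n^'n" where
  "matpow M 0 = mat 1"
| "matpow M (Suc k) = M ** matpow M k"

definition sym_mat :: "real^'n^'n \<Rightarrow> bool" where
  "sym_mat X \<longleftrightarrow> transpose X = X"

definition psd :: "real^'n^'n \<Rightarrow> bool" where
  "psd X \<longleftrightarrow> sym_mat X \<and> (\<forall>v. 0 \<le> v \<bullet> (X *v v))"

definition cpsd :: "complex^'n^'n \<Rightarrow> bool" where
  "cpsd M \<longleftrightarrow> (\<forall>v. let s = (\<Sum>i\<in>UNIV. \<Sum>j\<in>UNIV. cnj (v $ i) * M $ i $ j * v $ j)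
                    in Im s = 0 \<and> 0 \<le> Re s)"

definition Lambda ::
  "real^'d^'d \<Rightarrow> real^'n^'d \<Rightarrow> real^'d^'m \<Rightarrow> real^'n^'m \<Rightarrow> real^'d^'d
     \<Rightarrow> real^('d + 'n)^('d + 'n)" where
  "Lambda A B C D X = (\<chi> i j.
     (case i of
        Inl a \<Rightarrow> (case j of
                    Inl b \<Rightarrow> (- (transpose A ** X) - X ** A - transpose C ** C) $ a $ b
                  | Inr b \<Rightarrow> (- (transpose C ** D) - X ** B) $ a $ b)
      | Inr a \<Rightarrow> (case j of
                    Inl b \<Rightarrow> (- (transpose D ** C) - transpose B ** X) $ a $ b
                  | Inr b \<Rightarrow> (mat 1 - transpose D ** D) $ a $ b)))"

text \<open>An indexing of the finite type 'd by 0..d-1 (used to order the blocks of V_o;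
  the rank of V_o does not depend on this ordering).\<close>
definition idx :: "'d::finite \<Rightarrow> nat" where
  "idx = (SOME f. bij_betw f (UNIV::'d set) {..<CARD('d)})"

definition Vo :: "real^'d^'d \<Rightarrow> real^'d^'m \<Rightarrow> real^'d^('d \<times> 'm)" where
  "Vo A C = (\<chi> r j. (C ** matpow A (idx (fst r))) $ snd r $ j)"

definition observable :: "real^'d^'m \<Rightarrow> real^'d^'d \<Rightarrow> bool" where
  "observable C A \<longleftrightarrow> rank (Vo A C) = CARD('d)"

definition spec :: "real^'d^'d \<Rightarrow> complex set" where
  "spec A = {c. \<exists>v::complex^'d. v \<noteq> 0 \<and> map_matrix complex_of_real A *v v = c *s v}"

definition L2loc :: "(real \<Rightarrow> 'a::euclidean_space) \<Rightarrow> bool" where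
  "L2loc f \<longleftrightarrow> f \<in> borel_measurable lborel \<and>
     (\<forall>a b. set_integrable lborel {a..b} (\<lambda>t. (norm (f t))\<^sup>2))"

text \<open>State-space behaviour. x is taken as the (absolutely) continuous representative:
  it satisfies the integral form of dx/dt = Ax + Bu; y = Cx + Du holds almost everywhere.\<close>
definition Bs ::
  "real^'d^'d \<Rightarrow> real^'n^'d \<Rightarrow> real^'d^'m \<Rightarrow> real^'n^'m
     \<Rightarrow> ((real \<Rightarrow> real^'n) \<times> (real \<Rightarrow> real^'m) \<times> (real \<Rightarrow> real^'d)) set" where
  "Bs A B C D = {(u, y, x). L2loc u \<and> L2loc y \<and> L2loc x \<and>
     (\<forall>a b. a \<le> b \<longrightarrow>
        set_integrable lborel {a..b} (\<lambda>t. A *v x t + B *v u t) \<and>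
        x b - x a = (LINT t:{a..b}|lborel. A *v x t + B *v u t)) \<and>
     (AE t in lborel. y t = C *v x t + D *v u t)}"

definition ext_beh ::
  "real^'d^'d \<Rightarrow> real^'n^'d \<Rightarrow> real^'d^'m \<Rightarrow> real^'n^'m
     \<Rightarrow> ((real \<Rightarrow> real^'n) \<times> (real \<Rightarrow> real^'m)) set" where
  "ext_beh A B C D = {(u, y). \<exists>x. (u, y, x) \<in> Bs A B C D}"

definition avail_storage ::
  "real^'d^'d \<Rightarrow> real^'n^'d \<Rightarrow> real^'d^'m \<Rightarrow> real^'n^'m \<Rightarrow> real \<Rightarrow> real^'d \<Rightarrow> ereal" where
  "avail_storage A B C D t0 x0 =
     (SUP w \<in> {(t1, u, y, x). t1 \<ge> t0 \<and> (u, y, x) \<in> Bs A B C D \<and> x t0 = x0}.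
        ereal (case w of (t1, u, y, x) \<Rightarrow>
          LINT t:{t0..t1}|lborel. y t \<bullet> y t - u t \<bullet> u t))"

definition test_fun :: "(real \<Rightarrow> real) \<Rightarrow> bool" where
  "test_fun \<phi> \<longleftrightarrow> (\<forall>k t. ((deriv ^^ k) \<phi>) differentiable (at t)) \<and>
                    (\<exists>R. \<forall>t. R < \<bar>t\<bar> \<longrightarrow> \<phi> t = 0)"

definition adj_op :: "real poly \<Rightarrow> (real \<Rightarrow> real) \<Rightarrow> real \<Rightarrow> real" where
  "adj_op p \<phi> t = (\<Sum>k\<le>degree p. coeff p k * (-1) ^ k * (deriv ^^ k) \<phi> t)"

text \<open>P(d/dt) u = Q(d/dt) y in the sense of distributions\<close>
definition poly_diff_eq ::
  "real poly^'n^'m \<Rightarrow> real poly^'m^'m \<Rightarrow> (real \<Rightarrow> real^'n) \<Rightarrow> (real \<Rightarrow> real^'m) \<Rightarrow> bool" where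
  "poly_diff_eq P Q u y \<longleftrightarrow> (\<forall>\<phi>. test_fun \<phi> \<longrightarrow> (\<forall>i.
      (LINT t|lborel. (\<Sum>j\<in>UNIV. adj_op (P $ i $ j) \<phi> t * u t $ j)) =
      (LINT t|lborel. (\<Sum>j\<in>UNIV. adj_op (Q $ i $ j) \<phi> t * y t $ j))))"

definition evalC :: "real poly^'a^'b \<Rightarrow> complex \<Rightarrow> complex^'a^'b" where
  "evalC M s = (\<chi> i j. poly (map_poly complex_of_real (M $ i $ j)) s)"

definition evalCv :: "real poly^'a \<Rightarrow> complex \<Rightarrow> complex^'a" where
  "evalCv p s = (\<chi> i. poly (map_poly complex_of_real (p $ i)) s)"

definition pstar :: "real poly^'a^'b \<Rightarrow> real poly^'b^'a" where
  "pstar M = transpose (map_matrix (\<lambda>p. pcompose p [:0, -1:]) M)"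

definition PmQ :: "real poly^'n^'m \<Rightarrow> real poly^'m^'m \<Rightarrow> real poly^('n + 'm)^'m" where
  "PmQ P Q = (\<chi> i j. case j of Inl a \<Rightarrow> P $ i $ a | Inr b \<Rightarrow> - (Q $ i $ b))"

definition bounded_real_pair :: "real poly^'n^'m \<Rightarrow> real poly^'m^'m \<Rightarrow> bool" where
  "bounded_real_pair P Q \<longleftrightarrow>
     (\<forall>s. 0 \<le> Re s \<longrightarrow>
        cpsd (evalC Q s ** transpose (evalC Q (cnj s)) - evalC P s ** transpose (evalC P (cnj s)))) \<and>
     (\<forall>s. 0 \<le> Re s \<longrightarrow> rank (evalC (PmQ P Q) s) = CARD('m)) \<and>
     (\<forall>(p::real poly^'m) s. p v* (Q ** pstar Q - P ** pstar P) = 0 \<and>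
        evalCv p s v* evalC (PmQ P Q) s = 0 \<longrightarrow> evalCv p s = 0)"

end

theory Submission
  imports Defs "HOL-Computational_Algebra.Fundamental_Theorem_Algebra"
begin

text \<open>The available storage is computed by the equivalence of three kinds of data.

  If it is finite, it is a quadratic form because it obeys the parallelogram law, and letting
  trajectories become short turns its dissipation inequality into the matrix inequality.
  Minimality is the integrated dissipation inequality of any other solution.

  For the kernel representation, the polynomial rows q with q(d/dt) C exp(A t) = 0 form a free
  module; its generators are the rows of Q, and Q C = Y (s - A), P = Y B + Q D for some polynomial
  matrix Y. Modifying A off the observable quotient makes the storage function positive definite,
  and the inverse storage function of the dual system gives
  \<open>Q Q* - P P* \<ge> 2 Re s Y T Y*\<close>, which yields all three bounded-real conditions.

  Conversely, a bounded-real pair gives the same Y, and a modification of A off the observable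
  quotient that is Hurwitz. Spectral factorization is avoided: the polynomial columns dominated by
  Q Q* - P P* on the imaginary axis generate, together with P and Q, all polynomial vectors.
  Applied to the transforms of finite trajectories of the midpoint-discretized system, the
  resulting Bezout identity and Parseval's identity for the discrete Fourier transform bound the
  supplied energy, so the discretized system has a finite quadratic storage function, and this
  solves the original matrix inequality.\<close>

section \<open>Modules of polynomial vectors\<close>

text \<open>The obstacle is the initial state. Boundedness of Q^-1 P on the imaginary axis controls
  only motions from rest to rest, whereas the storage must bound the supply from an arbitrary state,
  which the input may be unable to reach. A finite motion is therefore closed into a loop by forcing
  the state equation directly. Such forcing enters the external equation through Y, which P and Q
  alone need not generate; writing Y = P a - Q b + r converts it into changes of input and output
  plus a remainder r controlled by the gap Q Q* - P P*. Pointwise, condition (b) supplies this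
  identity in the closed right half-plane and condition (c) in the open left one; a local-to-global
  step joins the points. Midpoint steps send the imaginary axis to the unit circle without -1, so
  that loops of odd length M see only M-th roots of unity and Parseval is a finite sum. The factor
  (1+q)^k in the forcing clears the denominators of a and b and absorbs the polynomial growth in the
  bound for r.\<close>

definition submodule :: "(('a::comm_ring_1) ^ 'm) set \<Rightarrow> bool" where
  "submodule M \<longleftrightarrow> 0 \<in> M \<and> (\<forall>v\<in>M. \<forall>w\<in>M. v + w \<in> M) \<and> (\<forall>c. \<forall>v\<in>M. c *s v \<in> M)"

lemma submoduleD:
  assumes "submodule M"
  shows "0 \<in> M" "v \<in> M \<Longrightarrow> w \<in> M \<Longrightarrow> v + w \<in> M" "v \<in> M \<Longrightarrow> c *s v \<in> M"
    "v \<in> M \<Longrightarrow> w \<in> M \<Longrightarrow> v - w \<in> M"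
proof -
  show "0 \<in> M" "v \<in> M \<Longrightarrow> w \<in> M \<Longrightarrow> v + w \<in> M" and sc: "\<And>c v. v \<in> M \<Longrightarrow> c *s v \<in> M"
    using assms by (auto simp: submodule_def)
  show "v \<in> M \<Longrightarrow> w \<in> M \<Longrightarrow> v - w \<in> M"
  proof -
    assume "v \<in> M" "w \<in> M"
    then have "v + (-1) *s w \<in> M" using assms sc by (auto simp: submodule_def)
    moreover have "v + (-1) *s w = v - w" by (simp add: vec_eq_iff)
    ultimately show ?thesis by simp
  qed
qed

lemma poly_vec_divide:
  fixes v :: "'a::field poly ^ 'm"
  assumes "\<And>i. poly (v $ i) l = 0"
  obtains w where "v = [:-l, 1:] *s w"
proof
  have "[:-l, 1:] dvd v $ i" for i using assms by (simp add: poly_eq_0_iff_dvd)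
  then show "v = [:-l, 1:] *s (\<chi> i. v $ i div [:-l, 1:])"
    unfolding vec_eq_iff vector_smult_component vec_lambda_beta by (metis dvd_mult_div_cancel)
qed

lemma divisible_by_all_powers:
  fixes p :: "'a::field poly"
  assumes "\<And>n. [:-l, 1:] ^ n dvd p"
  shows "p = 0"
proof (rule ccontr)
  assume "p \<noteq> 0"
  then have "degree ([:-l, 1:] ^ Suc (degree p)) \<le> degree p"
    by (intro dvd_imp_degree_le assms)
  moreover have "degree ([:-l, 1:] ^ Suc (degree p)) = Suc (degree p)"
    by (subst degree_power_eq) auto
  ultimately show False by simp
qed

text \<open>The induction eliminates one coordinate at a time: a vector of M that does not
  vanish at l in coordinate j serves as pivot.\<close>
lemma saturated_annihilator:
  fixes M :: "('a::field poly ^ 'm) set" and p0 :: "'m \<Rightarrow> 'a"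
  assumes "submodule M"
    and "\<And>r. [:-l, 1:] *s r \<in> M \<Longrightarrow> r \<in> M"
    and "\<And>v i. v \<in> M \<Longrightarrow> i \<notin> J \<Longrightarrow> v $ i = 0"
    and "\<And>r. r \<in> M \<Longrightarrow> (\<Sum>i\<in>J. p0 i * poly (r $ i) l) = 0"
  shows "\<exists>p. (\<forall>r\<in>M. (\<Sum>i\<in>J. p i * r $ i) = 0) \<and> (\<forall>i\<in>J. poly (p i) l = p0 i)"
  using assms
proof (induction "card J" arbitrary: J M rule: less_induct)
  case less
  note subm = submoduleD[OF less.prems(1)]
  show ?case
  proof (cases "\<forall>r\<in>M. \<forall>i\<in>J. poly (r $ i) l = 0")
    \<comment> \<open>Saturation divides the linear factor out of every vector again and again, so
      all entries are divisible by each of its powers and \<open>M\<close> is zero; constants then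
      do.\<close>
    case True
    have dv: "r \<in> M \<Longrightarrow> [:-l, 1:] ^ n dvd r $ i" for n r i
    proof (induction n arbitrary: r)
      case (Suc n)
      have "poly (r $ i) l = 0" for i using True Suc.prems less.prems(3) by (cases "i \<in> J") auto
      then obtain w where w: "r = [:-l, 1:] *s w" by (rule poly_vec_divide)
      with Suc.prems less.prems(2) have "w \<in> M" by auto
      then have "[:-l, 1:] ^ n dvd w $ i" by (rule Suc.IH)
      then show ?case unfolding w vector_smult_component power_Suc by (rule mult_dvd_mono[OF dvd_refl])
    qed simp
    then have "r \<in> M \<Longrightarrow> r $ i = 0" for r i by (rule divisible_by_all_powers)
    then show ?thesis by (intro exI[of _ "\<lambda>i. [:p0 i:]"]) auto
  next
    case False
    then obtain r j where r: "r \<in> M" "j \<in> J" "poly (r $ j) l \<noteq> 0" by blast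
    define M' where "M' = {v\<in>M. v $ j = 0}"
    have "\<exists>p. (\<forall>r\<in>M'. (\<Sum>i\<in>J - {j}. p i * r $ i) = 0) \<and> (\<forall>i\<in>J - {j}. poly (p i) l = p0 i)"
    proof (rule less.hyps)
      show "card (J - {j}) < card J" using r(2) by (intro card_Diff1_less) auto
      show "submodule M'" unfolding submodule_def M'_def using subm by auto
      show "r \<in> M'" if "[:-l, 1:] *s r \<in> M'" for r
        using that less.prems(2) unfolding M'_def
        by (simp del: mult_pCons_left)
      show "v $ i = 0" if "v \<in> M'" "i \<notin> J - {j}" for v i
        using that less.prems(3) unfolding M'_def by auto
      show "(\<Sum>i\<in>J - {j}. p0 i * poly (r $ i) l) = 0" if "r \<in> M'" for r
      proof -
        have "(\<Sum>i\<in>J. p0 i * poly (r $ i) l) = 0" using that less.prems(4) M'_def by auto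
        then show ?thesis using that r(2) by (subst (asm) sum.remove[of _ j]) (auto simp: M'_def)
      qed
    qed
    then obtain p where p: "\<And>r. r \<in> M' \<Longrightarrow> (\<Sum>i\<in>J - {j}. p i * r $ i) = 0"
      "\<And>i. i \<in> J - {j} \<Longrightarrow> poly (p i) l = p0 i" by blast
    define c where "c = inverse (poly (r $ j) l)"
    \<comment> \<open>Orthogonality to the pivot \<open>r\<close> fixes the missing coordinate up to
      the factor \<open>r $ j\<close>. Multiplying the others by \<open>r $ j\<close> keeps
      everything polynomial, and \<open>c\<close> restores the values at \<open>l\<close>.\<close>
    define p' where "p' i = [:c:] * (if i = j then - (\<Sum>i\<in>J - {j}. p i * r $ i) else r $ j * p i)" for i
    have 1: "(\<Sum>i\<in>J. p' i * v $ i) = 0" if "v \<in> M" for v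
    proof -
      have "r $ j *s v - v $ j *s r \<in> M'" using subm that r(1) by (auto simp: M'_def)
      from p(1)[OF this] have "(\<Sum>i\<in>J - {j}. p i * (r $ j * v $ i - v $ j * r $ i)) = 0" by simp
      then have e: "(\<Sum>i\<in>J - {j}. r $ j * p i * v $ i) = (\<Sum>i\<in>J - {j}. p i * r $ i) * v $ j"
        by (simp add: algebra_simps sum_subtractf sum_distrib_left)
      have "(\<Sum>i\<in>J. p' i * v $ i) = [:c:] * (- (\<Sum>i\<in>J - {j}. p i * r $ i) * v $ j
          + (\<Sum>i\<in>J - {j}. r $ j * p i * v $ i))"
        using r(2) by (subst sum.remove[of _ j])
          (auto simp: p'_def distrib_left right_diff_distrib sum_distrib_left sum_distrib_right mult.assoc
            simp del: mult_pCons_left)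
      then show ?thesis unfolding e by simp
    qed
    have 2: "poly (p' i) l = p0 i" if "i \<in> J" for i
    proof (cases "i = j")
      case True
      have "(\<Sum>i\<in>J. p0 i * poly (r $ i) l) = 0" using less.prems(4) r(1) by auto
      then have "p0 j * poly (r $ j) l = - (\<Sum>i\<in>J - {j}. p0 i * poly (r $ i) l)"
        using r(2) by (subst (asm) sum.remove[of _ j]) (auto simp: eq_neg_iff_add_eq_0)
      then show ?thesis using True r(3) p(2)
        by (simp add: p'_def poly_sum c_def field_simps)
    next
      case False
      then show ?thesis using that p(2)[of i] r(3) by (simp add: p'_def c_def)
    qed
    show ?thesis using 1 2 by blast
  qed
qed

text \<open>As for the Hermite form: the entries in one coordinate form an ideal, generated by an
  entry of least degree, and subtracting multiples of its vector passes to the vectors that are zero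
  there. One generator per coordinate is what makes the later matrix \<open>Q\<close>
  square.\<close>

lemma submodule_generators:
  fixes N :: "('a::field poly ^ 'm) set"
  assumes "submodule N" and "\<And>v i. v \<in> N \<Longrightarrow> i \<notin> J \<Longrightarrow> v $ i = 0"
  shows "\<exists>q. (\<forall>j\<in>J. q j \<in> N) \<and> (\<forall>v\<in>N. \<exists>c. v = (\<Sum>j\<in>J. c j *s q j))"
  using finite[of J] assms
proof (induction J arbitrary: N rule: finite_induct)
  case empty
  then show ?case by (auto simp: vec_eq_iff)
next
  case (insert j J)
  note subm = submoduleD[OF insert.prems(1)]
  define N' where "N' = {v\<in>N. v $ j = 0}"
  have "\<exists>q. (\<forall>j\<in>J. q j \<in> N') \<and> (\<forall>v\<in>N'. \<exists>c. v = (\<Sum>j\<in>J. c j *s q j))"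
  proof (rule insert.IH)
    show "submodule N'" unfolding submodule_def N'_def using subm by auto
    show "v $ i = 0" if "v \<in> N'" "i \<notin> J" for v i
      using that insert.prems(2) unfolding N'_def by (cases "i = j") auto
  qed
  then obtain q where q: "\<And>j. j \<in> J \<Longrightarrow> q j \<in> N'" "\<And>v. v \<in> N' \<Longrightarrow> \<exists>c. v = (\<Sum>j\<in>J. c j *s q j)"
    by blast
  have "\<exists>v0\<in>N. \<forall>v\<in>N. v0 $ j dvd v $ j"
  proof (cases "\<exists>v\<in>N. v $ j \<noteq> 0")
    case True
    define v0 where "v0 = arg_min (\<lambda>v. degree (v $ j)) (\<lambda>v. v \<in> N \<and> v $ j \<noteq> 0)"
    have v0: "v0 \<in> N" "v0 $ j \<noteq> 0" and mn: "\<And>v. v \<in> N \<Longrightarrow> v $ j \<noteq> 0 \<Longrightarrow> degree (v0 $ j) \<le> degree (v $ j)"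
      using arg_min_nat_lemma[of "\<lambda>v. v \<in> N \<and> v $ j \<noteq> 0" _ "\<lambda>v. degree (v $ j)"] True
      unfolding v0_def by blast+
    have "v0 $ j dvd v $ j" if "v \<in> N" for v
    proof -
      define w where "w = v - (v $ j div v0 $ j) *s v0"
      have w: "w \<in> N" unfolding w_def using subm that v0 by auto
      have "w $ j = v $ j mod v0 $ j" unfolding w_def by (simp add: minus_div_mult_eq_mod)
      then show ?thesis using mn[OF w] degree_mod_less[of "v0 $ j" "v $ j"] v0(2)
        by (metis mod_0_imp_dvd not_le)
    qed
    then show ?thesis using v0 by blast
  next
    case False
    then show ?thesis using subm(1) by auto
  qed
  then obtain v0 where v0: "v0 \<in> N" "\<And>v. v \<in> N \<Longrightarrow> v0 $ j dvd v $ j" by blast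
  have "\<exists>c. v = (\<Sum>i\<in>insert j J. c i *s (q(j := v0)) i)" if v: "v \<in> N" for v
  proof -
    obtain g where g: "v $ j = v0 $ j * g" using v0(2)[OF v] by (auto elim: dvdE)
    have "v - g *s v0 \<in> N'" using subm v v0 g by (auto simp: N'_def)
    from q(2)[OF this] obtain c where c: "v - g *s v0 = (\<Sum>j\<in>J. c j *s q j)" by blast
    have "(\<Sum>i\<in>J. c i *s q i) = (\<Sum>i\<in>J. (c(j := g)) i *s (q(j := v0)) i)"
      using insert.hyps(2) by (intro sum.cong) auto
    then have "v = (\<Sum>i\<in>insert j J. (c(j := g)) i *s (q(j := v0)) i)"
      using c insert.hyps by (simp add: algebra_simps)
    then show ?thesis by blast
  qed
  moreover have "\<forall>i\<in>insert j J. (q(j := v0)) i \<in> N" using q(1) v0(1) by (auto simp: N'_def)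
  ultimately show ?case by blast
qed

text \<open>Cramer's rule: the entries of \<open>B\<close> are determinants with one row replaced by
  a unit vector. By linearity in that row, entry (i, j) of the product is the determinant of
  \<open>A\<close> with row j replaced by row i; for distinct i and j two rows agree.\<close>

lemma adjugate_exists:
  fixes A :: "'a::comm_ring_1 ^ 'n ^ 'n"
  shows "\<exists>B. A ** B = mat (det A)"
proof -
  define B where "B = ((\<chi> k j. det (\<chi> i. if i = j then axis k 1 else A $ i)) :: 'a ^ 'n ^ 'n)"
  have "(A ** B) $ i $ j = mat (det A) $ i $ j" for i j
  proof -
    have "(A ** B) $ i $ j = (\<Sum>k\<in>UNIV. det (\<chi> r. if r = j then A $ i $ k *s axis k 1 else A $ r))"
      by (simp add: matrix_matrix_mult_def B_def det_row_mul)
    also have "\<dots> = det (\<chi> r. if r = j then (\<Sum>k\<in>UNIV. A $ i $ k *s axis k 1) else A $ r)"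
      by (subst det_linear_row_sum) auto
    also have "(\<Sum>k\<in>UNIV. A $ i $ k *s axis k 1) = A $ i"
      by (simp add: vec_eq_iff axis_def if_distrib cong: if_cong)
    also have "det (\<chi> r. if r = j then A $ i else A $ r) = mat (det A) $ i $ j"
    proof (cases "i = j")
      case True
      then have "(\<chi> r. if r = j then A $ i else A $ r) = A" by (simp add: vec_eq_iff)
      then show ?thesis using True by (simp add: mat_def)
    next
      case False
      then show ?thesis
        by (subst det_identical_rows[OF False]) (auto simp: row_def vec_eq_iff mat_def)
    qed
    finally show ?thesis .
  qed
  then show ?thesis by (auto simp: vec_eq_iff)
qed

text \<open>The Euclidean structure of \<open>complex ^ 'm\<close> is real, so orthogonality only
  controls real parts. Closure under multiplication by \<open>\<i>\<close> supplies the imaginary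
  parts.\<close>

lemma complex_subspace_annihilator:
  fixes S :: "(complex ^ 'm) set"
  assumes "\<And>v w. v \<in> S \<Longrightarrow> w \<in> S \<Longrightarrow> v + w \<in> S" "\<And>c v. v \<in> S \<Longrightarrow> c *s v \<in> S" "S \<noteq> UNIV" "S \<noteq> {}"
  shows "\<exists>p. p \<noteq> 0 \<and> (\<forall>s\<in>S. (\<Sum>i\<in>UNIV. p $ i * s $ i) = 0)"
proof -
  have sc: "r *\<^sub>R v = complex_of_real r *s v" for r and v :: "complex ^ 'm"
    unfolding vec_eq_iff vector_scaleR_component vector_smult_component by (simp add: scaleR_conv_of_real)
  obtain s0 where "s0 \<in> S" using assms(4) by blast
  from assms(2)[OF this, of 0] have "0 \<in> S" by simp
  then have sub: "subspace S" unfolding subspace_def sc using assms by auto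
  then have "span S = S" by (simp add: span_eq_iff)
  then have "dim S < DIM(complex ^ 'm)"
    using assms(3) dim_eq_full[of S] dim_subset_UNIV[of S] by (metis le_neq_implies_less)
  then obtain w where w: "w \<noteq> 0" "\<And>y. y \<in> span S \<Longrightarrow> orthogonal w y"
    using orthogonal_to_subspace_exists by blast
  have re: "v \<bullet> s = Re (\<Sum>i\<in>UNIV. cnj (v $ i) * s $ i)" for v s :: "complex ^ 'm"
    by (simp add: inner_vec_def inner_complex_def)
  have "(\<Sum>i\<in>UNIV. cnj (w $ i) * s $ i) = 0" if s: "s \<in> S" for s
  proof -
    have 1: "Re (\<Sum>i\<in>UNIV. cnj (w $ i) * s $ i) = 0"
      using w(2)[of s] span_superset[of S] s unfolding orthogonal_def re by auto
    have "\<i> *s s \<in> S" using assms(2) s by auto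
    then have "Re (\<Sum>i\<in>UNIV. cnj (w $ i) * (\<i> *s s) $ i) = 0"
      using w(2)[of "\<i> *s s"] span_superset[of S] unfolding orthogonal_def re by auto
    moreover have "(\<Sum>i\<in>UNIV. cnj (w $ i) * (\<i> *s s) $ i) = \<i> * (\<Sum>i\<in>UNIV. cnj (w $ i) * s $ i)"
      by (simp add: sum_distrib_left algebra_simps)
    ultimately show ?thesis using 1 by (simp add: complex_eq_iff)
  qed
  moreover have "(\<chi> i. cnj (w $ i)) \<noteq> 0" using w(1) by (auto simp: vec_eq_iff)
  ultimately show ?thesis by (intro exI[of _ "\<chi> i. cnj (w $ i)"]) auto
qed

text \<open>A multiplier \<open>e\<close> of least degree that carries every vector into
  \<open>N\<close> must be constant: at a root \<open>l\<close> of \<open>e\<close> the values of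
  \<open>N\<close> fill the whole space by \<open>loc\<close>, so every vector is congruent to a
  member of \<open>N\<close> modulo the linear factor, and that factor can be removed from
  \<open>e\<close>.\<close>

lemma submodule_local_global:
  fixes N :: "(complex poly ^ 'm) set"
  assumes N: "submodule N" and d: "d \<noteq> 0" "\<And>v. d *s v \<in> N"
    and loc: "\<And>l p0. (\<And>n. n \<in> N \<Longrightarrow> (\<Sum>i\<in>UNIV. p0 $ i * poly (n $ i) l) = 0) \<Longrightarrow> p0 = 0"
  shows "v \<in> N"
proof -
  note subm = submoduleD[OF N]
  define G where "G = {d. d \<noteq> 0 \<and> (\<forall>v. d *s v \<in> N)}"
  define e where "e = arg_min degree (\<lambda>d. d \<in> G)"
  have "d \<in> G" using d by (auto simp: G_def)
  then have e: "e \<in> G" "\<And>f. f \<in> G \<Longrightarrow> degree e \<le> degree f"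
    using arg_min_nat_lemma[of "\<lambda>d. d \<in> G" d degree] unfolding e_def by blast+
  have "degree e = 0"
  proof (rule ccontr)
    assume "degree e \<noteq> 0"
    then obtain l where "poly e l = 0"
      using fundamental_theorem_of_algebra[of e] constant_degree[of e] by auto
    then obtain f where f: "e = [:-l, 1:] * f" by (auto simp: poly_eq_0_iff_dvd elim: dvdE)
    have f0: "f \<noteq> 0" using e(1) f by (auto simp: G_def)
    define S where "S = (\<lambda>n. \<chi> i. poly (n $ i) l) ` N"
    have "S = UNIV"
    proof (rule ccontr)
      assume "S \<noteq> UNIV"
      moreover have "v + w \<in> S" if vw: "v \<in> S" "w \<in> S" for v w
      proof -
        obtain a b where "a \<in> N" "v = (\<chi> i. poly (a $ i) l)" "b \<in> N" "w = (\<chi> i. poly (b $ i) l)"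
          using vw unfolding S_def by blast
        then show ?thesis unfolding S_def by (intro image_eqI[of _ _ "a + b"]) (auto simp: vec_eq_iff subm)
      qed
      moreover have "c *s v \<in> S" if vw: "v \<in> S" for c v
      proof -
        obtain a where "a \<in> N" "v = (\<chi> i. poly (a $ i) l)" using vw unfolding S_def by blast
        then show ?thesis unfolding S_def by (intro image_eqI[of _ _ "[:c:] *s a"]) (auto simp: vec_eq_iff subm)
      qed
      moreover have "S \<noteq> {}" using subm(1) unfolding S_def by auto
      ultimately obtain p where "p \<noteq> 0" "\<And>s. s \<in> S \<Longrightarrow> (\<Sum>i\<in>UNIV. p $ i * s $ i) = 0"
        using complex_subspace_annihilator[of S] by metis
      then show False using loc[of p l] unfolding S_def by fastforce
    qed
    have "f *s v \<in> N" for v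
    proof -
      have "(\<chi> i. poly (v $ i) l) \<in> S" using \<open>S = UNIV\<close> by simp
      then obtain n where n: "n \<in> N" "\<And>i. poly (v $ i) l = poly (n $ i) l"
        unfolding S_def by (auto simp: vec_eq_iff)
      then have "poly ((v - n) $ i) l = 0" for i by simp
      then obtain w where w: "v - n = [:-l, 1:] *s w" using poly_vec_divide by blast
      have "f *s v = f *s n + f *s (v - n)" by (simp add: algebra_simps)
      also have "\<dots> = f *s n + e *s w" unfolding w f by (simp add: mult.commute vector_smult_assoc)
      also have "\<dots> \<in> N" using subm n(1) e(1) by (auto simp: G_def)
      finally show ?thesis .
    qed
    then have "f \<in> G" using f0 by (auto simp: G_def)
    from e(2)[OF this] have "degree e \<le> degree f" .
    moreover have "degree e = Suc (degree f)" unfolding f using f0 by (subst degree_mult_eq) auto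
    ultimately show False by simp
  qed
  then obtain c where c: "e = [:c:]" by (auto elim: degree_eq_zeroE)
  have "c \<noteq> 0" and "\<And>w. e *s w \<in> N" using c e(1) by (auto simp: G_def)
  then have "[:c:] *s ([:inverse c:] *s v) \<in> N" unfolding c by blast
  moreover have "[:c:] *s ([:inverse c:] *s v) = v"
  proof -
    have "[:c:] * [:inverse c:] = 1" using \<open>c \<noteq> 0\<close> by (simp add: one_pCons)
    then show ?thesis unfolding vector_smult_assoc by simp
  qed
  ultimately show ?thesis by metis
qed

section \<open>Bounded-real pairs\<close>

abbreviation cpoly :: "real poly \<Rightarrow> complex poly" where "cpoly \<equiv> map_poly complex_of_real"

lemma coeff_cpoly [simp]: "coeff (cpoly p) n = of_real (coeff p n)"
  by (simp add: coeff_map_poly)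

lemma cpoly_add: "cpoly (p + q) = cpoly p + cpoly q"
  and cpoly_diff: "cpoly (p - q) = cpoly p - cpoly q"
  and cpoly_minus: "cpoly (- p) = - cpoly p"
  by (auto intro!: poly_eqI)

lemma cpoly_mult: "cpoly (p * q) = cpoly p * cpoly q"
  by (auto intro!: poly_eqI simp: coeff_mult)

lemma cpoly_sum: "cpoly (sum f S) = (\<Sum>i\<in>S. cpoly (f i))"
  by (auto intro!: poly_eqI simp: coeff_sum)

lemma cpoly_eq_0_iff [simp]: "cpoly p = 0 \<longleftrightarrow> p = 0"
  by (simp add: poly_eq_iff)

lemma cpoly_pcompose: "poly (cpoly (pcompose p [:0, -1:])) s = poly (cpoly p) (- s)"
proof (induction p)
  case (pCons a p)
  then show ?case
    by (simp add: pcompose_pCons cpoly_add cpoly_mult cpoly_minus map_poly_pCons)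
qed simp

lemma cnj_poly_cpoly: "cnj (poly (cpoly p) s) = poly (cpoly p) (cnj s)"
proof -
  have "map_poly cnj (cpoly p) = cpoly p" by (rule poly_eqI) (simp add: coeff_map_poly)
  then show ?thesis by (metis poly_cnj)
qed

text \<open>The weight 1 + w^2 is chosen because \<open>cayley_imaginary\<close> turns it into 4 /
  |1 + q|^2, so that its powers are absorbed by powers of 1 + q.\<close>

lemma poly_complex_bound:
  "\<exists>c k. c \<ge> 0 \<and> (\<forall>w::real. (cmod (poly p (\<i> * of_real w)))\<^sup>2 \<le> c * (1 + w\<^sup>2) ^ k)"
proof (induction p)
  case 0
  then show ?case by (intro exI[of _ 0]) auto
next
  case (pCons a p)
  then obtain c k where c: "c \<ge> 0" "\<And>w::real. (cmod (poly p (\<i> * of_real w)))\<^sup>2 \<le> c * (1 + w\<^sup>2) ^ k" by blast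
  have "(cmod (poly (pCons a p) (\<i> * of_real w)))\<^sup>2 \<le> (2 * (cmod a)\<^sup>2 + 2 * c) * (1 + w\<^sup>2) ^ Suc k" for w :: real
  proof -
    let ?P = "cmod (poly p (\<i> * of_real w))"
    have "cmod (poly (pCons a p) (\<i> * of_real w)) \<le> cmod a + \<bar>w\<bar> * ?P"
      by (simp add: norm_mult order_trans[OF norm_triangle_ineq])
    then have "(cmod (poly (pCons a p) (\<i> * of_real w)))\<^sup>2 \<le> (cmod a + \<bar>w\<bar> * ?P)\<^sup>2"
      by (intro power_mono) auto
    also have "\<dots> \<le> 2 * (cmod a)\<^sup>2 + 2 * (w\<^sup>2 * ?P\<^sup>2)"
      using sum_squares_bound[of "cmod a" "\<bar>w\<bar> * ?P"] by (simp add: power2_sum power_mult_distrib)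
    also have "\<dots> \<le> 2 * (cmod a)\<^sup>2 * (1 + w\<^sup>2) ^ Suc k + 2 * (c * (1 + w\<^sup>2) ^ Suc k)"
    proof -
      have "(cmod a)\<^sup>2 * 1 \<le> (cmod a)\<^sup>2 * (1 + w\<^sup>2) ^ Suc k"
        by (intro mult_left_mono one_le_power) auto
      moreover have "w\<^sup>2 * ?P\<^sup>2 \<le> (1 + w\<^sup>2) * (c * (1 + w\<^sup>2) ^ k)"
        by (intro mult_mono c) (auto simp: c)
      ultimately show ?thesis by (simp add: algebra_simps)
    qed
    finally show ?thesis by (simp add: algebra_simps)
  qed
  then show ?case using c(1) by (intro exI[of _ "2 * (cmod a)\<^sup>2 + 2 * c"] exI[of _ "Suc k"]) auto
qed

text \<open>Includes c = 0, where an affine function bounded below must be constant; kernels of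
  semidefinite forms are later found through this case.\<close>

lemma quadratic_discriminant_bound:
  fixes a b c :: real
  assumes "\<And>t. 0 \<le> a + 2 * b * t + c * t\<^sup>2"
  shows "b\<^sup>2 \<le> a * c"
proof (cases "c = 0")
  case True
  have "b = 0"
  proof (rule ccontr)
    assume "b \<noteq> 0"
    with assms[of "- (\<bar>a\<bar> + 1) / (2 * b)"] True show False by simp
  qed
  then show ?thesis using True by simp
next
  case False
  have "0 \<le> c"
  proof (rule ccontr)
    assume c: "\<not> 0 \<le> c"

    have *: "0 \<le> a + c * t\<^sup>2" for t using assms[of t] assms[of "-t"] by simp
    have "(sqrt ((\<bar>a\<bar> + 1) / \<bar>c\<bar>))\<^sup>2 = (\<bar>a\<bar> + 1) / \<bar>c\<bar>" by simp
    with *[of "sqrt ((\<bar>a\<bar> + 1) / \<bar>c\<bar>)"] c show False by simp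
  qed
  then have c: "c > 0" using False by simp
  have "0 \<le> c * (a + 2 * b * (- b / c) + c * (- b / c)\<^sup>2)"
    using assms[of "- b / c"] c by (intro mult_nonneg_nonneg) auto
  also have "\<dots> = a * c - b\<^sup>2" using c by (simp add: field_simps power2_eq_square)
  finally show ?thesis by simp
qed

text \<open>Row vectors are used throughout: for v the conjugate of w this is the Hermitian form
  w* (Q Q* - P P* ) w.\<close>
definition gap :: "real poly^'n^'m \<Rightarrow> real poly^'m^'m \<Rightarrow> complex \<Rightarrow> complex^'m \<Rightarrow> real" where
  "gap P Q s v = (norm (v v* evalC Q s))\<^sup>2 - (norm (v v* evalC P s))\<^sup>2"

lemma norm2_vec_complex: "complex_of_real ((norm (v::complex^'k))\<^sup>2) = (\<Sum>i\<in>UNIV. v $ i * cnj (v $ i))"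
proof -
  have "(norm v)\<^sup>2 = (\<Sum>i\<in>UNIV. (cmod (v $ i))\<^sup>2)"
    by (simp add: norm_vec_def L2_set_def sum_nonneg)
  then show ?thesis unfolding of_real_sum complex_norm_square by (simp only: of_real_sum complex_norm_square)
qed

lemma vecmult_cnj_sum:
  fixes M :: "complex^'k^'m"
  shows "(\<Sum>k\<in>UNIV. (v v* M) $ k * cnj ((u v* M) $ k))
    = (\<Sum>i\<in>UNIV. \<Sum>j\<in>UNIV. v $ i * (\<Sum>k\<in>UNIV. M $ i $ k * cnj (M $ j $ k)) * cnj (u $ j))"
proof -
  have "(\<Sum>k\<in>UNIV. (v v* M) $ k * cnj ((u v* M) $ k))
      = (\<Sum>k\<in>UNIV. \<Sum>i\<in>UNIV. \<Sum>j\<in>UNIV. v $ i * (M $ i $ k * cnj (M $ j $ k)) * cnj (u $ j))"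
    by (simp add: vector_matrix_mult_def sum_product algebra_simps)
  also have "\<dots> = (\<Sum>i\<in>UNIV. \<Sum>k\<in>UNIV. \<Sum>j\<in>UNIV. v $ i * (M $ i $ k * cnj (M $ j $ k)) * cnj (u $ j))"
    by (rule sum.swap)
  also have "\<dots> = (\<Sum>i\<in>UNIV. \<Sum>j\<in>UNIV. \<Sum>k\<in>UNIV. v $ i * (M $ i $ k * cnj (M $ j $ k)) * cnj (u $ j))"
    by (intro sum.cong refl) (rule sum.swap)
  finally show ?thesis by (simp add: sum_distrib_left sum_distrib_right algebra_simps)
qed

lemma evalC_component [simp]: "evalC M s $ i $ j = poly (cpoly (M $ i $ j)) s"
  by (simp add: evalC_def)

lemma transpose_component [simp]: "transpose M $ i $ j = M $ j $ i"
  by (simp add: transpose_def)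

lemma evalC_self_mult:
  "(evalC M s ** transpose (evalC M (cnj s))) $ i $ j = (\<Sum>k\<in>UNIV. evalC M s $ i $ k * cnj (evalC M s $ j $ k))"
  by (simp add: matrix_matrix_mult_def cnj_poly_cpoly)

lemma cpsd_gap:
  assumes "cpsd (evalC Q s ** transpose (evalC Q (cnj s)) - evalC P s ** transpose (evalC P (cnj s)))"
  shows "gap P Q s v \<ge> 0"
proof -
  let ?M = "evalC Q s ** transpose (evalC Q (cnj s)) - evalC P s ** transpose (evalC P (cnj s))"
  \<comment> \<open>\<open>cpsd\<close> conjugates the left vector and \<open>gap\<close> the right
    one; the conjugate \<open>w\<close> reconciles them.\<close>
  define w where "w = (\<chi> i. cnj (v $ i))"
  have M: "?M $ i $ j = (\<Sum>k\<in>UNIV. evalC Q s $ i $ k * cnj (evalC Q s $ j $ k))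
    - (\<Sum>k\<in>UNIV. evalC P s $ i $ k * cnj (evalC P s $ j $ k))" for i j
    unfolding vector_minus_component evalC_self_mult ..
  have "complex_of_real (gap P Q s v) = (\<Sum>i\<in>UNIV. \<Sum>j\<in>UNIV. cnj (w $ i) * ?M $ i $ j * w $ j)"
    unfolding gap_def of_real_diff norm2_vec_complex vecmult_cnj_sum M w_def
    by (simp add: algebra_simps sum_subtractf)
  moreover have "0 \<le> Re (\<Sum>i\<in>UNIV. \<Sum>j\<in>UNIV. cnj (w $ i) * ?M $ i $ j * w $ j)"
    using assms unfolding cpsd_def Let_def by blast
  ultimately show ?thesis by (metis Re_complex_of_real)
qed

lemma gap_cpsd:
  assumes "\<And>v. gap P Q s v \<ge> 0"
  shows "cpsd (evalC Q s ** transpose (evalC Q (cnj s)) - evalC P s ** transpose (evalC P (cnj s)))"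
proof -
  let ?M = "evalC Q s ** transpose (evalC Q (cnj s)) - evalC P s ** transpose (evalC P (cnj s))"
  have M: "?M $ i $ j = (\<Sum>k\<in>UNIV. evalC Q s $ i $ k * cnj (evalC Q s $ j $ k))
    - (\<Sum>k\<in>UNIV. evalC P s $ i $ k * cnj (evalC P s $ j $ k))" for i j
    unfolding vector_minus_component evalC_self_mult ..
  have "(\<Sum>i\<in>UNIV. \<Sum>j\<in>UNIV. cnj (w $ i) * ?M $ i $ j * w $ j)
      = complex_of_real (gap P Q s (\<chi> i. cnj (w $ i)))" for w
    unfolding gap_def of_real_diff norm2_vec_complex vecmult_cnj_sum M
    by (simp add: algebra_simps sum_subtractf)
  then show ?thesis using assms unfolding cpsd_def Let_def by simp
qed

section \<open>The gap as a Hermitian form and the columns it dominates\<close>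

definition Phi :: "real poly^'n^'m \<Rightarrow> real poly^'m^'m \<Rightarrow> real poly^'m^'m" where
  "Phi P Q = Q ** pstar Q - P ** pstar P"

text \<open>On the imaginary axis - s is the conjugate of s, so \<open>pstar\<close> becomes the
  Hermitian adjoint and \<open>Phi\<close> the matrix of the form \<open>gap\<close>.\<close>

lemma Phi_eval:
  "poly (cpoly (Phi P Q $ i $ j)) (\<i> * of_real w) =
    (\<Sum>k\<in>UNIV. evalC Q (\<i> * of_real w) $ i $ k * cnj (evalC Q (\<i> * of_real w) $ j $ k))
    - (\<Sum>k\<in>UNIV. evalC P (\<i> * of_real w) $ i $ k * cnj (evalC P (\<i> * of_real w) $ j $ k))"
  by (simp add: Phi_def matrix_matrix_mult_def pstar_def map_matrix_def cpoly_diff cpoly_sum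
      cpoly_mult poly_sum cpoly_pcompose cnj_poly_cpoly)

text \<open>Cauchy-Schwarz for a possibly degenerate form. The inner product is the real one, so
  only the real part of the sesquilinear form appears; multiplying a vector by \<open>\<i>\<close>
  recovers the imaginary part.\<close>

lemma gap_cauchy_schwarz:
  fixes u v :: "complex^'m" and P :: "real poly^'n^'m"
  assumes "\<And>v. gap P Q s v \<ge> 0"
  shows "((v v* evalC Q s) \<bullet> (u v* evalC Q s) - (v v* evalC P s) \<bullet> (u v* evalC P s))\<^sup>2
    \<le> gap P Q s v * gap P Q s u"
proof (rule quadratic_discriminant_bound)
  fix t :: real
  have sc: "(v + of_real t *s u) v* M = v v* M + t *\<^sub>R (u v* M)" for M :: "complex^'k^'m"
    unfolding vec_eq_iff vector_add_component vector_scaleR_component vector_matrix_mult_def vec_lambda_beta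
      vector_smult_component
    by (simp add: scaleR_conv_of_real algebra_simps sum.distrib sum_distrib_left)
  have n: "(norm (a + t *\<^sub>R b))\<^sup>2 = (norm a)\<^sup>2 + 2 * (a \<bullet> b) * t + (norm b)\<^sup>2 * t\<^sup>2"
    for a b :: "complex^'k"
    unfolding power2_norm_eq_inner by (simp add: algebra_simps inner_commute power2_eq_square)
  have "0 \<le> gap P Q s (v + of_real t *s u)" by (rule assms)
  then show "0 \<le> gap P Q s v + 2 * ((v v* evalC Q s) \<bullet> (u v* evalC Q s) - (v v* evalC P s) \<bullet> (u v* evalC P s)) * t
      + gap P Q s u * t\<^sup>2"
    unfolding gap_def sc n by (simp add: algebra_simps)
qed

text \<open>The polynomial columns r with r r* bounded, on the imaginary axis, by a polynomial multiple
  of Q Q* - P P*. This module replaces a spectral factor.\<close>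
definition dominated :: "real poly^'n^'m \<Rightarrow> real poly^'m^'m \<Rightarrow> (complex poly^'m) set" where
  "dominated P Q = {r. \<exists>c k. c \<ge> 0 \<and> (\<forall>w v. (cmod (\<Sum>i\<in>UNIV. v $ i * poly (r $ i) (\<i> * of_real w)))\<^sup>2
      \<le> c * (1 + w\<^sup>2) ^ k * gap P Q (\<i> * of_real w) v)}"

text \<open>Polynomial weights give closure under multiplication by polynomials: a factor only
  raises \<open>c\<close> and \<open>k\<close>.\<close>

lemma submodule_dominated:
  assumes pos: "\<And>w v. gap P Q (\<i> * of_real w) v \<ge> 0"
  shows "submodule (dominated P Q)"
  unfolding submodule_def
proof (intro conjI ballI allI)
  show "0 \<in> dominated P Q" unfolding dominated_def by (auto intro!: exI[of _ 0])
next
  fix r r' assume "r \<in> dominated P Q" "r' \<in> dominated P Q"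
  then obtain c k c' k' where c: "c \<ge> 0" "\<And>w v. (cmod (\<Sum>i\<in>UNIV. v $ i * poly (r $ i) (\<i> * of_real w)))\<^sup>2
      \<le> c * (1 + w\<^sup>2) ^ k * gap P Q (\<i> * of_real w) v"
    and c': "c' \<ge> 0" "\<And>w v. (cmod (\<Sum>i\<in>UNIV. v $ i * poly (r' $ i) (\<i> * of_real w)))\<^sup>2
      \<le> c' * (1 + w\<^sup>2) ^ k' * gap P Q (\<i> * of_real w) v"
    unfolding dominated_def by blast
  show "r + r' \<in> dominated P Q" unfolding dominated_def
  proof (intro CollectI exI conjI allI)
    show "0 \<le> 2 * c + 2 * c'" using c c' by simp
    fix w v
    let ?a = "\<Sum>i\<in>UNIV. v $ i * poly (r $ i) (\<i> * of_real w)" and ?b = "\<Sum>i\<in>UNIV. v $ i * poly (r' $ i) (\<i> * of_real w)"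
    let ?g = "gap P Q (\<i> * of_real w) v"
    have "(\<Sum>i\<in>UNIV. v $ i * poly ((r + r') $ i) (\<i> * of_real w)) = ?a + ?b"
      by (simp add: algebra_simps sum.distrib)
    then have "(cmod (\<Sum>i\<in>UNIV. v $ i * poly ((r + r') $ i) (\<i> * of_real w)))\<^sup>2 \<le> (cmod ?a + cmod ?b)\<^sup>2"
      by (intro power_mono) (auto intro: norm_triangle_ineq)
    also have "\<dots> \<le> 2 * (cmod ?a)\<^sup>2 + 2 * (cmod ?b)\<^sup>2"
      using sum_squares_bound[of "cmod ?a" "cmod ?b"] by (simp add: power2_sum)
    also have "\<dots> \<le> 2 * (c * (1 + w\<^sup>2) ^ k * ?g) + 2 * (c' * (1 + w\<^sup>2) ^ k' * ?g)"
      using c(2)[of v w] c'(2)[of v w] by simp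
    also have "\<dots> \<le> 2 * (c * (1 + w\<^sup>2) ^ max k k' * ?g) + 2 * (c' * (1 + w\<^sup>2) ^ max k k' * ?g)"
      using c(1) c'(1) pos[of w v]
      by (intro add_mono mult_left_mono mult_right_mono power_increasing) auto
    finally show "(cmod (\<Sum>i\<in>UNIV. v $ i * poly ((r + r') $ i) (\<i> * of_real w)))\<^sup>2
        \<le> (2 * c + 2 * c') * (1 + w\<^sup>2) ^ max k k' * ?g"
      by (simp add: algebra_simps)
  qed
next
  fix f r assume "r \<in> dominated P Q"
  then obtain c k where c: "c \<ge> 0" "\<And>w v. (cmod (\<Sum>i\<in>UNIV. v $ i * poly (r $ i) (\<i> * of_real w)))\<^sup>2
      \<le> c * (1 + w\<^sup>2) ^ k * gap P Q (\<i> * of_real w) v"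
    unfolding dominated_def by blast
  obtain c' k' where c': "c' \<ge> 0" "\<And>w::real. (cmod (poly f (\<i> * of_real w)))\<^sup>2 \<le> c' * (1 + w\<^sup>2) ^ k'"
    using poly_complex_bound[of f] by blast
  show "f *s r \<in> dominated P Q" unfolding dominated_def
  proof (intro CollectI exI conjI allI)
    show "0 \<le> c' * c" using c c' by simp
    fix w v
    have "(\<Sum>i\<in>UNIV. v $ i * poly ((f *s r) $ i) (\<i> * of_real w))
        = poly f (\<i> * of_real w) * (\<Sum>i\<in>UNIV. v $ i * poly (r $ i) (\<i> * of_real w))"
      by (simp add: algebra_simps sum_distrib_left)
    then have "(cmod (\<Sum>i\<in>UNIV. v $ i * poly ((f *s r) $ i) (\<i> * of_real w)))\<^sup>2
        = (cmod (poly f (\<i> * of_real w)))\<^sup>2 * (cmod (\<Sum>i\<in>UNIV. v $ i * poly (r $ i) (\<i> * of_real w)))\<^sup>2"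
      by (simp add: norm_mult power_mult_distrib)
    also have "\<dots> \<le> (c' * (1 + w\<^sup>2) ^ k') * (c * (1 + w\<^sup>2) ^ k * gap P Q (\<i> * of_real w) v)"
      using c' c by (intro mult_mono) auto
    finally show "(cmod (\<Sum>i\<in>UNIV. v $ i * poly ((f *s r) $ i) (\<i> * of_real w)))\<^sup>2
        \<le> c' * c * (1 + w\<^sup>2) ^ (k' + k) * gap P Q (\<i> * of_real w) v"
      by (simp add: algebra_simps power_add)
  qed
qed

text \<open>On the imaginary axis the factor s - l has modulus at least |Re l|, so dividing by it
  only enlarges the constant. Points on the axis itself are left to condition (b).\<close>

lemma dominated_saturated:
  assumes "[:-l, 1:] *s r \<in> dominated P Q" and l: "Re l \<noteq> 0"
    and pos: "\<And>w v. gap P Q (\<i> * of_real w) v \<ge> 0"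
  shows "r \<in> dominated P Q"
proof -
  obtain c k where c: "c \<ge> 0" "\<And>w v. (cmod (\<Sum>i\<in>UNIV. v $ i * poly (([:-l, 1:] *s r) $ i) (\<i> * of_real w)))\<^sup>2
      \<le> c * (1 + w\<^sup>2) ^ k * gap P Q (\<i> * of_real w) v"
    using assms(1) unfolding dominated_def by blast
  show ?thesis unfolding dominated_def
  proof (intro CollectI exI conjI allI)
    show "0 \<le> c / (Re l)\<^sup>2" using c by simp
    fix w v
    let ?a = "\<Sum>i\<in>UNIV. v $ i * poly (r $ i) (\<i> * of_real w)"
    have "(\<Sum>i\<in>UNIV. v $ i * poly (([:-l, 1:] *s r) $ i) (\<i> * of_real w)) = (\<i> * of_real w - l) * ?a"
      by (simp add: algebra_simps sum_distrib_left sum_subtractf)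
    then have "(cmod (\<i> * of_real w - l))\<^sup>2 * (cmod ?a)\<^sup>2 \<le> c * (1 + w\<^sup>2) ^ k * gap P Q (\<i> * of_real w) v"
      using c(2)[of v w] by (simp add: norm_mult power_mult_distrib)
    moreover have "(Re l)\<^sup>2 * (cmod ?a)\<^sup>2 \<le> (cmod (\<i> * of_real w - l))\<^sup>2 * (cmod ?a)\<^sup>2"
      by (intro mult_right_mono) (auto simp: cmod_power2)
    ultimately have "(Re l)\<^sup>2 * (cmod ?a)\<^sup>2 \<le> c * (1 + w\<^sup>2) ^ k * gap P Q (\<i> * of_real w) v" by simp
    then show "(cmod ?a)\<^sup>2 \<le> c / (Re l)\<^sup>2 * (1 + w\<^sup>2) ^ k * gap P Q (\<i> * of_real w) v"
      using l by (simp add: field_simps)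
  qed
qed

lemma row_axis: "(axis j c v* M) $ k = c * M $ j $ k" for M :: "'a::comm_semiring_1^'k^'m"
proof -
  have "M $ i $ k * axis j c $ i = (if i = j then c * M $ j $ k else 0)" for i
    by (auto simp: axis_def mult.commute)
  then show ?thesis by (simp add: vector_matrix_mult_def mult.commute)
qed

text \<open>Pairing with column \<open>j\<close> of \<open>Phi\<close> is the sesquilinear form of
  \<open>gap\<close> against an axis vector, whose own gap grows polynomially. Hence a row that
  annihilates all dominated columns annihilates \<open>Phi\<close>, which is the hypothesis of
  condition (c).\<close>

lemma Phi_column_dominated:
  fixes P :: "real poly^'n^'m"
  assumes pos: "\<And>w v. gap P Q (\<i> * of_real w) v \<ge> 0"
  shows "(\<chi> i. cpoly (Phi P Q $ i $ j)) \<in> dominated P Q"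
proof -
  have "\<forall>k. \<exists>c n. c \<ge> 0 \<and> (\<forall>w::real. (cmod (poly (cpoly (Q $ j $ k)) (\<i> * of_real w)))\<^sup>2 \<le> c * (1 + w\<^sup>2) ^ n)"
    using poly_complex_bound by blast
  then obtain c n where c: "\<And>k. c k \<ge> 0"
    "\<And>k w. (cmod (poly (cpoly (Q $ j $ k)) (\<i> * of_real w)))\<^sup>2 \<le> c k * (1 + (w::real)\<^sup>2) ^ n k" by metis
  define N where "N = sum n UNIV"
  have n: "n k \<le> N" for k unfolding N_def by (rule member_le_sum) auto
  have g: "gap P Q (\<i> * of_real w) (axis j z) \<le> sum c UNIV * (1 + w\<^sup>2) ^ N" if z: "cmod z = 1" for w z
  proof -
    have "gap P Q (\<i> * of_real w) (axis j z) \<le> (norm (axis j z v* evalC Q (\<i> * of_real w)))\<^sup>2"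
      by (simp add: gap_def)
    also have "\<dots> = (\<Sum>k\<in>UNIV. (cmod (poly (cpoly (Q $ j $ k)) (\<i> * of_real w)))\<^sup>2)"
      using z by (simp add: norm_vec_def L2_set_def sum_nonneg row_axis norm_mult)
    also have "\<dots> \<le> (\<Sum>k\<in>UNIV. c k * (1 + w\<^sup>2) ^ N)"
    proof (intro sum_mono order_trans[OF c(2)] mult_left_mono c(1) power_increasing n)
    qed auto
    finally show ?thesis by (simp add: sum_distrib_right)
  qed
  show ?thesis unfolding dominated_def
  proof (intro CollectI exI conjI allI)
    show "0 \<le> 2 * sum c UNIV" using c by (simp add: sum_nonneg)
    fix w v
    let ?s = "\<i> * complex_of_real w"
    define z where "z = (\<Sum>i\<in>UNIV. v $ i * poly ((\<chi> i. cpoly (Phi P Q $ i $ j)) $ i) ?s)"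
    have inn: "a \<bullet> b = Re (\<Sum>k\<in>UNIV. a $ k * cnj (b $ k))" for a b :: "complex^'k"
      by (simp add: inner_vec_def inner_complex_def)
    have B: "(v v* evalC Q ?s) \<bullet> (axis j y v* evalC Q ?s) - (v v* evalC P ?s) \<bullet> (axis j y v* evalC P ?s)
        = Re (z * cnj y)" for y
    proof -
      have ax: "(\<Sum>i\<in>UNIV. \<Sum>l\<in>UNIV. v $ i * (F i l) * cnj (axis j y $ l)) = (\<Sum>i\<in>UNIV. v $ i * F i j) * cnj y"
        for F :: "'m \<Rightarrow> 'm \<Rightarrow> complex"
        by (simp add: axis_def if_distrib sum_distrib_right cong: if_cong)
      show ?thesis unfolding inn vecmult_cnj_sum ax z_def vec_lambda_beta Phi_eval
        by (simp add: algebra_simps sum_subtractf)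
    qed
    \<comment> \<open>The test values 1 and \<open>\<i>\<close> extract the real and the imaginary
      part of \<open>z\<close>.\<close>
    have "(Re z)\<^sup>2 \<le> gap P Q ?s v * gap P Q ?s (axis j 1)"
      using gap_cauchy_schwarz[OF pos[of w], where v=v and u="axis j 1"] unfolding B by simp
    moreover have "(Im z)\<^sup>2 \<le> gap P Q ?s v * gap P Q ?s (axis j \<i>)"
      using gap_cauchy_schwarz[OF pos[of w], where v=v and u="axis j \<i>"] unfolding B by simp
    moreover have "gap P Q ?s v * gap P Q ?s (axis j y) \<le> gap P Q ?s v * (sum c UNIV * (1 + w\<^sup>2) ^ N)"
      if "cmod y = 1" for y using g[OF that] pos by (intro mult_left_mono) auto
    ultimately have "(cmod z)\<^sup>2 \<le> 2 * (gap P Q ?s v * (sum c UNIV * (1 + w\<^sup>2) ^ N))"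
      unfolding cmod_power2 by (smt (verit) norm_one norm_ii)
    then show "(cmod (\<Sum>i\<in>UNIV. v $ i * poly ((\<chi> i. cpoly (Phi P Q $ i $ j)) $ i) ?s))\<^sup>2
      \<le> 2 * sum c UNIV * (1 + w\<^sup>2) ^ N * gap P Q ?s v" unfolding z_def by (simp add: algebra_simps)
  qed
qed

section \<open>Rank conditions as injectivity of row maps\<close>

lemma full_row_rank_iff:
  fixes M :: "'a::field^'k^'m"
  shows "rank M = CARD('m) \<longleftrightarrow> (\<forall>w. w v* M = 0 \<longrightarrow> w = 0)"
proof
  assume r: "rank M = CARD('m)"
  show "\<forall>w. w v* M = 0 \<longrightarrow> w = 0"
  proof (intro allI impI, rule ccontr)
    fix w assume w: "w v* M = 0" "w \<noteq> 0"
    then obtain k where k: "w $ k \<noteq> 0" by (auto simp: vec_eq_iff)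
    have s: "(\<Sum>i\<in>UNIV. w $ i *s row i M) = 0"
      using w(1) by (simp add: vec_eq_iff vector_matrix_mult_def row_def mult.commute)
    have e: "row k M = (\<Sum>i\<in>UNIV - {k}. (- w $ i / w $ k) *s row i M)"
    proof -
      have "w $ k *s row k M = - (\<Sum>i\<in>UNIV - {k}. w $ i *s row i M)"
        using s by (subst (asm) sum.remove[of _ k]) (auto simp: eq_neg_iff_add_eq_0)
      then have "(1 / w $ k) *s (w $ k *s row k M) = (1 / w $ k) *s (- (\<Sum>i\<in>UNIV - {k}. w $ i *s row i M))" by simp
      then show ?thesis using k
        by (simp add: vector_smult_assoc vec.scale_sum_right sum_negf[symmetric] vec_eq_iff)
    qed
    have "rows M \<subseteq> vec.span ((\<lambda>i. row i M) ` (UNIV - {k}))"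
    proof
      fix x assume "x \<in> rows M"
      then obtain i where i: "x = row i M" by (auto simp: rows_def)
      show "x \<in> vec.span ((\<lambda>i. row i M) ` (UNIV - {k}))"
      proof (cases "i = k")
        case True
        show ?thesis unfolding i True by (subst e) (intro vec.span_sum vec.span_scale vec.span_base imageI)
      qed (auto simp: i intro!: vec.span_base)
    qed
    then have "rank M \<le> card ((\<lambda>i. row i M) ` (UNIV - {k}))"
      unfolding row_rank_def_gen by (intro vec.dim_le_card) auto
    also have "\<dots> \<le> card (UNIV - {k})" by (rule card_image_le) auto
    also have "\<dots> < CARD('m)" by (intro card_Diff1_less) auto
    finally show False using r by simp
  qed
next
  assume a: "\<forall>w. w v* M = 0 \<longrightarrow> w = 0"
  have z: "c i = 0" if "(\<Sum>i\<in>UNIV. c i *s row i M) = 0" for c i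
  proof -
    have "(\<chi> i. c i) v* M = 0"
      using that by (simp add: vec_eq_iff vector_matrix_mult_def row_def mult.commute)
    then have "(\<chi> i. c i) = 0" using a by blast
    then show ?thesis by (simp add: vec_eq_iff)
  qed
  \<comment> \<open>\<open>rows M\<close> is a set, in which equal rows would be counted once; the
    hypothesis on row combinations excludes repetitions.\<close>
  have inj: "inj (\<lambda>i. row i M)"
  proof (rule injI, rule ccontr)
    fix i j assume ij: "row i M = row j M" "i \<noteq> j"
    have "(\<Sum>k\<in>UNIV. (if k = i then 1 else if k = j then - 1 else 0) *s row k M)
      = (\<Sum>k\<in>{i, j}. (if k = i then 1 else if k = j then - 1 else 0) *s row k M)"
      by (rule sum.mono_neutral_right) auto
    then show False using z[of "\<lambda>k. if k = i then 1 else if k = j then - 1 else 0" i] ij by simp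
  qed
  have rows: "rows M = range (\<lambda>i. row i M)" by (auto simp: rows_def)
  have "vec.independent (rows M)"
  proof (rule vec.independent_if_scalars_zero)
    fix f x assume s: "(\<Sum>x\<in>rows M. f x *s x) = 0" and x: "x \<in> rows M"
    from s have "(\<Sum>i\<in>UNIV. f (row i M) *s row i M) = 0"
      unfolding rows using inj by (subst (asm) sum.reindex) auto
    from z[OF this] x show "f x = 0" unfolding rows by auto
  qed (auto simp: rows)
  then have "rank M = card (rows M)" unfolding row_rank_def_gen by (rule vec.dim_eq_card_independent)
  then show "rank M = CARD('m)" unfolding rows using inj by (simp add: card_image)
qed

lemma full_row_rank_PmQ_iff:
  "rank (evalC (PmQ P Q) s) = CARD('m) \<longleftrightarrow>
    (\<forall>w::complex^'m. w v* evalC P s = 0 \<longrightarrow> w v* evalC Q s = 0 \<longrightarrow> w = 0)"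
  for P :: "real poly^'n^'m" and Q :: "real poly^'m^'m"
proof -
  have "w v* evalC (PmQ P Q) s = 0 \<longleftrightarrow> w v* evalC P s = 0 \<and> w v* evalC Q s = 0" for w :: "complex^'m"
  proof -
    have "(w v* evalC (PmQ P Q) s) $ Inl j = (w v* evalC P s) $ j"
         "(w v* evalC (PmQ P Q) s) $ Inr i = - (w v* evalC Q s) $ i" for i j
      by (simp_all add: vector_matrix_mult_def PmQ_def cpoly_minus sum_negf)
    then show ?thesis by (auto simp: vec_eq_iff split_sum_all)
  qed
  then show ?thesis unfolding full_row_rank_iff by blast
qed

lemma bounded_real_pairD:
  assumes "bounded_real_pair P Q"
  shows "0 \<le> Re s \<Longrightarrow> gap P Q s v \<ge> 0"
    and "0 \<le> Re s \<Longrightarrow> w v* evalC P s = 0 \<Longrightarrow> w v* evalC Q s = 0 \<Longrightarrow> w = 0"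
    and "p v* Phi P Q = 0 \<Longrightarrow> evalCv p s v* evalC P s = 0 \<Longrightarrow> evalCv p s v* evalC Q s = 0 \<Longrightarrow> evalCv p s = 0"
proof -
  show "0 \<le> Re s \<Longrightarrow> gap P Q s v \<ge> 0" using assms unfolding bounded_real_pair_def by (blast intro: cpsd_gap)
  show "0 \<le> Re s \<Longrightarrow> w v* evalC P s = 0 \<Longrightarrow> w v* evalC Q s = 0 \<Longrightarrow> w = 0"
    using assms unfolding bounded_real_pair_def full_row_rank_PmQ_iff by blast
  assume p: "p v* Phi P Q = 0" "evalCv p s v* evalC P s = 0" "evalCv p s v* evalC Q s = 0"
  have "(evalCv p s v* evalC (PmQ P Q) s) $ Inl j = (evalCv p s v* evalC P s) $ j"
       "(evalCv p s v* evalC (PmQ P Q) s) $ Inr i = - (evalCv p s v* evalC Q s) $ i" for i j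
    by (simp_all add: vector_matrix_mult_def PmQ_def cpoly_minus sum_negf)
  then have "evalCv p s v* evalC (PmQ P Q) s = 0" using p by (simp add: vec_eq_iff split_sum_all)
  then show "evalCv p s = 0" using assms p(1) unfolding bounded_real_pair_def Phi_def by blast
qed

text \<open>Nonnegativity of the gap forces a row killed by \<open>Q\<close> to be killed by
  \<open>P\<close> as well, which condition (b) excludes.\<close>

lemma Q_nonsingular:
  assumes "bounded_real_pair P Q" "0 \<le> Re s" "w v* evalC Q s = 0"
  shows "w = 0"
proof -
  have "gap P Q s w \<ge> 0" using bounded_real_pairD(1)[OF assms(1,2)] .
  then have "w v* evalC P s = 0" using assms(3) by (simp add: gap_def)
  then show ?thesis using bounded_real_pairD(2)[OF assms(1,2)] assms(3) by blast
qed

lemma row_scale_matrix: "(c *s w) v* M = c *s (w v* M)" for M :: "'a::comm_semiring_1^'k^'m"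
  by (simp add: vec_eq_iff vector_matrix_mult_def sum_distrib_left algebra_simps)

abbreviation repoly :: "complex poly \<Rightarrow> real poly" where "repoly \<equiv> map_poly Re"

lemma cpoly_repoly: "poly (cpoly (repoly f)) s = (poly f s + cnj (poly f (cnj s))) / 2"
proof -
  have "[:2:] * cpoly (repoly f) = f + map_poly cnj f"
    by (rule poly_eqI) (simp add: coeff_map_poly complex_eq_iff)
  then have "poly ([:2:] * cpoly (repoly f)) s = poly (f + map_poly cnj f) s" by simp
  then show ?thesis by (simp add: field_simps)
qed

lemma repoly_mult_cpoly: "repoly (f * cpoly g) = repoly f * g"
  by (rule poly_eqI) (simp add: coeff_map_poly coeff_mult)

lemma repoly_sum: "repoly (sum f S) = (\<Sum>i\<in>S. repoly (f i))"
  by (rule poly_eqI) (simp add: coeff_map_poly coeff_sum)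

text \<open>Condition (c) concerns real rows, but the row produced by
  \<open>saturated_annihilator\<close> is complex. Taking real parts of its coefficients mixes the
  values at \<open>s\<close> and at the conjugate of \<open>s\<close>; a scalar factor applied
  beforehand separates them.\<close>

lemma bounded_real_pair_complex_c:
  fixes p :: "'m::finite \<Rightarrow> complex poly" and P :: "real poly^'n^'m"
  assumes br: "bounded_real_pair P Q"
    and Phi0: "\<And>j. (\<Sum>i\<in>UNIV. p i * cpoly (Phi P Q $ i $ j)) = 0"
    and P0: "(\<chi> i. poly (p i) s) v* evalC P s = 0" and Q0: "(\<chi> i. poly (p i) s) v* evalC Q s = 0"
  shows "poly (p i) s = 0"
proof -
  have key: "poly (f i) s + cnj (poly (f i) (cnj s)) = 0"
    if f: "\<And>j. (\<Sum>i\<in>UNIV. f i * cpoly (Phi P Q $ i $ j)) = 0"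
      and v: "(\<chi> i. poly (f i) s + cnj (poly (f i) (cnj s))) v* evalC P s = 0"
             "(\<chi> i. poly (f i) s + cnj (poly (f i) (cnj s))) v* evalC Q s = 0" for f i
  proof -
    define q where "q = (\<chi> i. repoly (f i))"
    have half: "evalCv q s = (1/2) *s (\<chi> i. poly (f i) s + cnj (poly (f i) (cnj s)))"
      by (simp add: vec_eq_iff evalCv_def q_def cpoly_repoly)
    have "q v* Phi P Q = 0"
    proof -
      have "(q v* Phi P Q) $ j = repoly (\<Sum>i\<in>UNIV. f i * cpoly (Phi P Q $ i $ j))" for j
        by (simp add: vector_matrix_mult_def q_def repoly_sum repoly_mult_cpoly mult.commute)
      then show ?thesis by (simp add: f vec_eq_iff)
    qed
    then have "evalCv q s = 0"
      by (rule bounded_real_pairD(3)[OF br]) (simp_all add: half row_scale_matrix v)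
    then show ?thesis unfolding half by (simp add: vec_eq_iff)
  qed
  show ?thesis
  proof (cases "Im s = 0")
    case True
    then have cs: "cnj s = s" by (simp add: complex_eq_iff)
    have k: "poly (z * p i) s + cnj (poly (z * p i) s) = 0" if z: "z = [:c:]" for z c i
    proof (rule key[of "\<lambda>i. z * p i", unfolded cs])
      show "(\<Sum>i\<in>UNIV. z * p i * cpoly (Phi P Q $ i $ j)) = 0" for j
        using Phi0[of j] by (simp add: mult.assoc sum_distrib_left[symmetric])
      have e: "(\<chi> i. poly (z * p i) s + cnj (poly (z * p i) s)) v* evalC M s = 0"
        if "(\<chi> i. poly (p i) s) v* evalC M s = 0" for M :: "real poly^'k^'m"
      proof -
        have m: "(\<Sum>i\<in>UNIV. poly (cpoly (M $ i $ j)) s * poly (p i) s) = 0" for j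
          using that by (simp add: vec_eq_iff vector_matrix_mult_def mult.commute)
        have "((\<chi> i. poly (z * p i) s + cnj (poly (z * p i) s)) v* evalC M s) $ j =
          c * (\<Sum>i\<in>UNIV. poly (cpoly (M $ i $ j)) s * poly (p i) s)
          + cnj (c * (\<Sum>i\<in>UNIV. poly (cpoly (M $ i $ j)) s * poly (p i) s))" for j
          by (simp add: vector_matrix_mult_def z sum_distrib_left sum.distrib algebra_simps cnj_poly_cpoly cs)
        then show ?thesis unfolding m by (simp add: vec_eq_iff)
      qed
      show "(\<chi> i. poly (z * p i) s + cnj (poly (z * p i) s)) v* evalC P s = 0" by (rule e[OF P0])
      show "(\<chi> i. poly (z * p i) s + cnj (poly (z * p i) s)) v* evalC Q s = 0" by (rule e[OF Q0])
    qed
    \<comment> \<open>At a real point the factors 1 and \<open>- \<i>\<close> give the real and the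
      imaginary part of the value.\<close>
    from k[of "[:1:]" 1 i] k[of "[:-\<i>:]" "-\<i>" i] show ?thesis by (simp add: complex_eq_iff)
  next
    case False
    then have ne: "s - cnj s \<noteq> 0" by (simp add: complex_eq_iff)
    define e where "e = inverse (s - cnj s)"
    have e: "e * (s - cnj s) = 1" unfolding e_def by (rule left_inverse[OF ne])
    \<comment> \<open>\<open>h\<close> takes the value 1 at \<open>s\<close> and 0 at its conjugate,
      so only the value at \<open>s\<close> survives the averaging.\<close>
    define h where "h = smult e [:- cnj s, 1:]"
    have h: "poly h s = 1" using e by (simp add: h_def algebra_simps)
    have h': "poly h (cnj s) = 0" by (simp add: h_def)
    have "poly (h * p i) s + cnj (poly (h * p i) (cnj s)) = 0"
    proof (rule key)
      show "(\<Sum>i\<in>UNIV. h * p i * cpoly (Phi P Q $ i $ j)) = 0" for j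
        using Phi0[of j] by (simp add: mult.assoc sum_distrib_left[symmetric])
    qed (use P0 Q0 h h' in simp_all)
    then show ?thesis by (simp add: h h')
  qed
qed

abbreviation cmatp :: "real poly^'k^'m \<Rightarrow> complex poly^'k^'m" where "cmatp \<equiv> map_matrix cpoly"

lemma det_eval:
  fixes M :: "complex poly^'m^'m"
  shows "det (map_matrix (\<lambda>p. poly p s) M) = poly (det M) s"
  by (simp add: det_def map_matrix_def poly_sum poly_prod sign_def)

text \<open>On the level of polynomials, P and Q together with the dominated columns are left coprime.\<close>
theorem bounded_real_bezout:
  fixes P :: "real poly^'n^'m" and Q :: "real poly^'m^'m"
  assumes br: "bounded_real_pair P Q"
  shows "\<exists>a b. \<exists>r\<in>dominated P Q. v = cmatp P *v a - cmatp Q *v b + r"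
proof -
  have pos: "gap P Q (\<i> * of_real w) u \<ge> 0" for w u by (rule bounded_real_pairD(1)[OF br]) simp
  note subd = submoduleD[OF submodule_dominated[OF pos]]
  define N where "N = {n. \<exists>a b. \<exists>r\<in>dominated P Q. n = cmatp P *v a - cmatp Q *v b + r}"
  have NI: "cmatp P *v a - cmatp Q *v b + r \<in> N" if "r \<in> dominated P Q" for a b r
    using that unfolding N_def by blast
  obtain B where B: "cmatp Q ** B = mat (det (cmatp Q))" using adjugate_exists by blast
  have "v \<in> N"
  proof (rule submodule_local_global)
    show "submodule N" unfolding submodule_def
    proof (intro conjI ballI allI)
      show "0 \<in> N" using NI[OF subd(1), of 0 0] by (simp add: vec.zero)
      fix x y assume "x \<in> N" "y \<in> N"
      then obtain a b r a' b' r' where xy: "r \<in> dominated P Q" "x = cmatp P *v a - cmatp Q *v b + r"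
        "r' \<in> dominated P Q" "y = cmatp P *v a' - cmatp Q *v b' + r'" unfolding N_def by blast
      have "x + y = cmatp P *v (a + a') - cmatp Q *v (b + b') + (r + r')"
        unfolding xy by (simp add: matrix_vector_right_distrib algebra_simps)
      then show "x + y \<in> N" using NI[OF subd(2)[OF xy(1,3)]] by simp
    next
      fix c x assume "x \<in> N"
      then obtain a b r where x: "r \<in> dominated P Q" "x = cmatp P *v a - cmatp Q *v b + r"
        unfolding N_def by blast
      have "c *s x = cmatp P *v (c *s a) - cmatp Q *v (c *s b) + c *s r"
        unfolding x by (simp add: vec_eq_iff matrix_vector_mult_def algebra_simps sum_distrib_left)
      then show "c *s x \<in> N" using NI[OF subd(3)[OF x(1)]] by simp
    qed
  next
    show "det (cmatp Q) \<noteq> 0"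
    proof
      assume "det (cmatp Q) = 0"
      then have "det (map_matrix (\<lambda>p. poly p 0) (cmatp Q)) = 0" unfolding det_eval by simp
      moreover have "map_matrix (\<lambda>p. poly p 0) (cmatp Q) = evalC Q 0" by (simp add: vec_eq_iff map_matrix_def)
      ultimately have "det (evalC Q 0) = 0" by simp
      then have "\<not> invertible (transpose (evalC Q 0))" by (simp add: invertible_det_nz det_transpose)
      then obtain w where "w \<noteq> 0" "transpose (evalC Q 0) *v w = 0"
        unfolding invertible_left_inverse matrix_left_invertible_ker by blast
      then show False using Q_nonsingular[OF br, of 0 w] by (simp add: transpose_matrix_vector)
    qed
  next
    fix v
    \<comment> \<open>The adjugate carries every vector, multiplied by the determinant of
      \<open>Q\<close>, into the image of \<open>Q\<close>: the common multiplier that the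
      local-to-global step starts from.\<close>
    have "det (cmatp Q) *s v = cmatp Q *v (B *v v)"
      unfolding matrix_vector_mul_assoc B
      by (simp add: vec_eq_iff matrix_vector_mult_def mat_def if_distrib[of "\<lambda>x. x * _"] cong: if_cong)
    then have "det (cmatp Q) *s v = cmatp P *v 0 - cmatp Q *v (- (B *v v)) + 0"
      by (simp add: vec_eq_iff matrix_vector_mult_def sum_negf)
    then show "det (cmatp Q) *s v \<in> N" using NI[OF subd(1)] by metis
  next
    fix l p0 assume kill: "\<And>n. n \<in> N \<Longrightarrow> (\<Sum>i\<in>UNIV. p0 $ i * poly (n $ i) l) = 0"
    have ax: "M *v axis j 1 = (\<chi> i. M $ i $ j)" for M :: "complex poly^'k^'m" and j
    proof -
      have "M $ i $ k * axis j 1 $ k = (if k = j then M $ i $ j else 0)" for i k by (auto simp: axis_def)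
      then show ?thesis by (simp add: vec_eq_iff matrix_vector_mult_def)
    qed
    have P0: "p0 v* evalC P l = 0"
    proof -
      have "(\<Sum>i\<in>UNIV. p0 $ i * poly (cpoly (P $ i $ j)) l) = 0" for j
        using kill[OF NI[OF subd(1), of "axis j 1" 0]] by (simp add: ax vec.zero map_matrix_def)
      then show ?thesis by (simp add: vec_eq_iff vector_matrix_mult_def mult.commute)
    qed
    have Q0: "p0 v* evalC Q l = 0"
    proof -
      have "(\<Sum>i\<in>UNIV. p0 $ i * poly (cpoly (Q $ i $ j)) l) = 0" for j
        using kill[OF NI[OF subd(1), of 0 "axis j 1"]] by (simp add: ax vec.zero map_matrix_def sum_negf)
      then show ?thesis by (simp add: vec_eq_iff vector_matrix_mult_def mult.commute)
    qed
    show "p0 = 0"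
    proof (cases "0 \<le> Re l")
      case True
      then show ?thesis using bounded_real_pairD(2)[OF br] P0 Q0 by blast
    next
      case False
      have dN: "r \<in> dominated P Q \<Longrightarrow> r \<in> N" for r using NI[of r 0 0] by (simp add: vec.zero)
      \<comment> \<open>In the left half-plane the functional \<open>p0\<close> lifts to a
        polynomial row annihilating all dominated columns, and condition (c) makes its value at
        \<open>l\<close> vanish.\<close>
      have "\<exists>p. (\<forall>r\<in>dominated P Q. (\<Sum>i\<in>UNIV. p i * r $ i) = 0) \<and> (\<forall>i\<in>UNIV. poly (p i) l = p0 $ i)"
      proof (rule saturated_annihilator)
        show "submodule (dominated P Q)" by (rule submodule_dominated[OF pos])
        show "r \<in> dominated P Q" if "[:- l, 1:] *s r \<in> dominated P Q" for r
          by (rule dominated_saturated[OF that _ pos]) (use False in simp)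
        show "r \<in> dominated P Q \<Longrightarrow> (\<Sum>i\<in>UNIV. p0 $ i * poly (r $ i) l) = 0" for r
          by (intro kill dN)
      qed auto
      then obtain p where p: "\<And>r. r \<in> dominated P Q \<Longrightarrow> (\<Sum>i\<in>UNIV. p i * r $ i) = 0"
        "\<And>i. poly (p i) l = p0 $ i" by auto
      have "poly (p i) l = 0" for i
      proof (rule bounded_real_pair_complex_c[OF br])
        show "(\<Sum>i\<in>UNIV. p i * cpoly (Phi P Q $ i $ j)) = 0" for j
          using p(1)[OF Phi_column_dominated[OF pos, of j]] by simp
      qed (use P0 Q0 p(2) in simp_all)
      then show ?thesis using p(2) by (simp add: vec_eq_iff)
    qed
  qed
  then show ?thesis unfolding N_def by blast
qed

section \<open>Quadratic storage functions\<close>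

text \<open>Cauchy's functional equation with boundedness in place of continuity: after removal of
  the linear part the function vanishes at integers, so it is bounded on the whole line, and
  \<open>g (n * t) = n * g t\<close> leaves only zero.\<close>

lemma additive_bounded_linear:
  fixes f :: "real \<Rightarrow> real"
  assumes add: "\<And>s t. f (s + t) = f s + f t" and bd: "\<And>t. 0 \<le> t \<Longrightarrow> t \<le> 1 \<Longrightarrow> \<bar>f t\<bar> \<le> B"
  shows "f t = t * f 1"
proof -
  define g where "g t = f t - t * f 1" for t
  have gadd: "g (s + t) = g s + g t" for s t by (simp add: g_def add algebra_simps)
  have g0: "g 0 = 0" using gadd[of 0 0] by simp
  have gn: "g (of_nat n * t) = of_nat n * g t" for n t
    by (induction n) (auto simp: g0 gadd algebra_simps)
  have g1: "g 1 = 0" by (simp add: g_def)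
  have gneg: "g (- t) = - g t" for t using gadd[of t "- t"] g0 by simp
  have gi: "g (of_int k) = 0" for k
  proof (cases k)
    case (nonneg n) then show ?thesis using gn[of n 1] g1 by simp
  next
    case (neg n)
    then show ?thesis using gn[of "Suc n" 1] g1 gneg[of "of_nat (Suc n)"] by simp
  qed
  have bdg: "\<bar>g t\<bar> \<le> B + \<bar>f 1\<bar>" for t
  proof -
    have "g t = g (frac t) + g (of_int \<lfloor>t\<rfloor>)" unfolding gadd[symmetric] by (simp add: frac_def)
    then have "g t = g (frac t)" using gi by simp
    moreover have "\<bar>f (frac t)\<bar> \<le> B" by (rule bd) (auto simp: frac_lt_1 less_imp_le)
    moreover have "\<bar>frac t * f 1\<bar> \<le> 1 * \<bar>f 1\<bar>"
      unfolding abs_mult by (intro mult_right_mono) (auto simp: frac_lt_1 less_imp_le)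
    ultimately show ?thesis unfolding g_def by linarith
  qed
  have "g t = 0"
  proof (rule ccontr)
    assume nz: "g t \<noteq> 0"
    obtain n :: nat where n: "(B + \<bar>f 1\<bar>) / \<bar>g t\<bar> < n" using reals_Archimedean2 by blast
    have "of_nat n * \<bar>g t\<bar> \<le> B + \<bar>f 1\<bar>" using bdg[of "of_nat n * t"] unfolding gn abs_mult by simp
    then show False using n nz by (simp add: field_simps)
  qed
  then show ?thesis by (simp add: g_def)
qed

text \<open>The Jordan-von Neumann argument: polarization gives an additive form, and |b x y| <= (S
  x + S y) / 2 supplies the boundedness on [0, 1] that turns additivity into linearity.\<close>

lemma parallelogram_quadratic:
  fixes S :: "real^'d \<Rightarrow> real"
  assumes pos: "\<And>x. 0 \<le> S x" and hom: "\<And>r x. S (r *\<^sub>R x) = r\<^sup>2 * S x"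
    and par: "\<And>x y. S (x + y) + S (x - y) = 2 * S x + 2 * S y"
  shows "\<exists>X. sym_mat X \<and> (\<forall>x. S x = x \<bullet> (X *v x))"
proof -
  define b where "b x y = (S (x + y) - S (x - y)) / 4" for x y
  have S0: "S 0 = 0" using hom[of 0 0] by simp
  have Sneg: "S (- x) = S x" for x using hom[of "-1" x] by simp
  have bsym: "b x y = b y x" for x y
    using Sneg[of "x - y"] by (simp add: b_def add.commute)
  \<comment> \<open>The law for x + z, y + z minus the law for x - z, y - z; the terms in x - y
    cancel.\<close>
  have half: "b x z + b y z = b (x + y) (2 *\<^sub>R z) / 2" for x y z
  proof -
    have 1: "S ((x + z) + (y + z)) + S ((x + z) - (y + z)) = 2 * S (x + z) + 2 * S (y + z)" by (rule par)
    have 2: "S ((x - z) + (y - z)) + S ((x - z) - (y - z)) = 2 * S (x - z) + 2 * S (y - z)" by (rule par)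
    have "(x + z) + (y + z) = (x + y) + 2 *\<^sub>R z" "(x - z) + (y - z) = (x + y) - 2 *\<^sub>R z"
      "(x + z) - (y + z) = (x - z) - (y - z)" by (simp_all add: scaleR_2)
    with 1 2 show ?thesis by (simp add: b_def field_simps)
  qed
  have b0: "b 0 z = 0" for z by (simp add: b_def Sneg)
  have dbl: "b x (2 *\<^sub>R z) / 2 = b x z" for x z using half[of x z 0] b0 by simp
  have badd: "b (x + y) z = b x z + b y z" for x y z using half[of x z y] dbl by simp
  have bd: "\<bar>b x y\<bar> \<le> (S x + S y) / 2" for x y
  proof -
    have "\<bar>S (x + y) - S (x - y)\<bar> \<le> S (x + y) + S (x - y)" using pos[of "x + y"] pos[of "x - y"] by linarith
    then show ?thesis using par[of x y] by (simp add: b_def)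
  qed
  have bscale: "b (t *\<^sub>R x) y = t * b x y" for t x y
  proof -
    have "b (t *\<^sub>R x) y = t * b (1 *\<^sub>R x) y"
    proof (rule additive_bounded_linear[where B = "(S x + S y) / 2"])
      show "b ((s + t) *\<^sub>R x) y = b (s *\<^sub>R x) y + b (t *\<^sub>R x) y" for s t
        by (simp add: scaleR_add_left badd)
      fix t :: real assume t: "0 \<le> t" "t \<le> 1"
      have "t\<^sup>2 * S x \<le> 1 * S x" using t by (intro mult_right_mono pos) (auto simp: power_le_one)
      then show "\<bar>b (t *\<^sub>R x) y\<bar> \<le> (S x + S y) / 2" using bd[of "t *\<^sub>R x" y] by (simp add: hom)
    qed
    then show ?thesis by simp
  qed
  have lin: "linear (\<lambda>x. b x y)" for y by (rule linearI) (auto simp: badd bscale)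
  define X where "X = (\<chi> i j. b (axis i 1) (axis j 1))"
  have ex: "b x y = (\<Sum>i\<in>UNIV. x $ i * b (axis i 1) y)" for x y
  proof -
    have "x = (\<Sum>i\<in>UNIV. x $ i *\<^sub>R axis i 1)"
      using basis_expansion[of x] by (simp add: scalar_mult_eq_scaleR)
    then have "b x y = b (\<Sum>i\<in>UNIV. x $ i *\<^sub>R axis i 1) y" by simp
    also have "\<dots> = (\<Sum>i\<in>UNIV. x $ i * b (axis i 1) y)"
      by (simp add: linear_sum[OF lin] bscale)
    finally show ?thesis .
  qed
  have "S x = x \<bullet> (X *v x)" for x
  proof -
    have "S x = b x x" using hom[of 2 x] by (simp add: b_def S0 scaleR_2)
    also have "\<dots> = (\<Sum>i\<in>UNIV. x $ i * b x (axis i 1))" by (subst ex) (simp add: bsym)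
    also have "\<dots> = (\<Sum>i\<in>UNIV. x $ i * (\<Sum>j\<in>UNIV. x $ j * b (axis j 1) (axis i 1)))"
      by (subst ex) simp
    also have "\<dots> = x \<bullet> (X *v x)"
      by (simp add: inner_vec_def matrix_vector_mult_def X_def bsym mult.commute)
    finally show ?thesis .
  qed
  moreover have "sym_mat X" by (simp add: sym_mat_def transpose_def X_def vec_eq_iff bsym)
  ultimately show ?thesis by blast
qed

text \<open>Suprema only give 2 S x + 2 S y <= S (x + y) + S (x - y). Applied to x + y and x - y,
  together with S (2 x) = 4 S x, this becomes the reverse inequality.\<close>

lemma Sup_quadratic:
  fixes V :: "real^'d \<Rightarrow> real set"
  assumes bdd: "\<And>x. bdd_above (V x)" and nn: "\<And>x. \<exists>a\<in>V x. 0 \<le> a"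
    and sc: "\<And>r x a. a \<in> V x \<Longrightarrow> r\<^sup>2 * a \<in> V (r *\<^sub>R x)"
    and par: "\<And>x y a b. a \<in> V x \<Longrightarrow> b \<in> V y \<Longrightarrow> \<exists>c\<in>V (x + y). \<exists>d\<in>V (x - y). 2 * a + 2 * b \<le> c + d"
  shows "\<exists>X. sym_mat X \<and> psd X \<and> (\<forall>x. Sup (V x) = x \<bullet> (X *v x))"
proof -
  define S where "S x = Sup (V x)" for x
  have ne: "V x \<noteq> {}" for x using nn by blast
  have up: "a \<in> V x \<Longrightarrow> a \<le> S x" for a x unfolding S_def by (rule cSup_upper[OF _ bdd])
  have le: "S x \<le> z" if "\<And>a. a \<in> V x \<Longrightarrow> a \<le> z" for x z unfolding S_def by (rule cSup_least[OF ne that])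
  have pos: "0 \<le> S x" for x using nn[of x] up by fastforce
  have hom1: "r\<^sup>2 * S x \<le> S (r *\<^sub>R x)" for r x
  proof (cases "r = 0")
    case False
    have "S x \<le> S (r *\<^sub>R x) / r\<^sup>2"
      by (rule le) (use False up[OF sc] in \<open>simp add: field_simps\<close>)
    then show ?thesis using False by (simp add: field_simps)
  qed (use pos in simp)
  have hom: "S (r *\<^sub>R x) = r\<^sup>2 * S x" for r x
  proof (cases "r = 0")
    case True
    have "a \<le> 0" if "a \<in> V 0" for a
    proof (rule ccontr)
      assume "\<not> a \<le> 0"
      have "r\<^sup>2 * a \<le> S 0" for r using up[OF sc[OF that, of r]] by simp
      \<comment> \<open>For this r the product r^2 a equals S 0 + a, which exceeds S 0.\<close>
      from this[of "sqrt (S 0 / a + 1)"] show False using \<open>\<not> a \<le> 0\<close> pos[of 0]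
        by (simp add: algebra_simps)
    qed
    then have "S 0 \<le> 0" by (rule le)
    then show ?thesis using True pos[of 0] by simp
  next
    case False
    have "(1 / r)\<^sup>2 * S (r *\<^sub>R x) \<le> S ((1 / r) *\<^sub>R (r *\<^sub>R x))" by (rule hom1)
    then have "S (r *\<^sub>R x) \<le> r\<^sup>2 * S x" using False by (simp add: field_simps)
    then show ?thesis using hom1[of r x] by simp
  qed
  have par1: "2 * S x + 2 * S y \<le> S (x + y) + S (x - y)" for x y
  proof -
    have 1: "2 * a + 2 * b \<le> S (x + y) + S (x - y)" if ab: "a \<in> V x" "b \<in> V y" for a b
    proof -
      obtain c d where "c \<in> V (x + y)" "d \<in> V (x - y)" "2 * a + 2 * b \<le> c + d" using par[OF ab] by blast
      then show ?thesis using up[of c "x + y"] up[of d "x - y"] by linarith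
    qed
    have "S x \<le> (S (x + y) + S (x - y)) / 2 - b" if b: "b \<in> V y" for b
    proof (rule le)
      fix a assume "a \<in> V x"
      from 1[OF this b] show "a \<le> (S (x + y) + S (x - y)) / 2 - b" by (simp add: field_simps)
    qed
    then have "b \<le> (S (x + y) + S (x - y)) / 2 - S x" if "b \<in> V y" for b using that by fastforce
    then have "S y \<le> (S (x + y) + S (x - y)) / 2 - S x" by (rule le)
    then show ?thesis by (simp add: field_simps)
  qed
  have "S (x + y) + S (x - y) = 2 * S x + 2 * S y" for x y
  proof (rule antisym[OF _ par1])
    have "(x + y) + (x - y) = 2 *\<^sub>R x" "(x + y) - (x - y) = 2 *\<^sub>R y" by (simp_all add: scaleR_2)
    with par1[of "x + y" "x - y"] show "S (x + y) + S (x - y) \<le> 2 * S x + 2 * S y" by (simp add: hom)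
  qed
  from parallelogram_quadratic[of S, OF pos hom this] obtain X where
    X: "sym_mat X" "\<And>x. S x = x \<bullet> (X *v x)" by blast
  moreover have "psd X" using X pos by (auto simp: psd_def)
  ultimately show ?thesis unfolding S_def by blast
qed

lemma inner_matrix_transpose: "(M *v x) \<bullet> y = x \<bullet> (transpose M *v y)" for M :: "real^'k^'m"
  by (subst vector_transpose_matrix[symmetric]) (rule dot_lmul_matrix)
lemma sym_mat_inner: "sym_mat X \<Longrightarrow> x \<bullet> (X *v y) = (X *v x) \<bullet> y"
  by (simp add: inner_matrix_transpose sym_mat_def)

text \<open>The linear matrix inequality as a dissipation inequality for the storage function
  x \<bullet> X x.\<close>
definition dissipative :: "real^'d^'d \<Rightarrow> real^'n^'d \<Rightarrow> real^'d^'m \<Rightarrow> real^'n^'m \<Rightarrow> real^'d^'d \<Rightarrow> bool" where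
  "dissipative A B C D X \<longleftrightarrow> (\<forall>x u. 2 * (x \<bullet> (X *v (A *v x + B *v u))) + (norm (C *v x + D *v u))\<^sup>2 \<le> (norm u)\<^sup>2)"

lemma Lambda_form:
  fixes v :: "real^('d::finite + 'n::finite)" and A :: "real^'d^'d" and B :: "real^'n^'d"
  assumes "sym_mat X"
  defines "x \<equiv> (\<chi> i. v $ Inl i)" and "u \<equiv> (\<chi> i. v $ Inr i)"
  shows "v \<bullet> (Lambda A B C D X *v v) =
    (norm u)\<^sup>2 - (norm (C *v x + D *v u))\<^sup>2 - 2 * (x \<bullet> (X *v (A *v x + B *v u)))"
proof -
  have s: "sum f (UNIV :: ('d + 'n) set) = (\<Sum>i\<in>UNIV. f (Inl i)) + (\<Sum>i\<in>UNIV. f (Inr i))"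
    for f :: "'d + 'n \<Rightarrow> real"
    by (subst UNIV_Plus_UNIV[symmetric], subst sum.Plus) auto
  let ?L11 = "- (transpose A ** X) - X ** A - transpose C ** C" and ?L12 = "- (transpose C ** D) - X ** B"
    and ?L21 = "- (transpose D ** C) - transpose B ** X" and ?L22 = "mat 1 - transpose D ** D"
  have 1: "(Lambda A B C D X *v v) $ Inl i = (?L11 *v x + ?L12 *v u) $ i" for i
    by (simp add: matrix_vector_mult_def s Lambda_def x_def u_def)
  have 2: "(Lambda A B C D X *v v) $ Inr i = (?L21 *v x + ?L22 *v u) $ i" for i
    by (simp add: matrix_vector_mult_def s Lambda_def x_def u_def)
  have "v \<bullet> (Lambda A B C D X *v v) = x \<bullet> (?L11 *v x + ?L12 *v u) + u \<bullet> (?L21 *v x + ?L22 *v u)"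
    unfolding inner_vec_def s 1 2 by (simp add: x_def u_def)
  also have "\<dots> = (norm u)\<^sup>2 - (norm (C *v x + D *v u))\<^sup>2 - 2 * (x \<bullet> (X *v (A *v x + B *v u)))"
  proof -
    have neg: "(- M) *v w = - (M *v w)" for M :: "real^'k^'l" and w
      by (simp add: vec_eq_iff matrix_vector_mult_def sum_negf)
    have neg1: "(- M) *v w = - (M *v w)" for M :: "real^'n^'d" and w
      by (simp add: vec_eq_iff matrix_vector_mult_def sum_negf)
    have neg2: "(- M) *v w = - (M *v w)" for M :: "real^'d^'d" and w
      by (simp add: vec_eq_iff matrix_vector_mult_def sum_negf)
    have neg3: "(- M) *v w = - (M *v w)" for M :: "real^'d^'n" and w
      by (simp add: vec_eq_iff matrix_vector_mult_def sum_negf)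
    have t: "a \<bullet> (transpose M *v b) = (M *v a) \<bullet> b" for M :: "real^'d^'d" and a b
      by (simp add: inner_matrix_transpose)
    have t2: "a \<bullet> (transpose B *v b) = (B *v a) \<bullet> b" for a b by (simp add: inner_matrix_transpose)
    have t3: "a \<bullet> (transpose C *v b) = (C *v a) \<bullet> b" for a b by (simp add: inner_matrix_transpose)
    have t4: "a \<bullet> (transpose D *v b) = (D *v a) \<bullet> b" for a b by (simp add: inner_matrix_transpose)
    show ?thesis
      unfolding matrix_vector_mult_diff_rdistrib neg1 neg2 neg3 matrix_vector_mul_assoc[symmetric]
        inner_add_right inner_diff_right inner_minus_right t t2 t3 t4 matrix_vector_mul_lid
        matrix_vector_right_distrib power2_norm_eq_inner inner_add_left
      using sym_mat_inner[OF assms(1), of x "A *v x"] sym_mat_inner[OF assms(1), of x "B *v u"]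
        inner_commute[of "A *v x" "X *v x"] inner_commute[of "B *v u" "X *v x"]
        inner_commute[of "D *v u" "C *v x"]
      by (simp add: algebra_simps)
  qed
  finally show ?thesis .
qed

lemma psd_Lambda_iff:
  fixes A :: "real^'d^'d" and B :: "real^'n^'d"
  assumes X: "sym_mat X"
  shows "psd (Lambda A B C D X) \<longleftrightarrow> dissipative A B C D X"
proof
  assume p: "psd (Lambda A B C D X)"
  show "dissipative A B C D X" unfolding dissipative_def
  proof (intro allI)
    fix x u
    have "0 \<le> (\<chi> i. case i of Inl a \<Rightarrow> x $ a | Inr b \<Rightarrow> u $ b) \<bullet>
      (Lambda A B C D X *v (\<chi> i. case i of Inl a \<Rightarrow> x $ a | Inr b \<Rightarrow> u $ b))"
      using p unfolding psd_def by blast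
    then show "2 * (x \<bullet> (X *v (A *v x + B *v u))) + (norm (C *v x + D *v u))\<^sup>2 \<le> (norm u)\<^sup>2"
      unfolding Lambda_form[OF X] by simp
  qed
next
  assume d: "dissipative A B C D X"
  have "Lambda A B C D X $ i $ j = Lambda A B C D X $ j $ i" for i j
  proof -
    have XX: "X $ a $ b = X $ b $ a" for a b
      using X unfolding sym_mat_def transpose_def by (metis vec_lambda_beta)
    show ?thesis
      by (cases i; cases j) (auto simp: Lambda_def matrix_matrix_mult_def transpose_def XX mult.commute mat_def)
  qed
  then have "sym_mat (Lambda A B C D X)" by (simp add: sym_mat_def transpose_def vec_eq_iff)
  moreover have "0 \<le> v \<bullet> (Lambda A B C D X *v v)" for v
    unfolding Lambda_form[OF X] using d unfolding dissipative_def by (simp add: algebra_simps)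
  ultimately show "psd (Lambda A B C D X)" by (simp add: psd_def)
qed

text \<open>There are more vectors than dimensions. The coefficients form a polynomial, whose degree
  records the length of the relation; a repetition in the sequence, invisible to dependence of a
  set, is a difference of two monomials.\<close>

lemma exists_linear_relation:
  fixes f :: "nat \<Rightarrow> 'a::euclidean_space"
  shows "\<exists>a::real poly. a \<noteq> 0 \<and> degree a \<le> DIM('a) \<and> (\<Sum>k\<le>degree a. coeff a k *\<^sub>R f k) = 0"
proof (cases "inj_on f {..DIM('a)}")
  case True
  define S where "S = f ` {..DIM('a)}"
  have "card S = Suc DIM('a)" using True by (simp add: S_def card_image)
  then have "dependent S" by (intro dependent_biggerset) simp
  then obtain g where g: "\<exists>v\<in>S. g v \<noteq> 0" "(\<Sum>v\<in>S. g v *\<^sub>R v) = 0"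
    by (subst (asm) dependent_finite) (auto simp: S_def)
  define a where "a = (\<Sum>k\<le>DIM('a). monom (g (f k)) k)"
  have c: "coeff a k = (if k \<le> DIM('a) then g (f k) else 0)" for k
    by (simp add: a_def coeff_sum if_distrib cong: if_cong)
  obtain k where "k \<le> DIM('a)" "g (f k) \<noteq> 0" using g(1) by (auto simp: S_def)
  then have "coeff a k \<noteq> 0" by (simp add: c)
  then have "a \<noteq> 0" by auto
  have d: "degree a \<le> DIM('a)" by (intro degree_le) (simp add: c)
  then have "(\<Sum>k\<le>degree a. coeff a k *\<^sub>R f k) = (\<Sum>k\<le>DIM('a). coeff a k *\<^sub>R f k)" (is "?l = _")
    by (intro sum.mono_neutral_left) (auto simp: coeff_eq_0)
  also have "\<dots> = (\<Sum>v\<in>S. g v *\<^sub>R v)" unfolding S_def using True by (subst sum.reindex) (auto simp: c)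
  finally have "?l = 0" using g(2) by simp
  with \<open>a \<noteq> 0\<close> d show ?thesis by blast
next
  case False
  then obtain i j where ij: "f i = f j" "i < j" "j \<le> DIM('a)"
    unfolding inj_on_def by (metis atMost_iff linorder_neq_iff)
  define a :: "real poly" where "a = monom 1 j - monom 1 i"
  have "coeff a j = 1" using ij(2) by (simp add: a_def)
  then have d: "degree a = j"
    using ij(2) by (intro antisym degree_le le_degree) (auto simp: a_def)
  note \<open>coeff a j = 1\<close>
  then have "a \<noteq> 0" by auto
  moreover have "(\<Sum>k\<le>j. coeff a k *\<^sub>R f k) = (\<Sum>k\<le>j. (if k = j then f j else 0) - (if k = i then f i else 0))"
    by (rule sum.cong) (use ij in \<open>auto simp: a_def\<close>)
  then have "(\<Sum>k\<le>j. coeff a k *\<^sub>R f k) = 0" using ij by (simp add: sum_subtractf)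
  ultimately show ?thesis using d ij(3) by auto
qed

section \<open>The midpoint discretization\<close>

abbreviation cmat :: "real^'k^'m \<Rightarrow> complex^'k^'m" where "cmat \<equiv> map_matrix complex_of_real"

definition cvec :: "real^'k \<Rightarrow> complex^'k" where "cvec x = (\<chi> i. complex_of_real (x $ i))"

lemma cvec_component [simp]: "cvec x $ i = of_real (x $ i)" by (simp add: cvec_def)

lemma cmat_component [simp]: "cmat M $ i $ j = of_real (M $ i $ j)" by (simp add: map_matrix_def)

lemma cmat_cvec: "cmat M *v cvec x = cvec (M *v x)"
  by (simp add: vec_eq_iff matrix_vector_mult_def)

lemma cvec_add: "cvec (x + y) = cvec x + cvec y"
  and cvec_diff: "cvec (x - y) = cvec x - cvec y"
  and cvec_zero [simp]: "cvec 0 = 0"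
  by (simp_all add: vec_eq_iff)

lemma cvec_scale: "cvec (r *s x) = of_real r *s cvec x"
  by (simp add: vec_eq_iff)

lemma norm_cvec [simp]: "norm (cvec x) = norm x"
  by (simp add: norm_vec_def L2_set_def)

section \<open>Decay of matrix powers\<close>

lemma matpow_comm: "matpow M k ** M = M ** matpow M k" for M :: "'a::comm_ring_1^'n^'n"
  by (induction k) (simp_all add: matrix_mul_assoc matrix_mul_lid matrix_mul_rid, metis matrix_mul_assoc)

lemma matpow_Suc_vec: "matpow M (Suc k) *v v = matpow M k *v (M *v v)" for M :: "'a::comm_ring_1^'n^'n"
  by (simp add: matrix_vector_mul_assoc matpow_comm)

text \<open>In w (k+1) = l w k + error, the late errors contribute at most a small geometric series,
  while the earlier value decays like |l|^k.\<close>

lemma contracting_recursion: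
  fixes w :: "nat \<Rightarrow> complex^'n"
  assumes l: "cmod l < 1" and lim: "(\<lambda>k. w (Suc k) - l *s w k) \<longlonglongrightarrow> 0"
  shows "w \<longlonglongrightarrow> 0"
proof (rule LIMSEQ_I)
  fix e :: real assume e: "e > 0"
  let ?r = "cmod l"
  have nsc: "norm (c *s v) = cmod c * norm v" for c and v :: "complex^'n"
    by (simp add: norm_vec_def L2_set_def norm_mult power_mult_distrib sum_distrib_left[symmetric] real_sqrt_mult)
  \<comment> \<open>Errors below \<open>d\<close> sum geometrically to at most e / 2.\<close>
  define d where "d = e / 2 * (1 - ?r)"
  have d: "d > 0" using e l by (simp add: d_def)
  from LIMSEQ_D[OF lim d] obtain N where N: "\<And>k. k \<ge> N \<Longrightarrow> norm (w (Suc k) - l *s w k) < d" by auto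
  have bd: "norm (w (N + j)) \<le> ?r ^ j * norm (w N) + e / 2" for j
  proof (induction j)
    case 0 then show ?case using e by simp
  next
    case (Suc j)
    have "norm (w (Suc (N + j))) \<le> norm (w (Suc (N + j)) - l *s w (N + j)) + norm (l *s w (N + j))"
      using norm_triangle_ineq[of "w (Suc (N + j)) - l *s w (N + j)" "l *s w (N + j)"] by simp
    also have "\<dots> \<le> d + ?r * (?r ^ j * norm (w N) + e / 2)"
      using N[of "N + j"] Suc by (intro add_mono) (auto simp: nsc mult_left_mono)
    also have "\<dots> = ?r ^ Suc j * norm (w N) + e / 2" by (simp add: d_def field_simps)
    finally show ?case by simp
  qed
  have "(\<lambda>j. ?r ^ j * norm (w N)) \<longlonglongrightarrow> 0 * norm (w N)"
    by (intro tendsto_mult LIMSEQ_realpow_zero tendsto_const) (use l in auto)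
  then have "(\<lambda>j. ?r ^ j * norm (w N)) \<longlonglongrightarrow> 0" by simp
  from LIMSEQ_D[OF this, of "e / 2"] e obtain J where J: "\<And>j. j \<ge> J \<Longrightarrow> ?r ^ j * norm (w N) < e / 2" by auto
  show "\<exists>no. \<forall>n\<ge>no. norm (w n - 0) < e"
  proof (intro exI allI impI)
    fix n assume n: "n \<ge> N + J"
    then have "norm (w n) \<le> ?r ^ (n - N) * norm (w N) + e / 2" using bd[of "n - N"] by simp
    moreover have "?r ^ (n - N) * norm (w N) < e / 2" using n by (intro J) simp
    ultimately show "norm (w n - 0) < e" by simp
  qed
qed

lemma scaleR_complex_vec: "r *\<^sub>R v = complex_of_real r *s v" for v :: "complex^'k"
  unfolding vec_eq_iff vector_scaleR_component vector_smult_component by (simp add: scaleR_conv_of_real)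

lemma matpow_tendsto_zero:
  fixes M :: "complex^'n^'n"
  assumes ev: "\<And>z v. M *v v = z *s v \<Longrightarrow> v \<noteq> 0 \<Longrightarrow> cmod z < 1"
  shows "(\<lambda>k. matpow M k *v v) \<longlonglongrightarrow> 0"
proof -
  define app where "app n p v = (\<Sum>k\<le>n. coeff p k *s (matpow M k *v v))" for n p v
  have shift: "app (Suc n) ([:-l, 1:] * p) v = app n p (M *v v - l *s v)"
    "app (Suc n) ([:-l, 1:] * p) v = M *v app n p v - l *s app n p v" if "degree p \<le> n" for n p l v
  proof -
    have p0: "coeff p (Suc n) = 0" using that by (simp add: coeff_eq_0)
    have mp: "[:-l, 1:] * p = pCons 0 p - smult l p" by simp
    have "app (Suc n) ([:-l, 1:] * p) v = (\<Sum>k\<le>Suc n. coeff (pCons 0 p) k *s (matpow M k *v v))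
        - (\<Sum>k\<le>Suc n. (l * coeff p k) *s (matpow M k *v v))"
      unfolding app_def mp by (simp add: vector_sub_rdistrib sum_subtractf)
    also have "(\<Sum>k\<le>Suc n. (l * coeff p k) *s (matpow M k *v v)) = l *s app n p v"
      by (simp add: p0 app_def vec.scale_sum_right vector_smult_assoc)
    also have "(\<Sum>k\<le>Suc n. coeff (pCons 0 p) k *s (matpow M k *v v))
        = (\<Sum>k\<le>n. coeff p k *s (matpow M (Suc k) *v v))"
      by (subst sum.atMost_Suc_shift) simp
    finally have *: "app (Suc n) ([:-l, 1:] * p) v = (\<Sum>k\<le>n. coeff p k *s (matpow M (Suc k) *v v)) - l *s app n p v" .
    show "app (Suc n) ([:-l, 1:] * p) v = app n p (M *v v - l *s v)"
      unfolding * matpow_Suc_vec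
      by (simp add: app_def vec.diff vec.scale vec.scale_sum_right vector_smult_assoc sum_subtractf
          vector_ssub_ldistrib mult.commute)
    show "app (Suc n) ([:-l, 1:] * p) v = M *v app n p v - l *s app n p v"
      unfolding * by (simp add: app_def vec.sum vec.scale matrix_vector_mul_assoc)
  qed
  have key: "p \<noteq> 0 \<Longrightarrow> degree p \<le> n \<Longrightarrow> app n p v = 0 \<Longrightarrow> (\<lambda>k. matpow M k *v v) \<longlonglongrightarrow> 0" for n p v
  proof (induction n arbitrary: p v)
    case 0
    then have "coeff p 0 \<noteq> 0" by (metis le_zero_eq leading_coeff_0_iff)
    then have "v = 0" using 0 by (simp add: app_def)
    then show ?case by simp
  next
    case (Suc n)
    show ?case
    proof (cases "degree p = 0")
      case True
      have "app (Suc n) p v = (\<Sum>k\<le>Suc n. if k = 0 then coeff p 0 *s v else 0)"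
        unfolding app_def by (intro sum.cong) (use True in \<open>auto simp: coeff_eq_0\<close>)
      then have "coeff p 0 *s v = 0" using Suc.prems by simp
      moreover have "coeff p 0 \<noteq> 0" using True Suc.prems(1) by (metis leading_coeff_0_iff)
      ultimately have "v = 0" by simp
      then show ?thesis by simp
    next
      case False
      then obtain l where "poly p l = 0"
        using fundamental_theorem_of_algebra[of p] constant_degree[of p] by auto
      then obtain q where q: "p = [:-l, 1:] * q" by (auto simp: poly_eq_0_iff_dvd elim: dvdE)
      have q0: "q \<noteq> 0" using Suc.prems(1) q by auto
      have "degree p = Suc (degree q)" unfolding q using q0 by (subst degree_mult_eq) auto
      then have dq: "degree q \<le> n" using Suc.prems(2) by simp
      show ?thesis
      proof (cases "cmod l < 1")
        case True
        have "app n q (M *v v - l *s v) = 0" using shift(1)[OF dq] Suc.prems(3) unfolding q by simp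
        from Suc.IH[OF q0 dq this] have "(\<lambda>k. matpow M k *v (M *v v - l *s v)) \<longlonglongrightarrow> 0" .
        then have "(\<lambda>k. matpow M (Suc k) *v v - l *s (matpow M k *v v)) \<longlonglongrightarrow> 0"
          unfolding matpow_Suc_vec by (simp add: vec.diff vec.scale)
        then show ?thesis by (rule contracting_recursion[OF True])
      next
        case False
        have "M *v app n q v = l *s app n q v" using shift(2)[OF dq] Suc.prems(3) unfolding q by simp
        then have "app n q v = 0" using ev False by blast
        then show ?thesis by (rule Suc.IH[OF q0 dq])
      qed
    qed
  qed
  obtain a :: "real poly" where a: "a \<noteq> 0" "(\<Sum>k\<le>degree a. coeff a k *\<^sub>R (matpow M k *v v)) = 0"
    using exists_linear_relation[of "\<lambda>k. matpow M k *v v"] by auto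
  have "app (degree a) (cpoly a) v = (\<Sum>k\<le>degree a. coeff a k *\<^sub>R (matpow M k *v v))"
    by (simp add: app_def scaleR_complex_vec)
  then show ?thesis using a by (intro key[of "cpoly a" "degree a"]) (auto intro!: degree_le simp: coeff_eq_0)
qed

lemma matpow_cmat: "matpow (cmat M) k *v cvec x = cvec (matpow M k *v x)"
proof (induction k)
  case (Suc k)
  then show ?case by (simp add: matrix_vector_mul_assoc[symmetric] cmat_cvec)
qed simp

lemma real_matpow_tendsto_zero:
  fixes M :: "real^'n^'n"
  assumes "\<And>z v. cmat M *v v = z *s v \<Longrightarrow> v \<noteq> 0 \<Longrightarrow> cmod z < 1"
  shows "(\<lambda>k. matpow M k *v x) \<longlonglongrightarrow> 0"
proof -
  have "(\<lambda>k. norm (matpow (cmat M) k *v cvec x)) \<longlonglongrightarrow> 0"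
    by (intro tendsto_norm_zero matpow_tendsto_zero assms)
  then show ?thesis unfolding matpow_cmat norm_cvec by (rule tendsto_norm_zero_cancel)
qed

lemma dominated_family:
  fixes r :: "'d::finite \<Rightarrow> complex poly^'m"
  assumes r: "\<And>l. r l \<in> dominated P Q" and pos: "\<And>w v. gap P Q (\<i> * of_real w) v \<ge> 0"
  shows "\<exists>K k. K \<ge> 0 \<and> (\<forall>w v. (\<Sum>l\<in>UNIV. (cmod (\<Sum>i\<in>UNIV. v $ i * poly (r l $ i) (\<i> * of_real w)))\<^sup>2)
     \<le> K * (1 + w\<^sup>2) ^ k * gap P Q (\<i> * of_real w) v)"
proof -
  define F where "F l c k \<longleftrightarrow> c \<ge> 0 \<and> (\<forall>w v. (cmod (\<Sum>i\<in>UNIV. v $ i * poly (r l $ i) (\<i> * of_real w)))\<^sup>2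
      \<le> c * (1 + w\<^sup>2) ^ k * gap P Q (\<i> * of_real w) v)" for l c k
  have "\<exists>c k. F l c k" for l using r[of l] unfolding dominated_def F_def by (rule CollectD)
  then obtain c k where "\<And>l. F l (c l) (k l)" by metis
  then have c: "\<And>l. c l \<ge> 0" "\<And>l w v. (cmod (\<Sum>i\<in>UNIV. v $ i * poly (r l $ i) (\<i> * of_real w)))\<^sup>2
      \<le> c l * (1 + w\<^sup>2) ^ k l * gap P Q (\<i> * of_real w) v" unfolding F_def by blast+
  have k: "k l \<le> sum k UNIV" for l by (rule member_le_sum) auto
  show ?thesis
  proof (intro exI conjI allI)
    show "0 \<le> sum c UNIV" using c by (simp add: sum_nonneg)
    fix w v
    have "(\<Sum>l\<in>UNIV. (cmod (\<Sum>i\<in>UNIV. v $ i * poly (r l $ i) (\<i> * of_real w)))\<^sup>2)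
      \<le> (\<Sum>l\<in>UNIV. c l * (1 + w\<^sup>2) ^ sum k UNIV * gap P Q (\<i> * of_real w) v)"
    proof (rule sum_mono, rule order_trans[OF c(2)])
      fix l
      show "c l * (1 + w\<^sup>2) ^ k l * gap P Q (\<i> * of_real w) v \<le> c l * (1 + w\<^sup>2) ^ sum k UNIV * gap P Q (\<i> * of_real w) v"
        by (intro mult_right_mono mult_left_mono power_increasing pos c k) auto
    qed
    then show "(\<Sum>l\<in>UNIV. (cmod (\<Sum>i\<in>UNIV. v $ i * poly (r l $ i) (\<i> * of_real w)))\<^sup>2)
      \<le> sum c UNIV * (1 + w\<^sup>2) ^ sum k UNIV * gap P Q (\<i> * of_real w) v"
      by (simp add: sum_distrib_right)
  qed
qed

section \<open>The gain estimate at one frequency\<close>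

lemma cmod_sum_mult_le:
  "cmod (\<Sum>k\<in>UNIV. f k * g k) \<le> sqrt (\<Sum>k\<in>UNIV. (cmod (f k))\<^sup>2) * sqrt (\<Sum>k\<in>UNIV. (cmod (g k))\<^sup>2)"
  for f g :: "'k::finite \<Rightarrow> complex"
proof -
  have "cmod (\<Sum>k\<in>UNIV. f k * g k) \<le> (\<Sum>k\<in>UNIV. \<bar>cmod (f k)\<bar> * \<bar>cmod (g k)\<bar>)"
    by (rule sum_norm_le) (simp add: norm_mult)
  also have "\<dots> \<le> L2_set (\<lambda>k. cmod (f k)) UNIV * L2_set (\<lambda>k. cmod (g k)) UNIV" by (rule L2_set_mult_ineq)
  finally show ?thesis by (simp add: L2_set_def)
qed

lemma norm2_vec_sum: "(norm v)\<^sup>2 = (\<Sum>k\<in>UNIV. (cmod (v $ k))\<^sup>2)" for v :: "complex^'k"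
  by (simp add: norm_vec_def L2_set_def sum_nonneg)

text \<open>Choose the row v with v Q equal to the conjugate of y, so that |y|^2 = (v P) u plus the
  pairing of g with the numbers v r. Here |v P|^2 + gap = |y|^2, and the numbers v r are bounded by
  the gap. One Cauchy-Schwarz inequality for the pairs (|v P|, sqrt gap) and (|u|, sqrt K |g|) keeps
  the coefficient of |u|^2 equal to 1.\<close>

lemma frequency_contraction:
  fixes P :: "real poly^'n^'m" and r :: "'d::finite \<Rightarrow> complex^'m" and u :: "complex^'n"
  assumes ns: "\<And>v. v v* evalC Q s = 0 \<Longrightarrow> v = 0"
    and K: "\<And>v. (\<Sum>l\<in>UNIV. (cmod (\<Sum>i\<in>UNIV. v $ i * r l $ i))\<^sup>2) \<le> K * gap P Q s v"
    and K0: "K \<ge> 0" and pos: "\<And>v. gap P Q s v \<ge> 0"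
    and eq: "evalC Q s *v y = evalC P s *v u + (\<Sum>l\<in>UNIV. g l *s r l)"
  shows "(norm y)\<^sup>2 \<le> (norm u)\<^sup>2 + K * (\<Sum>l\<in>UNIV. (cmod (g l))\<^sup>2)"
proof -
  obtain L where "L ** transpose (evalC Q s) = mat 1"
    using ns matrix_left_invertible_ker[of "transpose (evalC Q s)"] by (auto simp: transpose_matrix_vector)
  then have L: "transpose (evalC Q s) ** L = mat 1" by (simp add: matrix_left_right_inverse)
  define v where "v = L *v (\<chi> i. cnj (y $ i))"
  have v: "v v* evalC Q s = (\<chi> i. cnj (y $ i))"
    unfolding v_def transpose_matrix_vector[symmetric] matrix_vector_mul_assoc L by simp
  have adj: "(\<Sum>k\<in>UNIV. (v v* M) $ k * x $ k) = (\<Sum>i\<in>UNIV. v $ i * (M *v x) $ i)" for M :: "complex^'k^'m" and x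
  proof -
    have "(\<Sum>k\<in>UNIV. (v v* M) $ k * x $ k) = (\<Sum>k\<in>UNIV. \<Sum>i\<in>UNIV. v $ i * (M $ i $ k * x $ k))"
      by (simp add: vector_matrix_mult_def sum_distrib_right mult.assoc)
    also have "\<dots> = (\<Sum>i\<in>UNIV. \<Sum>k\<in>UNIV. v $ i * (M $ i $ k * x $ k))" by (rule sum.swap)
    finally show ?thesis by (simp add: matrix_vector_mult_def sum_distrib_left)
  qed
  have nv: "norm (v v* evalC Q s) = norm y" unfolding v by (simp add: norm_vec_def)
  define z where "z l = (\<Sum>i\<in>UNIV. v $ i * r l $ i)" for l
  have "complex_of_real ((norm y)\<^sup>2) = (\<Sum>k\<in>UNIV. (v v* evalC Q s) $ k * y $ k)"
    unfolding norm2_vec_complex v by (simp add: mult.commute)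
  also have "\<dots> = (\<Sum>i\<in>UNIV. v $ i * (evalC P s *v u + (\<Sum>l\<in>UNIV. g l *s r l)) $ i)"
    unfolding adj eq ..
  also have "\<dots> = (\<Sum>i\<in>UNIV. v $ i * (evalC P s *v u) $ i) + (\<Sum>i\<in>UNIV. \<Sum>l\<in>UNIV. g l * (v $ i * r l $ i))"
    by (simp add: sum.distrib distrib_left sum_distrib_left mult.left_commute)
  also have "(\<Sum>i\<in>UNIV. \<Sum>l\<in>UNIV. g l * (v $ i * r l $ i)) = (\<Sum>l\<in>UNIV. g l * z l)"
    by (subst sum.swap) (simp add: z_def sum_distrib_left)
  also have "(\<Sum>i\<in>UNIV. v $ i * (evalC P s *v u) $ i) = (\<Sum>k\<in>UNIV. (v v* evalC P s) $ k * u $ k)"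
    unfolding adj ..
  finally have e: "complex_of_real ((norm y)\<^sup>2)
    = (\<Sum>k\<in>UNIV. (v v* evalC P s) $ k * u $ k) + (\<Sum>l\<in>UNIV. g l * z l)" .
  define p a b G where "p = norm (v v* evalC P s)" and "a = norm u" and "b = sqrt (\<Sum>l\<in>UNIV. (cmod (g l))\<^sup>2)"
    and "G = sqrt (K * gap P Q s v)"
  have sg: "0 \<le> (\<Sum>l\<in>UNIV. (cmod (g l))\<^sup>2)" by (simp add: sum_nonneg)
  have nn: "p \<ge> 0" "a \<ge> 0" "b \<ge> 0" "G \<ge> 0" unfolding p_def a_def b_def G_def using K0 pos sg by auto
  have "(norm y)\<^sup>2 = cmod (complex_of_real ((norm y)\<^sup>2))" by (simp only: norm_of_real) simp
  also have "\<dots> \<le> cmod (\<Sum>k\<in>UNIV. (v v* evalC P s) $ k * u $ k) + cmod (\<Sum>l\<in>UNIV. g l * z l)"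
    unfolding e by (rule norm_triangle_ineq)
  also have "cmod (\<Sum>k\<in>UNIV. (v v* evalC P s) $ k * u $ k) \<le> p * a"
    by (rule order_trans[OF cmod_sum_mult_le]) (simp add: p_def a_def norm_vec_def L2_set_def)
  also have "cmod (\<Sum>l\<in>UNIV. g l * z l) \<le> b * G"
    unfolding b_def G_def
    by (rule order_trans[OF cmod_sum_mult_le]) (use K sg in \<open>auto simp: z_def intro!: mult_left_mono\<close>)
  finally have 1: "(norm y)\<^sup>2 \<le> p * a + b * G" by simp
  have gp: "p\<^sup>2 + gap P Q s v = (norm y)\<^sup>2" by (simp add: gap_def nv p_def)
  have G2: "G\<^sup>2 = K * gap P Q s v" unfolding G_def using K0 pos by simp
  define q where "q = sqrt (gap P Q s v)"
  have q2: "q\<^sup>2 = gap P Q s v" unfolding q_def using pos by simp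
  have Gq: "G = sqrt K * q" unfolding G_def q_def by (rule real_sqrt_mult)
  have "(p * a + b * G)\<^sup>2 \<le> (p\<^sup>2 + q\<^sup>2) * (a\<^sup>2 + (sqrt K * b)\<^sup>2)"
  proof -
    have "(p\<^sup>2 + q\<^sup>2) * (a\<^sup>2 + (sqrt K * b)\<^sup>2) - (p * a + q * (sqrt K * b))\<^sup>2 = (p * (sqrt K * b) - q * a)\<^sup>2"
      by (simp add: power2_eq_square algebra_simps)
    moreover have "0 \<le> (p * (sqrt K * b) - q * a)\<^sup>2" by simp
    moreover have "p * a + b * G = p * a + q * (sqrt K * b)" unfolding Gq by simp
    ultimately show ?thesis by (metis diff_ge_0_iff_ge)
  qed
  also have "(p\<^sup>2 + q\<^sup>2) = (norm y)\<^sup>2" using gp q2 by simp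
  also have "(sqrt K * b)\<^sup>2 = K * (\<Sum>l\<in>UNIV. (cmod (g l))\<^sup>2)" using K0 sg by (simp add: power_mult_distrib b_def)
  finally have 2: "(p * a + b * G)\<^sup>2 \<le> (norm y)\<^sup>2 * (a\<^sup>2 + K * (\<Sum>l\<in>UNIV. (cmod (g l))\<^sup>2))" .
  have "(norm y)\<^sup>2 * (norm y)\<^sup>2 \<le> (p * a + b * G)\<^sup>2"
    unfolding power2_eq_square[of "p * a + b * G"] using 1 nn by (intro mult_mono) auto
  with 2 have 3: "(norm y)\<^sup>2 * (norm y)\<^sup>2 \<le> (norm y)\<^sup>2 * (a\<^sup>2 + K * (\<Sum>l\<in>UNIV. (cmod (g l))\<^sup>2))" by simp
  show ?thesis
  proof (cases "norm y = 0")
    case True then show ?thesis using K0 sg by simp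
  next
    case False
    then have "0 < (norm y)\<^sup>2" by simp
    with 3 have "(norm y)\<^sup>2 \<le> a\<^sup>2 + K * (\<Sum>l\<in>UNIV. (cmod (g l))\<^sup>2)" by (simp only: mult_le_cancel_left_pos)
    then show ?thesis by (simp add: a_def)
  qed
qed

text \<open>The denominator-free form of f ((1 - q) / (1 + q)), see \<open>poly_mobius\<close>. As a
  polynomial in the delay q it acts on sequences as a finite impulse response.\<close>

definition mobius :: "nat \<Rightarrow> complex poly \<Rightarrow> complex poly" where
  "mobius k f = (\<Sum>j\<le>k. smult (coeff f j) ([:1, -1:] ^ j * [:1, 1:] ^ (k - j)))"

lemma degree_mobius: "degree (mobius k f) \<le> k"
  unfolding mobius_def
proof (rule degree_sum_le)
  fix j assume j: "j \<in> {..k}"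
  have "degree ([:1, -1::complex:] ^ j * [:1, 1:] ^ (k - j)) \<le> degree ([:1, -1::complex:] ^ j) + degree ([:1, 1::complex:] ^ (k - j))"
    by (rule degree_mult_le)
  also have "\<dots> \<le> j + (k - j)"
    by (intro add_mono order_trans[OF degree_power_le]) auto
  finally show "degree (smult (coeff f j) ([:1, -1:] ^ j * [:1, 1:] ^ (k - j))) \<le> k"
    using j degree_smult_le[of "coeff f j" "[:1, -1:] ^ j * [:1, 1:] ^ (k - j)"] by simp
qed simp

lemma poly_mobius:
  assumes "degree f \<le> k" "q \<noteq> -1"
  shows "poly (mobius k f) q = (1 + q) ^ k * poly f ((1 - q) / (1 + q))"
proof -
  have nz: "1 + q \<noteq> 0" using assms(2) by (simp add: eq_neg_iff_add_eq_0 add.commute)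
  have "poly f s = (\<Sum>j\<le>k. coeff f j * s ^ j)" for s
    unfolding poly_altdef using assms(1) by (intro sum.mono_neutral_left) (auto simp: coeff_eq_0)
  then have "(1 + q) ^ k * poly f ((1 - q) / (1 + q)) = (\<Sum>j\<le>k. coeff f j * ((1 - q) ^ j * (1 + q) ^ (k - j)))"
    using nz by (simp add: sum_distrib_left power_divide power_diff field_simps)
  then show ?thesis by (simp add: mobius_def poly_sum)
qed

text \<open>On the unit circle |1 - q|^2 + |1 + q|^2 = 4, and w^2 is the quotient of the two
  terms.\<close>

lemma cayley_imaginary:
  assumes "cmod q = 1" "q \<noteq> -1"
  obtains w where "(1 - q) / (1 + q) = \<i> * of_real w" "(1 + w\<^sup>2) * (cmod (1 + q))\<^sup>2 = 4"
proof
  have nz: "1 + q \<noteq> 0" using assms(2) by (simp add: eq_neg_iff_add_eq_0 add.commute)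
  define w where "w = - 2 * Im q / (cmod (1 + q))\<^sup>2"
  have qq: "q * cnj q = 1" using complex_norm_square[of q] assms(1) by simp
  have "(1 - q) * cnj (1 + q) = \<i> * of_real (- 2 * Im q)"
  proof -
    have "(1 - q) * cnj (1 + q) = 1 - q + cnj q - q * cnj q" by (simp add: algebra_simps)
    then show ?thesis unfolding qq by (simp add: complex_eq_iff)
  qed
  moreover have "cnj (1 + q) \<noteq> 0" using nz by (metis complex_cnj_zero_iff)
  then have "(1 - q) / (1 + q) = ((1 - q) * cnj (1 + q)) / ((1 + q) * cnj (1 + q))"
    by (rule nonzero_mult_divide_mult_cancel_right[symmetric])
  ultimately have "(1 - q) / (1 + q) = \<i> * of_real (- 2 * Im q) / of_real ((cmod (1 + q))\<^sup>2)"
    unfolding complex_norm_square by simp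
  then show eq: "(1 - q) / (1 + q) = \<i> * of_real w" unfolding w_def by simp
  have "w\<^sup>2 = (cmod ((1 - q) / (1 + q)))\<^sup>2" unfolding eq by (simp add: norm_mult)
  then have "w\<^sup>2 * (cmod (1 + q))\<^sup>2 = (cmod (1 - q))\<^sup>2" using nz by (simp add: norm_divide power_divide)
  then have "(1 + w\<^sup>2) * (cmod (1 + q))\<^sup>2 = (cmod (1 + q))\<^sup>2 + (cmod (1 - q))\<^sup>2" by (simp add: algebra_simps)
  also have "\<dots> = 2 + 2 * (cmod q)\<^sup>2" unfolding cmod_power2 by (simp add: power2_eq_square algebra_simps)
  finally show "(1 + w\<^sup>2) * (cmod (1 + q))\<^sup>2 = 4" using assms(1) by simp
qed

definition pev :: "complex poly^'k \<Rightarrow> complex \<Rightarrow> complex^'k" where "pev p s = (\<chi> i. poly (p $ i) s)"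

lemma pev_component [simp]: "pev p s $ i = poly (p $ i) s" by (simp add: pev_def)

lemma pev_cmatp: "pev (cmatp M *v a) s = evalC M s *v pev a s"
  by (simp add: vec_eq_iff matrix_vector_mult_def poly_sum map_matrix_def)

text \<open>The columns Y l encode a polynomial matrix Y with Q C = Y (s - A) and P = Y B + Q D.\<close>
definition realizes ::
  "real poly^'n^'m \<Rightarrow> real poly^'m^'m \<Rightarrow> ('d \<Rightarrow> complex poly^'m) \<Rightarrow> real^'d^'d \<Rightarrow> real^'n^'d \<Rightarrow> real^'d^'m \<Rightarrow> real^'n^'m \<Rightarrow> bool"
  where "realizes P Q Y A B C D \<longleftrightarrow>
    (\<forall>s x. evalC Q s *v (cmat C *v x) = (\<Sum>l\<in>UNIV. (s *s x - cmat A *v x) $ l *s pev (Y l) s)) \<and>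
    (\<forall>s u. evalC P s *v u = (\<Sum>l\<in>UNIV. (cmat B *v u) $ l *s pev (Y l) s) + evalC Q s *v (cmat D *v u))"

text \<open>The Bezout identity turns the forcing \<open>v\<close> into corrections
  \<open>Na\<close> of the input and \<open>Nb\<close> of the output, up to dominated columns, so
  that \<open>frequency_contraction\<close> applies. The constant is uniform on the circle because
  (1 + q)^k absorbs the weights in w.\<close>

lemma circle_contraction:
  fixes P :: "real poly^'n^'m" and Q :: "real poly^'m^'m" and A :: "real^'d^'d"
  assumes br: "bounded_real_pair P Q" and re: "realizes P Q Y A B C D"
  shows "\<exists>k (Na :: nat \<Rightarrow> complex^'d^'n) (Nb :: nat \<Rightarrow> complex^'d^'m) K. K \<ge> 0 \<and>
    (\<forall>q m u v. cmod q = 1 \<longrightarrow> q \<noteq> -1 \<longrightarrow>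
      (1 - q) *s m = (1 + q) *s (cmat A *v m + cmat B *v u + (1 + q) ^ k *s v) \<longrightarrow>
      (norm (cmat C *v m + cmat D *v u + (\<Sum>j\<le>k. q ^ j *s (Nb j *v v))))\<^sup>2
        \<le> (norm (u + (\<Sum>j\<le>k. q ^ j *s (Na j *v v))))\<^sup>2 + K * (norm v)\<^sup>2)"
proof -
  have pos: "gap P Q (\<i> * of_real w) u \<ge> 0" for w u by (rule bounded_real_pairD(1)[OF br]) simp
  have "\<forall>l. \<exists>a b r. r \<in> dominated P Q \<and> Y l = cmatp P *v a - cmatp Q *v b + r"
    using bounded_real_bezout[OF br] by blast
  then obtain a b r where Y: "\<And>l. r l \<in> dominated P Q" "\<And>l. Y l = cmatp P *v a l - cmatp Q *v b l + r l"
    by metis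
  obtain K0 k0 where K0: "K0 \<ge> 0" "\<And>w v. (\<Sum>l\<in>UNIV. (cmod (\<Sum>i\<in>UNIV. v $ i * poly (r l $ i) (\<i> * of_real w)))\<^sup>2)
     \<le> K0 * (1 + w\<^sup>2) ^ k0 * gap P Q (\<i> * of_real w) v"
    using dominated_family[of r P Q, OF Y(1) pos] by blast
  \<comment> \<open>\<open>k0\<close> powers of 1 + q cancel the growth of the dominated bound; the
    sums bound the degrees of all entries of \<open>a\<close> and \<open>b\<close>, as
    \<open>poly_mobius\<close> requires.\<close>
  define k where "k = k0 + (\<Sum>l\<in>UNIV. \<Sum>i\<in>UNIV. degree (a l $ i)) + (\<Sum>l\<in>UNIV. \<Sum>i\<in>UNIV. degree (b l $ i))"
  have "degree (a l $ i) \<le> (\<Sum>l\<in>UNIV. \<Sum>i\<in>UNIV. degree (a l $ i))" for l i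
    by (rule order_trans[OF member_le_sum[of i UNIV] member_le_sum[of l UNIV]]) auto
  then have da: "degree (a l $ i) \<le> k" for l i unfolding k_def by (meson le_add1 le_add2 le_trans)
  have "degree (b l $ i) \<le> (\<Sum>l\<in>UNIV. \<Sum>i\<in>UNIV. degree (b l $ i))" for l i
    by (rule order_trans[OF member_le_sum[of i UNIV] member_le_sum[of l UNIV]]) auto
  then have db: "degree (b l $ i) \<le> k" for l i unfolding k_def by (meson le_add1 le_add2 le_trans)
  define Na :: "nat \<Rightarrow> complex^'d^'n" where "Na j = (\<chi> i l. coeff (mobius k (a l $ i)) j)" for j
  define Nb :: "nat \<Rightarrow> complex^'d^'m" where "Nb j = (\<chi> i l. coeff (mobius k (b l $ i)) j)" for j
  have sumN: "(\<Sum>j\<le>k. q ^ j *s (N j *v v)) = (\<Sum>l\<in>UNIV. ((1 + q) ^ k * v $ l) *s pev (p l) ((1 - q) / (1 + q)))"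
    if N: "\<And>j. N j = (\<chi> i l. coeff (mobius k (p l $ i)) j)" and p: "\<And>l i. degree (p l $ i) \<le> k" and q: "q \<noteq> -1"
    for N :: "nat \<Rightarrow> complex^'d^'j" and p q v
  proof -
    have "(\<Sum>j\<le>k. q ^ j *s (N j *v v)) $ i = (\<Sum>l\<in>UNIV. ((1 + q) ^ k * v $ l) *s pev (p l) ((1 - q) / (1 + q))) $ i" for i
    proof -
      have "(\<Sum>j\<le>k. q ^ j *s (N j *v v)) $ i = (\<Sum>j\<le>k. \<Sum>l\<in>UNIV. q ^ j * (coeff (mobius k (p l $ i)) j * v $ l))"
        by (simp add: N matrix_vector_mult_def sum_distrib_left)
      also have "\<dots> = (\<Sum>l\<in>UNIV. v $ l * (\<Sum>j\<le>k. coeff (mobius k (p l $ i)) j * q ^ j))"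
        by (subst sum.swap) (simp add: sum_distrib_left mult.commute mult.left_commute)
      also have "\<dots> = (\<Sum>l\<in>UNIV. v $ l * poly (mobius k (p l $ i)) q)"
      proof -
        have "(\<Sum>j\<le>k. coeff (mobius k f) j * q ^ j) = poly (mobius k f) q" for f
          unfolding poly_altdef using degree_mobius[of k f]
          by (intro sum.mono_neutral_right) (auto simp: coeff_eq_0)
        then show ?thesis by simp
      qed
      also have "\<dots> = (\<Sum>l\<in>UNIV. ((1 + q) ^ k * v $ l) *s pev (p l) ((1 - q) / (1 + q))) $ i"
        using poly_mobius[OF p q] by (simp add: mult.assoc mult.left_commute)
      finally show ?thesis .
    qed
    then show ?thesis by (simp add: vec_eq_iff)
  qed
  have main: "(norm (cmat C *v m + cmat D *v u + (\<Sum>j\<le>k. q ^ j *s (Nb j *v v))))\<^sup>2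
        \<le> (norm (u + (\<Sum>j\<le>k. q ^ j *s (Na j *v v))))\<^sup>2 + K0 * 4 ^ k * (norm v)\<^sup>2"
    if q: "cmod q = 1" "q \<noteq> -1"
      and dyn: "(1 - q) *s m = (1 + q) *s (cmat A *v m + cmat B *v u + (1 + q) ^ k *s v)" for q m u v
  proof -
    have nz: "1 + q \<noteq> 0" using q(2) by (simp add: eq_neg_iff_add_eq_0 add.commute)
    define s where "s = (1 - q) / (1 + q)"
    obtain w where w: "s = \<i> * of_real w" "(1 + w\<^sup>2) * (cmod (1 + q))\<^sup>2 = 4"
      using cayley_imaginary[OF q] unfolding s_def by blast
    define g where "g l = (1 + q) ^ k * v $ l" for l
    \<comment> \<open>In terms of s the dynamics read (s - A) m = B u + g.\<close>
    have sm: "(s *s m - cmat A *v m) $ l = (cmat B *v u) $ l + g l" for l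
    proof -
      have cancel: "inverse (1 + q) *s ((1 + q) *s x) = x" for x :: "complex^'d"
        using nz by (simp only: vector_smult_assoc left_inverse) simp
      have "inverse (1 + q) *s ((1 - q) *s m) = inverse (1 + q) *s ((1 + q) *s (cmat A *v m + cmat B *v u + (1 + q) ^ k *s v))"
        using dyn by simp
      then have "s *s m = cmat A *v m + cmat B *v u + (1 + q) ^ k *s v"
        unfolding cancel by (simp only: vector_smult_assoc s_def divide_inverse mult.commute)
      then show ?thesis by (simp add: g_def)
    qed
    have E: "evalC Q s *v (cmat C *v m + cmat D *v u) = evalC P s *v u + (\<Sum>l\<in>UNIV. g l *s pev (Y l) s)"
    proof -
      have "evalC Q s *v (cmat C *v m) = (\<Sum>l\<in>UNIV. (cmat B *v u) $ l *s pev (Y l) s) + (\<Sum>l\<in>UNIV. g l *s pev (Y l) s)"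
      proof -
        have "evalC Q s *v (cmat C *v m) = (\<Sum>l\<in>UNIV. (s *s m - cmat A *v m) $ l *s pev (Y l) s)"
          using re unfolding realizes_def by blast
        then show ?thesis unfolding sm by (simp add: vector_sadd_rdistrib sum.distrib)
      qed
      moreover have "evalC P s *v u = (\<Sum>l\<in>UNIV. (cmat B *v u) $ l *s pev (Y l) s) + evalC Q s *v (cmat D *v u)"
        using re unfolding realizes_def by blast
      ultimately show ?thesis by (simp add: matrix_vector_right_distrib)
    qed
    have Ys: "pev (Y l) s = evalC P s *v pev (a l) s - evalC Q s *v pev (b l) s + pev (r l) s" for l
      unfolding Y(2) pev_cmatp[symmetric] by (simp add: vec_eq_iff)
    let ?a = "\<Sum>l\<in>UNIV. g l *s pev (a l) s" and ?b = "\<Sum>l\<in>UNIV. g l *s pev (b l) s"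
    have lin: "(\<Sum>l\<in>UNIV. g l *s (M *v x l)) = M *v (\<Sum>l\<in>UNIV. g l *s x l)" for M :: "complex^'k^'m" and x
      by (simp add: vec.sum vec.scale)
    have lin2: "(\<Sum>l\<in>UNIV. g l *s (M *v x l)) = M *v (\<Sum>l\<in>UNIV. g l *s x l)" for M :: "complex^'n^'m" and x
      by (simp add: vec.sum vec.scale)
    have lin3: "(\<Sum>l\<in>UNIV. g l *s (M *v x l)) = M *v (\<Sum>l\<in>UNIV. g l *s x l)" for M :: "complex^'m^'m" and x
      by (simp add: vec.sum vec.scale)
    have "(\<Sum>l\<in>UNIV. g l *s pev (Y l) s) = evalC P s *v ?a - evalC Q s *v ?b + (\<Sum>l\<in>UNIV. g l *s pev (r l) s)"
      unfolding Ys by (simp add: vector_add_ldistrib vector_ssub_ldistrib sum.distrib sum_subtractf lin2 lin3)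
    then have "evalC Q s *v (cmat C *v m + cmat D *v u + ?b) = evalC P s *v (u + ?a) + (\<Sum>l\<in>UNIV. g l *s pev (r l) s)"
      unfolding matrix_vector_right_distrib[of _ _ ?b] matrix_vector_right_distrib[of _ _ ?a] E by simp
    then have "(norm (cmat C *v m + cmat D *v u + ?b))\<^sup>2 \<le> (norm (u + ?a))\<^sup>2 + K0 * (1 + w\<^sup>2) ^ k0 * (\<Sum>l\<in>UNIV. (cmod (g l))\<^sup>2)"
    proof (rule frequency_contraction[rotated -1])
      show "v v* evalC Q s = 0 \<Longrightarrow> v = 0" for v by (rule Q_nonsingular[OF br]) (auto simp: w)
      show "(\<Sum>l\<in>UNIV. (cmod (\<Sum>i\<in>UNIV. v $ i * pev (r l) s $ i))\<^sup>2) \<le> K0 * (1 + w\<^sup>2) ^ k0 * gap P Q s v" for v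
        using K0(2) unfolding w(1) by simp
      show "0 \<le> K0 * (1 + w\<^sup>2) ^ k0" using K0(1) by simp
      show "gap P Q s v \<ge> 0" for v unfolding w(1) by (rule pos)
    qed
    also have "K0 * (1 + w\<^sup>2) ^ k0 * (\<Sum>l\<in>UNIV. (cmod (g l))\<^sup>2) \<le> K0 * 4 ^ k * (norm v)\<^sup>2"
    proof -
      have "(\<Sum>l\<in>UNIV. (cmod (g l))\<^sup>2) = ((cmod (1 + q))\<^sup>2) ^ k * (norm v)\<^sup>2"
        by (simp add: g_def norm2_vec_sum norm_mult norm_power power_mult_distrib sum_distrib_left
            power_mult[symmetric] mult.commute)
      \<comment> \<open>Each of \<open>k0\<close> factors pairs 1 + w^2 with |1 + q|^2 to give 4;
        the remaining factors |1 + q|^2 are at most 4.\<close>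
      moreover have "(1 + w\<^sup>2) ^ k0 * ((cmod (1 + q))\<^sup>2) ^ k \<le> 4 ^ k"
      proof -
        have kk: "k = k0 + (k - k0)" by (simp add: k_def)
        have "cmod (1 + q) \<le> 2" using norm_triangle_ineq[of 1 q] q(1) by simp
        then have "(cmod (1 + q))\<^sup>2 \<le> 2\<^sup>2" by (intro power_mono) auto
        then have "((cmod (1 + q))\<^sup>2) ^ (k - k0) \<le> 4 ^ (k - k0)" by (intro power_mono) auto
        then have "4 ^ k0 * ((cmod (1 + q))\<^sup>2) ^ (k - k0) \<le> 4 ^ k0 * 4 ^ (k - k0)" by simp
        also have "\<dots> = 4 ^ k" using kk by (metis power_add)
        also have "(4::real) ^ k0 * ((cmod (1 + q))\<^sup>2) ^ (k - k0) = (1 + w\<^sup>2) ^ k0 * ((cmod (1 + q))\<^sup>2) ^ k"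
        proof -
          have "a ^ k = a ^ k0 * a ^ (k - k0)" for a :: real using kk by (metis power_add)
          then show ?thesis unfolding w(2)[symmetric] power_mult_distrib by (simp add: mult.assoc)
        qed
        finally show ?thesis .
      qed
      ultimately have "(1 + w\<^sup>2) ^ k0 * (\<Sum>l\<in>UNIV. (cmod (g l))\<^sup>2) \<le> 4 ^ k * (norm v)\<^sup>2"
        using mult_right_mono[of "(1 + w\<^sup>2) ^ k0 * ((cmod (1 + q))\<^sup>2) ^ k" "4 ^ k" "(norm v)\<^sup>2"]
        by (simp only: mult.assoc zero_le_power2 simp_thms)
      then show ?thesis using mult_left_mono[OF _ K0(1)] by (simp only: mult.assoc)
    qed
    finally show ?thesis
      using sumN[of Nb b q v, OF Nb_def db q(2)] sumN[of Na a q v, OF Na_def da q(2)]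
      by (simp add: g_def s_def)
  qed
  show ?thesis
    by (rule exI[of _ k], rule exI[of _ Na], rule exI[of _ Nb], rule exI[of _ "K0 * 4 ^ k"])
       (use main K0(1) in auto)
qed

section \<open>The finite Fourier transform and closed loops\<close>

lemma cis_root_of_unity:
  assumes "M > 0"
  shows "cis (2 * pi / real M) ^ M = 1"
proof -
  have "cis (2 * pi / real M) ^ M = cis (real M * (2 * pi / real M))" by (rule Complex.DeMoivre)
  also have "real M * (2 * pi / real M) = 2 * pi" using assms by simp
  finally show ?thesis by simp
qed

text \<open>Orthogonality of characters: the ratio of two of them is a power of an M-th root of
  unity, whose geometric sum vanishes unless the root is 1. The transform is not normalized, hence
  the factor M.\<close>

lemma dft_parseval_complex:
  fixes f :: "nat \<Rightarrow> complex"
  assumes M: "M > 0"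
  defines "z \<equiv> cis (2 * pi / M)"
  shows "(\<Sum>j<M. (cmod (\<Sum>t<M. (z ^ j) ^ t * f t))\<^sup>2) = M * (\<Sum>t<M. (cmod (f t))\<^sup>2)"
proof -
  have zM: "z ^ M = 1" unfolding z_def by (rule cis_root_of_unity[OF M])
  have cz: "cnj z * z = 1" "cmod z = 1" by (simp_all add: z_def cis_cnj flip: cis_mult) (simp add: cis_mult)
  have orth: "(\<Sum>j<M. (z ^ j) ^ t * cnj ((z ^ j) ^ s)) = (if t = s then of_nat M else 0)" if ts: "t < M" "s < M" for t s
  proof -
    define w where "w = z ^ t * cnj (z ^ s)"
    have e: "(z ^ j) ^ t * cnj ((z ^ j) ^ s) = w ^ j" for j
      by (simp add: w_def power_mult_distrib power_mult[symmetric] mult.commute)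
    have wM: "w ^ M = 1"
      by (simp add: w_def power_mult_distrib power_mult[symmetric] mult.commute[of _ M])
         (simp add: power_mult zM flip: complex_cnj_power)
    have w1: "w = 1 \<longleftrightarrow> t = s"
    proof
      assume "w = 1"
      have "z ^ t = z ^ t * (cnj (z ^ s) * z ^ s)"
        using cz(1) by (simp flip: power_mult_distrib)
      also have "\<dots> = w * z ^ s" by (simp add: w_def)
      finally have e: "z ^ t = z ^ s" using \<open>w = 1\<close> by simp
      show "t = s"
      proof (rule ccontr)
        assume ne: "t \<noteq> s"
        have "cis (2 * pi * t / M) = cis (2 * pi * s / M)" using e by (simp add: z_def Complex.DeMoivre mult.commute)
        moreover have "inj_on (\<lambda>k. cis (2 * pi * real k / real M)) {..<M}"
          using Complex.bij_betw_roots_unity[OF M] by (simp add: bij_betw_def)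
        ultimately show False using ts ne by (auto dest: inj_onD)
      qed
    next
      assume "t = s"
      then show "w = 1" using cz by (simp add: w_def power_mult_distrib[symmetric] mult.commute)
    qed
    have "(\<Sum>j<M. w ^ j) = (if t = s then of_nat M else 0)"
    proof (cases "t = s")
      case False
      then have "w \<noteq> 1" using w1 by simp
      then show ?thesis using False geometric_sum[of w M] wM by simp
    qed (use w1 in simp)
    then show ?thesis unfolding e .
  qed
  have "complex_of_real (\<Sum>j<M. (cmod (\<Sum>t<M. (z ^ j) ^ t * f t))\<^sup>2)
    = (\<Sum>j<M. \<Sum>t<M. \<Sum>s<M. ((z ^ j) ^ t * cnj ((z ^ j) ^ s)) * (f t * cnj (f s)))"
    unfolding of_real_sum complex_norm_square
    by (simp add: sum_product mult.assoc mult.left_commute)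
  also have "\<dots> = (\<Sum>t<M. \<Sum>j<M. \<Sum>s<M. ((z ^ j) ^ t * cnj ((z ^ j) ^ s)) * (f t * cnj (f s)))"
    by (rule sum.swap)
  also have "\<dots> = (\<Sum>t<M. \<Sum>s<M. \<Sum>j<M. ((z ^ j) ^ t * cnj ((z ^ j) ^ s)) * (f t * cnj (f s)))"
    by (rule sum.cong[OF refl], rule sum.swap)
  also have "\<dots> = (\<Sum>t<M. \<Sum>s<M. (if t = s then of_nat M else 0) * (f t * cnj (f s)))"
    by (intro sum.cong refl) (simp only: sum_distrib_right[symmetric] orth lessThan_iff)
  also have "\<dots> = (\<Sum>t<M. of_nat M * (f t * cnj (f t)))"
    by (intro sum.cong refl) (simp add: if_distrib[of "\<lambda>x. x * _"] cong: if_cong)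
  also have "\<dots> = complex_of_real (M * (\<Sum>t<M. (cmod (f t))\<^sup>2))"
    by (simp only: sum_distrib_left[symmetric] complex_norm_square[symmetric] of_real_mult of_real_sum of_real_of_nat_eq)
  finally show ?thesis by (simp only: of_real_eq_iff)
qed

lemma dft_parseval:
  fixes f :: "nat \<Rightarrow> complex^'k"
  assumes M: "M > 0"
  defines "z \<equiv> cis (2 * pi / M)"
  shows "(\<Sum>j<M. (norm (\<Sum>t<M. (z ^ j) ^ t *s f t))\<^sup>2) = M * (\<Sum>t<M. (norm (f t))\<^sup>2)"
proof -
  have "(\<Sum>j<M. (norm (\<Sum>t<M. (z ^ j) ^ t *s f t))\<^sup>2)
    = (\<Sum>i\<in>UNIV. \<Sum>j<M. (cmod (\<Sum>t<M. (z ^ j) ^ t * f t $ i))\<^sup>2)"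
    unfolding norm2_vec_sum by (subst sum.swap) simp
  also have "\<dots> = (\<Sum>i\<in>UNIV. M * (\<Sum>t<M. (cmod (f t $ i))\<^sup>2))"
    unfolding z_def dft_parseval_complex[OF M] ..
  also have "\<dots> = M * (\<Sum>t<M. (norm (f t))\<^sup>2)"
    unfolding norm2_vec_sum by (subst sum.swap) (simp add: sum_distrib_left)
  finally show ?thesis .
qed

text \<open>Causal convolution with k + 1 matrix weights; the guard keeps \<open>t - j\<close> from
  being truncated at 0.\<close>

definition conv :: "nat \<Rightarrow> (nat \<Rightarrow> complex^'d^'k) \<Rightarrow> (nat \<Rightarrow> complex^'d) \<Rightarrow> nat \<Rightarrow> complex^'k" where
  "conv k N v t = (\<Sum>j\<le>k. if j \<le> t then N j *v v (t - j) else 0)"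

text \<open>As \<open>v\<close> vanishes on the last k steps, its response ends before M. Nothing is
  cut off or wrapped around, so convolution becomes a product for every q.\<close>

lemma conv_transform:
  assumes v: "\<And>t. M \<le> t + k \<Longrightarrow> v t = 0"
  shows "(\<Sum>t<M. q ^ t *s conv k N v t) = (\<Sum>j\<le>k. q ^ j *s (N j *v (\<Sum>t<M. q ^ t *s v t)))"
proof -
  have "(\<Sum>t<M. q ^ t *s conv k N v t) = (\<Sum>t<M. \<Sum>j\<le>k. if j \<le> t then q ^ t *s (N j *v v (t - j)) else 0)"
    unfolding conv_def by (simp add: vec.scale_sum_right if_distrib cong: if_cong)
  also have "\<dots> = (\<Sum>j\<le>k. \<Sum>t<M. if j \<le> t then q ^ t *s (N j *v v (t - j)) else 0)" by (rule sum.swap)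
  also have "\<dots> = (\<Sum>j\<le>k. q ^ j *s (N j *v (\<Sum>t<M. q ^ t *s v t)))"
  proof (rule sum.cong)
    fix j assume j: "j \<in> {..k}"
    have "(\<Sum>t<M. if j \<le> t then q ^ t *s (N j *v v (t - j)) else 0) = (\<Sum>t\<in>{j..<M}. q ^ t *s (N j *v v (t - j)))"
      by (rule sum.mono_neutral_cong_right) auto
    also have "\<dots> = (\<Sum>t<M - j. q ^ (t + j) *s (N j *v v t))"
      by (rule sum.reindex_bij_witness[of _ "\<lambda>t. t + j" "\<lambda>t. t - j"]) auto
    also have "\<dots> = (\<Sum>t<M. q ^ (t + j) *s (N j *v v t))"
    proof (rule sum.mono_neutral_left)
      show "\<forall>i\<in>{..<M} - {..<M - j}. q ^ (i + j) *s (N j *v v i) = 0"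
      proof
        fix i assume "i \<in> {..<M} - {..<M - j}"
        then have "M \<le> i + k" using j by auto
        then show "q ^ (i + j) *s (N j *v v i) = 0" by (simp add: v)
      qed
    qed auto
    also have "\<dots> = q ^ j *s (N j *v (\<Sum>t<M. q ^ t *s v t))"
      by (simp add: vec.sum vec.scale vec.scale_sum_right vector_smult_assoc power_add mult.commute)
    finally show "(\<Sum>t<M. if j \<le> t then q ^ t *s (N j *v v (t - j)) else 0) = q ^ j *s (N j *v (\<Sum>t<M. q ^ t *s v t))" .
  qed simp
  finally show ?thesis .
qed

lemma conv_pulse:
  "conv k N (\<lambda>t. if t = T then V else 0) t = (if T \<le> t \<and> t \<le> T + k then N (t - T) *v V else 0)"
proof -
  have "conv k N (\<lambda>t. if t = T then V else 0) t = (\<Sum>j\<le>k. if j = t - T \<and> T \<le> t then N j *v V else 0)"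
    unfolding conv_def by (intro sum.cong) auto
  also have "\<dots> = (if T \<le> t \<and> t \<le> T + k then N (t - T) *v V else 0)"
    by (cases "T \<le> t") (auto simp: if_distrib cong: if_cong)
  finally show ?thesis .
qed

lemma conv_add: "conv k N (\<lambda>t. v t + w t) t = conv k N v t + conv k N w t"
  unfolding conv_def sum.distrib[symmetric]
  by (intro sum.cong) (auto simp: matrix_vector_right_distrib)

text \<open>A loop that starts and ends at 0 has no boundary terms in its transform, so the
  hypothesis \<open>K\<close> applies at every M-th root of unity, and Parseval's identity sums the
  bounds. M is odd to avoid q = -1, which corresponds to the point at infinity.\<close>

lemma loop_inequality:
  fixes A :: "real^'d^'d" and B :: "real^'n^'d" and C :: "real^'d^'m" and D :: "real^'n^'m"
    and Na :: "nat \<Rightarrow> complex^'d^'n" and Nb :: "nat \<Rightarrow> complex^'d^'m"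
  assumes K: "\<And>q m u v. cmod q = 1 \<Longrightarrow> q \<noteq> -1 \<Longrightarrow>
      (1 - q) *s m = (1 + q) *s (cmat A *v m + cmat B *v u + (1 + q) ^ k *s v) \<Longrightarrow>
      (norm (cmat C *v m + cmat D *v u + (\<Sum>j\<le>k. q ^ j *s (Nb j *v v))))\<^sup>2
        \<le> (norm (u + (\<Sum>j\<le>k. q ^ j *s (Na j *v v))))\<^sup>2 + K * (norm v)\<^sup>2"
    and M: "odd M" and x0: "x 0 = 0" and xM: "x M = 0"
    and v: "\<And>t. M \<le> t + k \<Longrightarrow> v t = 0"
    and g: "\<And>t. cvec (g t) = conv k (\<lambda>j. mat (of_nat (k choose j))) v t"
    and dyn: "\<And>t. t < M \<Longrightarrow> x (Suc t) - x t = A *v (x (Suc t) + x t) + B *v u t + g t"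
  shows "(\<Sum>t<M. (norm (cvec (C *v (x (Suc t) + x t) + D *v u t) + conv k Nb v t))\<^sup>2)
    \<le> (\<Sum>t<M. (norm (cvec (u t) + conv k Na v t))\<^sup>2) + K * (\<Sum>t<M. (norm (v t))\<^sup>2)"
proof -
  have M0: "M > 0" using M by (cases M) auto
  define z where "z = cis (2 * pi / M)"
  have zM: "z ^ M = 1" unfolding z_def by (rule cis_root_of_unity[OF M0])
  define tr :: "(nat \<Rightarrow> complex^'k) \<Rightarrow> complex \<Rightarrow> complex^'k" where "tr f q = (\<Sum>t<M. q ^ t *s f t)" for f q
  have one: "(norm (\<Sum>t<M. q ^ t *s (cvec (C *v (x (Suc t) + x t) + D *v u t) + conv k Nb v t)))\<^sup>2
    \<le> (norm (\<Sum>t<M. q ^ t *s (cvec (u t) + conv k Na v t)))\<^sup>2 + K * (norm (\<Sum>t<M. q ^ t *s v t))\<^sup>2"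
    if qM: "q ^ M = 1" and q1: "cmod q = 1" for q
  proof -
    have qm: "q \<noteq> -1" using qM M by auto
    have q0: "q \<noteq> 0" using q1 by auto
    define X where "X = (\<Sum>t<M. q ^ t *s cvec (x t))"
    define X1 where "X1 = (\<Sum>t<M. q ^ t *s cvec (x (Suc t)))"
    define U where "U = (\<Sum>t<M. q ^ t *s cvec (u t))"
    define V where "V = (\<Sum>t<M. q ^ t *s v t)"
    \<comment> \<open>Because both ends vanish, advancing the sequence by one step divides its
      transform by q.\<close>
    have qX1: "q *s X1 = X"
    proof -
      have "(\<Sum>t<Suc M. q ^ t *s cvec (x t)) = q ^ 0 *s cvec (x 0) + (\<Sum>t<M. q ^ Suc t *s cvec (x (Suc t)))"
        by (rule sum.lessThan_Suc_shift)
      then show ?thesis by (simp add: x0 xM X_def X1_def vec.scale_sum_right vector_smult_assoc)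
    qed
    \<comment> \<open>The binomial weights are the impulse response of (1 + q)^k.\<close>
    have G: "(\<Sum>t<M. q ^ t *s cvec (g t)) = (1 + q) ^ k *s V"
    proof -
      have "mat c *v w = c *s w" for c and w :: "complex^'d"
        by (simp add: vec_eq_iff matrix_vector_mult_def mat_def if_distrib[of "\<lambda>x. x * _"] cong: if_cong)
      then have "(\<Sum>t<M. q ^ t *s cvec (g t)) = (\<Sum>j\<le>k. (q ^ j * of_nat (k choose j)) *s V)"
        using conv_transform[of M k v q "\<lambda>j. mat (of_nat (k choose j))", OF v]
        by (simp add: g V_def vector_smult_assoc)
      also have "\<dots> = (\<Sum>j\<le>k. of_nat (k choose j) * q ^ j) *s V"
        by (simp add: vec.scale_sum_left mult.commute)
      also have "(\<Sum>j\<le>k. of_nat (k choose j) * q ^ j) = (q + 1) ^ k"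
        unfolding binomial_ring by simp
      finally show ?thesis by (simp add: add.commute)
    qed
    have m: "(\<Sum>t<M. q ^ t *s cvec (x (Suc t) + x t)) = X1 + X"
      by (simp add: cvec_add vector_add_ldistrib sum.distrib X1_def X_def)
    have "(\<Sum>t<M. q ^ t *s cvec (x (Suc t) - x t)) = (\<Sum>t<M. q ^ t *s cvec (A *v (x (Suc t) + x t) + B *v u t + g t))"
      using dyn by simp
    also have "\<dots> = cmat A *v (\<Sum>t<M. q ^ t *s cvec (x (Suc t) + x t)) + cmat B *v U + (1 + q) ^ k *s V"
    proof -
      define mm where "mm t = x (Suc t) + x t" for t
      show ?thesis unfolding U_def G[symmetric] mm_def[symmetric]
        by (simp add: cvec_add cmat_cvec[symmetric] vector_add_ldistrib sum.distrib vec.sum vec.scale)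
    qed
    also have "(\<Sum>t<M. q ^ t *s cvec (x (Suc t) - x t)) = X1 - X"
      by (simp add: cvec_diff vector_ssub_ldistrib sum_subtractf X1_def X_def)
    finally have "X1 - X = cmat A *v (X1 + X) + cmat B *v U + (1 + q) ^ k *s V" unfolding m .
    moreover have "(1 - q) *s (X1 + X) = (1 + q) *s (X1 - X)"
    proof -
      have "X1 + X = (1 + q) *s X1" "X1 - X = (1 - q) *s X1"
        unfolding qX1[symmetric] by (simp_all add: vector_sadd_rdistrib vector_sub_rdistrib)
      then show ?thesis by (simp only: vector_smult_assoc mult.commute)
    qed
    ultimately have "(1 - q) *s (X1 + X) = (1 + q) *s (cmat A *v (X1 + X) + cmat B *v U + (1 + q) ^ k *s V)"
      by simp
    from K[OF q1 qm this]
    have "(norm (cmat C *v (X1 + X) + cmat D *v U + (\<Sum>j\<le>k. q ^ j *s (Nb j *v V))))\<^sup>2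
      \<le> (norm (U + (\<Sum>j\<le>k. q ^ j *s (Na j *v V))))\<^sup>2 + K * (norm V)\<^sup>2" .
    moreover have "(\<Sum>t<M. q ^ t *s (cvec (C *v (x (Suc t) + x t) + D *v u t) + conv k Nb v t))
      = cmat C *v (X1 + X) + cmat D *v U + (\<Sum>j\<le>k. q ^ j *s (Nb j *v V))"
    proof -
      define mm where "mm t = x (Suc t) + x t" for t
      have "(\<Sum>t<M. q ^ t *s (cvec (C *v mm t + D *v u t) + conv k Nb v t))
        = (\<Sum>t<M. q ^ t *s cvec (C *v mm t + D *v u t)) + (\<Sum>j\<le>k. q ^ j *s (Nb j *v V))"
        using conv_transform[of M k v q Nb, OF v] by (simp add: V_def vector_add_ldistrib sum.distrib)
      then show ?thesis unfolding m[symmetric] U_def mm_def[symmetric]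
        by (simp add: cvec_add cmat_cvec[symmetric] vector_add_ldistrib sum.distrib vec.sum[of "cmat C"]
            vec.sum[of "cmat D"] vec.scale)
    qed
    moreover have "(\<Sum>t<M. q ^ t *s (cvec (u t) + conv k Na v t)) = U + (\<Sum>j\<le>k. q ^ j *s (Na j *v V))"
      using conv_transform[of M k v q Na, OF v] by (simp add: U_def V_def vector_add_ldistrib sum.distrib)
    ultimately show ?thesis unfolding V_def by simp
  qed
  have q: "(z ^ j) ^ M = 1" "cmod (z ^ j) = 1" for j
    using zM by (simp_all add: power_mult[symmetric] mult.commute[of j] norm_power z_def) (simp add: power_mult)
  have "(\<Sum>j<M. (norm (\<Sum>t<M. (z ^ j) ^ t *s (cvec (C *v (x (Suc t) + x t) + D *v u t) + conv k Nb v t)))\<^sup>2)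
    \<le> (\<Sum>j<M. (norm (\<Sum>t<M. (z ^ j) ^ t *s (cvec (u t) + conv k Na v t)))\<^sup>2 + K * (norm (\<Sum>t<M. (z ^ j) ^ t *s v t))\<^sup>2)"
    by (intro sum_mono one q)
  then have "M * (\<Sum>t<M. (norm (cvec (C *v (x (Suc t) + x t) + D *v u t) + conv k Nb v t))\<^sup>2)
    \<le> M * (\<Sum>t<M. (norm (cvec (u t) + conv k Na v t))\<^sup>2) + K * (M * (\<Sum>t<M. (norm (v t))\<^sup>2))"
    unfolding sum.distrib sum_distrib_left[symmetric] z_def dft_parseval[OF M0] .
  then have "real M * (\<Sum>t<M. (norm (cvec (C *v (x (Suc t) + x t) + D *v u t) + conv k Nb v t))\<^sup>2)
    \<le> real M * ((\<Sum>t<M. (norm (cvec (u t) + conv k Na v t))\<^sup>2) + K * (\<Sum>t<M. (norm (v t))\<^sup>2))"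
    by (simp add: algebra_simps)
  then show ?thesis using M0 by simp
qed

text \<open>For the doubled state this is the implicit midpoint rule with step 2, and
  \<open>x (Suc t) + x t\<close> is its midpoint, where \<open>cost\<close> also evaluates the
  output.\<close>

definition traj :: "real^'d^'d \<Rightarrow> real^'n^'d \<Rightarrow> (nat \<Rightarrow> real^'d) \<Rightarrow> (nat \<Rightarrow> real^'n) \<Rightarrow> bool" where
  "traj A B x u \<longleftrightarrow> (\<forall>t. x (Suc t) - x t = A *v (x (Suc t) + x t) + B *v u t)"

definition cost :: "real^'d^'m \<Rightarrow> real^'n^'m \<Rightarrow> nat \<Rightarrow> (nat \<Rightarrow> real^'d) \<Rightarrow> (nat \<Rightarrow> real^'n) \<Rightarrow> real" where
  "cost C D N x u = (\<Sum>t<N. (norm (C *v (x (Suc t) + x t) + D *v u t))\<^sup>2 - (norm (u t))\<^sup>2)"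

section \<open>Explicit steps, and states reached by pulses\<close>

lemma mat_minus_vec: "(mat 1 - A) *v x = x - A *v x" for A :: "'a::comm_ring_1^'n^'n"
  by (simp add: matrix_vector_mult_diff_rdistrib)

lemma mat_plus_vec: "(mat 1 + A) *v x = x + A *v x" for A :: "'a::comm_ring_1^'n^'n"
  by (simp add: matrix_vector_mult_add_rdistrib)

locale cayley =
  fixes A E :: "real^'d^'d"
  assumes left: "E ** (mat 1 - A) = mat 1" and right: "(mat 1 - A) ** E = mat 1"
begin

lemma E_left: "E *v (x - A *v x) = x"
  using arg_cong[OF left, of "\<lambda>M. M *v x"] by (simp add: matrix_vector_mul_assoc[symmetric] mat_minus_vec)

lemma E_right: "E *v x - A *v (E *v x) = x"
  using arg_cong[OF right, of "\<lambda>M. M *v x"] by (simp add: matrix_vector_mul_assoc[symmetric] mat_minus_vec)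

lemma step_iff: "x' - x = A *v (x' + x) + w \<longleftrightarrow> x' = E *v (x + A *v x + w)"
proof
  assume "x' - x = A *v (x' + x) + w"
  then have "x' - A *v x' = x + A *v x + w" by (simp add: matrix_vector_right_distrib algebra_simps)
  then show "x' = E *v (x + A *v x + w)" using E_left[of x'] by simp
next
  assume "x' = E *v (x + A *v x + w)"
  then have "x' - A *v x' = x + A *v x + w" using E_right by simp
  then show "x' - x = A *v (x' + x) + w" by (simp add: matrix_vector_right_distrib algebra_simps)
qed

lemma traj_iff: "traj A B x u \<longleftrightarrow> (\<forall>t. x (Suc t) = E *v (x t + A *v x t + B *v u t))"
  unfolding traj_def step_iff ..

lemma traj_exists: "\<exists>x. x 0 = x0 \<and> traj A B x u"
  unfolding traj_iff
  by (intro exI[of _ "rec_nat x0 (\<lambda>t y. E *v (y + A *v y + B *v u t))"]) simp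

text \<open>Motion from rest under the state forcing binom(k, t) v, the signal with transform (1 +
  q)^k v; the forcing ends after t = k.\<close>

definition pulse :: "nat \<Rightarrow> real^'d \<Rightarrow> nat \<Rightarrow> real^'d" where
  "pulse k v = rec_nat 0 (\<lambda>t y. E *v (y + A *v y + real (k choose t) *s v))"

lemma pulse_0 [simp]: "pulse k v 0 = 0" and
  pulse_Suc: "pulse k v (Suc t) = E *v (pulse k v t + A *v pulse k v t + real (k choose t) *s v)"
  by (simp_all add: pulse_def)

lemma pulse_Pascal: "pulse (Suc k) v (Suc t) = pulse k v (Suc t) + pulse k v t"
proof (induction t)
  case 0
  then show ?case by (simp add: pulse_Suc)
next
  case (Suc t)
  have "pulse (Suc k) v (Suc (Suc t)) = E *v ((pulse k v (Suc t) + pulse k v t)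
      + A *v (pulse k v (Suc t) + pulse k v t) + real (Suc k choose Suc t) *s v)"
    by (subst pulse_Suc) (simp only: Suc)
  also have "\<dots> = E *v (pulse k v (Suc t) + A *v pulse k v (Suc t) + real (k choose Suc t) *s v)
     + E *v (pulse k v t + A *v pulse k v t + real (k choose t) *s v)"
  proof -
    have "(a1 + a2) + A *v (a1 + a2) + real (Suc k choose Suc t) *s v
      = (a1 + A *v a1 + real (k choose Suc t) *s v) + (a2 + A *v a2 + real (k choose t) *s v)" for a1 a2
      by (simp add: matrix_vector_right_distrib vector_sadd_rdistrib)
    then show ?thesis by (simp only: matrix_vector_right_distrib)
  qed
  also have "\<dots> = pulse k v (Suc (Suc t)) + pulse k v (Suc t)" by (simp add: pulse_Suc)
  finally show ?case .
qed

text \<open>By Pascal's rule the pulse of order k + 1 is the sum of two consecutive values of the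
  pulse of order k. The later of them is the unforced step E (y + A y), and adding y = E (y - A y)
  gives 2 E y.\<close>

lemma pulse_end: "pulse k v (Suc k) = (2 ^ k) *s (matpow E (Suc k) *v v)"
proof (induction k)
  case 0
  then show ?case by (simp add: pulse_Suc)
next
  case (Suc k)
  define y where "y = pulse k v (Suc k)"
  have "pulse (Suc k) v (Suc (Suc k)) = pulse k v (Suc (Suc k)) + y" by (simp add: pulse_Pascal y_def)
  also have "pulse k v (Suc (Suc k)) = E *v (y + A *v y)" by (subst pulse_Suc) (simp add: y_def binomial_eq_0)
  also have "E *v (y + A *v y) + y = E *v (y + A *v y) + E *v (y - A *v y)" by (simp add: E_left)
  also have "\<dots> = E *v ((y + A *v y) + (y - A *v y))" by (rule matrix_vector_right_distrib[symmetric])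
  also have "(y + A *v y) + (y - A *v y) = 2 *s y" by (simp add: vec_eq_iff)
  also have "E *v (2 *s y) = 2 ^ Suc k *s (matpow E (Suc (Suc k)) *v v)"
    unfolding y_def Suc
    by (simp only: vec.scale vector_smult_assoc matrix_vector_mul_assoc[symmetric] matpow.simps power_Suc)
  finally show ?case .
qed

text \<open>Solves \<open>pulse_end\<close> for v: as \<open>E\<close> is invertible, forcing the
  state directly reaches any x in \<open>Suc k\<close> steps.\<close>

definition aim :: "nat \<Rightarrow> real^'d \<Rightarrow> real^'d" where
  "aim k x = (1 / 2 ^ k) *s (matpow (mat 1 - A) (Suc k) *v x)"

lemma pulse_aim: "pulse k (aim k x) (Suc k) = x"
proof -
  have "matpow E n *v (matpow (mat 1 - A) n *v y) = y" for n y
  proof (induction n arbitrary: y)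
    case (Suc n)
    have "matpow E (Suc n) *v (matpow (mat 1 - A) (Suc n) *v y)
        = matpow E n *v ((E ** (mat 1 - A)) *v (matpow (mat 1 - A) n *v y))"
      unfolding matpow_Suc_vec[of E] by (simp add: matrix_vector_mul_assoc matrix_mul_assoc)
    then show ?case using Suc by (simp add: left)
  qed simp
  then show ?thesis unfolding pulse_end aim_def vec.scale by (simp add: vector_smult_assoc del: matpow.simps)
qed

definition Ad :: "real^'d^'d" where "Ad = E ** (mat 1 + A)"

lemma Ad_vec: "Ad *v x = E *v (x + A *v x)"
  by (simp add: Ad_def matrix_vector_mul_assoc[symmetric] mat_plus_vec)

text \<open>An eigenvalue z of the Cayley transform comes from the eigenvalue (z - 1) / (z + 1) of
  A, and this fraction has negative real part exactly when |z| < 1.\<close>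

lemma Ad_contracting:
  assumes hur: "\<And>z v. cmat A *v v = z *s v \<Longrightarrow> v \<noteq> 0 \<Longrightarrow> Re z < 0"
    and ev: "cmat Ad *v v = z *s v" "v \<noteq> 0"
  shows "cmod z < 1"
proof -
  have "(mat 1 - A) ** Ad = mat 1 + A" by (simp add: Ad_def matrix_mul_assoc right)
  then have "cmat ((mat 1 - A) ** Ad) = cmat (mat 1 + A)" by simp
  moreover have "cmat (M ** N) = cmat M ** cmat N" for M N :: "real^'d^'d"
    by (simp add: vec_eq_iff matrix_matrix_mult_def)
  moreover have "cmat (mat 1 - A) = mat 1 - cmat A" "cmat (mat 1 + A) = mat 1 + cmat A"
    by (simp_all add: vec_eq_iff mat_def)
  ultimately have "(mat 1 - cmat A) *v (cmat Ad *v v) = (mat 1 + cmat A) *v v"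
    by (simp add: matrix_vector_mul_assoc)
  then have e: "z *s v - z *s (cmat A *v v) = v + cmat A *v v"
    unfolding ev mat_minus_vec mat_plus_vec by (simp add: vec.scale)
  then have e2: "(z + 1) *s (cmat A *v v) = (z - 1) *s v" by (simp add: vec_eq_iff algebra_simps)
  \<comment> \<open>z = -1 would correspond to an infinite eigenvalue of A.\<close>
  have z1: "z + 1 \<noteq> 0"
  proof
    assume "z + 1 = 0"
    then have "z = -1" by (simp add: eq_neg_iff_add_eq_0)
    with e2 have "(-2) *s v = 0" by simp
    then show False using ev(2) by simp
  qed
  have cancel: "inverse (z + 1) *s ((z + 1) *s y) = y" for y :: "complex^'d"
    using z1 by (simp only: vector_smult_assoc left_inverse) simp
  have "inverse (z + 1) *s ((z + 1) *s (cmat A *v v)) = inverse (z + 1) *s ((z - 1) *s v)" using e2 by simp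
  then have "cmat A *v v = ((z - 1) / (z + 1)) *s v"
    unfolding cancel by (simp only: vector_smult_assoc divide_inverse mult.commute)
  from hur[OF this ev(2)] have "Re ((z - 1) / (z + 1)) < 0" .
  then have "((Re z - 1) * (Re z + 1) + Im z * Im z) / ((Re z + 1)\<^sup>2 + (Im z)\<^sup>2) < 0"
    by (simp add: Re_divide)
  then have "(Re z - 1) * (Re z + 1) + Im z * Im z < 0"
    by (simp add: divide_less_0_iff) (smt (verit) zero_le_power2)
  then have "(cmod z)\<^sup>2 < 1\<^sup>2" unfolding cmod_power2 by (simp add: power2_eq_square algebra_simps)
  then show ?thesis by (rule power2_less_imp_less) simp
qed

lemma free_motion:
  assumes "\<And>t. t \<ge> N \<Longrightarrow> x (Suc t) = E *v (x t + A *v x t)"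
  shows "x (N + j) = matpow Ad j *v x N"
proof (induction j)
  case (Suc j)
  have "x (N + Suc j) = Ad *v x (N + j)" by (simp add: assms Ad_vec)
  then show ?case unfolding Suc by (simp add: matrix_vector_mul_assoc)
qed simp

end

lemma matrix_norm_bound: "\<exists>c\<ge>0. \<forall>w. norm (N *v w) \<le> c * norm w" for N :: "complex^'k^'m"
proof -
  have "linear ((*v) N)" by (rule linearI) (simp_all add: matrix_vector_right_distrib scaleR_complex_vec vec.scale)
  then have "bounded_linear ((*v) N)" by (rule linear_conv_bounded_linear[THEN iffD1])
  from bounded_linear.nonneg_bounded[OF this] show ?thesis by (metis mult.commute)
qed

text \<open>The loop: a pulse brings the state from 0 to \<open>x0\<close>, the given motion of
  length N follows, then F steps without input, then a second pulse returns the state to 0.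
  \<open>loop_inequality\<close> bounds the supply by the two pulse amplitudes. By
  \<open>hur\<close> the second one tends to 0 with growing F, so the bound depends on
  \<open>x0\<close> alone.\<close>

lemma (in cayley) loop_cost_bound:
  fixes B :: "real^'n^'d" and C :: "real^'d^'m" and D :: "real^'n^'m"
    and Na :: "nat \<Rightarrow> complex^'d^'n" and Nb :: "nat \<Rightarrow> complex^'d^'m"
  assumes hur: "\<And>z v. cmat A *v v = z *s v \<Longrightarrow> v \<noteq> 0 \<Longrightarrow> Re z < 0"
    and K0: "K \<ge> 0"
    and K: "\<And>q m u v. cmod q = 1 \<Longrightarrow> q \<noteq> -1 \<Longrightarrow>
      (1 - q) *s m = (1 + q) *s (cmat A *v m + cmat B *v u + (1 + q) ^ k *s v) \<Longrightarrow>
      (norm (cmat C *v m + cmat D *v u + (\<Sum>j\<le>k. q ^ j *s (Nb j *v v))))\<^sup>2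
        \<le> (norm (u + (\<Sum>j\<le>k. q ^ j *s (Na j *v v))))\<^sup>2 + K * (norm v)\<^sup>2"
  shows "\<exists>b. \<forall>x u N. traj A B x u \<longrightarrow> x 0 = x0 \<longrightarrow> cost C D N x u \<le> b"
proof -
  define bnd where "bnd j c \<longleftrightarrow> c \<ge> 0 \<and> (\<forall>w. norm (Na j *v w) \<le> c * norm w)" for j c
  have "\<exists>c. bnd j c" for j using matrix_norm_bound[of "Na j"] unfolding bnd_def by blast
  then obtain c where "\<And>j. bnd j (c j)" by metis
  then have c: "\<And>j. c j \<ge> 0" "\<And>j w. norm (Na j *v w) \<le> c j * norm w" unfolding bnd_def by blast+
  \<comment> \<open>The input corrections of the pulses contribute the squares of \<open>c\<close>,
    the dominated remainder contributes \<open>K\<close>.\<close>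
  define cc where "cc = (\<Sum>j\<le>k. (c j)\<^sup>2) + K"
  have bound: "cost C D N x u \<le> cc * ((norm (aim k x0))\<^sup>2 + (norm V2)\<^sup>2)"
    if tr: "traj A B x u" and x0: "x 0 = x0" and F: "odd (2 * Suc k + N + F)"
      and xf: "x' 0 = x0" "traj A B x' u'" "\<And>t. u' t = (if t < N then u t else 0)"
      and V2: "V2 = aim k (- (matpow Ad (Suc k) *v x' (N + F)))" for x u N F x' u' V2
  proof -
    define V1 where "V1 = aim k x0"
    define T where "T = Suc k + N + F"
    define M where "M = T + Suc k"
    define p where "p a V t = (if t = a then V else 0 :: complex^'d)" for a V and t :: nat
    define v where "v t = p 0 (cvec V1) t + p T (cvec V2) t" for t
    define U where "U t = (if Suc k \<le> t \<and> t < Suc k + N then u (t - Suc k) else 0)" for t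
    define g where "g t = real (k choose t) *s V1 + (if T \<le> t then real (k choose (t - T)) *s V2 else 0)" for t
    define X where "X = rec_nat 0 (\<lambda>t y. E *v (y + A *v y + (B *v U t + g t)))"
    have X0: "X 0 = 0" and XS: "X (Suc t) = E *v (X t + A *v X t + (B *v U t + g t))" for t
      by (simp_all add: X_def)
    have conv_v: "conv k W v t = (if t \<le> k then W t *v cvec V1 else 0)
        + (if T \<le> t \<and> t \<le> T + k then W (t - T) *v cvec V2 else 0)" for W :: "nat \<Rightarrow> complex^'d^'z" and t
      unfolding v_def conv_add unfolding p_def conv_pulse by simp
    have XA: "t \<le> Suc k \<Longrightarrow> X t = pulse k V1 t" for t
    proof (induction t)
      case (Suc t)
      then have "U t = 0" "g t = real (k choose t) *s V1" by (simp_all add: U_def g_def T_def)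
      then show ?case using Suc by (simp add: XS pulse_Suc)
    qed (simp add: X0)
    have XB: "j \<le> N + F \<Longrightarrow> X (Suc k + j) = x' j" for j
    proof (induction j)
      case 0
      then show ?case using XA[of "Suc k"] by (simp add: pulse_aim V1_def xf)
    next
      case (Suc j)
      have "U (Suc k + j) = u' j" by (simp add: U_def xf(3))
      moreover have "g (Suc k + j) = 0" using Suc.prems by (simp add: g_def T_def)
      ultimately have "X (Suc (Suc k + j)) = E *v (x' j + A *v x' j + B *v u' j)" using Suc by (simp add: XS)
      then show ?case using xf(2) unfolding traj_iff by simp
    qed
    have XT: "X T = x' (N + F)" using XB[of "N + F"] by (simp add: T_def add.assoc)
    \<comment> \<open>After T the state is the free motion of \<open>X T\<close> plus the second
      pulse, and \<open>V2\<close> is chosen to make them cancel at M.\<close>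
    have XC: "X (T + j) = matpow Ad j *v X T + pulse k V2 j" for j
    proof (induction j)
      case (Suc j)
      have "U (T + j) = 0" by (simp add: U_def T_def)
      moreover have "g (T + j) = real (k choose j) *s V2" by (simp add: g_def T_def)
      ultimately show ?case
        by (simp add: XS Suc pulse_Suc Ad_vec matrix_vector_right_distrib matrix_vector_mul_assoc[symmetric] algebra_simps)
    qed simp
    have XM: "X M = 0" unfolding M_def XC V2 pulse_aim XT by simp
    have "(\<Sum>t<M. (norm (cvec (C *v (X (Suc t) + X t) + D *v U t) + conv k Nb v t))\<^sup>2)
      \<le> (\<Sum>t<M. (norm (cvec (U t) + conv k Na v t))\<^sup>2) + K * (\<Sum>t<M. (norm (v t))\<^sup>2)"
    proof (rule loop_inequality[OF K])
      show "odd M" using F by (simp add: M_def T_def add.assoc add.left_commute)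
      show "X 0 = 0" "X M = 0" by (fact X0, fact XM)
      show "v t = 0" if "M \<le> t + k" for t using that by (simp add: v_def p_def M_def T_def)
      have mt: "mat c *v w = c *s w" for c and w :: "complex^'d"
        by (simp add: vec_eq_iff matrix_vector_mult_def mat_def if_distrib[of "\<lambda>x. x * _"] cong: if_cong)
      show "cvec (g t) = conv k (\<lambda>j. mat (of_nat (k choose j))) v t" for t
        unfolding conv_v mt by (auto simp: g_def cvec_add cvec_scale binomial_eq_0 T_def)
      show "X (Suc t) - X t = A *v (X (Suc t) + X t) + B *v U t + g t" for t
        unfolding add.assoc step_iff XS ..
    qed
    \<comment> \<open>Output energy outside the given motion is dropped, so \<open>Nb\<close> enters
      no estimate.\<close>
    moreover have "(\<Sum>t<N. (norm (C *v (x (Suc t) + x t) + D *v u t))\<^sup>2)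
      \<le> (\<Sum>t<M. (norm (cvec (C *v (X (Suc t) + X t) + D *v U t) + conv k Nb v t))\<^sup>2)"
    proof -
      have xx: "t \<le> N \<Longrightarrow> x t = x' t" for t
        by (induction t) (use tr xf x0 in \<open>auto simp: traj_iff\<close>)
      have "(\<Sum>t<N. (norm (C *v (x (Suc t) + x t) + D *v u t))\<^sup>2)
        = (\<Sum>t\<in>{Suc k..<Suc k + N}. (norm (cvec (C *v (X (Suc t) + X t) + D *v U t) + conv k Nb v t))\<^sup>2)"
      proof (rule sum.reindex_bij_witness[of _ "\<lambda>t. t - Suc k" "\<lambda>t. Suc k + t"])
        fix t assume "t \<in> {..<N}"
        then have t: "t < N" by simp
        have "X (Suc k + t) = x t" using XB[of t] xx[of t] t by simp
        moreover have "X (Suc (Suc k + t)) = x (Suc t)" using XB[of "Suc t"] xx[of "Suc t"] t by simp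
        moreover have "U (Suc k + t) = u t" using t by (simp add: U_def)
        moreover have "conv k Nb v (Suc k + t) = 0" unfolding conv_v using t by (simp add: T_def)
        ultimately show "(norm (cvec (C *v (X (Suc (Suc k + t)) + X (Suc k + t)) + D *v U (Suc k + t)) + conv k Nb v (Suc k + t)))\<^sup>2
            = (norm (C *v (x (Suc t) + x t) + D *v u t))\<^sup>2" by simp
      qed auto
      also have "\<dots> \<le> (\<Sum>t<M. (norm (cvec (C *v (X (Suc t) + X t) + D *v U t) + conv k Nb v t))\<^sup>2)"
        by (rule sum_mono2) (auto simp: M_def T_def)
      finally show ?thesis .
    qed
    moreover have "(\<Sum>t<M. (norm (cvec (U t) + conv k Na v t))\<^sup>2)
      \<le> (\<Sum>t<N. (norm (u t))\<^sup>2) + (\<Sum>j\<le>k. (c j)\<^sup>2) * ((norm V1)\<^sup>2 + (norm V2)\<^sup>2)"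
    proof -
      \<comment> \<open>The input and the two pulse responses live on disjoint time intervals;
        squares add without cross terms and the energy of \<open>u\<close> keeps the factor
        1.\<close>
      have pw: "(norm (cvec (U t) + conv k Na v t))\<^sup>2 = (if Suc k \<le> t \<and> t < Suc k + N then (norm (u (t - Suc k)))\<^sup>2 else 0)
        + ((if t \<le> k then (norm (Na t *v cvec V1))\<^sup>2 else 0)
        + (if T \<le> t \<and> t \<le> T + k then (norm (Na (t - T) *v cvec V2))\<^sup>2 else 0))" for t
        unfolding conv_v by (auto simp: U_def T_def)
      have s1: "(\<Sum>t<M. if Suc k \<le> t \<and> t < Suc k + N then (norm (u (t - Suc k)))\<^sup>2 else 0) = (\<Sum>t<N. (norm (u t))\<^sup>2)"
      proof -
        have "(\<Sum>t<M. if Suc k \<le> t \<and> t < Suc k + N then (norm (u (t - Suc k)))\<^sup>2 else 0)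
          = (\<Sum>t\<in>{Suc k..<Suc k + N}. (norm (u (t - Suc k)))\<^sup>2)"
          by (rule sum.mono_neutral_cong_right) (auto simp: M_def T_def)
        also have "\<dots> = (\<Sum>t<N. (norm (u t))\<^sup>2)"
          by (rule sum.reindex_bij_witness[of _ "\<lambda>t. Suc k + t" "\<lambda>t. t - Suc k"]) auto
        finally show ?thesis .
      qed
      have nb: "(norm (Na j *v cvec V))\<^sup>2 \<le> (c j)\<^sup>2 * (norm V)\<^sup>2" for j V
        using power_mono[OF c(2)[of j "cvec V"], of 2] by (simp add: power_mult_distrib)
      have s2: "(\<Sum>t<M. if t \<le> k then (norm (Na t *v cvec V1))\<^sup>2 else 0) \<le> (\<Sum>j\<le>k. (c j)\<^sup>2) * (norm V1)\<^sup>2"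
      proof -
        have "(\<Sum>t<M. if t \<le> k then (norm (Na t *v cvec V1))\<^sup>2 else 0) = (\<Sum>t\<le>k. (norm (Na t *v cvec V1))\<^sup>2)"
          by (rule sum.mono_neutral_cong_right) (auto simp: M_def)
        then show ?thesis unfolding sum_distrib_right by (simp add: sum_mono nb)
      qed
      have s3: "(\<Sum>t<M. if T \<le> t \<and> t \<le> T + k then (norm (Na (t - T) *v cvec V2))\<^sup>2 else 0) \<le> (\<Sum>j\<le>k. (c j)\<^sup>2) * (norm V2)\<^sup>2"
      proof -
        have "(\<Sum>t<M. if T \<le> t \<and> t \<le> T + k then (norm (Na (t - T) *v cvec V2))\<^sup>2 else 0)
          = (\<Sum>t\<in>{T..T + k}. (norm (Na (t - T) *v cvec V2))\<^sup>2)"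
          by (rule sum.mono_neutral_cong_right) (auto simp: M_def)
        also have "\<dots> = (\<Sum>j\<le>k. (norm (Na j *v cvec V2))\<^sup>2)"
          by (rule sum.reindex_bij_witness[of _ "\<lambda>t. T + t" "\<lambda>t. t - T"]) auto
        finally show ?thesis unfolding sum_distrib_right by (simp add: sum_mono nb)
      qed
      show ?thesis unfolding pw sum.distrib s1 using s2 s3 by (simp add: distrib_left)
    qed
    moreover have "(\<Sum>t<M. (norm (v t))\<^sup>2) = (norm V1)\<^sup>2 + (norm V2)\<^sup>2"
    proof -
      have "(norm (v t))\<^sup>2 = (if t = 0 then (norm V1)\<^sup>2 else 0) + (if t = T then (norm V2)\<^sup>2 else 0)" for t
        by (auto simp: v_def p_def T_def)
      then show ?thesis by (simp add: sum.distrib M_def T_def)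
    qed
    ultimately have "(\<Sum>t<N. (norm (C *v (x (Suc t) + x t) + D *v u t))\<^sup>2)
      \<le> (\<Sum>t<N. (norm (u t))\<^sup>2) + cc * ((norm V1)\<^sup>2 + (norm V2)\<^sup>2)"
      unfolding cc_def by (simp add: algebra_simps)
    then show ?thesis by (simp add: cost_def sum_subtractf V1_def)
  qed
  have "cost C D N x u \<le> cc * ((norm (aim k x0))\<^sup>2 + 0)" if tr: "traj A B x u" and x0: "x 0 = x0" for x u N
  proof -
    define u' where "u' t = (if t < N then u t else 0)" for t
    obtain x' where x': "x' 0 = x0" "traj A B x' u'" using traj_exists by blast
    have fr: "x' (N + j) = matpow Ad j *v x' N" for j
      by (rule free_motion) (use x'(2) in \<open>simp add: traj_iff u'_def\<close>)
    \<comment> \<open>The waiting time F = 2 i + 1 + N makes the loop length 2 (k + 1) + N + F odd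
      for every i.\<close>
    define V2 where "V2 i = aim k (- (matpow Ad (Suc k) *v x' (N + (2 * i + 1 + N))))" for i
    have "cost C D N x u \<le> cc * ((norm (aim k x0))\<^sup>2 + (norm (V2 i))\<^sup>2)" for i
      by (rule bound[OF tr x0 _ x' u'_def V2_def]) simp
    moreover have "(\<lambda>i. cc * ((norm (aim k x0))\<^sup>2 + (norm (V2 i))\<^sup>2)) \<longlonglongrightarrow> cc * ((norm (aim k x0))\<^sup>2 + 0)"
    proof -
      have "(\<lambda>j. matpow Ad j *v x' N) \<longlonglongrightarrow> 0"
        by (rule real_matpow_tendsto_zero) (rule Ad_contracting[OF hur])
      then have "(\<lambda>i. matpow Ad (2 * i + 1 + N) *v x' N) \<longlonglongrightarrow> 0"
        by (rule filterlim_compose[OF _ filterlim_subseq]) (simp add: strict_mono_def)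
      then have l: "(\<lambda>i. x' (N + (2 * i + 1 + N))) \<longlonglongrightarrow> 0" unfolding fr .
      define L where "L y = aim k (- (matpow Ad (Suc k) *v y))" for y
      have "linear L"
        by (rule linearI)
           (simp_all add: L_def aim_def vec.add vec.neg vec.scale vec_eq_iff algebra_simps matrix_vector_mult_scaleR)
      then have "bounded_linear L" by (rule linear_conv_bounded_linear[THEN iffD1])
      from bounded_linear.tendsto[OF this l] have "V2 \<longlonglongrightarrow> 0"
        unfolding V2_def L_def by (simp add: aim_def vec.zero)
      then have "(\<lambda>i. norm (V2 i)) \<longlonglongrightarrow> 0" by (rule tendsto_norm_zero)
      then have "(\<lambda>i. (norm (V2 i))\<^sup>2) \<longlonglongrightarrow> 0\<^sup>2" by (rule tendsto_power)
      then show ?thesis by (intro tendsto_intros) simp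
    qed
    ultimately show ?thesis by (intro LIMSEQ_le_const) auto
  qed
  then show ?thesis by blast
qed

lemma parallelogram_norm: "(norm (a + b))\<^sup>2 + (norm (a - b))\<^sup>2 = 2 * (norm a)\<^sup>2 + 2 * (norm b)\<^sup>2"
  for a b :: "'a::real_inner"
  unfolding power2_norm_eq_inner by (simp add: algebra_simps inner_commute)

text \<open>Switching the input off after \<open>N1\<close> makes every later contribution
  nonnegative; two trajectories thus get the common horizon that the parallelogram law
  requires.\<close>

lemma (in cayley) cost_truncate:
  assumes tr: "traj A B x u" and N: "N1 \<le> N"
  shows "\<exists>x' u'. traj A B x' u' \<and> x' 0 = x 0 \<and> cost C D N1 x u \<le> cost C D N x' u'"
proof -
  define u' where "u' t = (if t < N1 then u t else 0)" for t
  obtain x' where x': "x' 0 = x 0" "traj A B x' u'" using traj_exists by blast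
  have xx: "t \<le> N1 \<Longrightarrow> x' t = x t" for t
    by (induction t) (use tr x' in \<open>auto simp: traj_iff u'_def\<close>)
  have "cost C D N1 x u = cost C D N1 x' u'" unfolding cost_def by (intro sum.cong) (auto simp: xx u'_def)
  also have "\<dots> \<le> cost C D N x' u'" unfolding cost_def
    by (rule sum_mono2) (use N in \<open>auto simp: u'_def\<close>)
  finally show ?thesis using x' by blast
qed

lemma traj_linear:
  assumes "traj A B x u" "traj A B y v"
  shows "traj A B (\<lambda>t. x t + y t) (\<lambda>t. u t + v t)" "traj A B (\<lambda>t. x t - y t) (\<lambda>t. u t - v t)"
    "traj A B (\<lambda>t. r *\<^sub>R x t) (\<lambda>t. r *\<^sub>R u t)"
proof -
  have x: "x (Suc t) - x t = A *v (x (Suc t) + x t) + B *v u t" and y: "y (Suc t) - y t = A *v (y (Suc t) + y t) + B *v v t"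
    for t using assms unfolding traj_def by auto
  show "traj A B (\<lambda>t. x t + y t) (\<lambda>t. u t + v t)" unfolding traj_def
  proof
    fix t
    have "x (Suc t) + y (Suc t) - (x t + y t) = (x (Suc t) - x t) + (y (Suc t) - y t)" by simp
    also have "\<dots> = A *v (x (Suc t) + y (Suc t) + (x t + y t)) + B *v (u t + v t)"
      unfolding x y by (simp add: matrix_vector_right_distrib)
    finally show "x (Suc t) + y (Suc t) - (x t + y t) = A *v (x (Suc t) + y (Suc t) + (x t + y t)) + B *v (u t + v t)" .
  qed
  show "traj A B (\<lambda>t. x t - y t) (\<lambda>t. u t - v t)" unfolding traj_def
  proof
    fix t
    have "x (Suc t) - y (Suc t) - (x t - y t) = (x (Suc t) - x t) - (y (Suc t) - y t)" by simp
    also have "\<dots> = A *v (x (Suc t) - y (Suc t) + (x t - y t)) + B *v (u t - v t)"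
      unfolding x y by (simp add: matrix_vector_right_distrib matrix_vector_mult_diff_distrib)
    finally show "x (Suc t) - y (Suc t) - (x t - y t) = A *v (x (Suc t) - y (Suc t) + (x t - y t)) + B *v (u t - v t)" .
  qed
  show "traj A B (\<lambda>t. r *\<^sub>R x t) (\<lambda>t. r *\<^sub>R u t)" unfolding traj_def
    by (auto simp: scaleR_diff_right[symmetric] x scaleR_add_right matrix_vector_mult_scaleR matrix_vector_right_distrib
        simp flip: scaleR_add_right)
qed

text \<open>The implicit midpoint rule leaves quadratic storage functions and the matrix inequality
  unchanged, so a storage function of the discretized system solves the original inequality.\<close>
lemma discrete_storage_LMI:
  fixes A :: "real^'d^'d" and B :: "real^'n^'d" and C :: "real^'d^'m" and D :: "real^'n^'m"
  assumes "cayley A E"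
    and bd: "\<And>x0. \<exists>b. \<forall>x u N. traj A B x u \<longrightarrow> x 0 = x0 \<longrightarrow> cost C D N x u \<le> b"
  shows "\<exists>X. sym_mat X \<and> psd X \<and> dissipative A B C D X"
proof -
  interpret cayley A E by fact
  define V where "V x0 = {cost C D N x u | N x u. traj A B x u \<and> x 0 = x0}" for x0
  have VI: "traj A B x u \<Longrightarrow> cost C D N x u \<in> V (x 0)" for x u N unfolding V_def by blast
  have bdd: "bdd_above (V x)" for x
  proof -
    obtain b where "\<forall>y u N. traj A B y u \<longrightarrow> y 0 = x \<longrightarrow> cost C D N y u \<le> b" using bd by blast
    then show ?thesis unfolding V_def by (intro bdd_aboveI[of _ b]) blast
  qed
  have "\<exists>X. sym_mat X \<and> psd X \<and> (\<forall>x. Sup (V x) = x \<bullet> (X *v x))"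
  proof (rule Sup_quadratic)
    show "bdd_above (V x)" for x by (rule bdd)
    show "\<exists>a\<in>V x. 0 \<le> a" for x
    proof -
      obtain y where "y 0 = x" "traj A B y (\<lambda>_. 0)" using traj_exists by blast
      then show ?thesis using VI[of y "\<lambda>_. 0" 0] by (intro bexI[of _ "cost C D 0 y (\<lambda>_. 0)"]) (auto simp: cost_def)
    qed
    show "r\<^sup>2 * a \<in> V (r *\<^sub>R x)" if a: "a \<in> V x" for r x a
    proof -
      obtain N y u where y: "a = cost C D N y u" "traj A B y u" "y 0 = x" using a unfolding V_def by blast
      have n2: "(norm (r *\<^sub>R w))\<^sup>2 = r\<^sup>2 * (norm w)\<^sup>2" for w :: "real^'z" by (simp add: power_mult_distrib)
      have n3: "(norm (r *\<^sub>R w))\<^sup>2 = r\<^sup>2 * (norm w)\<^sup>2" for w :: "real^'n" by (simp add: power_mult_distrib)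
      have n4: "(norm (r *\<^sub>R w))\<^sup>2 = r\<^sup>2 * (norm w)\<^sup>2" for w :: "real^'m" by (simp add: power_mult_distrib)
      have "cost C D N (\<lambda>t. r *\<^sub>R y t) (\<lambda>t. r *\<^sub>R u t) = r\<^sup>2 * a"
        unfolding y(1) cost_def sum_distrib_left
        by (simp only: scaleR_add_right[symmetric] matrix_vector_mult_scaleR n3 n4 right_diff_distrib)
      then show ?thesis using VI[OF traj_linear(3)[OF y(2) y(2), of r], of N] y(3) by simp
    qed
    show "\<exists>c\<in>V (x + y). \<exists>d\<in>V (x - y). 2 * a + 2 * b \<le> c + d" if ab: "a \<in> V x" "b \<in> V y" for x y a b
    proof -
      obtain N1 x1 u1 where 1: "a = cost C D N1 x1 u1" "traj A B x1 u1" "x1 0 = x" using ab unfolding V_def by blast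
      obtain N2 x2 u2 where 2: "b = cost C D N2 x2 u2" "traj A B x2 u2" "x2 0 = y" using ab unfolding V_def by blast
      define N where "N = max N1 N2"
      obtain x1' u1' where h1: "traj A B x1' u1'" "x1' 0 = x" "a \<le> cost C D N x1' u1'"
        using cost_truncate[OF 1(2), of N1 N C D] 1 by (auto simp: N_def)
      obtain x2' u2' where h2: "traj A B x2' u2'" "x2' 0 = y" "b \<le> cost C D N x2' u2'"
        using cost_truncate[OF 2(2), of N2 N C D] 2 by (auto simp: N_def)
      let ?c = "cost C D N (\<lambda>t. x1' t + x2' t) (\<lambda>t. u1' t + u2' t)"
      let ?d = "cost C D N (\<lambda>t. x1' t - x2' t) (\<lambda>t. u1' t - u2' t)"
      have pw: "(norm (C *v (x1' (Suc t) + x2' (Suc t) + (x1' t + x2' t)) + D *v (u1' t + u2' t)))\<^sup>2 - (norm (u1' t + u2' t))\<^sup>2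
        + ((norm (C *v (x1' (Suc t) - x2' (Suc t) + (x1' t - x2' t)) + D *v (u1' t - u2' t)))\<^sup>2 - (norm (u1' t - u2' t))\<^sup>2)
        = 2 * ((norm (C *v (x1' (Suc t) + x1' t) + D *v u1' t))\<^sup>2 - (norm (u1' t))\<^sup>2)
        + 2 * ((norm (C *v (x2' (Suc t) + x2' t) + D *v u2' t))\<^sup>2 - (norm (u2' t))\<^sup>2)" for t
      proof -
        have s1: "C *v (x1' (Suc t) + x2' (Suc t) + (x1' t + x2' t)) + D *v (u1' t + u2' t)
          = (C *v (x1' (Suc t) + x1' t) + D *v u1' t) + (C *v (x2' (Suc t) + x2' t) + D *v u2' t)"
          by (simp add: matrix_vector_right_distrib)
        have s2: "C *v (x1' (Suc t) - x2' (Suc t) + (x1' t - x2' t)) + D *v (u1' t - u2' t)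
          = (C *v (x1' (Suc t) + x1' t) + D *v u1' t) - (C *v (x2' (Suc t) + x2' t) + D *v u2' t)"
          by (simp add: matrix_vector_right_distrib matrix_vector_mult_diff_distrib)
        show ?thesis unfolding s1 s2
          using parallelogram_norm[of "C *v (x1' (Suc t) + x1' t) + D *v u1' t" "C *v (x2' (Suc t) + x2' t) + D *v u2' t"]
            parallelogram_norm[of "u1' t" "u2' t"] by (simp add: algebra_simps)
      qed
      have "?c + ?d = 2 * cost C D N x1' u1' + 2 * cost C D N x2' u2'"
        unfolding cost_def sum.distrib[symmetric] sum_distrib_left by (rule sum.cong[OF refl], rule pw)
      then have "2 * a + 2 * b \<le> ?c + ?d" using h1 h2 by simp
      moreover have "?c \<in> V (x + y)" using VI[OF traj_linear(1)[OF h1(1) h2(1)], of N] h1 h2 by simp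
      moreover have "?d \<in> V (x - y)" using VI[OF traj_linear(2)[OF h1(1) h2(1)], of N] h1 h2 by simp
      ultimately show ?thesis by blast
    qed
  qed
  then obtain X where X: "sym_mat X" "psd X" "\<And>x. Sup (V x) = x \<bullet> (X *v x)" by blast
  \<comment> \<open>One step changes the storage by m X w; the factor 1/2 compensates the 2 in the
    dissipation inequality.\<close>
  have diss: "2 * (m \<bullet> (((1/2) *\<^sub>R X) *v (A *v m + B *v u))) + (norm (C *v m + D *v u))\<^sup>2 \<le> (norm u)\<^sup>2" for m u
  proof -
    define w where "w = A *v m + B *v u"
    \<comment> \<open>The two states with sum m and difference w, so that any pair (m, u) occurs as
      the first step of a trajectory.\<close>
    define x where "x = (1/2) *\<^sub>R (m - w)"
    define x' where "x' = (1/2) *\<^sub>R (m + w)"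
    have sum: "x' + x = m" and diff: "x' - x = w"
      unfolding x_def x'_def by (simp_all add: scaleR_add_right scaleR_diff_right flip: scaleR_add_left)
    have "a \<le> x \<bullet> (X *v x) - ((norm (C *v m + D *v u))\<^sup>2 - (norm u)\<^sup>2)" if a: "a \<in> V x'" for a
    proof -
      obtain N y v where y: "a = cost C D N y v" "traj A B y v" "y 0 = x'" using a unfolding V_def by blast
      define y2 where "y2 t = (case t of 0 \<Rightarrow> x | Suc t \<Rightarrow> y t)" for t
      define v2 where "v2 t = (case t of 0 \<Rightarrow> u | Suc t \<Rightarrow> v t)" for t
      have "traj A B y2 v2" unfolding traj_def
      proof
        fix t show "y2 (Suc t) - y2 t = A *v (y2 (Suc t) + y2 t) + B *v v2 t"
          using y(2) sum diff by (cases t) (auto simp: y2_def v2_def traj_def y(3) w_def)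
      qed
      from VI[OF this, of "Suc N"] have "cost C D (Suc N) y2 v2 \<in> V x" by (simp add: y2_def)
      from cSup_upper[OF this bdd] have "cost C D (Suc N) y2 v2 \<le> x \<bullet> (X *v x)" unfolding X(3) .
      moreover have "cost C D (Suc N) y2 v2 = ((norm (C *v m + D *v u))\<^sup>2 - (norm u)\<^sup>2) + a"
        unfolding cost_def sum.lessThan_Suc_shift y(1) by (simp add: y2_def v2_def y(3) sum)
      ultimately show ?thesis by simp
    qed
    moreover have "V x' \<noteq> {}"
    proof -
      obtain y where "y 0 = x'" "traj A B y (\<lambda>_. 0)" using traj_exists by blast
      then show ?thesis using VI by blast
    qed
    ultimately have "x' \<bullet> (X *v x') \<le> x \<bullet> (X *v x) - ((norm (C *v m + D *v u))\<^sup>2 - (norm u)\<^sup>2)"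
      unfolding X(3)[symmetric, of x'] by (intro cSup_least)
    moreover have "x' \<bullet> (X *v x') - x \<bullet> (X *v x) = m \<bullet> (X *v w)"
    proof -
      have "m \<bullet> (X *v w) = x' \<bullet> (X *v x') - x \<bullet> (X *v x) + (x \<bullet> (X *v x') - x' \<bullet> (X *v x))"
        unfolding sum[symmetric] diff[symmetric]
        by (simp add: matrix_vector_mult_diff_distrib inner_add_left inner_diff_right)
      then show ?thesis using sym_mat_inner[OF X(1), of x x'] by (simp add: inner_commute)
    qed
    ultimately show ?thesis
      unfolding w_def[symmetric] by (simp add: scaleR_matrix_vector_assoc[symmetric])
  qed
  have "sym_mat ((1/2) *\<^sub>R X)" using X(1) by (simp add: sym_mat_def transpose_scalar)
  moreover have "psd ((1/2) *\<^sub>R X)"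
    using X(2) \<open>sym_mat ((1/2) *\<^sub>R X)\<close> by (simp add: psd_def scaleR_matrix_vector_assoc[symmetric])
  ultimately show ?thesis using diss unfolding dissipative_def by blast
qed

theorem bounded_real_LMI:
  fixes A :: "real^'d^'d" and B :: "real^'n^'d" and C :: "real^'d^'m" and D :: "real^'n^'m"
  assumes br: "bounded_real_pair P Q" and re: "realizes P Q Y A B C D"
    and hur: "\<And>z v. cmat A *v v = z *s v \<Longrightarrow> v \<noteq> 0 \<Longrightarrow> Re z < 0"
  shows "\<exists>X. sym_mat X \<and> psd X \<and> dissipative A B C D X"
proof -
  have "\<exists>E. E ** (mat 1 - A) = mat 1"
  proof -
    have "x = 0" if "(mat 1 - A) *v x = 0" for x
    proof (rule ccontr)
      assume "x \<noteq> 0"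
      then have "norm (cvec x) \<noteq> 0" by simp
      then have "cvec x \<noteq> 0" by (metis norm_zero)
      moreover have "cmat A *v cvec x = 1 *s cvec x" using that unfolding mat_minus_vec cmat_cvec by simp
      ultimately show False using hur by fastforce
    qed
    then show ?thesis using matrix_left_invertible_ker by blast
  qed
  then obtain E where "E ** (mat 1 - A) = mat 1" by blast
  then have cay: "cayley A E" unfolding cayley_def by (simp add: matrix_left_right_inverse)
  obtain k K and Na :: "nat \<Rightarrow> complex^'d^'n" and Nb :: "nat \<Rightarrow> complex^'d^'m" where "K \<ge> 0" and
    "\<And>q m u v. cmod q = 1 \<Longrightarrow> q \<noteq> -1 \<Longrightarrow>
      (1 - q) *s m = (1 + q) *s (cmat A *v m + cmat B *v u + (1 + q) ^ k *s v) \<Longrightarrow>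
      (norm (cmat C *v m + cmat D *v u + (\<Sum>j\<le>k. q ^ j *s (Nb j *v v))))\<^sup>2
        \<le> (norm (u + (\<Sum>j\<le>k. q ^ j *s (Na j *v v))))\<^sup>2 + K * (norm v)\<^sup>2"
    using circle_contraction[OF br re] by blast
  note cb = cayley.loop_cost_bound[OF cay hur this]
  show ?thesis by (rule discrete_storage_LMI[OF cay cb])
qed

section \<open>Absolutely continuous functions and linear differential equations\<close>

text \<open>Absolute continuity of \<open>F\<close> with derivative \<open>f\<close> almost
  everywhere, expressed by integrals so that no pointwise differentiation occurs.\<close>

definition antideriv :: "(real \<Rightarrow> 'a::euclidean_space) \<Rightarrow> (real \<Rightarrow> 'a) \<Rightarrow> bool" where
  "antideriv F f \<longleftrightarrow> (\<forall>a b. a \<le> b \<longrightarrow> set_integrable lborel {a..b} f \<and> F b - F a = (LINT t:{a..b}|lborel. f t))"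

lemma antiderivD:
  assumes "antideriv F f" "a \<le> b"
  shows "set_integrable lborel {a..b} f" "F b - F a = (LINT t:{a..b}|lborel. f t)"
  using assms by (auto simp: antideriv_def)

lemma antideriv_continuous:
  assumes "antideriv F f"
  shows "continuous_on S F"
proof -
  have "continuous_on {a..b} F" for a b
  proof (cases "a \<le> b")
    case True
    have "f integrable_on {a..b}" using set_borel_integral_eq_integral(1)[OF antiderivD(1)[OF assms True]] .
    then have "continuous_on {a..b} (\<lambda>t. F a + integral {a..t} f)"
      by (intro continuous_intros indefinite_integral_continuous_1)
    then show ?thesis
    proof (rule continuous_on_eq)
      fix t assume "t \<in> {a..b}"
      then have t: "a \<le> t" by simp
      show "F a + integral {a..t} f = F t"
        using antiderivD(2)[OF assms t] set_borel_integral_eq_integral(2)[OF antiderivD(1)[OF assms t]]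
        by (simp add: algebra_simps)
    qed
  qed simp
  then have "continuous_on {x - 1<..<x + 1} F" for x
    by (rule continuous_on_subset[of "{x - 1..x + 1}"]) auto
  then have "isCont F x" for x
    by (metis continuous_on_interior greaterThanLessThan_iff interior_open open_greaterThanLessThan
        less_add_one diff_less_eq)
  then show ?thesis by (simp add: continuous_at_imp_continuous_on)
qed

lemma antideriv_const: "antideriv (\<lambda>_. c) (\<lambda>_. 0)"
  by (simp add: antideriv_def set_integrable_def set_lebesgue_integral_def)

lemma antideriv_add:
  assumes "antideriv F f" "antideriv G g"
  shows "antideriv (\<lambda>t. F t + G t) (\<lambda>t. f t + g t)"
  unfolding antideriv_def
proof (intro allI impI)
  fix a b :: real assume ab: "a \<le> b"
  note 1 = antiderivD[OF assms(1) ab] and 2 = antiderivD[OF assms(2) ab]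
  show "set_integrable lborel {a..b} (\<lambda>t. f t + g t) \<and> F b + G b - (F a + G a) = (LINT t:{a..b}|lborel. f t + g t)"
    using set_integral_add[OF 1(1) 2(1)] 1(2) 2(2) by (simp add: algebra_simps)
qed

lemma antideriv_bounded_linear:
  assumes F: "antideriv F f" and L: "bounded_linear L"
  shows "antideriv (\<lambda>t. L (F t)) (\<lambda>t. L (f t))"
  unfolding antideriv_def
proof (intro allI impI)
  fix a b :: real assume ab: "a \<le> b"
  interpret L: bounded_linear L by fact
  note 1 = antiderivD[OF F ab]
  have e: "indicat_real {a..b} t *\<^sub>R L (f t) = L (indicat_real {a..b} t *\<^sub>R f t)" for t
    by (simp add: L.scaleR)
  have i: "integrable lborel (\<lambda>t. indicat_real {a..b} t *\<^sub>R f t)" using 1(1) by (simp add: set_integrable_def)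
  have "integrable lborel (\<lambda>t. L (indicat_real {a..b} t *\<^sub>R f t))"
    by (rule integrable_bounded_linear[OF L i])
  moreover have "(LINT t|lborel. L (indicat_real {a..b} t *\<^sub>R f t)) = L (LINT t|lborel. indicat_real {a..b} t *\<^sub>R f t)"
    by (rule integral_bounded_linear[OF L i])
  ultimately show "set_integrable lborel {a..b} (\<lambda>t. L (f t)) \<and> L (F b) - L (F a) = (LINT t:{a..b}|lborel. L (f t))"
    using 1(2) by (simp add: set_integrable_def set_lebesgue_integral_def e L.diff[symmetric])
qed

lemma antideriv_sum:
  "(\<And>i. i \<in> I \<Longrightarrow> antideriv (F i) (f i)) \<Longrightarrow> antideriv (\<lambda>t. \<Sum>i\<in>I. F i t) (\<lambda>t. \<Sum>i\<in>I. f i t)"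
  by (induction I rule: infinite_finite_induct) (auto intro: antideriv_add antideriv_const)

lemma antideriv_vec_iff:
  fixes F :: "real \<Rightarrow> real^'k"
  shows "antideriv F f \<longleftrightarrow> (\<forall>i. antideriv (\<lambda>t. F t $ i) (\<lambda>t. f t $ i))"
proof
  assume "antideriv F f"
  then show "\<forall>i. antideriv (\<lambda>t. F t $ i) (\<lambda>t. f t $ i)"
    by (auto intro: antideriv_bounded_linear bounded_linear_vec_nth)
next
  assume a: "\<forall>i. antideriv (\<lambda>t. F t $ i) (\<lambda>t. f t $ i)"
  have "antideriv (\<lambda>t. \<Sum>i\<in>UNIV. F t $ i *\<^sub>R axis i 1) (\<lambda>t. \<Sum>i\<in>UNIV. f t $ i *\<^sub>R (axis i 1 :: real^'k))"
  proof (rule antideriv_sum)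
    fix i
    show "antideriv (\<lambda>t. F t $ i *\<^sub>R axis i 1) (\<lambda>t. f t $ i *\<^sub>R (axis i 1 :: real^'k))"
      by (rule antideriv_bounded_linear[OF a[rule_format, of i] bounded_linear_scaleR_left])
  qed
  moreover have "(\<Sum>i\<in>UNIV. x $ i *\<^sub>R axis i 1) = x" for x :: "real^'k"
    using basis_expansion[of x] by (simp add: scalar_mult_eq_scaleR)
  ultimately show "antideriv F f" by simp
qed

lemma antideriv_C1:
  fixes F :: "real \<Rightarrow> 'a::euclidean_space"
  assumes "\<And>t. (F has_vector_derivative f t) (at t)" "continuous_on UNIV f"
  shows "antideriv F f"
  unfolding antideriv_def
proof (intro allI impI)
  fix a b :: real assume ab: "a \<le> b"
  have i: "set_integrable lborel {a..b} f"
    by (intro borel_integrable_atLeastAtMost' continuous_on_subset[OF assms(2)]) simp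
  have h: "(f has_integral (F b - F a)) {a..b}"
    by (rule fundamental_theorem_of_calculus[OF ab]) (rule has_vector_derivative_at_within[OF assms(1)])
  then show "set_integrable lborel {a..b} f \<and> F b - F a = (LINT t:{a..b}|lborel. f t)"
    using i set_borel_integral_eq_integral(2)[OF i] integral_unique[OF h] by simp
qed

lemma antideriv_exists:
  fixes f :: "real \<Rightarrow> 'a::euclidean_space"
  assumes "\<And>a b. set_integrable lborel {a..b} f"
  shows "\<exists>F. antideriv F f \<and> F t0 = c"
proof -
  have fi: "f integrable_on {a..b}" for a b by (rule set_borel_integral_eq_integral(1)[OF assms])
  define F where "F t = c + (if t0 \<le> t then integral {t0..t} f else - integral {t..t0} f)" for t
  have "F b - F a = integral {a..b} f" if ab: "a \<le> b" for a b
  proof -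
    consider "t0 \<le> a" | "a < t0" "t0 \<le> b" | "b < t0" using ab by linarith
    then show ?thesis
    proof cases
      case 1
      then show ?thesis using Henstock_Kurzweil_Integration.integral_combine[OF 1 ab fi] ab by (simp add: F_def algebra_simps)
    next
      case 2
      then show ?thesis using Henstock_Kurzweil_Integration.integral_combine[of a t0 b f, OF _ _ fi] by (simp add: F_def algebra_simps)
    next
      case 3
      then show ?thesis using Henstock_Kurzweil_Integration.integral_combine[of a b t0 f, OF ab _ fi] ab by (simp add: F_def algebra_simps)
    qed
  qed
  then have "antideriv F f" unfolding antideriv_def
    using assms set_borel_integral_eq_integral(2)[OF assms] by auto
  then show ?thesis by (intro exI[of _ F]) (simp add: F_def)
qed

lemma set_integrable_finite_sum:
  fixes f :: "'i \<Rightarrow> 'b \<Rightarrow> 'a::{banach, second_countable_topology}"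
  assumes "\<And>i. i \<in> I \<Longrightarrow> set_integrable M S (f i)"
  shows "set_integrable M S (\<lambda>t. \<Sum>i\<in>I. f i t)"
  using assms by (simp add: set_integrable_def scaleR_sum_right)

lemma set_integrable_continuous_mult:
  fixes F :: "real \<Rightarrow> real" and g :: "real \<Rightarrow> real"
  assumes F: "continuous_on UNIV F" and g: "set_integrable lborel {a..b} g"
  shows "set_integrable lborel {a..b} (\<lambda>t. F t * g t)"
proof -
  have "compact (F ` {a..b})" by (intro compact_continuous_image continuous_on_subset[OF F]) auto
  then obtain c where c: "\<And>t. t \<in> {a..b} \<Longrightarrow> \<bar>F t\<bar> \<le> c"
    by (metis compact_imp_bounded bounded_real imageI)
  have mF: "F \<in> borel_measurable borel" using F by (rule borel_measurable_continuous_onI)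
  have mg: "(\<lambda>t. indicat_real {a..b} t * g t) \<in> borel_measurable lborel"
    using g unfolding set_integrable_def by (auto dest: borel_measurable_integrable)
  have i: "integrable lborel (\<lambda>t. c * (indicat_real {a..b} t * g t))"
    using g unfolding set_integrable_def by simp
  show ?thesis unfolding set_integrable_def
  proof (rule Bochner_Integration.integrable_bound[OF i])
    have "(\<lambda>t. F t * (indicat_real {a..b} t * g t)) \<in> borel_measurable lborel"
      using mF mg by simp
    then show "(\<lambda>t. indicat_real {a..b} t *\<^sub>R (F t * g t)) \<in> borel_measurable lborel" by (simp add: mult.left_commute)
    show "AE t in lborel. norm (indicat_real {a..b} t *\<^sub>R (F t * g t)) \<le> norm (c * (indicat_real {a..b} t * g t))"
    proof (rule AE_I2)
      fix t
      have "t \<in> {a..b} \<Longrightarrow> \<bar>F t\<bar> \<le> \<bar>c\<bar>" using c[of t] by linarith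
      then show "norm (indicat_real {a..b} t *\<^sub>R (F t * g t)) \<le> norm (c * (indicat_real {a..b} t * g t))"
        by (auto simp: indicator_def abs_mult intro: mult_right_mono)
    qed
  qed
qed

text \<open>Integration by parts for absolutely continuous functions, by Fubini over the triangle
  a \<le> s \<le> r \<le> b.\<close>
lemma antideriv_mult:
  fixes F G :: "real \<Rightarrow> real"
  assumes F: "antideriv F f" and G: "antideriv G g"
  shows "antideriv (\<lambda>t. F t * G t) (\<lambda>t. f t * G t + F t * g t)"
  unfolding antideriv_def
proof (intro allI impI)
  fix a b :: real assume ab: "a \<le> b"
  have fi: "set_integrable lborel {a..b} f" and gi: "set_integrable lborel {a..b} g"
    using antiderivD(1)[OF F ab] antiderivD(1)[OF G ab] .
  have cF: "continuous_on UNIV F" and cG: "continuous_on UNIV G" using F G antideriv_continuous by blast+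
  have Gf: "set_integrable lborel {a..b} (\<lambda>t. G t * f t)" by (rule set_integrable_continuous_mult[OF cG fi])
  have Fg: "set_integrable lborel {a..b} (\<lambda>t. F t * g t)" by (rule set_integrable_continuous_mult[OF cF gi])
  define f' where "f' s = indicat_real {a..b} s * f s" for s
  define g' where "g' s = indicat_real {a..b} s * g s" for s
  have f': "integrable lborel f'" using fi by (simp add: set_integrable_def f'_def[abs_def])
  have g': "integrable lborel g'" using gi by (simp add: set_integrable_def g'_def[abs_def])
  have mf: "f' \<in> borel_measurable borel" and mg: "g' \<in> borel_measurable borel"
    using borel_measurable_integrable[OF f'] borel_measurable_integrable[OF g'] by simp_all
  define h where "h s r = f' s * g' r * (if s \<le> r then 1 else 0)" for s r
  have prod: "integrable (lborel \<Otimes>\<^sub>M lborel) (\<lambda>(s, r). f' s * g' r)"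
  proof (rule lborel_pair.Fubini_integrable)
    show "(\<lambda>(s, r). f' s * g' r) \<in> borel_measurable (lborel \<Otimes>\<^sub>M lborel)"
      using mf mg by simp
    show "integrable lborel (\<lambda>x. LINT y|lborel. norm (case (x, y) of (s, r) \<Rightarrow> f' s * g' r))"
      using f' by (simp add: abs_mult)
    show "AE x in lborel. integrable lborel (\<lambda>y. case (x, y) of (s, r) \<Rightarrow> f' s * g' r)"
      using g' by simp
  qed
  have "integrable (lborel \<Otimes>\<^sub>M lborel) (case_prod h)"
  proof (rule Bochner_Integration.integrable_bound[OF prod])
    show "case_prod h \<in> borel_measurable (lborel \<Otimes>\<^sub>M lborel)"
      unfolding h_def case_prod_beta using mf mg by measurable
    show "AE x in lborel \<Otimes>\<^sub>M lborel. norm (case_prod h x) \<le> norm (case x of (s, r) \<Rightarrow> f' s * g' r)"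
      by (auto simp: h_def)
  qed
  from lborel_pair.Fubini_integral[OF this]
  have fub: "(LINT r|lborel. LINT s|lborel. h s r) = (LINT s|lborel. LINT r|lborel. h s r)" .
  have i1: "(LINT s|lborel. h s r) = indicat_real {a..b} r * (g r * (F r - F a))" for r
  proof (cases "r \<in> {a..b}")
    case True
    have "(LINT s|lborel. h s r) = (LINT s|lborel. g r * (indicat_real {a..r} s * f s))"
      by (rule Bochner_Integration.integral_cong) (use True in \<open>auto simp: h_def f'_def g'_def indicator_def\<close>)
    also have "\<dots> = g r * (F r - F a)" using antiderivD(2)[OF F, of a r] True by (simp add: set_lebesgue_integral_def)
    finally show ?thesis using True by simp
  qed (simp add: h_def g'_def)
  have i2: "(LINT r|lborel. h s r) = indicat_real {a..b} s * (f s * (G b - G s))" for s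
  proof (cases "s \<in> {a..b}")
    case True
    have "(LINT r|lborel. h s r) = (LINT r|lborel. f s * (indicat_real {s..b} r * g r))"
      by (rule Bochner_Integration.integral_cong) (use True in \<open>auto simp: h_def f'_def g'_def indicator_def\<close>)
    also have "\<dots> = f s * (G b - G s)" using antiderivD(2)[OF G, of s b] True by (simp add: set_lebesgue_integral_def)
    finally show ?thesis using True by simp
  qed (simp add: h_def f'_def)
  have "(LINT r:{a..b}|lborel. F r * g r - F a * g r) = (LINT s:{a..b}|lborel. G b * f s - G s * f s)"
    using fub unfolding i1 i2 set_lebesgue_integral_def by (simp add: algebra_simps)
  moreover have "(LINT r:{a..b}|lborel. F r * g r - F a * g r) = (LINT r:{a..b}|lborel. F r * g r) - F a * (G b - G a)"
    using gi by (subst set_integral_diff(2)[OF Fg]) (auto simp: antiderivD(2)[OF G ab])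
  moreover have "(LINT s:{a..b}|lborel. G b * f s - G s * f s) = G b * (F b - F a) - (LINT s:{a..b}|lborel. G s * f s)"
    using fi by (subst set_integral_diff(2)[OF _ Gf]) (auto simp: antiderivD(2)[OF F ab])
  moreover have "(LINT t:{a..b}|lborel. f t * G t + F t * g t) = (LINT s:{a..b}|lborel. G s * f s) + (LINT r:{a..b}|lborel. F r * g r)"
    using set_integral_add(2)[OF Gf Fg] by (simp add: mult.commute)
  moreover have "set_integrable lborel {a..b} (\<lambda>t. f t * G t + F t * g t)"
    using set_integral_add(1)[OF Gf Fg] by (simp add: mult.commute)
  ultimately show "set_integrable lborel {a..b} (\<lambda>t. f t * G t + F t * g t) \<and>
      F b * G b - F a * G a = (LINT t:{a..b}|lborel. f t * G t + F t * g t)"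
    by (simp add: algebra_simps)
qed

lemma antideriv_inner:
  fixes F G :: "real \<Rightarrow> real^'k"
  assumes "antideriv F f" "antideriv G g"
  shows "antideriv (\<lambda>t. F t \<bullet> G t) (\<lambda>t. f t \<bullet> G t + F t \<bullet> g t)"
proof -
  have "antideriv (\<lambda>t. \<Sum>i\<in>UNIV. F t $ i * G t $ i) (\<lambda>t. \<Sum>i\<in>UNIV. f t $ i * G t $ i + F t $ i * g t $ i)"
    using assms by (intro antideriv_sum antideriv_mult) (auto simp: antideriv_vec_iff)
  then show ?thesis by (simp add: inner_vec_def sum.distrib)
qed

lemma antideriv_matrix_vector:
  fixes F :: "real \<Rightarrow> real^'k" and E :: "real \<Rightarrow> real^'k^'l"
  assumes "antideriv F f" and "\<And>i j. antideriv (\<lambda>t. E t $ i $ j) (\<lambda>t. e t $ i $ j)"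
  shows "antideriv (\<lambda>t. E t *v F t) (\<lambda>t. e t *v F t + E t *v f t)"
  unfolding antideriv_vec_iff
proof
  fix i
  have "antideriv (\<lambda>t. \<Sum>j\<in>UNIV. E t $ i $ j * F t $ j) (\<lambda>t. \<Sum>j\<in>UNIV. e t $ i $ j * F t $ j + E t $ i $ j * f t $ j)"
    using assms by (intro antideriv_sum antideriv_mult) (auto simp: antideriv_vec_iff)
  then show "antideriv (\<lambda>t. (E t *v F t) $ i) (\<lambda>t. (e t *v F t + E t *v f t) $ i)"
    by (simp add: matrix_vector_mult_def sum.distrib)
qed

section \<open>The matrix exponential and linear differential equations\<close>

definition expm :: "real^'n^'n \<Rightarrow> real \<Rightarrow> real^'n^'n" where
  "expm A t = (\<chi> i j. \<Sum>n. (matpow A n $ i $ j / fact n) * t ^ n)"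

lemma matpow_bound: "\<bar>matpow A n $ i $ j\<bar> \<le> (\<Sum>i\<in>UNIV. \<Sum>j\<in>UNIV. \<bar>A $ i $ j\<bar>) ^ n"
  for A :: "real^'n^'n"
proof (induction n arbitrary: i j)
  case (Suc n)
  let ?K = "\<Sum>i\<in>UNIV. \<Sum>j\<in>UNIV. \<bar>A $ i $ j\<bar>"
  have "\<bar>matpow A (Suc n) $ i $ j\<bar> \<le> (\<Sum>k\<in>UNIV. \<bar>A $ i $ k\<bar> * ?K ^ n)"
    unfolding matpow.simps matrix_matrix_mult_def vec_lambda_beta
    by (rule order_trans[OF sum_abs]) (auto simp: abs_mult intro!: sum_mono mult_left_mono Suc)
  also have "\<dots> = (\<Sum>k\<in>UNIV. \<bar>A $ i $ k\<bar>) * ?K ^ n" by (simp add: sum_distrib_right)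
  also have "\<dots> \<le> ?K * ?K ^ n"
    by (intro mult_right_mono zero_le_power member_le_sum[of i UNIV "\<lambda>i. \<Sum>k\<in>UNIV. \<bar>A $ i $ k\<bar>"]) (auto simp: sum_nonneg)
  finally show ?case by simp
qed (simp add: mat_def)

lemma expm_summable: "summable (\<lambda>n. (matpow A n $ i $ j / fact n) * t ^ n)" for A :: "real^'n^'n"
proof (rule summable_comparison_test')
  let ?K = "\<Sum>i\<in>UNIV. \<Sum>j\<in>UNIV. \<bar>A $ i $ j\<bar>"
  show "summable (\<lambda>n. inverse (fact n) * (?K * \<bar>t\<bar>) ^ n)" by (rule summable_exp)
  fix n :: nat
  have "\<bar>matpow A n $ i $ j\<bar> * \<bar>t\<bar> ^ n \<le> ?K ^ n * \<bar>t\<bar> ^ n" by (intro mult_right_mono matpow_bound) simp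
  then show "norm (matpow A n $ i $ j / fact n * t ^ n) \<le> inverse (fact n) * (?K * \<bar>t\<bar>) ^ n"
    by (simp add: abs_mult power_abs power_mult_distrib divide_simps)
qed

lemma expm_0: "expm A 0 = mat 1"
  unfolding expm_def vec_eq_iff vec_lambda_beta powser_zero by simp
lemma matrix_expm_series:
  "(A ** expm A t) $ i $ j = (\<Sum>n. (matpow A (Suc n) $ i $ j / fact n) * t ^ n)"
  "(expm A t ** A) $ i $ j = (\<Sum>n. (matpow A (Suc n) $ i $ j / fact n) * t ^ n)"
proof -
  have "(A ** expm A t) $ i $ j = (\<Sum>k\<in>UNIV. A $ i $ k * (\<Sum>n. (matpow A n $ k $ j / fact n) * t ^ n))"
    by (simp add: matrix_matrix_mult_def expm_def)
  also have "\<dots> = (\<Sum>k\<in>UNIV. (\<Sum>n. A $ i $ k * ((matpow A n $ k $ j / fact n) * t ^ n)))"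
    by (intro sum.cong refl suminf_mult[symmetric] expm_summable)
  also have "\<dots> = (\<Sum>n. \<Sum>k\<in>UNIV. A $ i $ k * ((matpow A n $ k $ j / fact n) * t ^ n))"
    by (intro suminf_sum[symmetric] summable_mult expm_summable)
  finally show "(A ** expm A t) $ i $ j = (\<Sum>n. (matpow A (Suc n) $ i $ j / fact n) * t ^ n)"
    by (simp add: matrix_matrix_mult_def sum_distrib_right sum_divide_distrib mult.assoc)
  have "(expm A t ** A) $ i $ j = (\<Sum>k\<in>UNIV. (\<Sum>n. (matpow A n $ i $ k / fact n) * t ^ n) * A $ k $ j)"
    by (simp add: matrix_matrix_mult_def expm_def)
  also have "\<dots> = (\<Sum>k\<in>UNIV. (\<Sum>n. (matpow A n $ i $ k / fact n) * t ^ n * A $ k $ j))"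
    by (intro sum.cong refl suminf_mult2 expm_summable)
  also have "\<dots> = (\<Sum>n. \<Sum>k\<in>UNIV. (matpow A n $ i $ k / fact n) * t ^ n * A $ k $ j)"
    by (intro suminf_sum[symmetric] summable_mult2 expm_summable)
  also have "\<dots> = (\<Sum>n. ((matpow A n ** A) $ i $ j / fact n) * t ^ n)"
    by (simp add: matrix_matrix_mult_def sum_distrib_right sum_distrib_left sum_divide_distrib mult.assoc
        mult.left_commute mult.commute)
  finally show "(expm A t ** A) $ i $ j = (\<Sum>n. (matpow A (Suc n) $ i $ j / fact n) * t ^ n)"
    by (simp add: matpow_comm)
qed

lemma expm_commute: "expm A t ** A = A ** expm A t"
  by (simp add: vec_eq_iff matrix_expm_series)

lemma expm_deriv: "((\<lambda>t. expm A t $ i $ j) has_field_derivative (A ** expm A t) $ i $ j) (at t)"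
proof -
  have "diffs (\<lambda>n. matpow A n $ i $ j / fact n) n = matpow A (Suc n) $ i $ j / fact n" for n
  proof -
    have "real (Suc n) * (x / (real (Suc n) * fact n)) = x / fact n" for x by simp
    then show ?thesis unfolding diffs_def fact_Suc of_nat_mult .
  qed
  then show ?thesis
    using termdiffs_strong_converges_everywhere[OF expm_summable, of A i j t]
    unfolding matrix_expm_series(1) by (simp add: expm_def del: matpow.simps)
qed

text \<open>The product has derivative zero because A commutes with its exponential, and it is the
  identity at t = 0.\<close>

lemma expm_inverse: "expm A t ** expm A (- t) = mat 1"
proof -
  have der: "\<forall>t. ((\<lambda>t. (expm A t ** expm A (- t)) $ i $ j) has_field_derivative 0) (at t)" for i j
  proof
    fix t
    have m: "((\<lambda>t. expm A (- t) $ k $ j) has_field_derivative - (A ** expm A (- t)) $ k $ j) (at t)" for k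
      using DERIV_chain2[OF expm_deriv[of A k j "- t"] DERIV_minus[OF DERIV_ident]] by simp
    have "((\<lambda>t. \<Sum>k\<in>UNIV. expm A t $ i $ k * expm A (- t) $ k $ j) has_field_derivative
       (\<Sum>k\<in>UNIV. expm A t $ i $ k * (- (A ** expm A (- t)) $ k $ j) + (A ** expm A t) $ i $ k * expm A (- t) $ k $ j)) (at t)"
      by (intro DERIV_sum DERIV_mult' expm_deriv m)
    moreover have "(\<Sum>k\<in>UNIV. expm A t $ i $ k * (- (A ** expm A (- t)) $ k $ j) + (A ** expm A t) $ i $ k * expm A (- t) $ k $ j)
      = - (expm A t ** (A ** expm A (- t))) $ i $ j + ((A ** expm A t) ** expm A (- t)) $ i $ j"
      by (simp add: matrix_matrix_mult_def[of "expm A t"] matrix_matrix_mult_def[of "A ** expm A t"] sum.distrib sum_negf sum_subtractf)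
    moreover have "expm A t ** (A ** expm A (- t)) = (A ** expm A t) ** expm A (- t)"
      by (simp add: matrix_mul_assoc expm_commute)
    ultimately have "((\<lambda>t. \<Sum>k\<in>UNIV. expm A t $ i $ k * expm A (- t) $ k $ j) has_field_derivative 0) (at t)"
      by simp
    then show "((\<lambda>t. (expm A t ** expm A (- t)) $ i $ j) has_field_derivative 0) (at t)"
      by (simp add: matrix_matrix_mult_def)
  qed
  have "(expm A t ** expm A (- t)) $ i $ j = (expm A 0 ** expm A (- 0)) $ i $ j" for i j
    using DERIV_isconst_all[OF der[of i j], of t 0] .
  then show ?thesis by (simp add: vec_eq_iff expm_0)
qed

lemma expm_continuous: "continuous_on S (\<lambda>t. expm A t $ i $ j)"
  by (intro continuous_at_imp_continuous_on ballI DERIV_isCont[OF expm_deriv])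

lemma has_vector_derivative_vecI:
  fixes F :: "real \<Rightarrow> real^'k"
  assumes "\<And>i. ((\<lambda>t. F t $ i) has_vector_derivative f $ i) (at t)"
  shows "(F has_vector_derivative f) (at t)"
proof -
  have "((\<lambda>t. \<Sum>i\<in>UNIV. F t $ i *\<^sub>R (axis i 1 :: real^'k)) has_vector_derivative (\<Sum>i\<in>UNIV. f $ i *\<^sub>R axis i 1)) (at t)"
    by (intro has_vector_derivative_sum bounded_linear.has_vector_derivative[OF bounded_linear_scaleR_left] assms)
  moreover have "(\<Sum>i\<in>UNIV. x $ i *\<^sub>R axis i 1) = x" for x :: "real^'k"
    using basis_expansion[of x] by (simp add: scalar_mult_eq_scaleR)
  ultimately show ?thesis by simp
qed

lemma expm_vec_deriv: "((\<lambda>t. expm A t *v x) has_vector_derivative A *v (expm A t *v x)) (at t)"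
proof -
  have "((\<lambda>t. (expm A t *v x) $ i) has_vector_derivative (A *v (expm A t *v x)) $ i) (at t)" for i
  proof -
    have "((\<lambda>t. \<Sum>j\<in>UNIV. expm A t $ i $ j * x $ j) has_field_derivative (\<Sum>j\<in>UNIV. (A ** expm A t) $ i $ j * x $ j)) (at t)"
      by (intro DERIV_sum DERIV_cmult_right expm_deriv)
    then show ?thesis
      unfolding has_real_derivative_iff_has_vector_derivative[symmetric] matrix_vector_mul_assoc
      by (simp add: matrix_vector_mult_def)
  qed
  then show ?thesis by (rule has_vector_derivative_vecI)
qed

lemma antideriv_expm: "antideriv (\<lambda>t. expm A t $ i $ j) (\<lambda>t. (A ** expm A t) $ i $ j)"
proof (rule antideriv_C1)
  show "((\<lambda>t. expm A t $ i $ j) has_vector_derivative (A ** expm A t) $ i $ j) (at t)" for t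
    using expm_deriv by (simp add: has_real_derivative_iff_has_vector_derivative)
  show "continuous_on UNIV (\<lambda>t. (A ** expm A t) $ i $ j)"
    unfolding matrix_matrix_mult_def vec_lambda_beta by (intro continuous_intros expm_continuous)
qed

lemma antideriv_expm_neg: "antideriv (\<lambda>t. expm A (- t) $ i $ j) (\<lambda>t. (- (A ** expm A (- t))) $ i $ j)"
proof (rule antideriv_C1)
  show "((\<lambda>t. expm A (- t) $ i $ j) has_vector_derivative (- (A ** expm A (- t))) $ i $ j) (at t)" for t
    using DERIV_chain2[OF expm_deriv[of A i j "- t"] DERIV_minus[OF DERIV_ident]]
    by (simp add: has_real_derivative_iff_has_vector_derivative)
  show "continuous_on UNIV (\<lambda>t. (- (A ** expm A (- t))) $ i $ j)"
    unfolding matrix_matrix_mult_def vec_lambda_beta vector_uminus_component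
    by (intro continuous_intros continuous_on_compose2[OF expm_continuous[of UNIV]]) auto
qed

text \<open>The integrating factor \<open>expm A (- t)\<close> turns the solution into a
  constant.\<close>

lemma linear_ode_unique:
  fixes A :: "real^'d^'d" and z :: "real \<Rightarrow> real^'d"
  assumes z: "antideriv z (\<lambda>t. A *v z t)" and "z t0 = 0"
  shows "z t = 0"
proof -
  have "antideriv (\<lambda>t. expm A (- t) *v z t) (\<lambda>t. (- (A ** expm A (- t))) *v z t + expm A (- t) *v (A *v z t))"
    by (rule antideriv_matrix_vector[OF z antideriv_expm_neg])
  moreover have "(- (A ** expm A (- t))) *v z t + expm A (- t) *v (A *v z t) = 0" for t
  proof -
    have "(- M) *v w = - (M *v w)" for M :: "real^'d^'d" and w
      by (simp add: vec_eq_iff matrix_vector_mult_def sum_negf)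
    then show ?thesis by (simp add: matrix_vector_mul_assoc expm_commute)
  qed
  ultimately have a: "antideriv (\<lambda>t. expm A (- t) *v z t) (\<lambda>t. 0)" by simp
  have "expm A (- t) *v z t = expm A (- t0) *v z t0" for t
    using antiderivD(2)[OF a, of t t0] antiderivD(2)[OF a, of t0 t]
    by (cases "t \<le> t0") (auto simp: set_lebesgue_integral_def)
  then have "expm A (- t) *v z t = 0" using assms(2) by simp
  then have "(expm A t ** expm A (- t)) *v z t = 0" by (simp add: matrix_vector_mul_assoc[symmetric])
  then show ?thesis by (simp add: expm_inverse)
qed

text \<open>Variation of constants; the transformed forcing is integrated componentwise, since
  \<open>w\<close> is merely locally integrable.\<close>

lemma linear_ode_exists:
  fixes A :: "real^'d^'d" and w :: "real \<Rightarrow> real^'d"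
  assumes w: "\<And>a b. set_integrable lborel {a..b} w"
  shows "\<exists>x. x t0 = x0 \<and> antideriv x (\<lambda>t. A *v x t + w t)"
proof -
  have wi: "set_integrable lborel {a..b} (\<lambda>t. w t $ i)" for a b i
  proof -
    have "integrable lborel (\<lambda>t. (indicat_real {a..b} t *\<^sub>R w t) $ i)"
      using w[of a b] unfolding set_integrable_def by (rule integrable_bounded_linear[OF bounded_linear_vec_nth])
    then show ?thesis by (simp add: set_integrable_def)
  qed
  have "\<exists>F. antideriv F (\<lambda>t. (expm A (- t) *v w t) $ i) \<and> F t0 = (expm A (- t0) *v x0) $ i" for i
  proof (rule antideriv_exists)
    fix a b
    show "set_integrable lborel {a..b} (\<lambda>t. (expm A (- t) *v w t) $ i)"
      unfolding matrix_vector_mult_def vec_lambda_beta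
      by (intro set_integrable_finite_sum set_integrable_continuous_mult wi
          continuous_on_compose2[OF expm_continuous[of UNIV]] continuous_intros) auto
  qed
  then obtain F where F: "\<And>i. antideriv (F i) (\<lambda>t. (expm A (- t) *v w t) $ i)" "\<And>i. F i t0 = (expm A (- t0) *v x0) $ i"
    by metis
  define xi where "xi t = (\<chi> i. F i t)" for t
  have xi: "antideriv xi (\<lambda>t. expm A (- t) *v w t)"
    unfolding antideriv_vec_iff using F by (simp add: xi_def)
  have "antideriv (\<lambda>t. expm A t *v xi t) (\<lambda>t. (A ** expm A t) *v xi t + expm A t *v (expm A (- t) *v w t))"
    by (rule antideriv_matrix_vector[OF xi antideriv_expm])
  then have "antideriv (\<lambda>t. expm A t *v xi t) (\<lambda>t. A *v (expm A t *v xi t) + w t)"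
    by (simp add: matrix_vector_mul_assoc expm_inverse)
  moreover have "xi t0 = expm A (- t0) *v x0" by (simp add: xi_def F vec_eq_iff)
  then have "expm A t0 *v xi t0 = x0" by (simp add: matrix_vector_mul_assoc expm_inverse)
  ultimately show ?thesis by (intro exI[of _ "\<lambda>t. expm A t *v xi t"] conjI)
qed

section \<open>The unobservable subspace\<close>

lemma matpow_add: "matpow A (m + n) = matpow A m ** matpow A n" for A :: "'a::comm_ring_1^'n^'n"
  by (induction m) (simp_all add: matrix_mul_assoc)

text \<open>A polynomial relation of degree at most d annihilates the single vector
  \<open>z\<close>; its leading term expresses every higher power through lower ones.\<close>

lemma Krylov_annihilation:
  fixes A :: "real^'d^'d" and C :: "real^'d^'m"
  assumes z: "\<And>k. k < CARD('d) \<Longrightarrow> C *v (matpow A k *v z) = 0"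
  shows "C *v (matpow A n *v z) = 0"
proof -
  obtain a :: "real poly" where a: "a \<noteq> 0" "degree a \<le> CARD('d)" "(\<Sum>k\<le>degree a. coeff a k *\<^sub>R (matpow A k *v z)) = 0"
    using exists_linear_relation[of "\<lambda>k. matpow A k *v z"] by auto
  let ?m = "degree a"
  have rel: "(\<Sum>k\<le>?m. coeff a k *\<^sub>R (C *v (matpow A (l + k) *v z))) = 0" for l
  proof -
    have lin: "linear (\<lambda>w. C *v (matpow A l *v w))"
      by (rule linearI) (simp_all add: matrix_vector_right_distrib matrix_vector_mult_scaleR)
    have "(\<Sum>k\<le>?m. coeff a k *\<^sub>R (C *v (matpow A (l + k) *v z)))
        = C *v (matpow A l *v (\<Sum>k\<le>?m. coeff a k *\<^sub>R (matpow A k *v z)))"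
      unfolding linear_sum[OF lin] linear_cmul[OF lin] by (simp add: matpow_add matrix_vector_mul_assoc matrix_mul_assoc)
    then show ?thesis unfolding a(3) by simp
  qed
  show ?thesis
  proof (induction n rule: less_induct)
    case (less n)
    show ?case
    proof (cases "n < CARD('d)")
      case False
      then have n: "n = (n - ?m) + ?m" using a(2) by simp
      have "(\<Sum>k\<le>?m. coeff a k *\<^sub>R (C *v (matpow A ((n - ?m) + k) *v z)))
        = (\<Sum>k\<le>?m. if k = ?m then coeff a ?m *\<^sub>R (C *v (matpow A n *v z)) else 0)"
        by (rule sum.cong) (use n less in auto)
      then have "coeff a ?m *\<^sub>R (C *v (matpow A n *v z)) = 0" using rel[of "n - ?m"] by simp
      then show ?thesis using a(1) by simp
    qed (use z in simp)
  qed
qed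

text \<open>\<open>Krylov_annihilation\<close> extends the d powers in \<open>Vo\<close> to all
  powers, and since \<open>idx\<close> is a bijection onto the exponents the order of the blocks
  disappears.\<close>

lemma Vo_ker_iff: "Vo A C *v z = 0 \<longleftrightarrow> (\<forall>k. C *v (matpow A k *v z) = 0)"
  for A :: "real^'d^'d" and C :: "real^'d^'m"
proof -
  have bij: "bij_betw (idx :: 'd \<Rightarrow> nat) UNIV {..<CARD('d)}"
    unfolding idx_def
    by (rule someI_ex[where P = "\<lambda>f. bij_betw f UNIV {..<CARD('d)}"], rule finite_same_card_bij) simp_all
  have c: "(Vo A C *v z) $ (d, m) = (C *v (matpow A (idx d) *v z)) $ m" for d m
    by (simp add: Vo_def matrix_vector_mul_assoc) (simp add: matrix_vector_mult_def)
  show ?thesis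
  proof
    assume z: "Vo A C *v z = 0"
    have "C *v (matpow A k *v z) = 0" if "k < CARD('d)" for k
    proof -
      obtain d :: 'd where "idx d = k" using bij \<open>k < CARD('d)\<close> unfolding bij_betw_def by (metis imageE lessThan_iff)
      then show ?thesis using c[of d] z by (simp add: vec_eq_iff)
    qed
    then show "\<forall>k. C *v (matpow A k *v z) = 0" using Krylov_annihilation by blast
  next
    assume "\<forall>k. C *v (matpow A k *v z) = 0"
    then show "Vo A C *v z = 0" by (simp add: vec_eq_iff c split_paired_all)
  qed
qed

lemma observable_iff: "observable C A \<longleftrightarrow> (\<forall>z. (\<forall>k. C *v (matpow A k *v z) = 0) \<longrightarrow> z = 0)"
  unfolding observable_def full_rank_injective Vo_ker_iff[symmetric]
  using matrix_left_invertible_injective[of "Vo A C"] matrix_left_invertible_ker[of "Vo A C"] by simp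

text \<open>A projection along the unobservable subspace. It represents the observable quotient
  inside the given state type, and any complement may serve as its range.\<close>

definition unobs_proj :: "real^'d^'d \<Rightarrow> real^'d^'m \<Rightarrow> real^'d^'d \<Rightarrow> bool" where
  "unobs_proj A C R \<longleftrightarrow> R ** R = R \<and> (\<forall>z. R *v z = 0 \<longleftrightarrow> (\<forall>k. C *v (matpow A k *v z) = 0))"

lemma unobs_proj_exists: "\<exists>R. unobs_proj A C R"
proof -
  define U where "U = {z. \<forall>k. C *v (matpow A k *v z) = 0}"
  have sub: "subspace U"
    unfolding subspace_def U_def by (auto simp: matrix_vector_right_distrib matrix_vector_mult_scaleR)
  obtain g where g: "range g \<subseteq> U" "linear g" "\<And>v. v \<in> U \<Longrightarrow> g v = v"
    using linear_exists_left_inverse_on[of "\<lambda>x. x" U] sub by (auto simp: linear_id[unfolded id_def])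
  define R where "R = mat 1 - matrix g"
  have R: "R *v z = z - g z" for z
    by (simp add: R_def mat_minus_vec matrix_works[OF g(2)[folded linear_matrix_vector_mul_eq]])
  have "R *v (R *v z) = R *v z" for z
  proof -
    have "g (z - g z) = g z - g (g z)" by (rule linear_diff[OF g(2)])
    also have "g (g z) = g z" using g(1,3) by blast
    finally show ?thesis by (simp add: R)
  qed
  then have "R ** R = R" by (simp add: matrix_eq matrix_vector_mul_assoc[symmetric])
  moreover have "R *v z = 0 \<longleftrightarrow> z \<in> U" for z using g(1,3) unfolding R by (metis eq_iff_diff_eq_0 rangeI subsetD)
  ultimately show ?thesis unfolding unobs_proj_def U_def by blast
qed

lemma unobs_projD:
  assumes "unobs_proj A C R"
  shows "R *v (R *v z) = R *v z" "R *v z = 0 \<longleftrightarrow> (\<forall>k. C *v (matpow A k *v z) = 0)"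
    "C *v (matpow A k *v (R *v z)) = C *v (matpow A k *v z)" "C *v (R *v z) = C *v z"
    "R *v (A *v (R *v z)) = R *v (A *v z)"
proof -
  show rr: "R *v (R *v z) = R *v z" for z
    using assms by (simp add: unobs_proj_def matrix_vector_mul_assoc)
  show ker: "R *v z = 0 \<longleftrightarrow> (\<forall>k. C *v (matpow A k *v z) = 0)" for z using assms by (simp add: unobs_proj_def)
  have "R *v (R *v z - z) = 0" by (simp add: matrix_vector_mult_diff_distrib rr)
  then have u: "C *v (matpow A k *v (R *v z - z)) = 0" for k using ker by blast
  then show *: "C *v (matpow A k *v (R *v z)) = C *v (matpow A k *v z)" for k
    by (simp add: matrix_vector_mult_diff_distrib)
  from *[of 0] show "C *v (R *v z) = C *v z" by simp
  have "C *v (matpow A k *v (A *v (R *v z - z))) = 0" for k using u[of "Suc k"] by (simp add: matpow_Suc_vec del: matpow.simps)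
  then have "R *v (A *v (R *v z - z)) = 0" using ker by blast
  then show "R *v (A *v (R *v z)) = R *v (A *v z)" by (simp add: matrix_vector_mult_diff_distrib)
qed

section \<open>Kernels of storage functions and the observable case\<close>

lemma psd_ker_iff:
  assumes X: "psd X"
  shows "z \<bullet> (X *v z) = 0 \<longleftrightarrow> X *v z = 0"
proof
  assume z: "z \<bullet> (X *v z) = 0"
  have sym: "sym_mat X" using X by (simp add: psd_def)
  have "(y \<bullet> (X *v z))\<^sup>2 \<le> (y \<bullet> (X *v y)) * (z \<bullet> (X *v z))" for y
  proof (rule quadratic_discriminant_bound)
    fix t
    have "0 \<le> (y + t *\<^sub>R z) \<bullet> (X *v (y + t *\<^sub>R z))" using X by (simp add: psd_def)
    also have "\<dots> = y \<bullet> (X *v y) + 2 * (y \<bullet> (X *v z)) * t + (z \<bullet> (X *v z)) * t\<^sup>2"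
      using sym_mat_inner[OF sym, of z y]
      by (simp add: matrix_vector_right_distrib matrix_vector_mult_scaleR inner_add_left inner_add_right
          power2_eq_square inner_commute algebra_simps)
    finally show "0 \<le> y \<bullet> (X *v y) + 2 * (y \<bullet> (X *v z)) * t + (z \<bullet> (X *v z)) * t\<^sup>2" .
  qed
  from this[of "X *v z"] z have "(X *v z) \<bullet> (X *v z) = 0" by simp
  then show "X *v z = 0" by simp
qed simp

text \<open>The form -2 y Y A y - |C y|^2 is nonnegative. If Y z = 0, it vanishes at z, whence C z =
  0, and along y + t z it is affine in t; an affine function bounded below has slope zero. Here
  \<open>Y\<close> is merely symmetric.\<close>

lemma dissipative_ker_step:
  fixes A Y :: "real^'d^'d" and C :: "real^'d^'m"
  assumes sym: "sym_mat Y" and d: "\<And>x. 2 * (x \<bullet> (Y *v (A *v x))) + (norm (C *v x))\<^sup>2 \<le> 0" and z: "Y *v z = 0"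
  shows "C *v z = 0" "Y *v (A *v z) = 0"
proof -
  have z0: "z \<bullet> (Y *v w) = 0" for w using sym_mat_inner[OF sym, of z w] z by simp
  show Cz: "C *v z = 0" using d[of z] z0[of "A *v z"] by simp
  have "y \<bullet> (Y *v (A *v z)) = 0" for y
  proof -
    have "(- (y \<bullet> (Y *v (A *v z))))\<^sup>2 \<le> (- 2 * (y \<bullet> (Y *v (A *v y))) - (norm (C *v y))\<^sup>2) * 0"
    proof (rule quadratic_discriminant_bound)
      fix t
      have "0 \<le> - 2 * ((y + t *\<^sub>R z) \<bullet> (Y *v (A *v (y + t *\<^sub>R z)))) - (norm (C *v (y + t *\<^sub>R z)))\<^sup>2"
        using d[of "y + t *\<^sub>R z"] by simp
      also have "\<dots> = (- 2 * (y \<bullet> (Y *v (A *v y))) - (norm (C *v y))\<^sup>2) + 2 * (- (y \<bullet> (Y *v (A *v z)))) * t + 0 * t\<^sup>2"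
        using z0 Cz by (simp add: matrix_vector_right_distrib matrix_vector_mult_scaleR inner_add_left inner_add_right algebra_simps)
      finally show "0 \<le> (- 2 * (y \<bullet> (Y *v (A *v y))) - (norm (C *v y))\<^sup>2) + 2 * (- (y \<bullet> (Y *v (A *v z)))) * t + 0 * t\<^sup>2" .
    qed
    then show ?thesis by simp
  qed
  from this[of "Y *v (A *v z)"] show "Y *v (A *v z) = 0" by simp
qed

lemma dissipative_ker_unobservable:
  fixes A Y :: "real^'d^'d" and C :: "real^'d^'m"
  assumes sym: "sym_mat Y" and d: "\<And>x. 2 * (x \<bullet> (Y *v (A *v x))) + (norm (C *v x))\<^sup>2 \<le> 0" and z: "Y *v z = 0"
  shows "C *v (matpow A k *v z) = 0"
  using z
proof (induction k arbitrary: z)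
  case 0 then show ?case using dissipative_ker_step(1)[OF sym d] by simp
next
  case (Suc k)
  then show ?case using dissipative_ker_step(2)[OF sym d, of z] by (simp only: matpow_Suc_vec)
qed

lemma dissipative_free:
  assumes "dissipative A B C D X"
  shows "2 * (x \<bullet> (X *v (A *v x))) + (norm (C *v x))\<^sup>2 \<le> 0"
  using assms[unfolded dissipative_def, rule_format, of x 0] by simp

text \<open>Lyapunov's argument on the real and imaginary parts a, b of an eigenvector: if
  \<open>Re c\<close> were nonnegative, C a and C b would vanish, and the span of a and b, being
  invariant under A, would be unobservable.\<close>

lemma observable_spec:
  fixes A :: "real^'d^'d" and C :: "real^'d^'m"
  assumes ob: "observable C A" and X: "psd X" and d: "\<And>x. 2 * (x \<bullet> (X *v (A *v x))) + (norm (C *v x))\<^sup>2 \<le> 0"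
    and v: "cmat A *v v = c *s v" "v \<noteq> 0"
  shows "Re c < 0"
proof -
  define a where "a = (\<chi> i. Re (v $ i))"
  define b where "b = (\<chi> i. Im (v $ i))"
  have ai: "a $ i = Re (v $ i)" "b $ i = Im (v $ i)" for i by (simp_all add: a_def b_def)
  have re: "(A *v a) $ i = Re ((cmat A *v v) $ i)" and im: "(A *v b) $ i = Im ((cmat A *v v) $ i)" for i
    by (simp_all add: matrix_vector_mult_def ai)
  have Aa: "A *v a = Re c *\<^sub>R a - Im c *\<^sub>R b" and Ab: "A *v b = Im c *\<^sub>R a + Re c *\<^sub>R b"
    by (simp_all add: vec_eq_iff re im v(1) ai)
  have ab: "a \<noteq> 0 \<or> b \<noteq> 0"
  proof (rule ccontr)
    assume "\<not> (a \<noteq> 0 \<or> b \<noteq> 0)"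
    then have "v = 0" by (simp add: a_def b_def vec_eq_iff complex_eq_iff)
    then show False using v(2) by simp
  qed
  have sym: "sym_mat X" using X by (simp add: psd_def)
  have pos: "0 < z \<bullet> (X *v z)" if "z \<noteq> 0" for z
  proof -
    have "X *v z \<noteq> 0" using dissipative_ker_unobservable[OF sym d] ob that unfolding observable_iff by blast
    then have "z \<bullet> (X *v z) \<noteq> 0" using psd_ker_iff[OF X] by blast
    moreover have "0 \<le> z \<bullet> (X *v z)" using X by (simp add: psd_def)
    ultimately show ?thesis by simp
  qed
  have nn: "0 \<le> z \<bullet> (X *v z)" for z using X by (simp add: psd_def)
  let ?s = "a \<bullet> (X *v a) + b \<bullet> (X *v b)"
  have sp: "?s > 0" using ab pos[of a] pos[of b] nn[of a] nn[of b] by fastforce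
  have "a \<bullet> (X *v (A *v a)) + b \<bullet> (X *v (A *v b)) = Re c * ?s"
    using sym_mat_inner[OF sym, of a b] unfolding Aa Ab
    by (simp add: matrix_vector_right_distrib matrix_vector_mult_diff_distrib matrix_vector_mult_scaleR
        inner_add_right inner_diff_right inner_commute algebra_simps)
  with d[of a] d[of b] have le: "2 * (Re c * ?s) + ((norm (C *v a))\<^sup>2 + (norm (C *v b))\<^sup>2) \<le> 0" by simp
  show ?thesis
  proof (rule ccontr)
    assume "\<not> Re c < 0"
    then have "0 \<le> Re c * ?s" using sp by simp
    then have "(norm (C *v a))\<^sup>2 + (norm (C *v b))\<^sup>2 \<le> 0" using le by linarith
    then have C0: "C *v a = 0" "C *v b = 0"
      by (metis add_nonneg_eq_0_iff order_antisym zero_le_power2 add_nonneg_nonneg power2_eq_square mult_eq_0_iff norm_eq_zero)+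
    have "\<exists>p q. matpow A k *v z = p *\<^sub>R a + q *\<^sub>R b" if "z = a \<or> z = b" for k z
    proof (induction k)
      case 0
      show ?case using that
      proof
        assume "z = a" then show ?thesis by (intro exI[of _ 1] exI[of _ 0]) simp
      next
        assume "z = b" then show ?thesis by (intro exI[of _ 0] exI[of _ 1]) simp
      qed
    next
      case (Suc k)
      then obtain p q where "matpow A k *v z = p *\<^sub>R a + q *\<^sub>R b" by blast
      then have "matpow A (Suc k) *v z = A *v (p *\<^sub>R a + q *\<^sub>R b)" by (simp add: matrix_vector_mul_assoc[symmetric])
      also have "\<dots> = (p * Re c + q * Im c) *\<^sub>R a + (q * Re c - p * Im c) *\<^sub>R b"
        by (simp add: matrix_vector_right_distrib matrix_vector_mult_scaleR Aa Ab algebra_simps)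
      finally show ?case by blast
    qed
    then have "C *v (matpow A k *v z) = 0" if "z = a \<or> z = b" for k z
      using that C0 by (metis matrix_vector_right_distrib matrix_vector_mult_scaleR scaleR_zero_right add_0)
    then have "a = 0" "b = 0" using ob unfolding observable_iff by blast+
    then show False using ab by simp
  qed
qed

text \<open>Let mu be the least ratio of the forms of \<open>X\<close> and \<open>Xm\<close>,
  attained by compactness. If mu were negative, X - mu Xm would be semidefinite with a nonzero
  kernel vector and would still satisfy the free dissipation inequality, so that vector would be
  unobservable.\<close>

lemma observable_dissipative_psd:
  fixes A :: "real^'d^'d" and C :: "real^'d^'m"
  assumes ob: "observable C A"
    and Xm: "psd Xm" "dissipative A B C D Xm" and X: "sym_mat X" "dissipative A B C D X"
  shows "psd X"
proof -
  have symm: "sym_mat Xm" using Xm by (simp add: psd_def)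
  have pos: "0 < z \<bullet> (Xm *v z)" if "z \<noteq> 0" for z
  proof -
    have "Xm *v z \<noteq> 0"
      using dissipative_ker_unobservable[OF symm dissipative_free[OF Xm(2)]] ob that unfolding observable_iff by blast
    then have "z \<bullet> (Xm *v z) \<noteq> 0" using psd_ker_iff[OF Xm(1)] by blast
    moreover have "0 \<le> z \<bullet> (Xm *v z)" using Xm(1) by (simp add: psd_def)
    ultimately show ?thesis by simp
  qed
  define f where "f x = (x \<bullet> (X *v x)) / (x \<bullet> (Xm *v x))" for x
  have ne: "sphere (0::real^'d) 1 \<noteq> {}" by (simp add: sphere_eq_empty)
  have lin: "continuous_on S ((*v) M)" for S and M :: "real^'d^'d"
    by (intro linear_continuous_on matrix_vector_mul_bounded_linear)
  have "continuous_on (sphere 0 1) f" unfolding f_def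
  proof (intro continuous_intros lin ballI)
    fix x :: "real^'d" assume "x \<in> sphere 0 1"
    then have "x \<noteq> 0" by auto
    then show "x \<bullet> (Xm *v x) \<noteq> 0" using pos[of x] by simp
  qed
  from continuous_attains_inf[OF compact_sphere ne this] obtain z where
    z: "z \<in> sphere 0 1" "\<And>y. y \<in> sphere 0 1 \<Longrightarrow> f z \<le> f y" by blast
  have z0: "z \<noteq> 0" using z(1) by auto
  define mu where "mu = f z"
  have ge: "mu * (x \<bullet> (Xm *v x)) \<le> x \<bullet> (X *v x)" for x
  proof (cases "x = 0")
    case False
    define y where "y = (1 / norm x) *\<^sub>R x"
    have xy: "x = norm x *\<^sub>R y" using False by (simp add: y_def)
    have "y \<in> sphere 0 1" using False by (simp add: y_def)
    then have "mu \<le> f y" "y \<noteq> 0" using z(2) by (auto simp: mu_def)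
    then have "mu * (y \<bullet> (Xm *v y)) \<le> y \<bullet> (X *v y)" using pos[of y] by (simp add: f_def field_simps)
    then have "(norm x)\<^sup>2 * (mu * (y \<bullet> (Xm *v y))) \<le> (norm x)\<^sup>2 * (y \<bullet> (X *v y))" by (rule mult_left_mono) simp
    moreover have "x \<bullet> (M *v x) = (norm x)\<^sup>2 * (y \<bullet> (M *v y))" for M :: "real^'d^'d"
      by (subst xy, subst (2) xy) (simp add: matrix_vector_mult_scaleR power2_eq_square)
    ultimately show ?thesis by (simp add: algebra_simps)
  qed simp
  have "mu \<ge> 0"
  proof (rule ccontr)
    assume mu: "\<not> mu \<ge> 0"
    define Y where "Y = X - mu *\<^sub>R Xm"
    have Yv: "Y *v x = X *v x - mu *\<^sub>R (Xm *v x)" for x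
      by (simp add: Y_def matrix_vector_mult_diff_rdistrib scaleR_matrix_vector_assoc)
    have symY: "sym_mat Y" using X(1) symm by (simp add: sym_mat_def Y_def transpose_def vec_eq_iff)
    have psdY: "psd Y" using symY ge by (simp add: psd_def Yv inner_diff_right)
    have "z \<bullet> (Y *v z) = 0" using pos[OF z0] by (simp add: Yv inner_diff_right mu_def f_def)
    then have Yz: "Y *v z = 0" using psd_ker_iff[OF psdY] by blast
    \<comment> \<open>Adding the two inequalities with weights 1 and -mu leaves (1 - mu) |C x|^2,
      which is at least |C x|^2.\<close>
    have "2 * (x \<bullet> (Y *v (A *v x))) + (norm (C *v x))\<^sup>2 \<le> 0" for x
    proof -
      have "0 \<le> mu * (2 * (x \<bullet> (Xm *v (A *v x))) + (norm (C *v x))\<^sup>2)"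
        using dissipative_free[OF Xm(2), of x] mu by (intro mult_nonpos_nonpos) auto
      moreover have "0 \<le> - mu * (norm (C *v x))\<^sup>2" using mu by (intro mult_nonneg_nonneg) auto
      ultimately show ?thesis using dissipative_free[OF X(2), of x] by (simp add: Yv inner_diff_right algebra_simps)
    qed
    from dissipative_ker_unobservable[OF symY this Yz] have "z = 0" using ob unfolding observable_iff by blast
    then show False using z0 by simp
  qed
  then have "0 \<le> x \<bullet> (X *v x)" for x
    using ge[of x] Xm(1) by (meson mult_nonneg_nonneg order_trans psd_def)
  then show ?thesis using X(1) by (simp add: psd_def)
qed

section \<open>Trajectories and the available storage\<close>

lemma L2loc_bound:
  fixes f :: "real \<Rightarrow> 'a::euclidean_space"
  assumes m: "f \<in> borel_measurable lborel" and g: "\<And>a b. set_integrable lborel {a..b} g"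
    and le: "\<And>t. (norm (f t))\<^sup>2 \<le> g t"
  shows "L2loc f"
  unfolding L2loc_def
proof (intro conjI allI)
  fix a b :: real
  show "set_integrable lborel {a..b} (\<lambda>t. (norm (f t))\<^sup>2)"
  proof (rule set_integrable_bound[OF g])
    show "set_borel_measurable lborel {a..b} (\<lambda>t. (norm (f t))\<^sup>2)"
      unfolding set_borel_measurable_def using m by measurable
    show "AE x in lborel. x \<in> {a..b} \<longrightarrow> norm ((norm (f x))\<^sup>2) \<le> norm (g x)"
      using le by (auto intro!: AE_I2 order_trans[OF _ abs_ge_self])
  qed
qed (use m in simp)

lemma L2locD:
  assumes "L2loc f"
  shows "f \<in> borel_measurable borel" "set_integrable lborel {a..b} (\<lambda>t. (norm (f t))\<^sup>2)"
  using assms by (auto simp: L2loc_def)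

lemma set_integrable_const: "set_integrable lborel {a..b::real} (\<lambda>_. c::real)"
  by (intro borel_integrable_atLeastAtMost' continuous_intros)

lemma L2loc_set_integrable:
  fixes f :: "real \<Rightarrow> 'a::euclidean_space"
  assumes "L2loc f"
  shows "set_integrable lborel {a..b} f"
proof (rule set_integrable_bound)
  show "set_integrable lborel {a..b} (\<lambda>t. 1 + (norm (f t))\<^sup>2)"
    by (intro set_integral_add set_integrable_const L2locD assms)
  show "set_borel_measurable lborel {a..b} f"
    unfolding set_borel_measurable_def using L2locD(1)[OF assms] by measurable
  have "norm (f x) \<le> 1 + (norm (f x))\<^sup>2" for x
    using sum_squares_bound[of 1 "norm (f x)"] norm_ge_zero[of "f x"] by (simp only: mult_1_right power_one)
  then show "AE x in lborel. x \<in> {a..b} \<longrightarrow> norm (f x) \<le> norm (1 + (norm (f x))\<^sup>2)"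
    by (auto intro!: AE_I2 order_trans[OF _ abs_ge_self])
qed

lemma L2loc_continuous:
  fixes f :: "real \<Rightarrow> 'a::euclidean_space"
  assumes "continuous_on UNIV f"
  shows "L2loc f"
  unfolding L2loc_def
  using assms by (auto intro!: borel_integrable_atLeastAtMost' borel_measurable_continuous_onI continuous_intros
      continuous_on_subset[OF assms])

lemma norm_add_square_le: "(norm (a + b))\<^sup>2 \<le> 2 * (norm a)\<^sup>2 + 2 * (norm b)\<^sup>2" for a b :: "'a::real_inner"
  using parallelogram_norm[of a b] zero_le_power2[of "norm (a - b)"] by linarith

lemma L2loc_add:
  fixes f g :: "real \<Rightarrow> 'a::euclidean_space"
  assumes "L2loc f" "L2loc g"
  shows "L2loc (\<lambda>t. f t + g t)"
proof (rule L2loc_bound)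
  show "(\<lambda>t. f t + g t) \<in> borel_measurable lborel" using L2locD(1)[OF assms(1)] L2locD(1)[OF assms(2)] by simp
  show "set_integrable lborel {a..b} (\<lambda>t. 2 * (norm (f t))\<^sup>2 + 2 * (norm (g t))\<^sup>2)" for a b
    by (intro set_integral_add set_integrable_mult_right impI L2locD assms)
qed (rule norm_add_square_le)

lemma borel_measurable_matrix_vector:
  fixes M :: "real^'k^'l"
  assumes "f \<in> borel_measurable N"
  shows "(\<lambda>t. M *v f t) \<in> borel_measurable N"
proof -
  have "(*v) M \<in> borel_measurable borel"
    by (intro borel_measurable_continuous_onI linear_continuous_on matrix_vector_mul_bounded_linear)
  from measurable_compose[OF assms this] show ?thesis .
qed

lemma L2loc_matrix:
  fixes M :: "real^'k^'l"
  assumes "L2loc f"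
  shows "L2loc (\<lambda>t. M *v f t)"
proof -
  have "bounded_linear ((*v) M)" by (rule matrix_vector_mul_bounded_linear)
  from bounded_linear.nonneg_bounded[OF this] obtain c where c: "\<And>x. norm (M *v x) \<le> norm x * c" by blast
  show ?thesis
  proof (rule L2loc_bound)
    show "(\<lambda>t. M *v f t) \<in> borel_measurable lborel"
      using borel_measurable_matrix_vector[OF L2locD(1)[OF assms], of M] by simp
    show "set_integrable lborel {a..b} (\<lambda>t. c\<^sup>2 * (norm (f t))\<^sup>2)" for a b
      by (intro set_integrable_mult_right impI L2locD assms)
    show "(norm (M *v f t))\<^sup>2 \<le> c\<^sup>2 * (norm (f t))\<^sup>2" for t
      using power_mono[OF c[of "f t"], of 2] by (simp add: power_mult_distrib mult.commute)
  qed
qed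

lemma L2loc_scaleR: "L2loc f \<Longrightarrow> L2loc (\<lambda>t. r *\<^sub>R f t)" for f :: "real \<Rightarrow> real^'k"
  using L2loc_matrix[of f "r *\<^sub>R mat 1"] by (simp add: scaleR_matrix_vector_assoc[symmetric])

lemma L2loc_diff: "L2loc f \<Longrightarrow> L2loc g \<Longrightarrow> L2loc (\<lambda>t. f t - g t)" for f :: "real \<Rightarrow> real^'k"
  using L2loc_add[OF _ L2loc_scaleR[of g "-1"], of f] by simp

lemma L2loc_if:
  fixes f g :: "real \<Rightarrow> 'a::euclidean_space"
  assumes "L2loc f" "L2loc g"
  shows "L2loc (\<lambda>t. if t \<le> s then f t else g t)"
proof (rule L2loc_bound)
  show "(\<lambda>t. if t \<le> s then f t else g t) \<in> borel_measurable lborel"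
    using L2locD(1)[OF assms(1)] L2locD(1)[OF assms(2)] by simp
  show "set_integrable lborel {a..b} (\<lambda>t. (norm (f t))\<^sup>2 + (norm (g t))\<^sup>2)" for a b
    by (intro set_integral_add L2locD assms)
qed auto

lemma set_integrable_shift:
  fixes f :: "real \<Rightarrow> 'a::euclidean_space"
  assumes "set_integrable lborel {a + h..b + h} f"
  shows "set_integrable lborel {a..b} (\<lambda>t. f (t + h))" "(LINT t:{a..b}|lborel. f (t + h)) = (LINT t:{a + h..b + h}|lborel. f t)"
proof -
  have e: "indicat_real {a + h..b + h} (h + 1 * t) *\<^sub>R f (h + 1 * t) = indicat_real {a..b} t *\<^sub>R f (t + h)" for t
    by (auto simp: indicator_def add.commute)
  have "integrable lborel (\<lambda>t. indicat_real {a + h..b + h} (h + 1 * t) *\<^sub>R f (h + 1 * t))"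
    using assms unfolding set_integrable_def by (rule lborel_integrable_real_affine) simp
  then show "set_integrable lborel {a..b} (\<lambda>t. f (t + h))" unfolding e set_integrable_def .
  have "(LINT t|lborel. indicat_real {a + h..b + h} t *\<^sub>R f t) = \<bar>1\<bar> *\<^sub>R (LINT t|lborel. indicat_real {a + h..b + h} (h + 1 * t) *\<^sub>R f (h + 1 * t))"
    by (rule lborel_integral_real_affine) simp
  then show "(LINT t:{a..b}|lborel. f (t + h)) = (LINT t:{a + h..b + h}|lborel. f t)"
    unfolding e set_lebesgue_integral_def by simp
qed

lemma L2loc_shift:
  fixes f :: "real \<Rightarrow> 'a::euclidean_space"
  assumes "L2loc f"
  shows "L2loc (\<lambda>t. f (t + h))"
  unfolding L2loc_def
proof (intro conjI allI)
  show "(\<lambda>t. f (t + h)) \<in> borel_measurable lborel" using L2locD(1)[OF assms] by simp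
  show "set_integrable lborel {a..b} (\<lambda>t. (norm (f (t + h)))\<^sup>2)" for a b
    using set_integrable_shift(1)[OF L2locD(2)[OF assms]] .
qed

lemma antideriv_shift:
  assumes "antideriv F f"
  shows "antideriv (\<lambda>t. F (t + h)) (\<lambda>t. f (t + h))"
  unfolding antideriv_def
proof (intro allI impI)
  fix a b :: real assume "a \<le> b"
  then have ab: "a + h \<le> b + h" by simp
  show "set_integrable lborel {a..b} (\<lambda>t. f (t + h)) \<and> F (b + h) - F (a + h) = (LINT t:{a..b}|lborel. f (t + h))"
    using set_integrable_shift[OF antiderivD(1)[OF assms ab]] antiderivD(2)[OF assms ab] by simp
qed

lemma AE_not_equal: "AE t in lborel. t \<noteq> (s::real)"
  by (simp add: AE_iff_measurable[of "{s}"] finite_imp_null_set_lborel null_setsD1)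

lemma antideriv_AE_cong:
  fixes f g :: "real \<Rightarrow> 'a::euclidean_space"
  assumes "antideriv F f" and m: "f \<in> borel_measurable borel" "g \<in> borel_measurable borel"
    and ae: "AE t in lborel. f t = g t"
  shows "antideriv F g"
  unfolding antideriv_def
proof (intro allI impI)
  fix a b :: real assume ab: "a \<le> b"
  note 1 = antiderivD[OF assms(1) ab]
  have "set_integrable lborel {a..b} g \<longleftrightarrow> set_integrable lborel {a..b} f"
    unfolding set_integrable_def
    by (rule integrable_cong_AE) (use m ae in \<open>auto elim: AE_mp\<close>)
  moreover have "(LINT t:{a..b}|lborel. g t) = (LINT t:{a..b}|lborel. f t)"
    by (rule set_lebesgue_integral_cong_AE) (use m ae in \<open>auto elim: AE_mp\<close>)
  ultimately show "set_integrable lborel {a..b} g \<and> F b - F a = (LINT t:{a..b}|lborel. g t)" using 1 by simp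
qed

text \<open>Stopping \<open>F\<close> at s and starting \<open>G\<close> at s gives two
  antiderivatives on the whole line whose sum, less a constant, is the concatenation; the integrands
  overlap only at the null point s.\<close>

lemma antideriv_concat:
  fixes f g :: "real \<Rightarrow> 'a::euclidean_space"
  assumes F: "antideriv F f" and G: "antideriv G g" and eq: "F s = G s"
    and m: "f \<in> borel_measurable borel" "g \<in> borel_measurable borel"
  shows "antideriv (\<lambda>t. if t \<le> s then F t else G t) (\<lambda>t. if t \<le> s then f t else g t)"
proof -
  have 1: "antideriv (\<lambda>t. F (min t s)) (\<lambda>t. if t \<le> s then f t else 0)"
    unfolding antideriv_def
  proof (intro allI impI)
    fix a b :: real assume ab: "a \<le> b"
    have e: "indicat_real {a..b} t *\<^sub>R (if t \<le> s then f t else 0) = indicat_real {a..min b s} t *\<^sub>R f t" for t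
      by (auto simp: indicator_def)
    show "set_integrable lborel {a..b} (\<lambda>t. if t \<le> s then f t else 0) \<and>
      F (min b s) - F (min a s) = (LINT t:{a..b}|lborel. if t \<le> s then f t else 0)"
    proof (cases "a \<le> s")
      case True
      then show ?thesis using antiderivD[OF F, of a "min b s"] ab
        unfolding set_integrable_def set_lebesgue_integral_def e by simp
    next
      case False
      then show ?thesis using ab unfolding set_integrable_def set_lebesgue_integral_def e by simp
    qed
  qed
  have 2: "antideriv (\<lambda>t. G (max t s)) (\<lambda>t. if s \<le> t then g t else 0)"
    unfolding antideriv_def
  proof (intro allI impI)
    fix a b :: real assume ab: "a \<le> b"
    have e: "indicat_real {a..b} t *\<^sub>R (if s \<le> t then g t else 0) = indicat_real {max a s..b} t *\<^sub>R g t" for t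
      by (auto simp: indicator_def)
    show "set_integrable lborel {a..b} (\<lambda>t. if s \<le> t then g t else 0) \<and>
      G (max b s) - G (max a s) = (LINT t:{a..b}|lborel. if s \<le> t then g t else 0)"
    proof (cases "s \<le> b")
      case True
      then show ?thesis using antiderivD[OF G, of "max a s" b] ab
        unfolding set_integrable_def set_lebesgue_integral_def e by simp
    next
      case False
      then show ?thesis using ab unfolding set_integrable_def set_lebesgue_integral_def e by simp
    qed
  qed
  have "antideriv (\<lambda>t. (F (min t s) + G (max t s)) + - G s) (\<lambda>t. ((if t \<le> s then f t else 0) + (if s \<le> t then g t else 0)) + 0)"
    by (intro antideriv_add 1 2 antideriv_const)
  moreover have "(F (min t s) + G (max t s)) + - G s = (if t \<le> s then F t else G t)" for t
    using eq by (auto simp: min_def max_def)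
  ultimately have 3: "antideriv (\<lambda>t. if t \<le> s then F t else G t)
    (\<lambda>t. ((if t \<le> s then f t else 0) + (if s \<le> t then g t else 0)) + 0)" by simp
  show ?thesis
  proof (rule antideriv_AE_cong[OF 3])
    show "AE t in lborel. ((if t \<le> s then f t else 0) + (if s \<le> t then g t else 0)) + 0 = (if t \<le> s then f t else g t)"
      using AE_not_equal[of s] by eventually_elim auto
  qed (use m in measurable)
qed

section \<open>State trajectories and their supply\<close>

definition ctraj :: "real^'d^'d \<Rightarrow> real^'n^'d \<Rightarrow> (real \<Rightarrow> real^'d) \<Rightarrow> (real \<Rightarrow> real^'n) \<Rightarrow> bool" where
  "ctraj A B x u \<longleftrightarrow> L2loc u \<and> antideriv x (\<lambda>t. A *v x t + B *v u t)"

definition surplus :: "real^'d^'m \<Rightarrow> real^'n^'m \<Rightarrow> (real \<Rightarrow> real^'d) \<Rightarrow> (real \<Rightarrow> real^'n) \<Rightarrow> real \<Rightarrow> real" where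
  "surplus C D x u t = (norm (C *v x t + D *v u t))\<^sup>2 - (norm (u t))\<^sup>2"

lemma ctraj_L2loc:
  assumes "ctraj A B x u"
  shows "L2loc u" "L2loc x" "L2loc (\<lambda>t. C *v x t + D *v u t)"
proof -
  show u: "L2loc u" using assms by (simp add: ctraj_def)
  show x: "L2loc x" using assms antideriv_continuous L2loc_continuous unfolding ctraj_def by blast
  show "L2loc (\<lambda>t. C *v x t + D *v u t)" by (intro L2loc_add L2loc_matrix u x)
qed

lemma Bs_iff:
  "(u, y, x) \<in> Bs A B C D \<longleftrightarrow> L2loc y \<and> ctraj A B x u \<and> (AE t in lborel. y t = C *v x t + D *v u t)"
proof
  assume "(u, y, x) \<in> Bs A B C D"
  then show "L2loc y \<and> ctraj A B x u \<and> (AE t in lborel. y t = C *v x t + D *v u t)"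
    unfolding Bs_def ctraj_def antideriv_def by auto
next
  assume a: "L2loc y \<and> ctraj A B x u \<and> (AE t in lborel. y t = C *v x t + D *v u t)"
  then have "L2loc x" using ctraj_L2loc(2) by blast
  then show "(u, y, x) \<in> Bs A B C D" using a unfolding Bs_def ctraj_def antideriv_def by auto
qed

lemma surplus_integrable:
  assumes "ctraj A B x u"
  shows "set_integrable lborel {a..b} (surplus C D x u)" "surplus C D x u \<in> borel_measurable borel"
proof -
  note l = ctraj_L2loc[OF assms]
  show "set_integrable lborel {a..b} (surplus C D x u)"
    unfolding surplus_def by (intro set_integral_diff L2locD l)
  show "surplus C D x u \<in> borel_measurable borel"
    unfolding surplus_def using L2locD(1)[OF l(1)] L2locD(1)[OF l(3), of C D] by measurable
qed

lemma surplus_split: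
  assumes "ctraj A B x u" "a \<le> b" "b \<le> c"
  shows "(LINT t:{a..c}|lborel. surplus C D x u t) = (LINT t:{a..b}|lborel. surplus C D x u t) + (LINT t:{b..c}|lborel. surplus C D x u t)"
proof -
  obtain S where S: "antideriv S (surplus C D x u)"
    using antideriv_exists[OF surplus_integrable(1)[OF assms(1)]] by blast
  show ?thesis using antiderivD(2)[OF S, of a b] antiderivD(2)[OF S, of b c] antiderivD(2)[OF S, of a c] assms by simp
qed

lemma ctraj_exists: "L2loc u \<Longrightarrow> \<exists>x. x t0 = x0 \<and> ctraj A B x u"
  using linear_ode_exists[of "\<lambda>t. B *v u t" t0 x0 A] L2loc_set_integrable[OF L2loc_matrix[of u B]]
  unfolding ctraj_def by blast

lemma ctraj_linear:
  assumes "ctraj A B x u" "ctraj A B y v"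
  shows "ctraj A B (\<lambda>t. x t + y t) (\<lambda>t. u t + v t)" "ctraj A B (\<lambda>t. x t - y t) (\<lambda>t. u t - v t)"
    "ctraj A B (\<lambda>t. r *\<^sub>R x t) (\<lambda>t. r *\<^sub>R u t)"
proof -
  have sc: "ctraj A B (\<lambda>t. r *\<^sub>R x t) (\<lambda>t. r *\<^sub>R u t)" if "ctraj A B x u" for r x u
    using that antideriv_bounded_linear[OF _ bounded_linear_scaleR_right[of r], of x "\<lambda>t. A *v x t + B *v u t"]
    unfolding ctraj_def by (auto simp: L2loc_scaleR scaleR_add_right matrix_vector_mult_scaleR)
  have ad: "ctraj A B (\<lambda>t. x t + y t) (\<lambda>t. u t + v t)" if "ctraj A B x u" "ctraj A B y v" for x u y v
    using that antideriv_add[of x "\<lambda>t. A *v x t + B *v u t" y "\<lambda>t. A *v y t + B *v v t"]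
    unfolding ctraj_def by (auto simp: L2loc_add matrix_vector_right_distrib algebra_simps)
  show "ctraj A B (\<lambda>t. x t + y t) (\<lambda>t. u t + v t)" by (rule ad[OF assms])
  show "ctraj A B (\<lambda>t. r *\<^sub>R x t) (\<lambda>t. r *\<^sub>R u t)" by (rule sc[OF assms(1)])
  show "ctraj A B (\<lambda>t. x t - y t) (\<lambda>t. u t - v t)" using ad[OF assms(1) sc[OF assms(2), of "-1"]] by simp
qed

lemma ctraj_shift: "ctraj A B x u \<Longrightarrow> ctraj A B (\<lambda>t. x (t + h)) (\<lambda>t. u (t + h))"
  unfolding ctraj_def using L2loc_shift antideriv_shift by fastforce

lemma ctraj_concat:
  assumes 1: "ctraj A B x1 u1" and 2: "ctraj A B x2 u2" and eq: "x1 s = x2 s"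
  defines "x \<equiv> \<lambda>t. if t \<le> s then x1 t else x2 t" and "u \<equiv> \<lambda>t. if t \<le> s then u1 t else u2 t"
  shows "ctraj A B x u"
    "b \<le> s \<Longrightarrow> (LINT t:{a..b}|lborel. surplus C D x u t) = (LINT t:{a..b}|lborel. surplus C D x1 u1 t)"
    "s \<le> a \<Longrightarrow> (LINT t:{a..b}|lborel. surplus C D x u t) = (LINT t:{a..b}|lborel. surplus C D x2 u2 t)"
proof -
  note l1 = ctraj_L2loc[OF 1] and l2 = ctraj_L2loc[OF 2]
  have "antideriv x (\<lambda>t. if t \<le> s then A *v x1 t + B *v u1 t else A *v x2 t + B *v u2 t)"
    unfolding x_def using 1 2 eq L2locD(1)[OF l1(3)] L2locD(1)[OF l2(3)]
    by (intro antideriv_concat) (auto simp: ctraj_def)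
  moreover have "(\<lambda>t. if t \<le> s then A *v x1 t + B *v u1 t else A *v x2 t + B *v u2 t) = (\<lambda>t. A *v x t + B *v u t)"
    by (auto simp: x_def u_def)
  moreover have "L2loc u" unfolding u_def by (intro L2loc_if l1 l2)
  ultimately show c: "ctraj A B x u" unfolding ctraj_def by simp
  show "(LINT t:{a..b}|lborel. surplus C D x u t) = (LINT t:{a..b}|lborel. surplus C D x1 u1 t)" if "b \<le> s"
    by (rule set_lebesgue_integral_cong) (use that in \<open>auto simp: surplus_def x_def u_def\<close>)
  show "(LINT t:{a..b}|lborel. surplus C D x u t) = (LINT t:{a..b}|lborel. surplus C D x2 u2 t)" if sa: "s \<le> a"
  proof (rule set_lebesgue_integral_cong_AE)
    show "AE t \<in> {a..b} in lborel. surplus C D x u t = surplus C D x2 u2 t"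
      using AE_not_equal[of s] by eventually_elim (use sa in \<open>auto simp: surplus_def x_def u_def\<close>)
  qed (use surplus_integrable(2)[OF c] surplus_integrable(2)[OF 2] in auto)
qed

definition costs :: "real^'d^'d \<Rightarrow> real^'n^'d \<Rightarrow> real^'d^'m \<Rightarrow> real^'n^'m \<Rightarrow> real \<Rightarrow> real^'d \<Rightarrow> real set" where
  "costs A B C D t0 x0 = {LINT t:{t0..t1}|lborel. surplus C D x u t | t1 x u. t0 \<le> t1 \<and> ctraj A B x u \<and> x t0 = x0}"

text \<open>The output is determined almost everywhere by x and u and can therefore be eliminated
  from the integral.\<close>

lemma avail_storage_costs: "avail_storage A B C D t0 x0 = (SUP c\<in>costs A B C D t0 x0. ereal c)"
proof -
  let ?W = "{(t1, u, y, x). t1 \<ge> t0 \<and> (u, y, x) \<in> Bs A B C D \<and> x t0 = x0}"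
  let ?f = "\<lambda>w. case w of (t1, u, y, x) \<Rightarrow> LINT t:{t0..t1}|lborel. y t \<bullet> y t - u t \<bullet> u t"
  have e: "(LINT t:{t0..t1}|lborel. y t \<bullet> y t - u t \<bullet> u t) = (LINT t:{t0..t1}|lborel. surplus C D x u t)"
    if b: "(u, y, x) \<in> Bs A B C D" for t1 u y x
  proof (rule set_lebesgue_integral_cong_AE)
    have b': "L2loc y" "ctraj A B x u" "AE t in lborel. y t = C *v x t + D *v u t" using b by (auto simp: Bs_iff)
    show "AE t \<in> {t0..t1} in lborel. y t \<bullet> y t - u t \<bullet> u t = surplus C D x u t"
      using b'(3) by eventually_elim (auto simp: surplus_def power2_norm_eq_inner)
    show "(\<lambda>t. y t \<bullet> y t - u t \<bullet> u t) \<in> borel_measurable lborel"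
      using L2locD(1)[OF b'(1)] L2locD(1)[OF ctraj_L2loc(1)[OF b'(2)]] by simp
    show "surplus C D x u \<in> borel_measurable lborel" using surplus_integrable(2)[OF b'(2)] by simp
  qed simp
  have "?f ` ?W = costs A B C D t0 x0"
  proof (intro set_eqI iffI)
    fix c assume "c \<in> ?f ` ?W"
    then obtain t1 u y x where "t1 \<ge> t0" "(u, y, x) \<in> Bs A B C D" "x t0 = x0"
      "c = (LINT t:{t0..t1}|lborel. y t \<bullet> y t - u t \<bullet> u t)" by auto
    then show "c \<in> costs A B C D t0 x0" unfolding costs_def using e Bs_iff by blast
  next
    fix c assume "c \<in> costs A B C D t0 x0"
    then obtain t1 x u where c: "t0 \<le> t1" "ctraj A B x u" "x t0 = x0" "c = (LINT t:{t0..t1}|lborel. surplus C D x u t)"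
      unfolding costs_def by blast
    have b: "(u, \<lambda>t. C *v x t + D *v u t, x) \<in> Bs A B C D"
      unfolding Bs_iff using c(2) ctraj_L2loc(3)[OF c(2)] by simp
    have "c = ?f (t1, u, \<lambda>t. C *v x t + D *v u t, x)" using e[OF b] c(4) by simp
    then show "c \<in> ?f ` ?W" using b c by (intro image_eqI[of _ _ "(t1, u, \<lambda>t. C *v x t + D *v u t, x)"]) auto
  qed
  then have "(\<lambda>c. ereal c) ` costs A B C D t0 x0 = (\<lambda>w. ereal (?f w)) ` ?W" by (simp flip: image_image)
  then show ?thesis unfolding avail_storage_def by simp
qed

text \<open>Integrates the dissipation inequality along the trajectory by the product rule for
  antiderivatives and drops the nonnegative final storage.\<close>

lemma dissipation_bound:
  assumes X: "sym_mat X" "psd X" "dissipative A B C D X" and tr: "ctraj A B x u" and t: "t0 \<le> t1"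
  shows "(LINT t:{t0..t1}|lborel. surplus C D x u t) \<le> x t0 \<bullet> (X *v x t0)"
proof -
  let ?w = "\<lambda>t. A *v x t + B *v u t"
  have x: "antideriv x ?w" using tr by (simp add: ctraj_def)
  have Xx: "antideriv (\<lambda>t. X *v x t) (\<lambda>t. X *v ?w t)"
    by (rule antideriv_bounded_linear[OF x matrix_vector_mul_bounded_linear])
  have "antideriv (\<lambda>t. x t \<bullet> (X *v x t)) (\<lambda>t. ?w t \<bullet> (X *v x t) + x t \<bullet> (X *v ?w t))"
    by (rule antideriv_inner[OF x Xx])
  moreover have "?w t \<bullet> (X *v x t) = x t \<bullet> (X *v ?w t)" for t
    using sym_mat_inner[OF X(1), of "x t" "?w t"] by (simp add: inner_commute)
  ultimately have V: "antideriv (\<lambda>t. x t \<bullet> (X *v x t)) (\<lambda>t. 2 * (x t \<bullet> (X *v ?w t)))" by simp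
  have "antideriv (\<lambda>t. - (x t \<bullet> (X *v x t))) (\<lambda>t. - (2 * (x t \<bullet> (X *v ?w t))))"
    by (rule antideriv_bounded_linear[OF V bounded_linear_minus[OF bounded_linear_ident]])
  note nV = antiderivD[OF this t]
  have "(LINT t:{t0..t1}|lborel. surplus C D x u t) \<le> (LINT t:{t0..t1}|lborel. - (2 * (x t \<bullet> (X *v ?w t))))"
  proof (rule set_integral_mono[OF surplus_integrable(1)[OF tr] nV(1)])
    fix t
    show "surplus C D x u t \<le> - (2 * (x t \<bullet> (X *v ?w t)))"
      using X(3)[unfolded dissipative_def, rule_format, of "x t" "u t"] by (simp add: surplus_def)
  qed
  also have "\<dots> = - (x t1 \<bullet> (X *v x t1)) + x t0 \<bullet> (X *v x t0)" using nV(2) by simp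
  also have "\<dots> \<le> x t0 \<bullet> (X *v x t0)" using X(2) by (simp add: psd_def)
  finally show ?thesis .
qed

text \<open>Continuing with zero input makes the supply after \<open>t1\<close> nonnegative, so
  trajectories can be compared on a common interval.\<close>

lemma surplus_extend:
  assumes tr: "ctraj A B x u" and t: "t0 \<le> t1" "t1 \<le> T"
  shows "\<exists>x' u'. ctraj A B x' u' \<and> x' t0 = x t0 \<and>
    (LINT t:{t0..t1}|lborel. surplus C D x u t) \<le> (LINT t:{t0..T}|lborel. surplus C D x' u' t)"
proof -
  have "L2loc (\<lambda>_::real. 0 :: real^'n)" by (intro L2loc_continuous continuous_intros)
  then obtain f where f: "f t1 = x t1" "ctraj A B f (\<lambda>_. 0)" using ctraj_exists by blast
  note c = ctraj_concat[OF tr f(2) f(1)[symmetric]]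
  have "0 \<le> (LINT t:{t1..T}|lborel. surplus C D f (\<lambda>_. 0) t)"
    unfolding set_lebesgue_integral_def by (intro Bochner_Integration.integral_nonneg) (simp add: surplus_def)
  then have "(LINT t:{t0..t1}|lborel. surplus C D x u t)
    \<le> (LINT t:{t0..T}|lborel. surplus C D (\<lambda>t. if t \<le> t1 then x t else f t) (\<lambda>t. if t \<le> t1 then u t else 0) t)"
    unfolding surplus_split[OF c(1) t] by (simp add: c(2,3))
  then show ?thesis using c(1) t(1) by fastforce
qed

text \<open>Linearity of the trajectories gives a quadratic form through
  \<open>Sup_quadratic\<close>; the principle of optimality on short intervals with constant input
  gives the matrix inequality.\<close>

theorem storage_quadratic:
  fixes A :: "real^'d^'d" and B :: "real^'n^'d" and C :: "real^'d^'m" and D :: "real^'n^'m"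
  assumes bdd: "\<And>x0. bdd_above (costs A B C D t0 x0)"
  shows "\<exists>X. sym_mat X \<and> psd X \<and> dissipative A B C D X \<and> (\<forall>x. Sup (costs A B C D t0 x) = x \<bullet> (X *v x))"
proof -
  let ?V = "costs A B C D t0"
  have VI: "t0 \<le> t1 \<Longrightarrow> ctraj A B x u \<Longrightarrow> (LINT t:{t0..t1}|lborel. surplus C D x u t) \<in> ?V (x t0)" for t1 x u
    unfolding costs_def by blast
  have L0: "L2loc (\<lambda>_::real. c :: real^'n)" for c by (intro L2loc_continuous continuous_intros)
  have "\<exists>X. sym_mat X \<and> psd X \<and> (\<forall>x. Sup (?V x) = x \<bullet> (X *v x))"
  proof (rule Sup_quadratic[OF bdd])
    show "\<exists>a\<in>?V x. 0 \<le> a" for x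
    proof -
      obtain y where y: "y t0 = x" "ctraj A B y (\<lambda>_. 0)" using ctraj_exists[OF L0] by blast
      have "0 \<le> (LINT t:{t0..t0}|lborel. surplus C D y (\<lambda>_. 0) t)"
        unfolding set_lebesgue_integral_def by (intro Bochner_Integration.integral_nonneg) (simp add: surplus_def)
      then show ?thesis using VI[OF order_refl y(2)] y(1) by blast
    qed
    show "r\<^sup>2 * a \<in> ?V (r *\<^sub>R x)" if a: "a \<in> ?V x" for r x a
    proof -
      obtain t1 y u where y: "a = (LINT t:{t0..t1}|lborel. surplus C D y u t)" "t0 \<le> t1" "ctraj A B y u" "y t0 = x"
        using a unfolding costs_def by blast
      have "surplus C D (\<lambda>t. r *\<^sub>R y t) (\<lambda>t. r *\<^sub>R u t) t = r\<^sup>2 * surplus C D y u t" for t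
      proof -
        have "C *v (r *\<^sub>R y t) + D *v (r *\<^sub>R u t) = r *\<^sub>R (C *v y t + D *v u t)"
          by (simp add: matrix_vector_mult_scaleR scaleR_add_right)
        then show ?thesis
          by (simp only: surplus_def norm_scaleR power_mult_distrib power2_abs right_diff_distrib)
      qed
      then have "(LINT t:{t0..t1}|lborel. surplus C D (\<lambda>t. r *\<^sub>R y t) (\<lambda>t. r *\<^sub>R u t) t) = r\<^sup>2 * a"
        unfolding y(1) by simp
      then show ?thesis using VI[OF y(2) ctraj_linear(3)[OF y(3) y(3), of r]] y(4) by simp
    qed
    show "\<exists>c\<in>?V (x + y). \<exists>d\<in>?V (x - y). 2 * a + 2 * b \<le> c + d" if ab: "a \<in> ?V x" "b \<in> ?V y" for x y a b
    proof -
      obtain s1 x1 u1 where 1: "a = (LINT t:{t0..s1}|lborel. surplus C D x1 u1 t)" "t0 \<le> s1" "ctraj A B x1 u1" "x1 t0 = x"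
        using ab unfolding costs_def by blast
      obtain s2 x2 u2 where 2: "b = (LINT t:{t0..s2}|lborel. surplus C D x2 u2 t)" "t0 \<le> s2" "ctraj A B x2 u2" "x2 t0 = y"
        using ab unfolding costs_def by blast
      define T where "T = max s1 s2"
      obtain y1 v1 where h1: "ctraj A B y1 v1" "y1 t0 = x" "a \<le> (LINT t:{t0..T}|lborel. surplus C D y1 v1 t)"
        using surplus_extend[OF 1(3,2), of T C D] 1 by (auto simp: T_def)
      obtain y2 v2 where h2: "ctraj A B y2 v2" "y2 t0 = y" "b \<le> (LINT t:{t0..T}|lborel. surplus C D y2 v2 t)"
        using surplus_extend[OF 2(3,2), of T C D] 2 by (auto simp: T_def)
      have T: "t0 \<le> T" using 1(2) by (simp add: T_def)
      note p = ctraj_linear(1)[OF h1(1) h2(1)] and m = ctraj_linear(2)[OF h1(1) h2(1)]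
      have pw: "surplus C D (\<lambda>t. y1 t + y2 t) (\<lambda>t. v1 t + v2 t) t + surplus C D (\<lambda>t. y1 t - y2 t) (\<lambda>t. v1 t - v2 t) t
        = 2 * surplus C D y1 v1 t + 2 * surplus C D y2 v2 t" for t
      proof -
        have s1: "C *v (y1 t + y2 t) + D *v (v1 t + v2 t) = (C *v y1 t + D *v v1 t) + (C *v y2 t + D *v v2 t)"
          by (simp add: matrix_vector_right_distrib)
        have s2: "C *v (y1 t - y2 t) + D *v (v1 t - v2 t) = (C *v y1 t + D *v v1 t) - (C *v y2 t + D *v v2 t)"
          by (simp add: matrix_vector_right_distrib matrix_vector_mult_diff_distrib)
        show ?thesis unfolding surplus_def s1 s2
          using parallelogram_norm[of "C *v y1 t + D *v v1 t" "C *v y2 t + D *v v2 t"] parallelogram_norm[of "v1 t" "v2 t"]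
          by (simp add: algebra_simps)
      qed
      let ?c = "LINT t:{t0..T}|lborel. surplus C D (\<lambda>t. y1 t + y2 t) (\<lambda>t. v1 t + v2 t) t"
      let ?d = "LINT t:{t0..T}|lborel. surplus C D (\<lambda>t. y1 t - y2 t) (\<lambda>t. v1 t - v2 t) t"
      have "?c + ?d = (LINT t:{t0..T}|lborel. 2 * surplus C D y1 v1 t + 2 * surplus C D y2 v2 t)"
        unfolding pw[symmetric] by (rule set_integral_add(2)[OF surplus_integrable(1)[OF p] surplus_integrable(1)[OF m], symmetric])
      also have "\<dots> = 2 * (LINT t:{t0..T}|lborel. surplus C D y1 v1 t) + 2 * (LINT t:{t0..T}|lborel. surplus C D y2 v2 t)"
        using surplus_integrable(1)[OF h1(1)] surplus_integrable(1)[OF h2(1)] by (subst set_integral_add(2)) auto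
      finally have "2 * a + 2 * b \<le> ?c + ?d" using h1 h2 by simp
      moreover have "?c \<in> ?V (x + y)" using VI[OF T p] h1 h2 by simp
      moreover have "?d \<in> ?V (x - y)" using VI[OF T m] h1 h2 by simp
      ultimately show ?thesis by blast
    qed
  qed
  then obtain X where X: "sym_mat X" "psd X" "\<And>x. Sup (?V x) = x \<bullet> (X *v x)" by blast
  \<comment> \<open>Principle of optimality: a motion followed by any continuation from its end
    point is itself a competitor. Continuations in \<open>costs\<close> start at \<open>t0\<close>
    and are shifted by \<open>h\<close> to start at \<open>t1\<close>.\<close>
  have step: "x t1 \<bullet> (X *v x t1) \<le> x t0 \<bullet> (X *v x t0) - (LINT t:{t0..t1}|lborel. surplus C D x u t)"
    if tr: "ctraj A B x u" and t: "t0 \<le> t1" for x u t1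
  proof -
    have "a \<le> x t0 \<bullet> (X *v x t0) - (LINT t:{t0..t1}|lborel. surplus C D x u t)" if a: "a \<in> ?V (x t1)" for a
    proof -
      obtain s y v where y: "a = (LINT t:{t0..s}|lborel. surplus C D y v t)" "t0 \<le> s" "ctraj A B y v" "y t0 = x t1"
        using a unfolding costs_def by blast
      define h where "h = t0 - t1"
      have sh: "ctraj A B (\<lambda>t. y (t + h)) (\<lambda>t. v (t + h))" by (rule ctraj_shift[OF y(3)])
      note c = ctraj_concat[OF tr sh, of t1]
      have eq: "x t1 = y (t1 + h)" using y(4) by (simp add: h_def)
      have "surplus C D (\<lambda>t. y (t + h)) (\<lambda>t. v (t + h)) t = surplus C D y v (t + h)" for t by (simp add: surplus_def)
      then have "(LINT t:{t1..s - h}|lborel. surplus C D (\<lambda>t. y (t + h)) (\<lambda>t. v (t + h)) t) = a"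
        using set_integrable_shift(2)[of t1 h "s - h" "surplus C D y v", OF surplus_integrable(1)[OF y(3)]] y(1)
        by (simp add: h_def)
      then have "(LINT t:{t0..s - h}|lborel. surplus C D (\<lambda>t. if t \<le> t1 then x t else y (t + h)) (\<lambda>t. if t \<le> t1 then u t else v (t + h)) t)
        = (LINT t:{t0..t1}|lborel. surplus C D x u t) + a"
        using t y(2) by (subst surplus_split[OF c(1)[OF eq], of t0 t1]) (auto simp: c(2,3)[OF eq] h_def)
      moreover have "(LINT t:{t0..s - h}|lborel. surplus C D (\<lambda>t. if t \<le> t1 then x t else y (t + h)) (\<lambda>t. if t \<le> t1 then u t else v (t + h)) t)
        \<in> ?V (x t0)"
        using VI[OF _ c(1)[OF eq], of "s - h"] t y(2) by (simp add: h_def)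
      ultimately have "(LINT t:{t0..t1}|lborel. surplus C D x u t) + a \<le> Sup (?V (x t0))"
        using cSup_upper[OF _ bdd] by simp
      then show ?thesis unfolding X(3) by simp
    qed
    moreover have "?V (x t1) \<noteq> {}"
    proof -
      obtain y where "y t0 = x t1" "ctraj A B y (\<lambda>_. 0)" using ctraj_exists[OF L0] by blast
      then show ?thesis using VI by fastforce
    qed
    ultimately show ?thesis unfolding X(3)[symmetric, of "x t1"] by (intro cSup_least)
  qed
  have "2 * (x0 \<bullet> (X *v (A *v x0 + B *v u0))) + (norm (C *v x0 + D *v u0))\<^sup>2 \<le> (norm u0)\<^sup>2" for x0 u0
  proof (rule ccontr)
    assume neg: "\<not> ?thesis"
    obtain x where x: "x t0 = x0" "ctraj A B x (\<lambda>_. u0)" using ctraj_exists[OF L0] by blast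
    have xa: "antideriv x (\<lambda>t. A *v x t + B *v u0)" using x(2) by (simp add: ctraj_def)
    \<comment> \<open>\<open>k\<close> is the derivative of the storage along the motion plus the
      supply. If the inequality failed, \<open>k\<close> would stay positive for a while after
      \<open>t0\<close>, against \<open>step\<close>.\<close>
    define k where "k t = 2 * (x t \<bullet> (X *v (A *v x t + B *v u0))) + surplus C D x (\<lambda>_. u0) t" for t
    have cx: "continuous_on UNIV x" by (rule antideriv_continuous[OF xa])
    have lin: "continuous_on UNIV (\<lambda>t. M *v f t)" if "continuous_on UNIV f" for M :: "real^'d^'k" and f :: "real \<Rightarrow> real^'d"
      by (rule continuous_on_compose2[OF linear_continuous_on[OF matrix_vector_mul_bounded_linear] that]) auto
    have lind: "continuous_on UNIV (\<lambda>t. M *v f t)" if "continuous_on UNIV f" for M :: "real^'d^'d" and f :: "real \<Rightarrow> real^'d"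
      by (rule continuous_on_compose2[OF linear_continuous_on[OF matrix_vector_mul_bounded_linear] that]) auto
    have linm: "continuous_on UNIV (\<lambda>t. M *v f t)" if "continuous_on UNIV f" for M :: "real^'d^'m" and f :: "real \<Rightarrow> real^'d"
      by (rule continuous_on_compose2[OF linear_continuous_on[OF matrix_vector_mul_bounded_linear] that]) auto
    have ck: "continuous_on UNIV k"
      unfolding k_def surplus_def by (intro continuous_intros lind linm cx)
    have "k t0 > 0" using neg by (simp add: k_def surplus_def x(1))
    moreover have "isCont k t0" using ck by (simp add: continuous_on_eq_continuous_at)
    ultimately obtain d where d: "d > 0" "\<And>t. dist t t0 < d \<Longrightarrow> k t > k t0 / 2"
    proof -
      assume k0: "k t0 > 0" and "isCont k t0"
      then obtain d where "d > 0" "\<And>t. dist t t0 < d \<Longrightarrow> dist (k t) (k t0) < k t0 / 2"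
        unfolding continuous_at_eps_delta by (metis half_gt_zero)
      moreover have "dist (k t) (k t0) < k t0 / 2 \<Longrightarrow> k t > k t0 / 2" for t by (simp add: dist_real_def abs_if split: if_splits)
      ultimately show ?thesis using that by blast
    qed
    define t1 where "t1 = t0 + d / 2"
    have t: "t0 \<le> t1" using d(1) by (simp add: t1_def)
    have Xx: "antideriv (\<lambda>t. X *v x t) (\<lambda>t. X *v (A *v x t + B *v u0))"
      by (rule antideriv_bounded_linear[OF xa matrix_vector_mul_bounded_linear])
    have "(A *v x t + B *v u0) \<bullet> (X *v x t) = x t \<bullet> (X *v (A *v x t + B *v u0))" for t
      using sym_mat_inner[OF X(1), of "x t" "A *v x t + B *v u0"] by (simp add: inner_commute)
    then have V: "antideriv (\<lambda>t. x t \<bullet> (X *v x t)) (\<lambda>t. 2 * (x t \<bullet> (X *v (A *v x t + B *v u0))))"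
      using antideriv_inner[OF xa Xx] by simp
    have ki: "set_integrable lborel {t0..t1} k"
      by (intro borel_integrable_atLeastAtMost' continuous_on_subset[OF ck]) simp
    have "(LINT t:{t0..t1}|lborel. k t) = (x t1 \<bullet> (X *v x t1) - x t0 \<bullet> (X *v x t0)) + (LINT t:{t0..t1}|lborel. surplus C D x (\<lambda>_. u0) t)"
      unfolding k_def antiderivD(2)[OF V t] by (rule set_integral_add(2)[OF antiderivD(1)[OF V t] surplus_integrable(1)[OF x(2)]])
    then have "(LINT t:{t0..t1}|lborel. k t) \<le> 0" using step[OF x(2) t] by simp
    moreover have "(LINT t:{t0..t1}|lborel. k t0 / 2) \<le> (LINT t:{t0..t1}|lborel. k t)"
      by (rule set_integral_mono[OF set_integrable_const ki])
        (use d in \<open>auto simp: t1_def dist_real_def intro!: less_imp_le\<close>)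
    moreover have "(LINT t:{t0..t1}|lborel. k t0 / 2) = (t1 - t0) * (k t0 / 2)"
      using t by (simp add: set_lebesgue_integral_def)
    moreover have "0 < (t1 - t0) * (k t0 / 2)" using \<open>k t0 > 0\<close> d(1) by (simp add: t1_def)
    ultimately show False by linarith
  qed
  then have "dissipative A B C D X" unfolding dissipative_def by blast
  then show ?thesis using X by blast
qed

section \<open>Test functions\<close>

text \<open>n-fold differentiability by recursion on the derivative, the form in which closure under
  products is proved by induction; \<open>nd_iff\<close> relates it to iterated
  \<open>deriv\<close>.\<close>

primrec nd :: "nat \<Rightarrow> (real \<Rightarrow> real) \<Rightarrow> bool" where
  "nd 0 f \<longleftrightarrow> True"
| "nd (Suc n) f \<longleftrightarrow> (\<forall>t. f differentiable (at t)) \<and> nd n (deriv f)"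

definition smooth :: "(real \<Rightarrow> real) \<Rightarrow> bool" where "smooth f \<longleftrightarrow> (\<forall>n. nd n f)"

lemma nd_iff: "nd n f \<longleftrightarrow> (\<forall>k<n. \<forall>t. ((deriv ^^ k) f) differentiable (at t))"
proof (induction n arbitrary: f)
  case (Suc n)
  show ?case
  proof
    assume "nd (Suc n) f"
    then have "\<forall>t. f differentiable (at t)" "\<forall>k<n. \<forall>t. ((deriv ^^ k) (deriv f)) differentiable (at t)"
      using Suc by simp_all
    then show "\<forall>k<Suc n. \<forall>t. ((deriv ^^ k) f) differentiable (at t)"
      by (auto simp: less_Suc_eq_0_disj funpow_Suc_right simp del: funpow.simps)
  next
    assume a: "\<forall>k<Suc n. \<forall>t. ((deriv ^^ k) f) differentiable (at t)"
    have "\<forall>t. f differentiable (at t)" using a[rule_format, of 0] by simp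
    moreover have "((deriv ^^ k) (deriv f)) differentiable (at t)" if "k < n" for k t
      using a[rule_format, of "Suc k" t] that by (simp add: funpow_Suc_right del: funpow.simps)
    ultimately show "nd (Suc n) f" using Suc by simp
  qed
qed simp

lemma smooth_iff: "smooth f \<longleftrightarrow> (\<forall>k t. ((deriv ^^ k) f) differentiable (at t))"
  unfolding smooth_def nd_iff by blast

lemma smoothD:
  assumes "smooth f"
  shows "(f has_real_derivative deriv f t) (at t)" "smooth (deriv f)" "continuous_on S f"
proof -
  have 1: "nd (Suc n) f" for n using assms unfolding smooth_def by blast
  from 1[of 0] have d: "f differentiable (at t)" for t by simp
  then show "(f has_real_derivative deriv f t) (at t)" by (simp add: DERIV_deriv_iff_real_differentiable)
  show "smooth (deriv f)" using 1 by (simp add: smooth_def)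
  show "continuous_on S f"
    by (intro continuous_at_imp_continuous_on ballI differentiable_imp_continuous_within d)
qed

lemma smooth_deriv_pow: "smooth f \<Longrightarrow> smooth ((deriv ^^ k) f)"
  by (induction k) (auto intro: smoothD(2))

lemma derivI: "(\<And>t. (f has_real_derivative g t) (at t)) \<Longrightarrow> deriv f = g"
  by (auto intro!: ext DERIV_imp_deriv)

lemma nd_mono: "nd (Suc n) f \<Longrightarrow> nd n f"
  by (induction n arbitrary: f) auto

lemma nd_SucI:
  assumes "\<And>t. (f has_real_derivative g t) (at t)" "nd n g"
  shows "nd (Suc n) f"
  using assms derivI[of f g] by (auto simp: real_differentiable_def)

lemma nd_SucD: "nd (Suc n) f \<Longrightarrow> (f has_real_derivative deriv f t) (at t)"
  by (simp add: DERIV_deriv_iff_real_differentiable)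

lemma smoothI:
  assumes "\<And>t. (f has_real_derivative g t) (at t)" "smooth g"
  shows "smooth f"
  unfolding smooth_def
proof
  fix n show "nd n f" using assms by (cases n) (auto simp: smooth_def simp del: nd.simps(2) intro: nd_SucI)
qed

lemma nd_const: "nd n (\<lambda>_. c)"
proof (induction n arbitrary: c)
  case (Suc n)
  show ?case by (rule nd_SucI[OF DERIV_const Suc])
qed simp

lemma nd_add: "nd n f \<Longrightarrow> nd n g \<Longrightarrow> nd n (\<lambda>t. f t + g t)"
proof (induction n arbitrary: f g)
  case (Suc n)
  show ?case
    by (rule nd_SucI[OF DERIV_add[OF nd_SucD[OF Suc.prems(1)] nd_SucD[OF Suc.prems(2)]]])
      (use Suc in auto)
qed simp

lemma nd_mult: "nd n f \<Longrightarrow> nd n g \<Longrightarrow> nd n (\<lambda>t. f t * g t)"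
proof (induction n arbitrary: f g)
  case (Suc n)
  show ?case
  proof (rule nd_SucI[OF DERIV_mult'[OF nd_SucD[OF Suc.prems(1)] nd_SucD[OF Suc.prems(2)]]])
    show "nd n (\<lambda>t. f t * deriv g t + deriv f t * g t)"
      using Suc.prems nd_mono[OF Suc.prems(1)] nd_mono[OF Suc.prems(2)] by (intro nd_add Suc.IH) simp_all
  qed
qed simp

lemma nd_sum: "(\<And>i. i \<in> I \<Longrightarrow> nd n (f i)) \<Longrightarrow> nd n (\<lambda>t. \<Sum>i\<in>I. f i t)"
  by (induction I rule: infinite_finite_induct) (auto intro: nd_add nd_const)

lemma nd_affine: "nd n f \<Longrightarrow> nd n (\<lambda>t. f (a + b * t))"
proof (induction n arbitrary: f)
  case (Suc n)
  have "((\<lambda>t. f (a + b * t)) has_real_derivative deriv f (a + b * t) * b) (at t)" for t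
    by (rule DERIV_chain2[OF nd_SucD[OF Suc.prems]]) (auto intro!: derivative_eq_intros)
  then show ?case by (rule nd_SucI) (use Suc in \<open>auto intro!: nd_mult nd_const\<close>)
qed simp

lemma nd_exp: "smooth h \<Longrightarrow> nd n (\<lambda>t. exp (h t))"
proof (induction n)
  case (Suc n)
  have "((\<lambda>t. exp (h t)) has_real_derivative exp (h t) * deriv h t) (at t)" for t
    by (rule DERIV_fun_exp[OF smoothD(1)[OF Suc.prems]])
  then show ?case by (rule nd_SucI) (use Suc smoothD(2)[OF Suc.prems] in \<open>auto simp: smooth_def intro!: nd_mult\<close>)
qed simp

lemma smooth_const: "smooth (\<lambda>_. c)" and smooth_add: "smooth f \<Longrightarrow> smooth g \<Longrightarrow> smooth (\<lambda>t. f t + g t)"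
  and smooth_mult: "smooth f \<Longrightarrow> smooth g \<Longrightarrow> smooth (\<lambda>t. f t * g t)"
  and smooth_affine: "smooth f \<Longrightarrow> smooth (\<lambda>t. f (a + b * t))"
  and smooth_exp: "smooth h \<Longrightarrow> smooth (\<lambda>t. exp (h t))"
  by (auto simp: smooth_def intro: nd_const nd_add nd_mult nd_affine nd_exp[unfolded smooth_def])

lemma smooth_sum: "(\<And>i. i \<in> I \<Longrightarrow> smooth (f i)) \<Longrightarrow> smooth (\<lambda>t. \<Sum>i\<in>I. f i t)"
  unfolding smooth_def by (blast intro: nd_sum)

lemma smooth_cmult: "smooth f \<Longrightarrow> smooth (\<lambda>t. c * f t)" by (intro smooth_mult smooth_const)

lemma smooth_ident: "smooth (\<lambda>t. t)"
  by (rule smoothI[OF DERIV_ident smooth_const])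

lemma smooth_poly: "smooth (poly p)"
proof (induction p)
  case (pCons a p)
  have "smooth (\<lambda>t. a + t * poly p t)" by (intro smooth_add smooth_mult smooth_const smooth_ident pCons)
  then show ?case by (simp add: fun_eq_iff[symmetric] poly_pCons[abs_def])
qed (simp add: smooth_const)

lemma deriv_pow_cmult_add:
  assumes "smooth f" "smooth g"
  shows "(deriv ^^ k) (\<lambda>t. a * f t + b * g t) = (\<lambda>t. a * (deriv ^^ k) f t + b * (deriv ^^ k) g t)"
proof (induction k)
  case (Suc k)
  have "deriv (\<lambda>t. a * (deriv ^^ k) f t + b * (deriv ^^ k) g t) = (\<lambda>t. a * deriv ((deriv ^^ k) f) t + b * deriv ((deriv ^^ k) g) t)"
    by (rule derivI) (intro DERIV_add DERIV_cmult smoothD(1) smooth_deriv_pow assms)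
  then show ?case using Suc by simp
qed simp

text \<open>The polynomial factor makes the family around exp (-1/t) closed under differentiation,
  so one derivative formula gives smoothness.\<close>

definition flat :: "real poly \<Rightarrow> real \<Rightarrow> real" where
  "flat p t = (if 0 < t then poly p (1 / t) * exp (- (1 / t)) else 0)"

lemma poly_exp_tendsto_0: "((\<lambda>x. poly p x * exp (- x)) \<longlongrightarrow> 0) at_top" for p :: "real poly"
proof -
  have "((\<lambda>x. \<Sum>i\<le>degree p. coeff p i * (x ^ i / exp x)) \<longlongrightarrow> (\<Sum>i\<le>degree p. coeff p i * 0)) at_top"
    by (intro tendsto_sum tendsto_mult tendsto_const tendsto_power_div_exp_0)
  then show ?thesis by (simp add: poly_altdef sum_distrib_right exp_minus divide_inverse mult.assoc)
qed

text \<open>With x = 1/t, d/dt is -x^2 d/dx, which sends p exp (-x) to x^2 (p - p') exp (-x). At t =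
  0 the difference quotient tends to 0, since the exponential beats every polynomial.\<close>

lemma flat_deriv: "(flat p has_real_derivative flat ([:0, 0, 1:] * (p - pderiv p)) t) (at t)"
proof -
  consider "t > 0" | "t < 0" | "t = 0" by linarith
  then show ?thesis
  proof cases
    case 1
    have i: "((\<lambda>t. 1 / t) has_real_derivative - (1 / t\<^sup>2)) (at t)"
      using 1 by (auto intro!: derivative_eq_intros simp: power2_eq_square)
    have "((\<lambda>t. poly p (1 / t) * exp (- (1 / t))) has_real_derivative
        poly p (1 / t) * (exp (- (1 / t)) * - (- (1 / t\<^sup>2))) + poly (pderiv p) (1 / t) * (- (1 / t\<^sup>2)) * exp (- (1 / t))) (at t)"
      by (intro DERIV_mult' DERIV_chain2[OF poly_DERIV i] DERIV_fun_exp DERIV_minus i)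
    moreover have "poly p (1 / t) * (exp (- (1 / t)) * - (- (1 / t\<^sup>2))) + poly (pderiv p) (1 / t) * (- (1 / t\<^sup>2)) * exp (- (1 / t))
      = flat ([:0, 0, 1:] * (p - pderiv p)) t"
      using 1 by (simp add: flat_def power2_eq_square algebra_simps)
    ultimately have "((\<lambda>t. poly p (1 / t) * exp (- (1 / t))) has_real_derivative flat ([:0, 0, 1:] * (p - pderiv p)) t) (at t)"
      by simp
    then show ?thesis
      by (rule has_field_derivative_transform_within_open[where S = "{0<..}"]) (use 1 in \<open>auto simp: flat_def\<close>)
  next
    case 2
    have "((\<lambda>_. 0) has_real_derivative 0) (at t)" by simp
    then have "(flat p has_real_derivative 0) (at t)"
      by (rule has_field_derivative_transform_within_open[where S = "{..<0}"]) (use 2 in \<open>auto simp: flat_def\<close>)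
    then show ?thesis using 2 by (simp add: flat_def)
  next
    case 3
    have "((\<lambda>h. flat p h / h) \<longlongrightarrow> 0) (at_right 0)"
    proof (rule Lim_transform_eventually)
      show "((\<lambda>h. poly ([:0, 1:] * p) (inverse h) * exp (- inverse h)) \<longlongrightarrow> 0) (at_right (0::real))"
        by (rule filterlim_compose[OF poly_exp_tendsto_0 filterlim_inverse_at_top_right])
      show "eventually (\<lambda>h. poly ([:0, 1:] * p) (inverse h) * exp (- inverse h) = flat p h / h) (at_right 0)"
        by (auto simp: eventually_at_filter flat_def divide_inverse)
    qed
    moreover have "((\<lambda>h. flat p h / h) \<longlongrightarrow> 0) (at_left 0)"
      by (rule Lim_transform_eventually[OF tendsto_const]) (auto simp: eventually_at_filter flat_def)
    ultimately have "((\<lambda>h. flat p h / h) \<longlongrightarrow> 0) (at 0)" by (simp add: filterlim_split_at)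
    then have "(flat p has_real_derivative 0) (at 0)" by (simp add: DERIV_def flat_def)
    then show ?thesis using 3 by (simp add: flat_def)
  qed
qed

lemma smooth_flat: "smooth (flat p)"
proof -
  have "nd n (flat p)" for n
  proof (induction n arbitrary: p)
    case (Suc n) show ?case by (rule nd_SucI[OF flat_deriv Suc])
  qed simp
  then show ?thesis by (simp add: smooth_def)
qed

lemma test_fun_iff: "test_fun \<phi> \<longleftrightarrow> smooth \<phi> \<and> (\<exists>R. \<forall>t. R < \<bar>t\<bar> \<longrightarrow> \<phi> t = 0)"
  unfolding test_fun_def smooth_iff ..

lemma deriv_outside:
  fixes \<phi> :: "real \<Rightarrow> real"
  assumes "\<And>t. R < \<bar>t\<bar> \<Longrightarrow> \<phi> t = 0" "R < \<bar>t\<bar>"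
  shows "deriv \<phi> t = 0"
proof -
  have "open {s::real. R < \<bar>s\<bar>}" by (intro open_Collect_less continuous_intros)
  have "((\<lambda>_. 0) has_real_derivative 0) (at t)" by simp
  then have "(\<phi> has_real_derivative 0) (at t)"
    by (rule has_field_derivative_transform_within_open[OF _ \<open>open {s. R < \<bar>s\<bar>}\<close>]) (use assms in auto)
  then show ?thesis by (rule DERIV_imp_deriv)
qed

lemma test_fun_deriv: "test_fun \<phi> \<Longrightarrow> test_fun (deriv \<phi>)"
  unfolding test_fun_iff using smoothD(2) deriv_outside by metis

lemma test_fun_deriv_pow: "test_fun \<phi> \<Longrightarrow> test_fun ((deriv ^^ k) \<phi>)"
  by (induction k) (auto intro: test_fun_deriv)

lemma test_fun_lincomb:
  assumes "test_fun \<phi>" "test_fun \<psi>"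
  shows "test_fun (\<lambda>t. a * \<phi> t + b * \<psi> t)"
proof -
  obtain R S where "\<forall>t. R < \<bar>t\<bar> \<longrightarrow> \<phi> t = 0" "\<forall>t. S < \<bar>t\<bar> \<longrightarrow> \<psi> t = 0" using assms unfolding test_fun_iff by blast
  then have "\<forall>t. max R S < \<bar>t\<bar> \<longrightarrow> a * \<phi> t + b * \<psi> t = 0" by auto
  moreover have "smooth (\<lambda>t. a * \<phi> t + b * \<psi> t)" using assms by (intro smooth_add smooth_cmult) (auto simp: test_fun_iff)
  ultimately show ?thesis unfolding test_fun_iff by blast
qed

text \<open>The exponent is -n times a bump that is positive exactly between a and b; with growing n
  these functions increase to the indicator of the open interval and stay below 1.\<close>

lemma interval_test_functions:
  assumes "a < b"
  shows "test_fun (\<lambda>t. 1 - exp (- (real n * (flat 1 (t - a) * flat 1 (b - t)))))"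
    (is "test_fun ?f")
proof -
  have "smooth (\<lambda>t. flat 1 (-a + 1 * t))" "smooth (\<lambda>t. flat 1 (b + (-1) * t))" by (intro smooth_affine smooth_flat)+
  then have "smooth (\<lambda>t. flat 1 (t - a) * flat 1 (b - t))" by (intro smooth_mult) simp_all
  then have "smooth (\<lambda>t. 1 + (-1) * exp ((- real n) * (flat 1 (t - a) * flat 1 (b - t))))"
    by (intro smooth_add smooth_const smooth_cmult smooth_exp)
  then have sm: "smooth ?f" by simp
  have out: "?f t = 0" if "max \<bar>a\<bar> \<bar>b\<bar> < \<bar>t\<bar>" for t
  proof -
    have "t \<le> a \<or> b \<le> t" using that by linarith
    then show ?thesis by (auto simp: flat_def)
  qed
  show ?thesis unfolding test_fun_iff
    by (intro conjI sm exI[of _ "max \<bar>a\<bar> \<bar>b\<bar>"] allI impI out)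
qed

lemma test_fun_mult_integrable:
  assumes "test_fun \<phi>" and f: "\<And>a b. set_integrable lborel {a..b} f"
  shows "integrable lborel (\<lambda>t. \<phi> t * f t)"
    "\<exists>R. \<forall>S\<ge>R. (LINT t|lborel. \<phi> t * f t) = (LINT t:{-S..S}|lborel. \<phi> t * f t)"
proof -
  obtain R where R: "\<And>t. R < \<bar>t\<bar> \<Longrightarrow> \<phi> t = 0" and s: "smooth \<phi>" using assms(1) unfolding test_fun_iff by blast
  have e: "\<phi> t * f t = indicat_real {-S..S} t *\<^sub>R (\<phi> t * f t)" if "S \<ge> R" for S t
    using R[of t] that by (cases "R < \<bar>t\<bar>") (auto simp: indicator_def not_less abs_le_iff)
  show "integrable lborel (\<lambda>t. \<phi> t * f t)"
    using set_integrable_continuous_mult[OF smoothD(3)[OF s] f, of "-R" R]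
    unfolding set_integrable_def e[OF order_refl, symmetric] .
  show "\<exists>R. \<forall>S\<ge>R. (LINT t|lborel. \<phi> t * f t) = (LINT t:{-S..S}|lborel. \<phi> t * f t)"
    unfolding set_lebesgue_integral_def using e by (intro exI[of _ R]) (auto intro!: Bochner_Integration.integral_cong)
qed

lemma test_fun_parts:
  assumes phi: "test_fun \<phi>" and F: "antideriv F f"
  shows "(LINT t|lborel. deriv \<phi> t * F t) = - (LINT t|lborel. \<phi> t * f t)"
proof -
  have s: "smooth \<phi>" using phi by (simp add: test_fun_iff)
  have fi: "set_integrable lborel {a..b} f" for a b
  proof (cases "a \<le> b")
    case True then show ?thesis by (rule antiderivD(1)[OF F])
  qed (simp add: set_integrable_def)
  have Fi: "set_integrable lborel {a..b} F" for a b
    by (intro borel_integrable_atLeastAtMost' antideriv_continuous[OF F])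
  have pa: "antideriv \<phi> (deriv \<phi>)"
    by (rule antideriv_C1)
       (use smoothD(1)[OF s] smoothD(3)[OF smoothD(2)[OF s]] in \<open>auto simp: has_real_derivative_iff_has_vector_derivative\<close>)
  obtain R0 where R0: "\<And>t. R0 < \<bar>t\<bar> \<Longrightarrow> \<phi> t = 0" using phi unfolding test_fun_iff by blast
  obtain R1 where R1: "\<And>S. S \<ge> R1 \<Longrightarrow> (LINT t|lborel. deriv \<phi> t * F t) = (LINT t:{-S..S}|lborel. deriv \<phi> t * F t)"
    using test_fun_mult_integrable(2)[OF test_fun_deriv[OF phi] Fi] by blast
  obtain R2 where R2: "\<And>S. S \<ge> R2 \<Longrightarrow> (LINT t|lborel. \<phi> t * f t) = (LINT t:{-S..S}|lborel. \<phi> t * f t)"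
    using test_fun_mult_integrable(2)[OF phi fi] by blast
  define S where "S = \<bar>R0\<bar> + \<bar>R1\<bar> + \<bar>R2\<bar> + 1"
  have S: "R0 < \<bar>S\<bar>" "S \<ge> R1" "S \<ge> R2" "-S \<le> S" unfolding S_def by auto
  have i1: "set_integrable lborel {-S..S} (\<lambda>t. deriv \<phi> t * F t)"
    by (rule set_integrable_continuous_mult[OF smoothD(3)[OF smoothD(2)[OF s]] Fi])
  have i2: "set_integrable lborel {-S..S} (\<lambda>t. \<phi> t * f t)"
    by (rule set_integrable_continuous_mult[OF smoothD(3)[OF s] fi])
  have "(LINT t:{-S..S}|lborel. deriv \<phi> t * F t + \<phi> t * f t) = \<phi> S * F S - \<phi> (-S) * F (-S)"
    using antiderivD(2)[OF antideriv_mult[OF pa F] S(4)] by simp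
  also have "\<dots> = 0" using R0[of S] R0[of "-S"] S(1) by simp
  finally show ?thesis unfolding R1[OF S(2)] R2[OF S(3)] using set_integral_add(2)[OF i1 i2] by simp
qed

section \<open>The fundamental lemma of the calculus of variations\<close>

text \<open>Half-lines generate the Borel sets and are stable under intersection, so vanishing
  integrals spread from intervals to all Borel sets; the truncation to [-n, n] makes w integrable on
  the whole line.\<close>

lemma antideriv_zero_AE:
  fixes w :: "real \<Rightarrow> real"
  assumes wi: "\<And>a b. set_integrable lborel {a..b} w" and z: "\<And>a b. a < b \<Longrightarrow> (LINT t:{a..b}|lborel. w t) = 0"
  shows "AE t in lborel. w t = 0"
proof -
  have "AE t in lborel. indicat_real {-real n..real n} t * w t = 0" for n
  proof -
    define v where "v t = indicat_real {-real n..real n} t * w t" for t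
    have v: "integrable lborel v" using wi[of "-real n" "real n"] by (simp add: set_integrable_def v_def[abs_def])
    have vA: "set_integrable lborel A v" if "A \<in> sets borel" for A
      unfolding set_integrable_def using v that by (intro integrable_mult_indicator) auto
    have "(LINT t:A|lborel. v t) = 0" if A: "A \<in> sigma_sets UNIV (range (\<lambda>a::real. {..a}))" for A
    proof -
      have sb: "sigma_sets UNIV (range (\<lambda>a::real. {..a})) = sets borel"
        by (simp add: borel_eq_atMost)
      have Ist: "Int_stable (range (\<lambda>a::real. {..a}))" unfolding Int_stable_def by auto
      have bas: "(LINT t:{..a}|lborel. v t) = 0" for a
      proof -
        have "(LINT t:{..a}|lborel. v t) = (LINT t:{-real n..min a (real n)}|lborel. w t)"
          unfolding set_lebesgue_integral_def v_def by (intro Bochner_Integration.integral_cong) (auto simp: indicator_def)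
        also have "\<dots> = 0"
        proof (cases "-real n < min a (real n)")
          case True then show ?thesis by (rule z)
        next
          case False
          have "AE t in lborel. indicat_real {-real n..min a (real n)} t *\<^sub>R w t = 0"
            using AE_not_equal[of "-real n"] by eventually_elim (use False in \<open>auto simp: indicator_def\<close>)
          then show ?thesis unfolding set_lebesgue_integral_def by (rule integral_eq_zero_AE)
        qed
        finally show ?thesis .
      qed
      have "(LINT t:UNIV|lborel. v t) = (LINT t:{..real n}|lborel. v t)"
        unfolding set_lebesgue_integral_def v_def by (intro Bochner_Integration.integral_cong) (auto simp: indicator_def)
      then have all: "(LINT t:UNIV|lborel. v t) = 0" using bas by simp
      show ?thesis
      proof (rule sigma_sets_induct_disjoint[OF Ist _ A])
        show "range (\<lambda>a::real. {..a}) \<subseteq> Pow UNIV" by simp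
        show "\<And>A. A \<in> range (\<lambda>a. {..a}) \<Longrightarrow> (LINT t:A|lborel. v t) = 0" using bas by auto
        show "(LINT t:{}|lborel. v t) = 0" by (simp add: set_lebesgue_integral_def)
        show "(LINT t:UNIV - A|lborel. v t) = 0"
          if A: "A \<in> sigma_sets UNIV (range (\<lambda>a. {..a}))" and 0: "(LINT t:A|lborel. v t) = 0" for A
        proof -
          have A': "A \<in> sets borel" using A sb by simp
          have "(LINT t:A \<union> (UNIV - A)|lborel. v t) = (LINT t:A|lborel. v t) + (LINT t:UNIV - A|lborel. v t)"
            by (rule set_integral_Un) (use A' in \<open>auto intro!: vA\<close>)
          then show ?thesis using all 0 by simp
        qed
        show "(LINT t:(\<Union>i::nat. A i)|lborel. v t) = 0"
          if A: "disjoint_family A" "range A \<subseteq> sigma_sets UNIV (range (\<lambda>a. {..a}))" "\<And>i. (LINT t:A i|lborel. v t) = 0" for A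
        proof -
          have A': "A i \<in> sets borel" for i using A(2) sb by auto
          have "(LINT t:(\<Union>i::nat. A i)|lborel. v t) = (\<Sum>i. (LINT t:A i|lborel. v t))"
            by (rule lebesgue_integral_countable_add)
               (use A' A(1) in \<open>auto simp: disjoint_family_on_def intro!: vA\<close>)
          then show ?thesis using A(3) by simp
        qed
      qed
    qed
    then have "(LINT t:A|lborel. v t) = (LINT t:A|lborel. 0)" if "A \<in> sets lborel" for A
      using that by (simp add: borel_eq_atMost set_lebesgue_integral_def)
    from density_unique_real[OF v _ this] show ?thesis unfolding v_def by simp
  qed
  then have "AE t in lborel. \<forall>n. indicat_real {-real n..real n} t * w t = 0"
    by (intro AE_all_countable[THEN iffD2] allI)
  then show ?thesis
  proof eventually_elim
    case (elim t)
    obtain n :: nat where "\<bar>t\<bar> \<le> n" using real_arch_simple by blast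
    then show ?case using elim[rule_format, of n] by (auto simp: indicator_def abs_le_iff split: if_splits)
  qed
qed

text \<open>Dominated convergence along the functions of \<open>interval_test_functions\<close>
  passes from smooth test functions to intervals.\<close>

lemma fundamental_lemma:
  fixes w :: "real \<Rightarrow> real"
  assumes wi: "\<And>a b. set_integrable lborel {a..b} w" and z: "\<And>\<phi>. test_fun \<phi> \<Longrightarrow> (LINT t|lborel. \<phi> t * w t) = 0"
  shows "AE t in lborel. w t = 0"
proof (rule antideriv_zero_AE[OF wi])
  fix a b :: real assume ab: "a < b"
  define f where "f n t = 1 - exp (- (real n * (flat 1 (t - a) * flat 1 (b - t))))" for n t
  have t: "test_fun (f n)" for n unfolding f_def[abs_def] by (rule interval_test_functions[OF ab])
  have w: "integrable lborel (\<lambda>t. indicat_real {a..b} t * w t)" using wi[of a b] by (simp add: set_integrable_def)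
  have fb: "0 \<le> f n t \<and> f n t \<le> indicat_real {a..b} t" for n t
    by (auto simp: f_def indicator_def flat_def)
  have "(\<lambda>n. LINT t|lborel. f n t * w t) \<longlonglongrightarrow> (LINT t|lborel. indicat_real {a<..<b} t * w t)"
  proof (rule integral_dominated_convergence[where w = "\<lambda>t. \<bar>indicat_real {a..b} t * w t\<bar>"])
    have "(\<lambda>t. w t) \<in> borel_measurable lborel"
    proof (rule borel_measurable_LIMSEQ_real)
      show "(\<lambda>n. indicat_real {-real n..real n} t * w t) \<longlonglongrightarrow> w t" for t
      proof (rule tendsto_eventually)
        obtain N :: nat where "\<bar>t\<bar> \<le> N" using real_arch_simple by blast
        then show "eventually (\<lambda>n. indicat_real {-real n..real n} t * w t = w t) sequentially"
          unfolding eventually_sequentially by (intro exI[of _ N]) (auto simp: indicator_def)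
      qed
      show "(\<lambda>t. indicat_real {-real n..real n} t * w t) \<in> borel_measurable lborel" for n
        using wi[of "-real n" "real n"] unfolding set_integrable_def by (auto dest: borel_measurable_integrable)
    qed
    then show "(\<lambda>t. indicat_real {a<..<b} t * w t) \<in> borel_measurable lborel" by simp
    show "(\<lambda>t. f n t * w t) \<in> borel_measurable lborel" for n
      using test_fun_mult_integrable(1)[OF t wi] by (rule borel_measurable_integrable)
    show "integrable lborel (\<lambda>t. \<bar>indicat_real {a..b} t * w t\<bar>)" using w by (rule integrable_abs)
    show "AE t in lborel. (\<lambda>n. f n t * w t) \<longlonglongrightarrow> indicat_real {a<..<b} t * w t"
    proof (rule AE_I2)
      fix t
      have "(\<lambda>n. f n t) \<longlonglongrightarrow> indicat_real {a<..<b} t"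
      proof (cases "a < t \<and> t < b")
        case True
        define c where "c = flat 1 (t - a) * flat 1 (b - t)"
        have c: "c > 0" using True by (simp add: c_def flat_def)
        have "(\<lambda>n. 1 - exp (- c) ^ n) \<longlonglongrightarrow> 1 - 0" by (intro tendsto_intros LIMSEQ_realpow_zero) (use c in auto)
        moreover have "exp (- c) ^ n = exp (- (real n * c))" for n by (simp add: exp_of_nat_mult[symmetric])
        ultimately show ?thesis using True by (simp add: f_def c_def)
      next
        case False
        then have "f n t = 0" for n by (auto simp: f_def flat_def)
        then show ?thesis using False by auto
      qed
      then show "(\<lambda>n. f n t * w t) \<longlonglongrightarrow> indicat_real {a<..<b} t * w t" by (intro tendsto_intros)
    qed
    show "AE t in lborel. norm (f n t * w t) \<le> \<bar>indicat_real {a..b} t * w t\<bar>" for n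
      using fb by (auto simp: abs_mult intro!: AE_I2 mult_right_mono)
  qed
  moreover have "(LINT t|lborel. f n t * w t) = 0" for n by (rule z[OF t])
  ultimately have "(LINT t|lborel. indicat_real {a<..<b} t * w t) = 0" by (simp add: LIMSEQ_const_iff)
  moreover have "(LINT t|lborel. indicat_real {a..b} t * w t) = (LINT t|lborel. indicat_real {a<..<b} t * w t)"
  proof (rule integral_cong_AE)
    show "AE t in lborel. indicat_real {a..b} t * w t = indicat_real {a<..<b} t * w t"
      using AE_not_equal[of a] AE_not_equal[of b] by eventually_elim (auto simp: indicator_def)
    show "(\<lambda>t. indicat_real {a..b} t * w t) \<in> borel_measurable lborel" using w by (rule borel_measurable_integrable)
    have "(\<lambda>t. indicat_real {a<..<b} t * (indicat_real {a..b} t * w t)) \<in> borel_measurable lborel"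
      using borel_measurable_integrable[OF w] by simp
    moreover have "indicat_real {a<..<b} t * (indicat_real {a..b} t * w t) = indicat_real {a<..<b} t * w t" for t
      by (auto simp: indicator_def)
    ultimately show "(\<lambda>t. indicat_real {a<..<b} t * w t) \<in> borel_measurable lborel" by simp
  qed
  ultimately show "(LINT t:{a..b}|lborel. w t) = 0" by (simp add: set_lebesgue_integral_def)
qed

lemma continuous_AE_zero:
  fixes f :: "real \<Rightarrow> real"
  assumes c: "continuous_on UNIV f" and z: "AE t in lborel. f t = 0"
  shows "f t = 0"
proof (rule ccontr)
  assume nz: "f t \<noteq> 0"
  have "open {s. f s \<noteq> 0}" using c by (simp add: open_Collect_neq continuous_on_const)
  then obtain e where e: "e > 0" "ball t e \<subseteq> {s. f s \<noteq> 0}" using nz unfolding open_contains_ball by auto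
  have "{s. f s \<noteq> 0} \<in> sets borel" using \<open>open {s. f s \<noteq> 0}\<close> by simp
  then have n: "{s. f s \<noteq> 0} \<in> null_sets lborel" using z AE_iff_null_sets[of "{s. f s \<noteq> 0}" lborel] by simp
  have "ball t e \<in> null_sets lborel" by (rule null_sets_subset[OF n _ e(2)]) simp
  then have "emeasure lborel (ball t e) = 0" by (rule null_setsD1)
  moreover have "ball t e = {t - e<..<t + e}" by (auto simp: ball_def dist_real_def)
  ultimately show False using e(1) by simp
qed

section \<open>Weak solutions of differential equations\<close>

definition locint :: "(real \<Rightarrow> real) \<Rightarrow> bool" where "locint f \<longleftrightarrow> (\<forall>a b. set_integrable lborel {a..b} f)"

lemma locintD: "locint f \<Longrightarrow> set_integrable lborel {a..b} f" by (simp add: locint_def)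

lemma locint_continuous: "continuous_on UNIV f \<Longrightarrow> locint f"
  unfolding locint_def by (auto intro!: borel_integrable_atLeastAtMost' intro: continuous_on_subset)

lemma locint_component: "L2loc u \<Longrightarrow> locint (\<lambda>t. u t $ i)" for u :: "real \<Rightarrow> real^'k"
  unfolding locint_def
proof (intro allI)
  fix a b :: real assume "L2loc u"
  from L2loc_set_integrable[OF this, of a b]
  have "integrable lborel (\<lambda>t. (indicat_real {a..b} t *\<^sub>R u t) $ i)"
    unfolding set_integrable_def by (rule integrable_bounded_linear[OF bounded_linear_vec_nth])
  then show "set_integrable lborel {a..b} (\<lambda>t. u t $ i)" by (simp add: set_integrable_def)
qed

lemma adj_op_eq: "degree p \<le> n \<Longrightarrow> adj_op p \<phi> t = (\<Sum>k\<le>n. coeff p k * (-1) ^ k * (deriv ^^ k) \<phi> t)"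
  unfolding adj_op_def by (intro sum.mono_neutral_left) (auto simp: coeff_eq_0)

lemma adj_op_0 [simp]: "adj_op 0 \<phi> t = 0" by (simp add: adj_op_def)

text \<open>Horner form of the formal adjoint, on which the inductions over the polynomial rest; the
  sign is that of one integration by parts.\<close>

lemma adj_op_pCons: "adj_op (pCons a p) \<phi> t = a * \<phi> t - adj_op p (deriv \<phi>) t"
proof -
  have "adj_op (pCons a p) \<phi> t = (\<Sum>k\<le>Suc (degree p). coeff (pCons a p) k * (-1) ^ k * (deriv ^^ k) \<phi> t)"
    by (rule adj_op_eq) (rule degree_pCons_le)
  also have "\<dots> = a * \<phi> t + (\<Sum>k\<le>degree p. coeff p k * (-1) ^ Suc k * (deriv ^^ Suc k) \<phi> t)"
    by (subst sum.atMost_Suc_shift) simp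
  also have "(\<Sum>k\<le>degree p. coeff p k * (-1) ^ Suc k * (deriv ^^ Suc k) \<phi> t) = - adj_op p (deriv \<phi>) t"
    by (simp add: adj_op_def funpow_Suc_right sum_negf del: funpow.simps)
  finally show ?thesis by simp
qed

lemma adj_op_add: "adj_op (p + q) \<phi> t = adj_op p \<phi> t + adj_op q \<phi> t"
  using degree_add_le_max[of p q]
  by (simp add: adj_op_eq[of "p + q" "max (degree p) (degree q)"] adj_op_eq[of p "max (degree p) (degree q)"]
      adj_op_eq[of q "max (degree p) (degree q)"] algebra_simps sum.distrib)

lemma adj_op_smult: "adj_op (smult a p) \<phi> t = a * adj_op p \<phi> t"
  by (simp add: adj_op_eq[of "smult a p" "degree p"] adj_op_def sum_distrib_left mult.assoc degree_smult_le)

lemma adj_op_sum: "adj_op (sum p S) \<phi> t = (\<Sum>i\<in>S. adj_op (p i) \<phi> t)"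
  by (induction S rule: infinite_finite_induct) (auto simp: adj_op_add)

lemma test_fun_smooth: "test_fun \<phi> \<Longrightarrow> smooth \<phi>" by (simp add: test_fun_iff)

lemma test_fun_adj_op: "test_fun \<phi> \<Longrightarrow> test_fun (adj_op p \<phi>)"
proof (induction p arbitrary: \<phi>)
  case 0
  then show ?case by (auto simp: test_fun_iff adj_op_0[abs_def] smooth_const)
next
  case (pCons a p)
  have "test_fun (\<lambda>t. a * \<phi> t + (-1) * adj_op p (deriv \<phi>) t)"
    by (intro test_fun_lincomb pCons test_fun_deriv)
  then show ?case by (simp add: adj_op_pCons[abs_def])
qed

lemma deriv_adj_op: "test_fun \<phi> \<Longrightarrow> deriv (adj_op p \<phi>) = adj_op p (deriv \<phi>)"
proof (induction p arbitrary: \<phi>)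
  case 0
  then show ?case by (auto simp: fun_eq_iff adj_op_0[abs_def])
next
  case (pCons a p)
  note d = test_fun_deriv[OF pCons.prems]
  show ?case
  proof (rule derivI)
    fix t
    have "((\<lambda>t. a * \<phi> t - adj_op p (deriv \<phi>) t) has_real_derivative (a * deriv \<phi> t - deriv (adj_op p (deriv \<phi>)) t)) (at t)"
      by (intro DERIV_diff DERIV_cmult smoothD(1) test_fun_smooth pCons.prems test_fun_adj_op d)
    then show "(adj_op (pCons a p) \<phi> has_real_derivative adj_op (pCons a p) (deriv \<phi>) t) (at t)"
      using pCons.IH[OF d] by (simp add: adj_op_pCons[abs_def] adj_op_pCons)
  qed
qed

lemma adj_op_mult: "test_fun \<phi> \<Longrightarrow> adj_op (p * q) \<phi> t = adj_op p (adj_op q \<phi>) t"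
proof (induction p arbitrary: \<phi> t)
  case (pCons a p)
  have "adj_op (pCons a p * q) \<phi> t = a * adj_op q \<phi> t - adj_op (p * q) (deriv \<phi>) t"
    by (simp add: adj_op_add adj_op_smult adj_op_pCons)
  also have "\<dots> = a * adj_op q \<phi> t - adj_op p (deriv (adj_op q \<phi>)) t"
    using pCons.IH[OF test_fun_deriv[OF pCons.prems]] deriv_adj_op[OF pCons.prems] by simp
  finally show ?case by (simp add: adj_op_pCons)
qed simp

text \<open>The pairing of the distribution p(d/dt) f with a test function.\<close>
definition wk :: "real poly \<Rightarrow> (real \<Rightarrow> real) \<Rightarrow> (real \<Rightarrow> real) \<Rightarrow> real" where
  "wk p f \<phi> = (LINT t|lborel. adj_op p \<phi> t * f t)"

lemma wk_integrable: "test_fun \<phi> \<Longrightarrow> locint f \<Longrightarrow> integrable lborel (\<lambda>t. adj_op p \<phi> t * f t)"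
  by (intro test_fun_mult_integrable(1) test_fun_adj_op locintD)

lemma wk_add: "test_fun \<phi> \<Longrightarrow> locint f \<Longrightarrow> wk (p + q) f \<phi> = wk p f \<phi> + wk q f \<phi>"
  unfolding wk_def by (simp add: adj_op_add distrib_right wk_integrable)

lemma wk_sum: "test_fun \<phi> \<Longrightarrow> locint f \<Longrightarrow> wk (sum p S) f \<phi> = (\<Sum>i\<in>S. wk (p i) f \<phi>)"
  unfolding wk_def by (simp add: adj_op_sum sum_distrib_right wk_integrable)

lemma wk_const_mult: "wk (p * [:c:]) f \<phi> = c * wk p f \<phi>"
  unfolding wk_def by (simp add: adj_op_smult mult.assoc)

lemma wk_diff: "test_fun \<phi> \<Longrightarrow> locint f \<Longrightarrow> wk (p - q) f \<phi> = wk p f \<phi> - wk q f \<phi>"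
  using wk_add[of \<phi> f p "q * [:-1:]"] wk_const_mult[of q "-1" f \<phi>] by simp

lemma wk_mult: "test_fun \<phi> \<Longrightarrow> wk (p * q) f \<phi> = wk p f (adj_op q \<phi>)"
  unfolding wk_def by (simp add: adj_op_mult)

lemma wk_fun_add: "test_fun \<phi> \<Longrightarrow> locint f \<Longrightarrow> locint g \<Longrightarrow> wk p (\<lambda>t. f t + g t) \<phi> = wk p f \<phi> + wk p g \<phi>"
  unfolding wk_def by (simp add: distrib_left wk_integrable)

lemma wk_fun_cmult: "wk p (\<lambda>t. c * f t) \<phi> = c * wk p f \<phi>"
  unfolding wk_def by (simp add: mult.left_commute)

lemma wk_fun_diff: "test_fun \<phi> \<Longrightarrow> locint f \<Longrightarrow> locint g \<Longrightarrow> wk p (\<lambda>t. f t - g t) \<phi> = wk p f \<phi> - wk p g \<phi>"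
  unfolding wk_def by (simp add: right_diff_distrib wk_integrable)

lemma wk_fun_sum:
  "test_fun \<phi> \<Longrightarrow> (\<And>i. i \<in> S \<Longrightarrow> locint (f i)) \<Longrightarrow> wk p (\<lambda>t. \<Sum>i\<in>S. f i t) \<phi> = (\<Sum>i\<in>S. wk p (f i) \<phi>)"
  unfolding wk_def by (simp add: sum_distrib_left wk_integrable)

lemma wk_matrix:
  fixes x :: "real \<Rightarrow> real^'k" and M :: "real^'k^'l"
  assumes "test_fun \<phi>" "L2loc x"
  shows "wk p (\<lambda>t. (M *v x t) $ i) \<phi> = (\<Sum>j\<in>UNIV. M $ i $ j * wk p (\<lambda>t. x t $ j) \<phi>)"
proof -
  have "locint (\<lambda>t. M $ i $ j * x t $ j)" for j
    using locint_component[OF assms(2), of j] unfolding locint_def by simp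
  then have "wk p (\<lambda>t. \<Sum>j\<in>UNIV. M $ i $ j * x t $ j) \<phi> = (\<Sum>j\<in>UNIV. wk p (\<lambda>t. M $ i $ j * x t $ j) \<phi>)"
    by (intro wk_fun_sum assms(1))
  then show ?thesis by (simp add: matrix_vector_mult_def wk_fun_cmult)
qed

text \<open>The factor \<open>[:0, 1:]\<close> stands for d/dt; an integration by parts moves it
  from the test function to \<open>F\<close>.\<close>

lemma wk_pCons_0:
  assumes "test_fun \<phi>" "antideriv F f"
  shows "wk ([:0, 1:] * p) F \<phi> = wk p f \<phi>"
proof -
  have "wk ([:0, 1:] * p) F \<phi> = (LINT t|lborel. - (adj_op p (deriv \<phi>) t * F t))"
    unfolding wk_def by (simp add: adj_op_pCons)
  also have "\<dots> = - (LINT t|lborel. deriv (adj_op p \<phi>) t * F t)" unfolding deriv_adj_op[OF assms(1)] by simp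
  also have "\<dots> = wk p f \<phi>" unfolding wk_def using test_fun_parts[OF test_fun_adj_op[OF assms(1)] assms(2)] by simp
  finally show ?thesis .
qed

lemma smooth_antideriv: "smooth h \<Longrightarrow> antideriv h (deriv h)"
  by (rule antideriv_C1) (use smoothD(1) smoothD(3)[OF smoothD(2)] in \<open>auto simp: has_real_derivative_iff_has_vector_derivative\<close>)

definition diffop :: "real poly \<Rightarrow> (real \<Rightarrow> real) \<Rightarrow> real \<Rightarrow> real" where
  "diffop p h t = (\<Sum>k\<le>degree p. coeff p k * (deriv ^^ k) h t)"

lemma smooth_diffop: "smooth h \<Longrightarrow> smooth (diffop p h)"
  unfolding diffop_def[abs_def] by (intro smooth_sum smooth_cmult smooth_deriv_pow)

lemma diffop_pCons: "diffop (pCons a p) h t = a * h t + diffop p (deriv h) t"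
proof -
  have "diffop (pCons a p) h t = (\<Sum>k\<le>Suc (degree p). coeff (pCons a p) k * (deriv ^^ k) h t)"
    unfolding diffop_def by (intro sum.mono_neutral_left) (auto simp: coeff_eq_0 degree_pCons_le)
  also have "\<dots> = a * h t + (\<Sum>k\<le>degree p. coeff p k * (deriv ^^ Suc k) h t)"
    by (subst sum.atMost_Suc_shift) simp
  finally show ?thesis by (simp add: diffop_def funpow_Suc_right del: funpow.simps)
qed

lemma wk_smooth:
  assumes "test_fun \<phi>" "smooth h"
  shows "wk p h \<phi> = (LINT t|lborel. \<phi> t * diffop p h t)"
  using assms(2)
proof (induction p arbitrary: h)
  case 0 then show ?case by (simp add: wk_def diffop_def)
next
  case (pCons a p)
  note h' = smoothD(2)[OF pCons.prems]
  have li: "locint f" if "smooth f" for f using smoothD(3)[OF that] by (rule locint_continuous)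
  have "pCons a p = [:1:] * [:a:] + [:0, 1:] * p" by simp
  then have "wk (pCons a p) h \<phi> = wk ([:1:] * [:a:]) h \<phi> + wk ([:0, 1:] * p) h \<phi>"
    using wk_add[OF assms(1) li[OF pCons.prems]] by metis
  also have "wk ([:1:] * [:a:]) h \<phi> = a * (LINT t|lborel. \<phi> t * h t)"
    unfolding wk_const_mult by (simp add: wk_def adj_op_pCons)
  also have "wk ([:0, 1:] * p) h \<phi> = (LINT t|lborel. \<phi> t * diffop p (deriv h) t)"
    using wk_pCons_0[OF assms(1) smooth_antideriv[OF pCons.prems]] pCons.IH[OF h'] by simp
  also have "a * (LINT t|lborel. \<phi> t * h t) + (LINT t|lborel. \<phi> t * diffop p (deriv h) t)
    = (LINT t|lborel. \<phi> t * diffop (pCons a p) h t)"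
    using test_fun_mult_integrable(1)[OF assms(1) locintD[OF li[OF pCons.prems]]]
      test_fun_mult_integrable(1)[OF assms(1) locintD[OF li[OF smooth_diffop[OF h']]]]
    by (simp add: diffop_pCons distrib_left mult.left_commute)
  finally show ?case .
qed

text \<open>For smooth arguments the tested expression is an ordinary continuous function; it
  vanishes almost everywhere by the fundamental lemma, hence everywhere.\<close>

lemma weak_to_strong:
  assumes h: "\<And>j. j \<in> J \<Longrightarrow> smooth (h j)"
    and z: "\<And>\<phi>. test_fun \<phi> \<Longrightarrow> (\<Sum>j\<in>J. wk (q j) (h j) \<phi>) = 0"
  shows "(\<Sum>j\<in>J. diffop (q j) (h j) t) = 0"
proof -
  define f where "f t = (\<Sum>j\<in>J. diffop (q j) (h j) t)" for t
  have sm: "smooth f" unfolding f_def[abs_def] by (intro smooth_sum smooth_diffop h)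
  have "AE t in lborel. f t = 0"
  proof (rule fundamental_lemma)
    show "set_integrable lborel {a..b} f" for a b by (intro locintD locint_continuous smoothD(3)[OF sm])
    fix \<phi> assume phi: "test_fun \<phi>"
    have "(LINT t|lborel. \<phi> t * f t) = (LINT t|lborel. (\<Sum>j\<in>J. \<phi> t * diffop (q j) (h j) t))"
      by (simp add: f_def sum_distrib_left)
    also have "\<dots> = (\<Sum>j\<in>J. (LINT t|lborel. \<phi> t * diffop (q j) (h j) t))"
      by (intro Bochner_Integration.integral_sum test_fun_mult_integrable(1)[OF phi] locintD locint_continuous smoothD(3) smooth_diffop h)
    also have "\<dots> = 0" using z[OF phi] by (simp add: wk_smooth[OF phi h])
    finally show "(LINT t|lborel. \<phi> t * f t) = 0" .
  qed
  from continuous_AE_zero[OF smoothD(3)[OF sm] this] show ?thesis by (simp add: f_def)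
qed

lemma antideriv_DERIV:
  fixes F :: "real \<Rightarrow> real"
  assumes F: "antideriv F g" and g: "continuous_on UNIV g"
  shows "(F has_real_derivative g t) (at t)"
proof -
  have i: "((\<lambda>u. integral {t - 1..u} g) has_vector_derivative g t) (at t within {t - 1..t + 1})"
    by (rule integral_has_vector_derivative[OF continuous_on_subset[OF g]]) auto
  have "((\<lambda>u. F (t - 1) + integral {t - 1..u} g) has_vector_derivative 0 + g t) (at t within {t - 1..t + 1})"
    by (intro has_vector_derivative_add has_vector_derivative_const i)
  then have i2: "((\<lambda>u. F (t - 1) + integral {t - 1..u} g) has_vector_derivative g t) (at t within {t - 1..t + 1})" by simp
  have "(F has_vector_derivative g t) (at t within {t - 1..t + 1})"
  proof (rule has_vector_derivative_transform[OF _ _ i2])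
    fix u assume "u \<in> {t - 1..t + 1}"
    then show "F u = F (t - 1) + integral {t - 1..u} g"
      using antiderivD[OF F, of "t - 1" u] set_borel_integral_eq_integral(2)[of "{t - 1..u}" g] by simp
  qed simp_all
  moreover have "at t within {t - 1..t + 1} = at t" by (rule at_within_interior) simp
  ultimately show ?thesis by (simp add: has_real_derivative_iff_has_vector_derivative)
qed

text \<open>Zero mean makes the antiderivative vanish to the right of the support as well as to the
  left.\<close>

lemma test_fun_antiderivative:
  assumes psi: "test_fun \<psi>" and z: "(LINT t|lborel. \<psi> t) = 0"
  shows "\<exists>\<phi>. test_fun \<phi> \<and> deriv \<phi> = \<psi>"
proof -
  have s: "smooth \<psi>" using psi by (rule test_fun_smooth)
  obtain R where R: "\<And>t. R < \<bar>t\<bar> \<Longrightarrow> \<psi> t = 0" using psi unfolding test_fun_iff by blast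
  define S where "S = \<bar>R\<bar> + 1"
  obtain F where F: "antideriv F \<psi>" "F (-S) = 0"
    using antideriv_exists[of \<psi>] locintD[OF locint_continuous[OF smoothD(3)[OF s]]] by blast
  have der: "(F has_real_derivative \<psi> t) (at t)" for t
    by (rule antideriv_DERIV[OF F(1) smoothD(3)[OF s]])
  have "F t = 0" if "S < \<bar>t\<bar>" for t
  proof (cases "t < 0")
    case True
    have "F (-S) - F t = (LINT s:{t..-S}|lborel. \<psi> s)" by (rule antiderivD(2)[OF F(1)]) (use that True in simp)
    also have "\<dots> = (LINT s:{t..-S}|lborel. 0)"
      by (rule set_lebesgue_integral_cong) (auto intro!: R simp: S_def)
    finally show ?thesis using F(2) by (simp add: set_lebesgue_integral_def)
  next
    case False
    have "F t - F (-S) = (LINT s:{-S..t}|lborel. \<psi> s)" by (rule antiderivD(2)[OF F(1)]) (use that False in \<open>simp add: S_def\<close>)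
    also have "\<dots> = (LINT s|lborel. \<psi> s)"
      unfolding set_lebesgue_integral_def
    proof (rule Bochner_Integration.integral_cong[OF refl])
      fix s show "indicat_real {-S..t} s *\<^sub>R \<psi> s = \<psi> s"
        using R[of s] that False by (cases "R < \<bar>s\<bar>") (auto simp: indicator_def S_def abs_le_iff)
    qed
    finally show ?thesis using F(2) z by simp
  qed
  moreover have "smooth F" by (rule smoothI[OF der s])
  ultimately have "test_fun F" unfolding test_fun_iff by blast
  then show ?thesis using derivI[OF der] by blast
qed

lemma test_fun_integrable: "test_fun \<phi> \<Longrightarrow> integrable lborel \<phi>"
  using test_fun_mult_integrable(1)[of \<phi> "\<lambda>_. 1"] set_integrable_const[of _ _ 1] by simp

lemma unit_test_function: "\<exists>\<psi>. test_fun \<psi> \<and> (LINT t|lborel. \<psi> t) = 1"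
proof (rule ccontr)
  assume no: "\<not> ?thesis"
  have z: "(LINT t|lborel. \<phi> t * 1) = 0" if phi: "test_fun \<phi>" for \<phi>
  proof (rule ccontr)
    define c where "c = (LINT t|lborel. \<phi> t)"
    assume "(LINT t|lborel. \<phi> t * 1) \<noteq> 0"
    then have c: "c \<noteq> 0" by (simp add: c_def)
    have "test_fun (\<lambda>t. (1 / c) * \<phi> t + 0 * \<phi> t)" by (intro test_fun_lincomb phi)
    moreover have "(LINT t|lborel. (1 / c) * \<phi> t + 0 * \<phi> t) = 1" using c by (simp add: c_def)
    ultimately show False using no by blast
  qed
  have "AE t::real in lborel. (1::real) = 0"
    by (rule fundamental_lemma[where w = "\<lambda>_. 1"]) (rule set_integrable_const, erule z)
  then have "(1::real) = 0" by (rule continuous_AE_zero[OF continuous_on_const])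
  then show False by simp
qed

text \<open>Du Bois-Reymond by induction: subtracting a monomial c t^n leaves a function annihilated
  already by n-th derivatives. For this, a test function minus a multiple of a fixed one of mean 1
  has mean 0 and is therefore a derivative.\<close>

lemma weak_polynomial:
  assumes w: "locint w" and z: "\<And>\<phi>. test_fun \<phi> \<Longrightarrow> (LINT t|lborel. (deriv ^^ n) \<phi> t * w t) = 0"
  shows "\<exists>p. AE t in lborel. w t = poly p t"
  using assms
proof (induction n arbitrary: w)
  case 0
  have "AE t in lborel. w t = 0" by (rule fundamental_lemma[OF locintD[OF 0(1)]]) (use 0(2) in simp)
  then show ?case by (intro exI[of _ 0]) simp
next
  case (Suc n)
  have mom: "(LINT t|lborel. (deriv ^^ m) \<psi> t * t ^ m) = (-1) ^ m * fact m * (LINT t|lborel. \<psi> t)"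
    if psi: "test_fun \<psi>" for \<psi> m
  proof (induction m)
    case (Suc m)
    have "antideriv (\<lambda>t::real. t ^ Suc m) (\<lambda>t. real (Suc m) * t ^ m)"
      by (rule antideriv_C1) (auto intro!: derivative_eq_intros continuous_intros
          simp flip: has_real_derivative_iff_has_vector_derivative simp del: power_Suc)
    from test_fun_parts[OF test_fun_deriv_pow[OF psi, of m] this]
    have "(LINT t|lborel. (deriv ^^ Suc m) \<psi> t * t ^ Suc m) = - (real (Suc m) * (LINT t|lborel. (deriv ^^ m) \<psi> t * t ^ m))"
      by (simp add: mult.left_commute del: power_Suc)
    then show ?case unfolding Suc by (simp add: mult.assoc)
  qed simp
  obtain \<psi>0 where p0: "test_fun \<psi>0" "(LINT t|lborel. \<psi>0 t) = 1" using unit_test_function by blast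
  \<comment> \<open>By \<open>mom\<close> the n-th derivative of \<open>\<psi>0\<close> paired with
    t^n gives (-1)^n n!, so this \<open>c\<close> makes its pairing with w - c t^n vanish.\<close>
  define c where "c = (LINT t|lborel. (deriv ^^ n) \<psi>0 t * w t) / ((-1) ^ n * fact n)"
  have pw: "locint (\<lambda>t. t ^ n)" by (intro locint_continuous continuous_intros)
  have w': "locint (\<lambda>t. w t - c * t ^ n)"
    using Suc.prems(1) pw unfolding locint_def by (intro allI set_integral_diff) (auto intro: set_integrable_mult_right)
  have i1: "integrable lborel (\<lambda>t. (deriv ^^ k) \<phi> t * w t)" if "test_fun \<phi>" for \<phi> k
    by (intro test_fun_mult_integrable(1) test_fun_deriv_pow that locintD Suc.prems)
  have i2: "integrable lborel (\<lambda>t. (deriv ^^ k) \<phi> t * t ^ n)" if "test_fun \<phi>" for \<phi> k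
    by (intro test_fun_mult_integrable(1) test_fun_deriv_pow that locintD pw)
  have "(LINT t|lborel. (deriv ^^ n) \<psi> t * (w t - c * t ^ n)) = 0" if psi: "test_fun \<psi>" for \<psi>
  proof -
    define m where "m = (LINT t|lborel. \<psi> t)"
    have t: "test_fun (\<lambda>t. 1 * \<psi> t + (-m) * \<psi>0 t)" by (intro test_fun_lincomb psi p0)
    have "(LINT t|lborel. 1 * \<psi> t + (-m) * \<psi>0 t) = 0"
      using test_fun_integrable[OF psi] test_fun_integrable[OF p0(1)] p0(2) by (simp add: m_def)
    then obtain \<phi> where phi: "test_fun \<phi>" "deriv \<phi> = (\<lambda>t. 1 * \<psi> t + (-m) * \<psi>0 t)"
      using test_fun_antiderivative[OF t] by blast
    have "(deriv ^^ Suc n) \<phi> = (\<lambda>t. 1 * (deriv ^^ n) \<psi> t + (-m) * (deriv ^^ n) \<psi>0 t)"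
      unfolding funpow_Suc_right o_def phi(2)
      by (rule deriv_pow_cmult_add) (use psi p0 in \<open>auto intro: test_fun_smooth\<close>)
    then have "(LINT t|lborel. (deriv ^^ n) \<psi> t * w t - m * ((deriv ^^ n) \<psi>0 t * w t)) = 0"
      using Suc.prems(2)[OF phi(1)] by (simp add: algebra_simps)
    then have "(LINT t|lborel. (deriv ^^ n) \<psi> t * w t) = m * (LINT t|lborel. (deriv ^^ n) \<psi>0 t * w t)"
      using i1[OF psi, of n] i1[OF p0(1), of n] by simp
    also have "\<dots> = c * ((-1) ^ n * fact n * m)" by (simp add: c_def)
    also have "\<dots> = c * (LINT t|lborel. (deriv ^^ n) \<psi> t * t ^ n)" unfolding mom[OF psi] m_def ..
    finally show ?thesis using i1[OF psi, of n] i2[OF psi, of n] by (simp add: right_diff_distrib mult.left_commute)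
  qed
  from Suc.IH[OF w' this] obtain p where "AE t in lborel. w t - c * t ^ n = poly p t" by blast
  then have "AE t in lborel. w t = poly (p + monom c n) t" by eventually_elim (simp add: poly_monom algebra_simps)
  then show ?case by blast
qed

text \<open>Integrating the equation n times turns it into an integral equation, from which the
  regularity of the solution is read off.\<close>
lemma weak_ode_smooth:
  assumes a: "a \<noteq> 0" and h: "locint h" and weak: "\<And>\<phi>. test_fun \<phi> \<Longrightarrow> wk a h \<phi> = 0"
  shows "\<exists>H. smooth H \<and> (AE t in lborel. h t = H t)"
proof -
  define n where "n = degree a"
  define b where "b = lead_coeff a"
  have b: "b \<noteq> 0" using a by (simp add: b_def)
  define I where "I f = (SOME F. antideriv F f \<and> F 0 = (0::real))" for f :: "real \<Rightarrow> real"
  have I: "antideriv (I f) f" if "locint f" for f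
    using someI_ex[OF antideriv_exists[of f 0 0]] locintD[OF that] unfolding I_def by blast
  have Ii: "locint f \<Longrightarrow> locint (I f)" for f by (rule locint_continuous[OF antideriv_continuous[OF I]])
  have Ik: "locint ((I ^^ k) h)" for k by (induction k) (auto simp: h Ii)
  have ant: "antideriv ((I ^^ Suc k) h) ((I ^^ k) h)" for k using I[OF Ik] by simp
  have move: "(LINT t|lborel. (deriv ^^ (k + m)) \<phi> t * (I ^^ k) h t) = (-1) ^ k * (LINT t|lborel. (deriv ^^ m) \<phi> t * h t)"
    if phi: "test_fun \<phi>" for \<phi> k m
  proof (induction k)
    case (Suc k)
    show ?case using test_fun_parts[OF test_fun_deriv_pow[OF phi, of "k + m"] ant[of k]] Suc by simp
  qed simp
  \<comment> \<open>The equation integrated n times; only its leading term contains \<open>h\<close>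
    itself.\<close>
  define w where "w t = (\<Sum>k\<le>n. coeff a k * (I ^^ (n - k)) h t)" for t
  have wl: "locint w"
    unfolding w_def[abs_def] locint_def by (intro allI set_integrable_finite_sum set_integrable_mult_right impI locintD Ik)
  have "\<exists>p. AE t in lborel. w t = poly p t"
  proof (rule weak_polynomial[OF wl])
    fix \<phi> assume phi: "test_fun \<phi>"
    have i: "integrable lborel (\<lambda>t. (deriv ^^ m) \<phi> t * (I ^^ k) h t)" for m k
      by (intro test_fun_mult_integrable(1) test_fun_deriv_pow phi locintD Ik)
    have i0: "integrable lborel (\<lambda>t. (deriv ^^ m) \<phi> t * h t)" for m using i[of m 0] by simp
    have "(LINT t|lborel. (deriv ^^ n) \<phi> t * w t) = (LINT t|lborel. (\<Sum>k\<le>n. coeff a k * ((deriv ^^ n) \<phi> t * (I ^^ (n - k)) h t)))"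
      by (simp add: w_def sum_distrib_left mult.left_commute)
    also have "\<dots> = (\<Sum>k\<le>n. coeff a k * (LINT t|lborel. (deriv ^^ n) \<phi> t * (I ^^ (n - k)) h t))"
      using i by simp
    also have "\<dots> = (\<Sum>k\<le>n. (-1) ^ n * (coeff a k * (-1) ^ k * (LINT t|lborel. (deriv ^^ k) \<phi> t * h t)))"
    proof (rule sum.cong[OF refl])
      fix k assume "k \<in> {..n}"
      then have k: "n = (n - k) + k" by simp
      have s: "(-1::real) ^ (n - k) = (-1) ^ n * (-1) ^ k"
        using \<open>k \<in> {..n}\<close> by (simp add: minus_one_power_iff)
      have "(LINT t|lborel. (deriv ^^ n) \<phi> t * (I ^^ (n - k)) h t) = (-1) ^ (n - k) * (LINT t|lborel. (deriv ^^ k) \<phi> t * h t)"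
        using move[OF phi, of "n - k" k] k by simp
      then show "coeff a k * (LINT t|lborel. (deriv ^^ n) \<phi> t * (I ^^ (n - k)) h t)
        = (-1) ^ n * (coeff a k * (-1) ^ k * (LINT t|lborel. (deriv ^^ k) \<phi> t * h t))" unfolding s by simp
    qed
    also have "\<dots> = (-1) ^ n * wk a h \<phi>"
      unfolding wk_def adj_op_def n_def sum_distrib_left[symmetric] using i0
      by (simp add: sum_distrib_right mult.assoc)
    finally show "(LINT t|lborel. (deriv ^^ n) \<phi> t * w t) = 0" using weak[OF phi] by simp
  qed
  then obtain p where p: "AE t in lborel. w t = poly p t" by blast
  \<comment> \<open>The same relation solved for \<open>h\<close>; the sum contains only integrals
    of \<open>h\<close>, which are more regular.\<close>
  define H where "H t = (poly p t - (\<Sum>k<n. coeff a k * (I ^^ (n - k)) h t)) / b" for t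
  have ae: "AE t in lborel. h t = H t"
    using p
  proof eventually_elim
    case (elim t)
    have "w t = (\<Sum>k<n. coeff a k * (I ^^ (n - k)) h t) + b * h t"
      unfolding w_def lessThan_Suc_atMost[symmetric] sum.lessThan_Suc by (simp add: b_def n_def)
    then show ?case using elim b by (simp add: H_def)
  qed
  have Ic: "continuous_on UNIV ((I ^^ Suc k) h)" for k by (rule antideriv_continuous[OF ant])
  have Hc: "continuous_on UNIV H" unfolding H_def
  proof (intro continuous_intros)
    fix k assume "k \<in> {..<n}"
    then have "n - k = Suc (n - k - 1)" by simp
    then show "continuous_on UNIV ((I ^^ (n - k)) h)" using Ic by metis
  qed (use b in auto)
  have hm: "h \<in> borel_measurable borel"
  proof -
    have "h \<in> borel_measurable lborel"
    proof (rule borel_measurable_LIMSEQ_real)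
      show "(\<lambda>n. indicat_real {-real n..real n} t * h t) \<longlonglongrightarrow> h t" for t
      proof (rule tendsto_eventually)
        obtain N :: nat where "\<bar>t\<bar> \<le> N" using real_arch_simple by blast
        then show "eventually (\<lambda>n. indicat_real {-real n..real n} t * h t = h t) sequentially"
          unfolding eventually_sequentially by (intro exI[of _ N]) (auto simp: indicator_def)
      qed
      show "(\<lambda>t. indicat_real {-real n..real n} t * h t) \<in> borel_measurable lborel" for n
        using locintD[OF h, of "-real n" "real n"] unfolding set_integrable_def by (auto dest: borel_measurable_integrable)
    qed
    then show ?thesis by simp
  qed
  have der: "((I ^^ Suc k) h has_real_derivative (if k = 0 then H t else (I ^^ k) h t)) (at t)" for k t
  proof -
    define g where "g = (if k = 0 then H else (I ^^ k) h)"
    have gc: "continuous_on UNIV g" unfolding g_def using Hc Ic[of "k - 1"] by (cases k) auto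
    have ag: "antideriv ((I ^^ Suc k) h) g"
    proof (cases "k = 0")
      case True
      have "antideriv ((I ^^ Suc 0) h) H"
        by (rule antideriv_AE_cong[OF ant[of 0]]) (use hm ae Hc in \<open>auto intro: borel_measurable_continuous_onI\<close>)
      then show ?thesis using True by (simp add: g_def)
    qed (use ant in \<open>simp add: g_def\<close>)
    have "((I ^^ Suc k) h has_real_derivative g t) (at t)" by (rule antideriv_DERIV[OF ag gc])
    then show ?thesis by (cases "k = 0") (simp_all only: g_def if_True if_False simp_thms)
  qed
  \<comment> \<open>Bootstrapping: if \<open>H\<close> is m times differentiable, the integrals are
    m + 1 times differentiable, and then so is \<open>H\<close>.\<close>
  have "nd m H" for m
  proof (induction m)
    case (Suc m)
    have ndI: "nd (Suc m) ((I ^^ Suc k) h)" for k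
    proof (induction k)
      case 0
      show ?case by (rule nd_SucI[OF der]) (use Suc in simp)
    next
      case (Suc k)
      show ?case by (rule nd_SucI[OF der]) (use nd_mono[OF Suc] in simp)
    qed
    have "nd (Suc m) (\<lambda>t. (1 / b) * (poly p t + (\<Sum>k<n. (- coeff a k) * (I ^^ (n - k)) h t)))"
    proof (intro nd_mult nd_add nd_sum nd_const)
      show "nd (Suc m) (poly p)" using smooth_poly[of p] unfolding smooth_def by blast
      fix k assume "k \<in> {..<n}"
      then have "n - k = Suc (n - k - 1)" by simp
      then show "nd (Suc m) ((I ^^ (n - k)) h)" using ndI by metis
    qed
    moreover have "(\<lambda>t. (1 / b) * (poly p t + (\<Sum>k<n. (- coeff a k) * (I ^^ (n - k)) h t))) = H"
      by (simp add: H_def fun_eq_iff sum_negf)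
    ultimately show ?case by simp
  qed simp
  then show ?thesis using ae unfolding smooth_def by blast
qed

section \<open>Polynomial annihilators of the free responses\<close>

definition peval :: "real poly \<Rightarrow> real^'d^'d \<Rightarrow> real^'d^'d" where
  "peval p A = (\<Sum>k\<le>degree p. coeff p k *\<^sub>R matpow A k)"

lemma peval_eq: "degree p \<le> n \<Longrightarrow> peval p A = (\<Sum>k\<le>n. coeff p k *\<^sub>R matpow A k)"
  unfolding peval_def by (intro sum.mono_neutral_left) (auto simp: coeff_eq_0)

lemma peval_0 [simp]: "peval 0 A = 0" by (simp add: peval_def)

lemma matrix_add_rdistrib: "(M + N) ** L = M ** L + N ** L" for M N :: "real^'b^'c"
  by (simp add: vec_eq_iff matrix_matrix_mult_def distrib_right sum.distrib)

lemma matrix_mult_sum_right: "M ** (\<Sum>i\<in>S. f i) = (\<Sum>i\<in>S. M ** f i)" for M :: "real^'b^'c"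
  by (induction S rule: infinite_finite_induct) (auto simp: matrix_add_ldistrib)

lemma peval_pCons: "peval (pCons a p) A = a *\<^sub>R mat 1 + A ** peval p A"
proof -
  have "peval (pCons a p) A = (\<Sum>k\<le>Suc (degree p). coeff (pCons a p) k *\<^sub>R matpow A k)"
    by (rule peval_eq) (rule degree_pCons_le)
  also have "\<dots> = a *\<^sub>R mat 1 + (\<Sum>k\<le>degree p. coeff p k *\<^sub>R (A ** matpow A k))"
    by (subst sum.atMost_Suc_shift) simp
  finally show ?thesis by (simp add: peval_def matrix_mult_sum_right matrix_scalar_ac scalar_matrix_assoc)
qed

lemma peval_add: "peval (p + q) A = peval p A + peval q A"
  using degree_add_le_max[of p q]
  by (simp add: peval_eq[of "p + q" "max (degree p) (degree q)"] peval_eq[of p "max (degree p) (degree q)"]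
      peval_eq[of q "max (degree p) (degree q)"] algebra_simps sum.distrib)

lemma peval_smult: "peval (smult a p) A = a *\<^sub>R peval p A"
  by (simp add: peval_eq[of "smult a p" "degree p"] peval_def scaleR_sum_right degree_smult_le)

lemma peval_mult: "peval (p * q) A = peval p A ** peval q A"
  by (induction p) (simp_all add: peval_add peval_smult peval_pCons matrix_add_rdistrib
      flip: matrix_mul_assoc scalar_matrix_assoc)

lemma peval_commute: "peval p A ** A = A ** peval p A"
proof -
  have "peval [:0, 1:] A = A" by (simp add: peval_pCons)
  then show ?thesis using peval_mult[of p "[:0, 1:]" A] peval_mult[of "[:0, 1:]" p A] by (simp add: mult.commute)
qed

lemma pCons_0_sum: "[:sum f S:] = (\<Sum>i\<in>S. [:f i:])"
proof (induction S rule: infinite_finite_induct)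
  case (insert x F)
  have "[:f x + sum f F:] = [:f x:] + [:sum f F:]" by simp
  then show ?case using insert by (simp del: add_pCons)
qed auto

text \<open>Horner's scheme proves the remainder theorem for matrices, p I = Y (s I - A) +
  p(A).\<close>

lemma peval_division:
  fixes A :: "real^'d^'d"
  shows "\<exists>Y. \<forall>i l. (if i = l then p else 0) =
    [:0, 1:] * Y i l - (\<Sum>j\<in>UNIV. Y i j * [:A $ j $ l:]) + [:peval p A $ i $ l:]"
proof (induction p)
  case 0
  show ?case by (intro exI[of _ "\<lambda>_ _. 0"]) simp
next
  case (pCons a p)
  then obtain Y where Y: "\<And>i l. (if i = l then p else 0) =
    [:0, 1:] * Y i l - (\<Sum>j\<in>UNIV. Y i j * [:A $ j $ l:]) + [:peval p A $ i $ l:]" by blast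
  let ?Z = "\<lambda>i l. [:0, 1:] * Y i l + [:peval p A $ i $ l:]"
  have "(if i = l then pCons a p else 0) =
    [:0, 1:] * ?Z i l - (\<Sum>j\<in>UNIV. ?Z i j * [:A $ j $ l:]) + [:peval (pCons a p) A $ i $ l:]" for i l
  proof -
    have 1: "(\<Sum>j\<in>UNIV. ?Z i j * [:A $ j $ l:]) = [:0, 1:] * (\<Sum>j\<in>UNIV. Y i j * [:A $ j $ l:])
      + [:(peval p A ** A) $ i $ l:]"
    proof -
      have "[:r:] * [:c:] = [:r * c:]" for r c :: real by simp
      then have "(a * y + [:r:]) * [:c:] = a * (y * [:c:]) + [:r * c:]" for a y :: "real poly" and r c
        by (simp only: distrib_right mult.assoc)
      then show ?thesis by (simp only: sum.distrib sum_distrib_left pCons_0_sum matrix_matrix_mult_def vec_lambda_beta)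
    qed
    have "[:0, 1:] * (if i = l then p else 0) + [:if i = l then a else 0:]
      = [:0, 1:] * ?Z i l - [:0, 1:] * (\<Sum>j\<in>UNIV. Y i j * [:A $ j $ l:]) + [:if i = l then a else 0:]"
      unfolding Y by (simp only: algebra_simps)
    moreover have "[:peval (pCons a p) A $ i $ l:] = [:(peval p A ** A) $ i $ l:] + [:if i = l then a else 0:]"
      by (simp add: peval_pCons peval_commute mat_def)
    moreover have "(if i = l then pCons a p else 0) = [:0, 1:] * (if i = l then p else 0) + [:if i = l then a else 0:]"
      by simp
    ultimately show ?thesis unfolding 1 by (simp only: algebra_simps)
  qed
  then show ?case by (intro exI[of _ ?Z] allI)
qed

text \<open>The value at time 0 of q(d/dt) applied to the free responses C exp(A t), as a row vector.\<close>
definition free_residue :: "real^'d^'d \<Rightarrow> real^'d^'m \<Rightarrow> real poly^'m \<Rightarrow> real^'d" where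
  "free_residue A C q = (\<chi> l. \<Sum>j\<in>UNIV. (C ** peval (q $ j) A) $ j $ l)"

text \<open>In matrix notation q C = y (s I - A), a division by s I - A without remainder.\<close>

definition free_quotient :: "real^'d^'d \<Rightarrow> real^'d^'m \<Rightarrow> real poly^'m \<Rightarrow> real poly^'d \<Rightarrow> bool" where
  "free_quotient A C q y \<longleftrightarrow>
    (\<forall>l. (\<Sum>j\<in>UNIV. q $ j * [:C $ j $ l:]) = [:0, 1:] * y $ l - (\<Sum>i\<in>UNIV. y $ i * [:A $ i $ l:]))"

text \<open>Dividing each entry of \<open>q\<close> by s I - A and summing against C leaves
  \<open>free_residue\<close> as the constant remainder.\<close>

lemma free_quotient_exists:
  fixes A :: "real^'d^'d" and C :: "real^'d^'m"
  assumes "free_residue A C q = 0"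
  shows "\<exists>y. free_quotient A C q y"
proof -
  have "\<exists>Y. \<forall>i l. (if i = l then q $ j else 0) =
    [:0, 1:] * Y i l - (\<Sum>k\<in>UNIV. Y i k * [:A $ k $ l:]) + [:peval (q $ j) A $ i $ l:]" for j
    by (rule peval_division)
  then obtain Y where Y: "\<And>j i l. (if i = l then q $ j else 0) =
    [:0, 1:] * Y j i l - (\<Sum>k\<in>UNIV. Y j i k * [:A $ k $ l:]) + [:peval (q $ j) A $ i $ l:]"
    using choice[of "\<lambda>j Y. \<forall>i l. (if i = l then q $ j else 0) =
      [:0, 1:] * Y i l - (\<Sum>k\<in>UNIV. Y i k * [:A $ k $ l:]) + [:peval (q $ j) A $ i $ l:]"] by blast
  define y where "y = (\<chi> l. \<Sum>j\<in>UNIV. \<Sum>i\<in>UNIV. Y j i l * [:C $ j $ i:])"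
  have "(\<Sum>j\<in>UNIV. q $ j * [:C $ j $ l:]) = [:0, 1:] * y $ l - (\<Sum>i\<in>UNIV. y $ i * [:A $ i $ l:])" for l
  proof -
    have "(\<Sum>j\<in>UNIV. q $ j * [:C $ j $ l:])
      = (\<Sum>j\<in>UNIV. \<Sum>i\<in>UNIV. (if i = l then q $ j else 0) * [:C $ j $ i:])"
      by (simp only: mult_delta_left sum.delta finite UNIV_I if_True mult_zero_left)
    also have "\<dots> = (\<Sum>j\<in>UNIV. \<Sum>i\<in>UNIV. [:0, 1:] * (Y j i l * [:C $ j $ i:]))
      - (\<Sum>j\<in>UNIV. \<Sum>i\<in>UNIV. \<Sum>k\<in>UNIV. Y j i k * [:C $ j $ i:] * [:A $ k $ l:])
      + (\<Sum>j\<in>UNIV. \<Sum>i\<in>UNIV. [:peval (q $ j) A $ i $ l:] * [:C $ j $ i:])"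
    proof -
      have "(if i = l then q $ j else 0) * [:C $ j $ i:] = [:0, 1:] * (Y j i l * [:C $ j $ i:])
        - (\<Sum>k\<in>UNIV. Y j i k * [:C $ j $ i:] * [:A $ k $ l:]) + [:peval (q $ j) A $ i $ l:] * [:C $ j $ i:]" for i j
      proof -
        have *: "(a * y - s + r) * c = a * (y * c) - s * c + r * c" for a y s r c :: "real poly"
          by (simp only: left_diff_distrib distrib_right mult.assoc)
        have "Y j i k * [:A $ k $ l:] * [:C $ j $ i:] = Y j i k * [:C $ j $ i:] * [:A $ k $ l:]" for k
          by (simp only: mult_ac)
        then show ?thesis unfolding Y * sum_distrib_right by simp
      qed
      then show ?thesis by (simp only: sum.distrib sum_subtractf)
    qed
    also have "(\<Sum>j\<in>UNIV. \<Sum>i\<in>UNIV. [:0, 1:] * (Y j i l * [:C $ j $ i:])) = [:0, 1:] * y $ l"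
      by (simp only: y_def vec_lambda_beta sum_distrib_left)
    also have "(\<Sum>j\<in>UNIV. \<Sum>i\<in>UNIV. \<Sum>k\<in>UNIV. Y j i k * [:C $ j $ i:] * [:A $ k $ l:])
      = (\<Sum>k\<in>UNIV. \<Sum>j\<in>UNIV. \<Sum>i\<in>UNIV. Y j i k * [:C $ j $ i:] * [:A $ k $ l:])"
      by (subst sum.swap[where B = "UNIV :: 'd set"], subst (2) sum.swap) (rule refl)
    also have "\<dots> = (\<Sum>k\<in>UNIV. y $ k * [:A $ k $ l:])" by (simp only: y_def vec_lambda_beta sum_distrib_right)
    also have "(\<Sum>j\<in>UNIV. \<Sum>i\<in>UNIV. [:peval (q $ j) A $ i $ l:] * [:C $ j $ i:]) = [:free_residue A C q $ l:]"
      by (simp add: free_residue_def pCons_0_sum matrix_matrix_mult_def mult.commute)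
    finally show ?thesis using assms by simp
  qed
  then show ?thesis unfolding free_quotient_def by blast
qed

text \<open>In s w = w M only the left side gains a degree, so the coefficients vanish from the top
  downwards.\<close>

lemma row_shift_zero:
  fixes w :: "real poly^'d" and M :: "real^'d^'d"
  assumes "\<And>l. [:0, 1:] * w $ l = (\<Sum>i\<in>UNIV. w $ i * [:M $ i $ l:])"
  shows "w = 0"
proof -
  define n where "n = Max (range (\<lambda>l. degree (w $ l)))"
  have n: "degree (w $ l) \<le> n" for l unfolding n_def by (intro Max_ge) auto
  have rec: "coeff (w $ l) k = (\<Sum>i\<in>UNIV. coeff (w $ i) (Suc k) * M $ i $ l)" for l k
    using arg_cong[OF assms[of l], of "\<lambda>p. coeff p (Suc k)"] by (simp add: coeff_sum mult.commute)
  \<comment> \<open>The descent starts at \<open>Suc n\<close>, one above all degrees.\<close>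
  have "coeff (w $ l) (Suc n - m) = 0" for l m
  proof (induction m arbitrary: l)
    case 0
    show ?case using n[of l] by (intro coeff_eq_0) simp
  next
    case (Suc m)
    show ?case
    proof (cases "m \<le> n")
      case True
      then have "Suc (Suc n - Suc m) = Suc n - m" by simp
      then show ?thesis using rec[of l "Suc n - Suc m"] Suc by simp
    qed (use Suc in simp)
  qed
  then have "coeff (w $ l) k = 0" if "k \<le> Suc n" for l k using that by (metis diff_diff_cancel)
  moreover have "coeff (w $ l) k = 0" if "\<not> k \<le> Suc n" for l k using that n[of l] by (intro coeff_eq_0) simp
  ultimately show ?thesis by (metis poly_eq_iff vec_eq_iff coeff_0 zero_index)
qed

lemma const_poly_row_mult:
  "(\<Sum>i\<in>UNIV. (\<Sum>k\<in>UNIV. y $ k * [:M $ k $ i:]) * [:L $ i $ l:]) = (\<Sum>k\<in>UNIV. y $ k * [:(M ** L) $ k $ l:])"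
  for M :: "real^'b^'c" and L :: "real^'e^'b"
proof -
  have "(\<Sum>i\<in>UNIV. (\<Sum>k\<in>UNIV. y $ k * [:M $ k $ i:]) * [:L $ i $ l:])
    = (\<Sum>i\<in>UNIV. \<Sum>k\<in>UNIV. y $ k * ([:M $ k $ i:] * [:L $ i $ l:]))"
    by (simp only: sum_distrib_right mult.assoc)
  also have "\<dots> = (\<Sum>k\<in>UNIV. y $ k * (\<Sum>i\<in>UNIV. [:M $ k $ i:] * [:L $ i $ l:]))"
    by (subst sum.swap) (simp only: sum_distrib_left)
  finally show ?thesis by (simp add: matrix_matrix_mult_def pCons_0_sum mult.commute)
qed

text \<open>The unobservable subspace is invariant under A and killed by C. With E = 1 - R the row w
  = y E therefore satisfies s w = w A E and is zero by \<open>row_shift_zero\<close>; y sees only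
  the observable quotient.\<close>

lemma free_quotient_unobs:
  fixes A :: "real^'d^'d" and C :: "real^'d^'m"
  assumes R: "unobs_proj A C R" and y: "free_quotient A C q y"
  shows "(\<Sum>i\<in>UNIV. y $ i * [:R $ i $ l:]) = y $ l"
proof -
  note RD = unobs_projD[OF R]
  define E where "E = mat 1 - R"
  have RE: "R ** E = 0" using RD(1) unfolding E_def
    by (simp add: matrix_eq matrix_vector_mul_assoc[symmetric] mat_minus_vec matrix_vector_mult_diff_distrib)
  have CE: "C ** E = 0"
    using RD(4) unfolding E_def by (simp add: matrix_eq matrix_vector_mul_assoc[symmetric] mat_minus_vec matrix_vector_mult_diff_distrib)
  have EAE: "E ** (A ** E) = A ** E"
    using RD(5) unfolding E_def
    by (simp add: matrix_eq matrix_vector_mul_assoc[symmetric] mat_minus_vec matrix_vector_mult_diff_distrib)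
  define w where "w = (\<chi> l. \<Sum>i\<in>UNIV. y $ i * [:E $ i $ l:])"
  have wE: "(\<Sum>i\<in>UNIV. w $ i * [:M $ i $ l:]) = (\<Sum>i\<in>UNIV. y $ i * [:(E ** M) $ i $ l:])" for M :: "real^'d^'d" and l
    unfolding w_def vec_lambda_beta const_poly_row_mult ..
  have "[:0, 1:] * w $ l = (\<Sum>i\<in>UNIV. w $ i * [:(A ** E) $ i $ l:])" for l
  proof -
    have "(\<Sum>i\<in>UNIV. (\<Sum>j\<in>UNIV. q $ j * [:C $ j $ i:]) * [:E $ i $ l:])
      = (\<Sum>i\<in>UNIV. ([:0, 1:] * y $ i) * [:E $ i $ l:]) - (\<Sum>i\<in>UNIV. (\<Sum>j\<in>UNIV. y $ j * [:A $ j $ i:]) * [:E $ i $ l:])"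
      using y unfolding free_quotient_def by (simp only: left_diff_distrib sum_subtractf)
    then have "0 = [:0, 1:] * w $ l - (\<Sum>i\<in>UNIV. y $ i * [:(A ** E) $ i $ l:])"
      unfolding const_poly_row_mult CE w_def vec_lambda_beta sum_distrib_left mult.assoc by simp
    then show ?thesis unfolding wE EAE by simp
  qed
  from row_shift_zero[OF this] have "w $ l = 0" by simp
  then have "(\<Sum>i\<in>UNIV. y $ i * [:mat 1 $ i $ l:]) - (\<Sum>i\<in>UNIV. y $ i * [:R $ i $ l:]) = 0"
    unfolding w_def E_def sum_subtractf[symmetric] vec_lambda_beta by (simp add: smult_diff_left)
  moreover have "(\<Sum>i\<in>UNIV. y $ i * [:mat 1 $ i $ l:]) = y $ l"
    by (subst sum.remove[OF finite UNIV_I[of l]]) (simp add: mat_def)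
  ultimately show ?thesis by simp
qed

text \<open>The row y B + q D, which remains on the input side when the state is eliminated from
  q(d/dt) applied to the output.\<close>

definition input_row :: "real^'n^'d \<Rightarrow> real^'n^'m \<Rightarrow> real poly^'d \<Rightarrow> real poly^'m \<Rightarrow> real poly^'n" where
  "input_row B D y q = (\<chi> k. (\<Sum>i\<in>UNIV. y $ i * [:B $ i $ k:]) + (\<Sum>j\<in>UNIV. q $ j * [:D $ j $ k:]))"

lemma wk_combine:
  fixes M :: "real^'k^'l" and x :: "real \<Rightarrow> real^'k"
  assumes "test_fun \<phi>" "L2loc x"
  shows "(\<Sum>j\<in>UNIV. wk (q $ j) (\<lambda>t. (M *v x t) $ j) \<phi>)
    = (\<Sum>k\<in>UNIV. wk (\<Sum>j\<in>UNIV. q $ j * [:M $ j $ k:]) (\<lambda>t. x t $ k) \<phi>)"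
  unfolding wk_matrix[OF assms] wk_sum[OF assms(1) locint_component[OF assms(2)]] wk_const_mult
  by (rule sum.swap)

lemma wk_vec_add:
  fixes x z :: "real \<Rightarrow> real^'k"
  assumes "test_fun \<phi>" "L2loc x" "L2loc z"
  shows "(\<Sum>j\<in>UNIV. wk (q $ j) (\<lambda>t. (x t + z t) $ j) \<phi>)
    = (\<Sum>j\<in>UNIV. wk (q $ j) (\<lambda>t. x t $ j) \<phi>) + (\<Sum>j\<in>UNIV. wk (q $ j) (\<lambda>t. z t $ j) \<phi>)"
  by (simp add: wk_fun_add[OF assms(1) locint_component[OF assms(2)] locint_component[OF assms(3)]] sum.distrib)

lemma wk_vec_diff:
  fixes x z :: "real \<Rightarrow> real^'k"
  assumes "test_fun \<phi>" "L2loc x" "L2loc z"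
  shows "(\<Sum>j\<in>UNIV. wk (q $ j) (\<lambda>t. (x t - z t) $ j) \<phi>)
    = (\<Sum>j\<in>UNIV. wk (q $ j) (\<lambda>t. x t $ j) \<phi>) - (\<Sum>j\<in>UNIV. wk (q $ j) (\<lambda>t. z t $ j) \<phi>)"
  by (simp add: wk_fun_diff[OF assms(1) locint_component[OF assms(2)] locint_component[OF assms(3)]] sum_subtractf)

text \<open>As q C = y (s - A), applying q(d/dt) to C x is applying y(d/dt) to x' - A x = B u, with
  all derivatives in the sense of distributions.\<close>

lemma ctraj_weak:
  fixes A :: "real^'d^'d" and B :: "real^'n^'d" and C :: "real^'d^'m" and D :: "real^'n^'m"
  assumes phi: "test_fun \<phi>" and tr: "ctraj A B x u" and y: "free_quotient A C q y"
  shows "(\<Sum>j\<in>UNIV. wk (q $ j) (\<lambda>t. (C *v x t + D *v u t) $ j) \<phi>)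
    = (\<Sum>k\<in>UNIV. wk (input_row B D y q $ k) (\<lambda>t. u t $ k) \<phi>)"
proof -
  have u: "L2loc u" and x: "L2loc x" using tr ctraj_L2loc[OF tr] by (auto simp: ctraj_def)
  note lx = locint_component[OF x] and lu = locint_component[OF u]
  have ax: "antideriv (\<lambda>t. x t $ l) (\<lambda>t. (A *v x t + B *v u t) $ l)" for l
    using tr unfolding ctraj_def antideriv_vec_iff by blast
  have "(\<Sum>j\<in>UNIV. wk (q $ j) (\<lambda>t. (C *v x t) $ j) \<phi>)
    = (\<Sum>l\<in>UNIV. wk ([:0, 1:] * y $ l) (\<lambda>t. x t $ l) \<phi>) - (\<Sum>l\<in>UNIV. wk (\<Sum>i\<in>UNIV. y $ i * [:A $ i $ l:]) (\<lambda>t. x t $ l) \<phi>)"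
    using y unfolding wk_combine[OF phi x] free_quotient_def
    by (simp add: wk_diff[OF phi lx] sum_subtractf del: mult_pCons_left)
  also have "(\<Sum>l\<in>UNIV. wk ([:0, 1:] * y $ l) (\<lambda>t. x t $ l) \<phi>)
    = (\<Sum>l\<in>UNIV. wk (y $ l) (\<lambda>t. (A *v x t + B *v u t) $ l) \<phi>)"
    by (simp only: wk_pCons_0[OF phi ax])
  also have "\<dots> = (\<Sum>l\<in>UNIV. wk (\<Sum>i\<in>UNIV. y $ i * [:A $ i $ l:]) (\<lambda>t. x t $ l) \<phi>)
     + (\<Sum>k\<in>UNIV. wk (\<Sum>i\<in>UNIV. y $ i * [:B $ i $ k:]) (\<lambda>t. u t $ k) \<phi>)"
    unfolding wk_vec_add[OF phi L2loc_matrix[OF x] L2loc_matrix[OF u]] wk_combine[OF phi x] wk_combine[OF phi u] ..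
  finally have "(\<Sum>j\<in>UNIV. wk (q $ j) (\<lambda>t. (C *v x t) $ j) \<phi>)
    = (\<Sum>k\<in>UNIV. wk (\<Sum>i\<in>UNIV. y $ i * [:B $ i $ k:]) (\<lambda>t. u t $ k) \<phi>)" by simp
  then show ?thesis
    unfolding wk_vec_add[OF phi L2loc_matrix[OF x] L2loc_matrix[OF u]] wk_combine[OF phi u]
    by (simp add: input_row_def wk_add[OF phi lu] sum.distrib)
qed

lemma poly_diff_eq_iff:
  fixes P :: "real poly^'n^'m"
  assumes u: "L2loc u" and y: "L2loc y"
  shows "poly_diff_eq P Q u y \<longleftrightarrow> (\<forall>\<phi>. test_fun \<phi> \<longrightarrow> (\<forall>i.
    (\<Sum>j\<in>UNIV. wk (P $ i $ j) (\<lambda>t. u t $ j) \<phi>) = (\<Sum>j\<in>UNIV. wk (Q $ i $ j) (\<lambda>t. y t $ j) \<phi>)))"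
proof -
  have "(LINT t|lborel. (\<Sum>j\<in>UNIV. adj_op (q $ j) \<phi> t * f t $ j)) = (\<Sum>j\<in>UNIV. wk (q $ j) (\<lambda>t. f t $ j) \<phi>)"
    if "test_fun \<phi>" "L2loc f" for \<phi> and q :: "real poly^'k" and f :: "real \<Rightarrow> real^'k"
    unfolding wk_def by (rule Bochner_Integration.integral_sum) (rule wk_integrable[OF that(1) locint_component[OF that(2)]])
  from this[OF _ u] this[OF _ y] show ?thesis unfolding poly_diff_eq_def by auto
qed

section \<open>Free responses and the equations satisfied by all trajectories\<close>

lemma free_response_deriv:
  "((\<lambda>t. (M *v (expm A t *v x0)) $ j) has_real_derivative ((M ** A) *v (expm A t *v x0)) $ j) (at t)"
  for M :: "real^'d^'m"
proof -
  have "bounded_linear (\<lambda>v. (M *v v) $ j)"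
    by (rule bounded_linear_compose[OF bounded_linear_vec_nth]) (rule matrix_vector_mul_bounded_linear)
  from bounded_linear.has_vector_derivative[OF this expm_vec_deriv]
  show ?thesis by (simp add: has_real_derivative_iff_has_vector_derivative matrix_vector_mul_assoc
      matrix_mul_assoc)
qed

lemma free_response_smooth: "smooth (\<lambda>t. (M *v (expm A t *v x0)) $ j)" for M :: "real^'d^'m"
proof -
  have "nd n (\<lambda>t. (M *v (expm A t *v x0)) $ j)" for n
  proof (induction n arbitrary: M)
    case (Suc n)
    show ?case by (rule nd_SucI[OF free_response_deriv Suc])
  qed simp
  then show ?thesis by (simp add: smooth_def)
qed

lemma free_response_deriv_pow:
  "(deriv ^^ k) (\<lambda>t. (M *v (expm A t *v x0)) $ j) = (\<lambda>t. ((M ** matpow A k) *v (expm A t *v x0)) $ j)"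
  for M :: "real^'d^'m"
proof (induction k arbitrary: M)
  case (Suc k)
  have "deriv (\<lambda>t. (M *v (expm A t *v x0)) $ j) = (\<lambda>t. ((M ** A) *v (expm A t *v x0)) $ j)"
    by (rule derivI) (rule free_response_deriv)
  then show ?case unfolding funpow_Suc_right o_def using Suc by (simp add: matrix_mul_assoc)
qed simp

lemma matrix_vector_mult_sum_left: "(\<Sum>i\<in>S. f i) *v x = (\<Sum>i\<in>S. f i *v x)" for x :: "real^'b"
  by (induction S rule: infinite_finite_induct) (auto simp: matrix_vector_mult_add_rdistrib)

lemma diffop_free_response:
  "diffop p (\<lambda>t. (C *v (expm A t *v x0)) $ j) t = ((C ** peval p A) *v (expm A t *v x0)) $ j"
  for C :: "real^'d^'m"
proof -
  have "((C ** peval p A) *v z) $ j = (\<Sum>k\<le>degree p. coeff p k * ((C ** matpow A k) *v z) $ j)" for z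
  proof -
    have "(C ** peval p A) *v z = (\<Sum>k\<le>degree p. coeff p k *\<^sub>R ((C ** matpow A k) *v z))"
      unfolding peval_def matrix_mult_sum_right matrix_vector_mult_sum_left
      by (simp add: matrix_scalar_ac scalar_matrix_assoc[symmetric] scaleR_matrix_vector_assoc)
    then show ?thesis by simp
  qed
  then show ?thesis by (simp add: diffop_def free_response_deriv_pow)
qed

lemma free_ctraj: "ctraj A B (\<lambda>t. expm A t *v x0) (\<lambda>_. 0)"
proof -
  have "continuous_on UNIV (\<lambda>t. expm A t *v (A *v x0))"
    by (intro continuous_at_imp_continuous_on ballI has_vector_derivative_continuous[OF expm_vec_deriv])
  then have "antideriv (\<lambda>t. expm A t *v x0) (\<lambda>t. A *v (expm A t *v x0))"
    by (intro antideriv_C1 expm_vec_deriv) (simp add: matrix_vector_mul_assoc expm_commute)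
  then show ?thesis by (simp add: ctraj_def L2loc_continuous)
qed

definition kernel_form ::
  "real^'d^'d \<Rightarrow> real^'n^'d \<Rightarrow> real^'d^'m \<Rightarrow> real^'n^'m \<Rightarrow> real poly^'n^'m \<Rightarrow> real poly^'m^'m \<Rightarrow> real poly^'d^'m \<Rightarrow> bool"
  where "kernel_form A B C D P Q Y \<longleftrightarrow>
    (\<forall>i. free_quotient A C (Q $ i) (Y $ i) \<and> P $ i = input_row B D (Y $ i) (Q $ i))"

lemma diffop_exp: "diffop p (\<lambda>t. exp (s * t)) 0 = poly p s"
proof -
  have d: "deriv (\<lambda>t. c * exp (s * t)) = (\<lambda>t. (c * s) * exp (s * t))" for c
    by (rule derivI) (auto intro!: derivative_eq_intros)
  have "(deriv ^^ k) (\<lambda>t. c * exp (s * t)) = (\<lambda>t. c * s ^ k * exp (s * t))" for k c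
  proof (induction k arbitrary: c)
    case (Suc k)
    show ?case unfolding funpow_Suc_right o_def d Suc by (simp add: mult_ac)
  qed simp
  from this[of _ 1] show ?thesis by (simp add: diffop_def poly_altdef)
qed

text \<open>Free responses satisfy the equation with zero input, which makes the residues of the
  rows of \<open>Q\<close> vanish. The input side is then compared on exponential inputs, whose
  rates range over all reals and so determine the polynomials.\<close>

lemma kernel_form_exists:
  fixes A :: "real^'d^'d" and B :: "real^'n^'d" and C :: "real^'d^'m" and D :: "real^'n^'m"
  assumes inc: "\<And>x u. ctraj A B x u \<Longrightarrow> poly_diff_eq P Q u (\<lambda>t. C *v x t + D *v u t)"
  shows "\<exists>Y. kernel_form A B C D P Q Y"
proof -
  have weq: "(\<Sum>k\<in>UNIV. wk (P $ i $ k) (\<lambda>t. u t $ k) \<phi>) = (\<Sum>j\<in>UNIV. wk (Q $ i $ j) (\<lambda>t. (C *v x t + D *v u t) $ j) \<phi>)"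
    if "ctraj A B x u" "test_fun \<phi>" for i x u \<phi>
    using inc[OF that(1)] that(2)
    unfolding poly_diff_eq_iff[OF ctraj_L2loc(1)[OF that(1)] ctraj_L2loc(3)[OF that(1)]] by blast
  have "free_residue A C (Q $ i) = 0" for i
  proof -
    have z: "(\<Sum>j\<in>UNIV. diffop (Q $ i $ j) (\<lambda>t. (C *v (expm A t *v x0)) $ j) 0) = 0" for x0
    proof (rule weak_to_strong)
      show "smooth (\<lambda>t. (C *v (expm A t *v x0)) $ j)" for j by (rule free_response_smooth)
      fix \<phi> assume "test_fun \<phi>"
      from weq[OF free_ctraj[of A B x0] this, where i = i]
      show "(\<Sum>j\<in>UNIV. wk (Q $ i $ j) (\<lambda>t. (C *v (expm A t *v x0)) $ j) \<phi>) = 0" by (simp add: wk_def)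
    qed
    have "free_residue A C (Q $ i) $ l = 0" for l
      using z[of "axis l 1"] unfolding diffop_free_response expm_0 matrix_vector_mul_lid
      by (simp add: free_residue_def matrix_vector_mult_basis column_def)
    then show ?thesis by (simp add: vec_eq_iff)
  qed
  then have ex: "\<forall>i. \<exists>y. free_quotient A C (Q $ i) y" by (intro allI free_quotient_exists)
  from choice[OF ex] obtain Y' where Y': "\<And>i. free_quotient A C (Q $ i) (Y' i)" by blast
  define Y where "Y = (\<chi> i. Y' i)"
  have Y: "free_quotient A C (Q $ i) (Y $ i)" for i using Y' by (simp add: Y_def)
  have "P $ i $ k = input_row B D (Y $ i) (Q $ i) $ k" for i k
  proof -
    define d where "d = P $ i - input_row B D (Y $ i) (Q $ i)"
    have "poly (d $ k) s = 0" for s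
    proof -
      define u where "u t = (exp (s * t)) *\<^sub>R (axis k 1 :: real^'n)" for t
      have sm: "smooth (\<lambda>t. exp (s * t))" using smooth_exp[OF smooth_cmult[OF smooth_ident]] .
      have u: "L2loc u" unfolding u_def[abs_def] by (intro L2loc_continuous continuous_intros)
      obtain x where tr: "ctraj A B x u" using ctraj_exists[OF u] by blast
      have "(\<Sum>l\<in>UNIV. diffop (d $ l) (\<lambda>t. u t $ l) 0) = 0"
      proof (rule weak_to_strong)
        show "smooth (\<lambda>t. u t $ l)" for l
          unfolding u_def using smooth_mult[OF sm smooth_const] by simp
        fix \<phi> assume phi: "test_fun \<phi>"
        show "(\<Sum>l\<in>UNIV. wk (d $ l) (\<lambda>t. u t $ l) \<phi>) = 0"
          using weq[OF tr phi, of i] ctraj_weak[OF phi tr Y[of i], where D = D]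
          by (simp add: d_def wk_diff[OF phi locint_component[OF u]] sum_subtractf)
      qed
      moreover have "diffop (d $ l) (\<lambda>t. u t $ l) 0 = (if l = k then poly (d $ k) s else 0)" for l
      proof (cases "l = k")
        case True then show ?thesis by (simp add: u_def diffop_exp)
      next
        case False
        have "(deriv ^^ n) (\<lambda>t. 0 * exp (s * t)) = (\<lambda>t. 0 :: real)" for n
          by (induction n) (simp_all add: derivI)
        then have "(deriv ^^ n) (\<lambda>t. u t $ l) 0 = 0" for n using False by (simp add: u_def axis_def)
        then show ?thesis using False by (simp add: diffop_def)
      qed
      ultimately show ?thesis by simp
    qed
    then have "d $ k = 0" by (simp flip: poly_all_0_iff_0)
    then show ?thesis by (simp add: d_def)
  qed
  then have "kernel_form A B C D P Q Y" using Y unfolding kernel_form_def by (simp add: vec_eq_iff)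
  then show ?thesis by blast
qed

lemma kernel_form_ctraj:
  assumes K: "kernel_form A B C D P Q Y" and tr: "ctraj A B x u"
  shows "poly_diff_eq P Q u (\<lambda>t. C *v x t + D *v u t)"
  unfolding poly_diff_eq_iff[OF ctraj_L2loc(1)[OF tr] ctraj_L2loc(3)[OF tr]]
proof (intro allI impI)
  fix \<phi> i assume phi: "test_fun \<phi>"
  have "free_quotient A C (Q $ i) (Y $ i)" and P: "P $ i = input_row B D (Y $ i) (Q $ i)"
    using K by (auto simp: kernel_form_def)
  from ctraj_weak[OF phi tr this(1), of D]
  show "(\<Sum>j\<in>UNIV. wk (P $ i $ j) (\<lambda>t. u t $ j) \<phi>) = (\<Sum>j\<in>UNIV. wk (Q $ i $ j) (\<lambda>t. (C *v x t + D *v u t) $ j) \<phi>)"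
    unfolding P by simp
qed

lemma cpoly_const [simp]: "cpoly [:c:] = [:of_real c:]" by (simp add: map_poly_pCons)

lemma kernel_form_eval:
  fixes A :: "real^'d^'d" and B :: "real^'n^'d" and C :: "real^'d^'m" and D :: "real^'n^'m"
  assumes K: "kernel_form A B C D P Q Y"
  shows "evalC Q s ** cmat C = evalC Y s ** (mat s - cmat A)"
    and "evalC P s = evalC Y s ** cmat B + evalC Q s ** cmat D"
proof -
  have "(evalC Q s ** cmat C) $ i $ l = (evalC Y s ** (mat s - cmat A)) $ i $ l" for i l
  proof -
    have "(evalC Q s ** cmat C) $ i $ l = poly (cpoly (\<Sum>j\<in>UNIV. Q $ i $ j * [:C $ j $ l:])) s"
      by (simp only: matrix_matrix_mult_def vec_lambda_beta cpoly_sum cpoly_mult cpoly_const poly_sum poly_mult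
          evalC_component cmat_component) simp
    also have "\<dots> = poly (cpoly ([:0, 1:] * Y $ i $ l - (\<Sum>k\<in>UNIV. Y $ i $ k * [:A $ k $ l:]))) s"
      using K unfolding kernel_form_def free_quotient_def by simp
    also have "\<dots> = s * poly (cpoly (Y $ i $ l)) s - (\<Sum>k\<in>UNIV. poly (cpoly (Y $ i $ k)) s * of_real (A $ k $ l))"
      by (simp only: cpoly_diff cpoly_sum cpoly_mult cpoly_const poly_sum poly_mult poly_diff) (simp add: map_poly_pCons)
    also have "\<dots> = (\<Sum>k\<in>UNIV. poly (cpoly (Y $ i $ k)) s * (mat s $ k $ l - of_real (A $ k $ l)))"
      by (simp add: right_diff_distrib sum_subtractf mat_def if_distrib[of "\<lambda>x. _ * x"] cong: if_cong)
    finally show ?thesis by (simp add: matrix_matrix_mult_def)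
  qed
  then show "evalC Q s ** cmat C = evalC Y s ** (mat s - cmat A)" by (simp add: vec_eq_iff)
  have "evalC P s $ i $ l = (evalC Y s ** cmat B + evalC Q s ** cmat D) $ i $ l" for i l
  proof -
    have "P $ i $ l = (\<Sum>j\<in>UNIV. Y $ i $ j * [:B $ j $ l:]) + (\<Sum>j\<in>UNIV. Q $ i $ j * [:D $ j $ l:])"
      using K by (simp add: kernel_form_def input_row_def)
    then show ?thesis
      by (simp only: evalC_component vector_add_component matrix_matrix_mult_def vec_lambda_beta cpoly_add cpoly_sum cpoly_mult
          cpoly_const poly_sum poly_mult poly_add cmat_component) simp
  qed
  then show "evalC P s = evalC Y s ** cmat B + evalC Q s ** cmat D" by (simp add: vec_eq_iff)
qed

lemma kernel_form_realizes:
  assumes K: "kernel_form A B C D P Q Y"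
  shows "realizes P Q (\<lambda>l. \<chi> i. cpoly (Y $ i $ l)) A B C D"
proof -
  have *: "(\<Sum>l\<in>UNIV. z $ l *s pev (\<chi> i. cpoly (Y $ i $ l)) s) = evalC Y s *v z" for z s
    by (simp add: vec_eq_iff matrix_vector_mult_def mult.commute)
  have 1: "(mat s - cmat A) *v x = s *s x - cmat A *v x" for s x
    by (simp add: vec_eq_iff matrix_vector_mult_def mat_def left_diff_distrib sum_subtractf
        if_distrib[of "\<lambda>x. x * _"] cong: if_cong)
  show ?thesis unfolding realizes_def *
  proof (intro conjI allI)
    show "evalC Q s *v (cmat C *v x) = evalC Y s *v (s *s x - cmat A *v x)" for s x
      using kernel_form_eval(1)[OF K, of s] by (metis 1 matrix_vector_mul_assoc)
    show "evalC P s *v u = evalC Y s *v (cmat B *v u) + evalC Q s *v (cmat D *v u)" for s u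
      unfolding kernel_form_eval(2)[OF K] by (simp add: matrix_vector_mult_add_rdistrib matrix_vector_mul_assoc)
  qed
qed

text \<open>Off the range of R the dynamics may be replaced by a stable one without changing the
  input-output relation.\<close>
definition reduced :: "real^'d^'d \<Rightarrow> real^'d^'d \<Rightarrow> real^'d^'d" where
  "reduced R A = R ** A - (mat 1 - R)"

text \<open>Since Y = Y R, a factor R may be inserted after Y, and Y (1 - R) = 0 removes the added
  stable part.\<close>

lemma kernel_form_reduced:
  fixes A :: "real^'d^'d" and B :: "real^'n^'d" and C :: "real^'d^'m" and D :: "real^'n^'m"
  assumes R: "unobs_proj A C R" and K: "kernel_form A B C D P Q Y"
  shows "kernel_form (reduced R A) (R ** B) C D P Q Y"
  unfolding kernel_form_def
proof (intro allI conjI)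
  fix i
  have fq: "free_quotient A C (Q $ i) (Y $ i)" and P: "P $ i = input_row B D (Y $ i) (Q $ i)"
    using K by (auto simp: kernel_form_def)
  note YR = free_quotient_unobs[OF R fq]
  have RM: "(\<Sum>k\<in>UNIV. Y $ i $ k * [:(R ** M) $ k $ l:]) = (\<Sum>k\<in>UNIV. Y $ i $ k * [:M $ k $ l:])" for M :: "real^'k^'d" and l
    unfolding const_poly_row_mult[symmetric] YR ..
  have "(\<Sum>k\<in>UNIV. Y $ i $ k * [:(mat 1 - R) $ k $ l:]) = 0" for l
  proof -
    have "(\<Sum>k\<in>UNIV. Y $ i $ k * [:(mat 1 - R) $ k $ l:]) = (\<Sum>k\<in>UNIV. Y $ i $ k * [:(R ** (mat 1 - R)) $ k $ l:])"
      unfolding RM ..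
    moreover have "R ** (mat 1 - R) = 0" using unobs_projD(1)[OF R]
      by (simp add: matrix_eq matrix_vector_mul_assoc[symmetric] mat_minus_vec matrix_vector_mult_diff_distrib)
    ultimately show ?thesis by simp
  qed
  moreover have "Y $ i $ k * [:reduced R A $ k $ l:] = Y $ i $ k * [:(R ** A) $ k $ l:] - Y $ i $ k * [:(mat 1 - R) $ k $ l:]" for k l
    by (simp add: reduced_def smult_diff_left)
  ultimately have "(\<Sum>k\<in>UNIV. Y $ i $ k * [:reduced R A $ k $ l:]) = (\<Sum>k\<in>UNIV. Y $ i $ k * [:A $ k $ l:])" for l
    by (simp only: sum_subtractf RM diff_zero)
  then show "free_quotient (reduced R A) C (Q $ i) (Y $ i)" using fq unfolding free_quotient_def by simp
  show "P $ i = input_row (R ** B) D (Y $ i) (Q $ i)" unfolding P input_row_def RM ..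
qed

lemma cmat_mult: "cmat (M ** N) = cmat M ** cmat N"
  by (simp add: vec_eq_iff matrix_matrix_mult_def)

text \<open>Modulo the range of R the reduced matrix acts as -1, so an eigenvector for another
  eigenvalue lies in that range. There the matrix acts as the observable quotient, and C v = 0 would
  make v unobservable.\<close>

lemma reduced_eigenvector:
  fixes A :: "real^'d^'d" and C :: "real^'d^'m"
  assumes R: "unobs_proj A C R" and v: "cmat (reduced R A) *v v = z *s v" "v \<noteq> 0" and z: "z \<noteq> -1"
  shows "cmat C *v v \<noteq> 0"
proof
  assume C0: "cmat C *v v = 0"
  note RD = unobs_projD[OF R]
  have RR: "R ** R = R" and CR: "(C ** matpow A k) ** R = C ** matpow A k" for k
    using RD(1,3) by (simp_all add: matrix_eq matrix_vector_mul_assoc[symmetric])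
  have A': "cmat (reduced R A) *v v = cmat R *v (cmat A *v v) - (v - cmat R *v v)"
  proof -
    have "cmat (reduced R A) = cmat R ** cmat A - (mat 1 - cmat R)"
      by (simp add: reduced_def cmat_mult[symmetric] vec_eq_iff mat_def)
    then show ?thesis by (simp add: mat_minus_vec matrix_vector_mul_assoc matrix_vector_mult_diff_rdistrib)
  qed
  have RRv: "cmat R *v (cmat R *v w) = cmat R *v w" for w
    using RR by (metis cmat_mult matrix_vector_mul_assoc)
  have "cmat R *v (z *s v) = cmat R *v (cmat A *v v)"
    unfolding v(1)[symmetric] A' by (simp add: matrix_vector_mult_diff_distrib RRv)
  then have 1: "cmat R *v (cmat A *v v) = z *s (cmat R *v v)" by (simp add: vector_scalar_commute)
  then have "(z + 1) *s (v - cmat R *v v) = 0"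
    using v(1) unfolding A' by (simp add: vec_eq_iff algebra_simps)
  then have "v - cmat R *v v = 0" using z unfolding vector_mul_eq_0 add_eq_0_iff2 by blast
  then have Rv: "cmat R *v v = v" by simp
  have "cmat (C ** matpow A k) *v v = 0" for k
  proof (induction k)
    case (Suc k)
    have "cmat (C ** matpow A (Suc k)) *v v = cmat (C ** matpow A k) *v (cmat A *v v)"
      unfolding matpow.simps matpow_comm[symmetric] cmat_mult by (simp add: matrix_vector_mul_assoc matrix_mul_assoc)
    also have "\<dots> = cmat (C ** matpow A k) *v (cmat R *v (cmat A *v v))"
      using CR[of k] by (metis cmat_mult matrix_vector_mul_assoc)
    also have "\<dots> = 0" unfolding 1 Rv by (simp add: vector_scalar_commute Suc)
    finally show ?case .
  qed (simp add: C0)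
  then have "cmat R *v v = 0"
  proof -
    assume *: "\<And>k. cmat (C ** matpow A k) *v v = 0"
    define a where "a = (\<chi> i. Re (v $ i))"
    define b where "b = (\<chi> i. Im (v $ i))"
    have r: "cmat L *v v = 0 \<longleftrightarrow> L *v a = 0 \<and> L *v b = 0" for L :: "real^'d^'j"
      by (auto simp: vec_eq_iff matrix_vector_mult_def a_def b_def complex_eq_iff)
    show ?thesis using * unfolding r RD(2) by (simp add: matrix_vector_mul_assoc)
  qed
  then show False using Rv v(2) by simp
qed

lemma right_injective_of_left:
  fixes M :: "complex^'m^'m"
  assumes inj: "\<And>w. w v* M = 0 \<Longrightarrow> w = 0" and x: "M *v x = 0"
  shows "x = 0"
proof -
  have "\<exists>L. L ** transpose M = mat 1"
    unfolding matrix_left_invertible_ker using inj by (simp add: vector_transpose_matrix transpose_matrix_vector)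
  then obtain L where "L ** transpose M = mat 1" ..
  then have "transpose (L ** transpose M) = mat 1" by (simp add: transpose_mat)
  then have "M ** transpose L = mat 1" by (simp add: matrix_transpose_mul)
  then have "transpose L ** M = mat 1" using matrix_left_right_inverse by blast
  then have "x = transpose L *v (M *v x)" by (simp add: matrix_vector_mul_assoc)
  then show ?thesis using x by simp
qed

text \<open>An eigenvector v of the reduced system with \<open>Re z\<close> nonnegative satisfies
  Q(z) C v = 0 by the realization, and Q(z) is invertible, so C v = 0 against
  \<open>reduced_eigenvector\<close>. Hence the reduced system is Hurwitz, and its storage function
  is pulled back along R.\<close>

theorem behaviour_dissipative:
  fixes A :: "real^'d^'d" and B :: "real^'n^'d" and C :: "real^'d^'m" and D :: "real^'n^'m"
  assumes br: "bounded_real_pair P Q"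
    and inc: "\<And>x u. ctraj A B x u \<Longrightarrow> poly_diff_eq P Q u (\<lambda>t. C *v x t + D *v u t)"
  shows "\<exists>X. sym_mat X \<and> psd X \<and> dissipative A B C D X"
proof -
  obtain Y where K: "kernel_form A B C D P Q Y" using kernel_form_exists[OF inc] by blast
  obtain R where R: "unobs_proj A C R" using unobs_proj_exists by blast
  note RD = unobs_projD[OF R]
  note K' = kernel_form_reduced[OF R K]
  have re: "realizes P Q (\<lambda>l. \<chi> i. cpoly (Y $ i $ l)) (reduced R A) (R ** B) C D" by (rule kernel_form_realizes[OF K'])
  have hur: "Re z < 0" if v: "cmat (reduced R A) *v v = z *s v" "v \<noteq> 0" for z v
  proof (rule ccontr)
    assume "\<not> Re z < 0"
    then have z: "0 \<le> Re z" "z \<noteq> -1" by auto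
    have "evalC Q z *v (cmat C *v v) = 0" using re v(1) unfolding realizes_def by simp
    then have "cmat C *v v = 0" using right_injective_of_left[OF Q_nonsingular[OF br z(1)]] by blast
    then show False using reduced_eigenvector[OF R v z(2)] by blast
  qed
  have "\<exists>X. sym_mat X \<and> psd X \<and> dissipative (reduced R A) (R ** B) C D X"
    by (rule bounded_real_LMI[OF br re]) (rule hur)
  then obtain X where X: "sym_mat X" "psd X" "dissipative (reduced R A) (R ** B) C D X" by blast
  define X' where "X' = transpose R ** X ** R"
  have form: "x \<bullet> (X' *v y) = (R *v x) \<bullet> (X *v (R *v y))" for x y
    by (simp add: X'_def inner_matrix_transpose matrix_vector_mul_assoc matrix_mul_assoc)
  have "sym_mat X'" using X(1) by (simp add: sym_mat_def X'_def matrix_transpose_mul matrix_mul_assoc)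
  moreover from this have "psd X'" using X(2) unfolding psd_def form by blast
  moreover have "dissipative A B C D X'" unfolding dissipative_def
  proof (intro allI)
    fix x u
    have "reduced R A *v (R *v x) + (R ** B) *v u = R *v (A *v x + B *v u)"
      by (simp add: reduced_def mat_minus_vec matrix_vector_mult_diff_rdistrib RD(1,5) matrix_vector_right_distrib
          flip: matrix_vector_mul_assoc)
    then show "2 * (x \<bullet> (X' *v (A *v x + B *v u))) + (norm (C *v x + D *v u))\<^sup>2 \<le> (norm u)\<^sup>2"
      using X(3)[unfolded dissipative_def, rule_format, of "R *v x" u] by (simp only: form RD(4))
  qed
  ultimately show ?thesis by blast
qed

section \<open>Kernel representations of the external behaviour\<close>

text \<open>Fredholm's alternative by induction: a new vector depending on the old ones is
  consistent by hypothesis, and an independent one is met by moving x along its component orthogonal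
  to their span.\<close>

lemma solvable_linear_system:
  fixes f :: "'i \<Rightarrow> 'a::euclidean_space"
  assumes "finite J" and "\<And>c. (\<Sum>j\<in>J. c j *\<^sub>R f j) = 0 \<Longrightarrow> (\<Sum>j\<in>J. c j * b j) = 0"
  shows "\<exists>x. \<forall>j\<in>J. f j \<bullet> x = (b j :: real)"
  using assms
proof (induction J rule: finite_induct)
  case (insert i J)
  have "(\<Sum>j\<in>J. c j * b j) = 0" if "(\<Sum>j\<in>J. c j *\<^sub>R f j) = 0" for c
  proof -
    have e: "(\<Sum>j\<in>J. (c(i := 0)) j *\<^sub>R f j) = (\<Sum>j\<in>J. c j *\<^sub>R f j)"
      "(\<Sum>j\<in>J. (c(i := 0)) j * b j) = (\<Sum>j\<in>J. c j * b j)"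
      using insert.hyps(2) by (auto intro!: sum.cong)
    show ?thesis using insert.prems[of "c(i := 0)"] insert.hyps that unfolding sum.insert[OF insert.hyps] e by simp
  qed
  from insert.IH[OF this] obtain x where x: "\<And>j. j \<in> J \<Longrightarrow> f j \<bullet> x = b j" by blast
  show ?case
  proof (cases "f i \<in> span (f ` J)")
    case True
    have "span (f ` J) \<subseteq> {v. \<exists>c. v = (\<Sum>j\<in>J. c j *\<^sub>R f j)}"
    proof (rule span_minimal)
      show "f ` J \<subseteq> {v. \<exists>c. v = (\<Sum>j\<in>J. c j *\<^sub>R f j)}"
      proof safe
        fix j assume "j \<in> J"
        then show "\<exists>c. f j = (\<Sum>j\<in>J. c j *\<^sub>R f j)"
          using insert.hyps(1) by (intro exI[of _ "\<lambda>k. if k = j then 1 else 0"]) (simp add: if_distrib[of "\<lambda>r. r *\<^sub>R _"] cong: if_cong)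
      qed
      show "subspace {v. \<exists>c. v = (\<Sum>j\<in>J. c j *\<^sub>R f j)}"
        unfolding subspace_def
      proof safe
        show "\<exists>c. 0 = (\<Sum>j\<in>J. c j *\<^sub>R f j)" by (rule exI[of _ "\<lambda>_. 0"]) simp
        show "\<exists>ca. (\<Sum>j\<in>J. c j *\<^sub>R f j) + (\<Sum>j\<in>J. d j *\<^sub>R f j) = (\<Sum>j\<in>J. ca j *\<^sub>R f j)" for c d
          by (rule exI[of _ "\<lambda>j. c j + d j"]) (simp add: scaleR_add_left sum.distrib)
        show "\<exists>ca. r *\<^sub>R (\<Sum>j\<in>J. c j *\<^sub>R f j) = (\<Sum>j\<in>J. ca j *\<^sub>R f j)" for r c
          by (rule exI[of _ "\<lambda>j. r * c j"]) (simp add: scaleR_sum_right)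
      qed
    qed
    then obtain c where c: "f i = (\<Sum>j\<in>J. c j *\<^sub>R f j)" using True by blast
    have e: "(\<Sum>j\<in>J. (c(i := -1)) j *\<^sub>R f j) = (\<Sum>j\<in>J. c j *\<^sub>R f j)"
      "(\<Sum>j\<in>J. (c(i := -1)) j * b j) = (\<Sum>j\<in>J. c j * b j)"
      using insert.hyps(2) by (auto intro!: sum.cong)
    have "- b i + (\<Sum>j\<in>J. c j * b j) = 0"
      using insert.prems[of "c(i := -1)"] unfolding sum.insert[OF insert.hyps] e by (simp add: c)
    moreover have "f i \<bullet> x = (\<Sum>j\<in>J. c j * b j)" unfolding c inner_sum_left using x by simp
    ultimately show ?thesis using x by (intro exI[of _ x]) auto
  next
    case False
    obtain y z where yz: "y \<in> span (f ` J)" "\<And>w. w \<in> span (f ` J) \<Longrightarrow> orthogonal z w" "f i = y + z"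
      using orthogonal_subspace_decomp_exists[of "f ` J" "f i"] by metis
    have z: "z \<noteq> 0" using yz(1,3) False by auto
    have fz: "f i \<bullet> z = z \<bullet> z" using yz(2)[OF yz(1)] unfolding yz(3) by (simp add: inner_add_left orthogonal_def inner_commute[of y z])
    have jz: "f j \<bullet> z = 0" if "j \<in> J" for j
      using yz(2)[OF span_base, of "f j"] that by (auto simp: orthogonal_def inner_commute)
    show ?thesis
      using x z fz jz
      by (intro exI[of _ "x + ((b i - f i \<bullet> x) / (z \<bullet> z)) *\<^sub>R z"]) (auto simp: inner_add_right)
  qed
qed simp

lemma smooth_deriv_pow_DERIV: "smooth z \<Longrightarrow> ((deriv ^^ k) z has_real_derivative (deriv ^^ Suc k) z t) (at t)"
  using smoothD(1)[OF smooth_deriv_pow, of z k t] by simp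

text \<open>Gronwall for the sum E of squares of the derivatives of order below n: the equation
  bounds the next derivative, so |E'| <= K E, and E exp (- K t) after 0 and E exp (K t) before 0 are
  monotone.\<close>

lemma smooth_ode_unique:
  assumes a: "a \<noteq> 0" and z: "smooth z" and ode: "\<And>t. diffop a z t = 0"
    and init: "\<And>k. k < degree a \<Longrightarrow> (deriv ^^ k) z 0 = 0"
  shows "z t = 0"
proof (cases "degree a = 0")
  case True
  then have "coeff a 0 \<noteq> 0" using a leading_coeff_neq_0[of a] by simp
  then show ?thesis using ode[of t] True by (simp add: diffop_def)
next
  case False
  define n where "n = degree a"
  define b where "b = lead_coeff a"
  have b: "b \<noteq> 0" using a by (simp add: b_def)
  define Z where "Z k = (deriv ^^ k) z" for k
  have dZ: "(Z k has_real_derivative Z (Suc k) t) (at t)" for k t unfolding Z_def by (rule smooth_deriv_pow_DERIV[OF z])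
  define E where "E t = (\<Sum>k<n. (Z k t)\<^sup>2)" for t
  define E' where "E' t = (\<Sum>k<n. 2 * (Z k t * Z (Suc k) t))" for t
  have E0: "E t \<ge> 0" for t by (simp add: E_def sum_nonneg)
  have dE: "(E has_real_derivative E' t) (at t)" for t
    unfolding E_def[abs_def] E'_def by (intro DERIV_sum) (auto intro!: derivative_eq_intros dZ)
  define M where "M = (\<Sum>k<n. \<bar>coeff a k / b\<bar>)"
  have M: "M \<ge> 0" by (simp add: M_def sum_nonneg)
  have Zk: "\<bar>Z k t\<bar> \<le> sqrt (E t)" if "k < n" for k t
  proof -
    have "(Z k t)\<^sup>2 \<le> E t" unfolding E_def using that by (intro member_le_sum) auto
    then show ?thesis by (metis real_sqrt_abs real_sqrt_le_iff)
  qed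
  have Zn: "\<bar>Z n t\<bar> \<le> M * sqrt (E t)" for t
  proof -
    have "(\<Sum>k<n. coeff a k * Z k t) + b * Z n t = 0"
      using ode[of t] unfolding diffop_def n_def[symmetric] lessThan_Suc_atMost[symmetric] sum.lessThan_Suc Z_def[symmetric]
      by (simp add: b_def n_def)
    then have "b * Z n t = - (\<Sum>k<n. coeff a k * Z k t)" by linarith
    then have "Z n t = - (\<Sum>k<n. (coeff a k / b) * Z k t)"
      using b by (simp add: field_simps flip: sum_divide_distrib)
    then have "\<bar>Z n t\<bar> \<le> (\<Sum>k<n. \<bar>coeff a k / b\<bar> * \<bar>Z k t\<bar>)" by (simp only: abs_minus_cancel flip: abs_mult) (rule sum_abs)
    also have "\<dots> \<le> (\<Sum>k<n. \<bar>coeff a k / b\<bar> * sqrt (E t))" by (intro sum_mono mult_left_mono Zk) auto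
    finally show ?thesis by (simp add: M_def sum_distrib_right)
  qed
  define K where "K = 2 * real n * (1 + M)"
  have E'K: "\<bar>E' t\<bar> \<le> K * E t" for t
  proof -
    have "\<bar>Z (Suc k) t\<bar> \<le> (1 + M) * sqrt (E t)" if "k < n" for k
    proof (cases "Suc k < n")
      case True
      have "\<bar>Z (Suc k) t\<bar> \<le> 1 * sqrt (E t)" using Zk[OF True] by simp
      also have "\<dots> \<le> (1 + M) * sqrt (E t)" using M E0 by (intro mult_right_mono) auto
      finally show ?thesis .
    next
      case False
      then have "Suc k = n" using that by simp
      then have "\<bar>Z (Suc k) t\<bar> \<le> M * sqrt (E t)" using Zn by simp
      also have "\<dots> \<le> (1 + M) * sqrt (E t)" using M E0 by (intro mult_right_mono) auto
      finally show ?thesis .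
    qed
    then have "\<bar>2 * (Z k t * Z (Suc k) t)\<bar> \<le> 2 * (sqrt (E t) * ((1 + M) * sqrt (E t)))" if "k < n" for k
      unfolding abs_mult using that Zk[OF that, of t] E0[of t] by (intro mult_mono) auto
    moreover have "2 * (sqrt (E t) * ((1 + M) * sqrt (E t))) = 2 * (1 + M) * E t"
    proof -
      have "2 * (r * ((1 + M) * r)) = 2 * (1 + M) * (r * r)" for r by (simp add: algebra_simps)
      from this[of "sqrt (E t)"] show ?thesis using E0[of t] by simp
    qed
    ultimately have "(\<Sum>k<n. \<bar>2 * (Z k t * Z (Suc k) t)\<bar>) \<le> real n * (2 * (1 + M) * E t)"
      using sum_bounded_above[of "{..<n}" "\<lambda>k. \<bar>2 * (Z k t * Z (Suc k) t)\<bar>"] by simp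
    then have "(\<Sum>k<n. \<bar>2 * (Z k t * Z (Suc k) t)\<bar>) \<le> K * E t" by (simp add: K_def mult_ac)
    then show ?thesis unfolding E'_def by (rule order_trans[OF sum_abs])
  qed
  have E00: "E 0 = 0" unfolding E_def using init by (simp add: Z_def n_def)
  have "E t = 0"
  proof (cases "0 \<le> t")
    case True
    have "E t * exp (- K * t) \<le> E 0 * exp (- K * 0)"
    proof (rule DERIV_nonpos_imp_nonincreasing[OF True])
      fix s :: real
      have "((\<lambda>t. E t * exp (- K * t)) has_real_derivative (E' s - K * E s) * exp (- K * s)) (at s)"
        by (auto intro!: derivative_eq_intros dE simp: algebra_simps)
      moreover have "(E' s - K * E s) * exp (- K * s) \<le> 0"
        using E'K[of s] by (intro mult_nonpos_nonneg) auto
      ultimately show "\<exists>y. ((\<lambda>t. E t * exp (- K * t)) has_real_derivative y) (at s) \<and> y \<le> 0" by blast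
    qed
    then show ?thesis using E0[of t] E00 by (simp add: mult_le_0_iff)
  next
    case False
    then have t: "t \<le> 0" by simp
    have "E t * exp (K * t) \<le> E 0 * exp (K * 0)"
    proof (rule DERIV_nonneg_imp_nondecreasing[OF t])
      fix s :: real
      have "((\<lambda>t. E t * exp (K * t)) has_real_derivative (E' s + K * E s) * exp (K * s)) (at s)"
        by (auto intro!: derivative_eq_intros dE simp: algebra_simps)
      moreover have "(E' s + K * E s) * exp (K * s) \<ge> 0"
        using E'K[of s] by (intro mult_nonneg_nonneg) auto
      ultimately show "\<exists>y. ((\<lambda>t. E t * exp (K * t)) has_real_derivative y) (at s) \<and> y \<ge> 0" by blast
    qed
    then show ?thesis using E0[of t] E00 by (simp add: mult_le_0_iff)
  qed
  then show ?thesis using Zk[of 0 t] False by (simp add: Z_def n_def)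
qed

definition annihilators :: "real^'d^'d \<Rightarrow> real^'d^'m \<Rightarrow> (real poly^'m) set" where
  "annihilators A C = {q. \<exists>y. free_quotient A C q y}"

lemma submodule_annihilators: "submodule (annihilators A C)"
  unfolding submodule_def
proof (intro conjI ballI allI)
  have "free_quotient A C 0 0" by (simp add: free_quotient_def)
  then show "0 \<in> annihilators A C" unfolding annihilators_def by blast
next
  fix v w assume "v \<in> annihilators A C" "w \<in> annihilators A C"
  then obtain y z where "free_quotient A C v y" "free_quotient A C w z" unfolding annihilators_def by blast
  then have "free_quotient A C (v + w) (y + z)"
    unfolding free_quotient_def vector_add_component distrib_right distrib_left sum.distrib by simp
  then show "v + w \<in> annihilators A C" unfolding annihilators_def by blast
next
  fix c v assume "v \<in> annihilators A C"
  then obtain y where "free_quotient A C v y" unfolding annihilators_def by blast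
  then have "free_quotient A C (c *s v) (c *s y)"
    unfolding free_quotient_def vector_smult_component mult.assoc sum_distrib_left[symmetric]
    by (simp only: right_diff_distrib mult.left_commute[of _ c] simp_thms)
  then show "c *s v \<in> annihilators A C" unfolding annihilators_def by blast
qed

lemma annihilatorsI: "free_residue A C q = 0 \<Longrightarrow> q \<in> annihilators A C"
  unfolding annihilators_def using free_quotient_exists by blast

lemma annihilating_polynomial: "\<exists>a. a \<noteq> 0 \<and> peval a A = 0" for A :: "real^'d^'d"
  using exists_linear_relation[of "matpow A"] unfolding peval_def by blast

text \<open>Multiples of coordinate vectors by an annihilating polynomial of A give the module full
  rank.\<close>

lemma annihilators_axis: "axis j a \<in> annihilators A C" if "peval a A = 0"
proof (rule annihilatorsI)
  have "C ** peval (axis j a $ k) A = 0" for k using that by (cases "k = j") (simp_all add: axis_def)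
  then show "free_residue A C (axis j a) = 0" by (simp add: free_residue_def vec_eq_iff)
qed

lemma wk_AE_cong:
  assumes "test_fun \<phi>" "locint f" "locint g" "AE t in lborel. f t = g t"
  shows "wk p f \<phi> = wk p g \<phi>"
  unfolding wk_def
  by (rule integral_cong_AE[OF borel_measurable_integrable[OF wk_integrable[OF assms(1,2)]]
      borel_measurable_integrable[OF wk_integrable[OF assms(1,3)]]]) (use assms(4) in \<open>auto elim: eventually_mono\<close>)

definition generates :: "real poly^'m^'m \<Rightarrow> (real poly^'m) set \<Rightarrow> bool" where
  "generates Q N \<longleftrightarrow> (\<forall>i. Q $ i \<in> N) \<and> (\<forall>v\<in>N. \<exists>c. v = (\<Sum>j\<in>UNIV. c j *s Q $ j))"

lemma generatesD:
  assumes "generates Q N"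
  shows "Q $ i \<in> N" and "\<And>thesis. v \<in> N \<Longrightarrow> (\<And>c. v = (\<Sum>j\<in>UNIV. c j *s Q $ j) \<Longrightarrow> thesis) \<Longrightarrow> thesis"
proof -
  show "Q $ i \<in> N" using assms by (simp add: generates_def)
  fix thesis assume "v \<in> N" and th: "\<And>c. v = (\<Sum>j\<in>UNIV. c j *s Q $ j) \<Longrightarrow> thesis"
  then have "\<exists>c. v = (\<Sum>j\<in>UNIV. c j *s Q $ j)" using assms by (simp add: generates_def)
  then show thesis by (elim exE) (rule th)
qed

text \<open>Each component solves a scalar equation given by a polynomial that annihilates A, hence
  is smooth and fixed by finitely many derivatives at 0. A state with these derivatives exists
  because every linear relation among the rows of C A^k is an annihilator and so is respected by
  y.\<close>

lemma annihilated_is_free_response: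
  fixes A :: "real^'d^'d" and C :: "real^'d^'m" and y :: "real \<Rightarrow> real^'m"
  assumes y: "L2loc y"
    and ann: "\<And>q \<phi>. q \<in> annihilators A C \<Longrightarrow> test_fun \<phi> \<Longrightarrow> (\<Sum>j\<in>UNIV. wk (q $ j) (\<lambda>t. y t $ j) \<phi>) = 0"
  shows "\<exists>x0. AE t in lborel. y t = C *v (expm A t *v x0)"
proof -
  obtain a where a: "a \<noteq> 0" "peval a A = 0" using annihilating_polynomial by blast
  have "wk a (\<lambda>t. y t $ j) \<phi> = 0" if "test_fun \<phi>" for j \<phi>
  proof -
    have "(\<Sum>k\<in>UNIV. wk (axis j a $ k) (\<lambda>t. y t $ k) \<phi>) = 0" by (rule ann[OF annihilators_axis[OF a(2)] that])
    moreover have "wk (axis j a $ k) (\<lambda>t. y t $ k) \<phi> = (if k = j then wk a (\<lambda>t. y t $ j) \<phi> else 0)" for k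
      by (auto simp: axis_def wk_def)
    ultimately show ?thesis by simp
  qed
  then have "\<forall>j. \<exists>H. smooth H \<and> (AE t in lborel. y t $ j = H t)"
    using weak_ode_smooth[OF a(1) locint_component[OF y]] by blast
  from choice[OF this] obtain H where H: "\<And>j. smooth (H j)" "\<And>j. AE t in lborel. y t $ j = H j t" by blast
  have Hl: "locint (H j)" for j by (rule locint_continuous[OF smoothD(3)[OF H(1)]])
  have strong: "(\<Sum>j\<in>UNIV. diffop (q $ j) (H j) t) = 0" if "q \<in> annihilators A C" for q t
    by (rule weak_to_strong[OF H(1)]) (use ann[OF that] wk_AE_cong[OF _ locint_component[OF y] Hl H(2)] in simp)
  have ode: "diffop a (H j) t = 0" for j t
  proof -
    have "diffop (axis j a $ k) (H k) t = (if k = j then diffop a (H j) t else 0)" for k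
      by (auto simp: axis_def diffop_def)
    then show ?thesis using strong[OF annihilators_axis[OF a(2)], of j t] by simp
  qed
  define n where "n = degree a"
  have "\<exists>x. \<forall>p\<in>{..<n} \<times> UNIV. (C ** matpow A (fst p)) $ snd p \<bullet> x = (deriv ^^ fst p) (H (snd p)) 0"
  proof (rule solvable_linear_system)
    fix c assume c: "(\<Sum>p\<in>{..<n} \<times> UNIV. c p *\<^sub>R (C ** matpow A (fst p)) $ snd p) = 0"
    \<comment> \<open>The relation \<open>c\<close> read as a polynomial row.\<close>
    define q where "q = (\<chi> j. \<Sum>k<n. monom (c (k, j)) k)"
    have cq: "coeff (q $ j) k = (if k < n then c (k, j) else 0)" for j k
      by (simp add: q_def coeff_sum)
    have dq: "degree (q $ j) \<le> n" for j by (rule degree_le) (simp add: cq)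
    have ex: "(\<Sum>k\<le>n. (if k < n then f k else 0) :: 'z::comm_monoid_add) = (\<Sum>k<n. f k)" for f
      by (rule sum.mono_neutral_cong_right) auto
    have "free_residue A C q $ l = 0" for l
    proof -
      have "(C ** peval (q $ j) A) $ j $ l = (\<Sum>k<n. c (k, j) * (C ** matpow A k) $ j $ l)" for j
      proof -
        have "(C ** peval (q $ j) A) $ j $ l = (\<Sum>k\<le>n. coeff (q $ j) k * (C ** matpow A k) $ j $ l)"
          unfolding peval_eq[OF dq] matrix_mult_sum_right by (simp add: matrix_scalar_ac scalar_matrix_assoc[symmetric])
        also have "\<dots> = (\<Sum>k\<le>n. if k < n then c (k, j) * (C ** matpow A k) $ j $ l else 0)"
          by (rule sum.cong) (auto simp: cq)
        finally show ?thesis unfolding ex .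
      qed
      then have "free_residue A C q $ l = (\<Sum>j\<in>UNIV. \<Sum>k<n. c (k, j) * (C ** matpow A k) $ j $ l)" by (simp add: free_residue_def)
      also have "\<dots> = (\<Sum>p\<in>{..<n} \<times> UNIV. c p * (C ** matpow A (fst p)) $ snd p $ l)"
        by (subst sum.swap) (simp add: sum.cartesian_product split_def)
      also have "\<dots> = (\<Sum>p\<in>{..<n} \<times> UNIV. c p *\<^sub>R (C ** matpow A (fst p)) $ snd p) $ l" by simp
      finally show ?thesis unfolding c by simp
    qed
    then have "q \<in> annihilators A C" by (intro annihilatorsI) (simp add: vec_eq_iff)
    from strong[OF this, of 0] have "(\<Sum>j\<in>UNIV. \<Sum>k<n. c (k, j) * (deriv ^^ k) (H j) 0) = 0"
    proof -
      assume s: "(\<Sum>j\<in>UNIV. diffop (q $ j) (H j) 0) = 0"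
      have "diffop (q $ j) (H j) 0 = (\<Sum>k<n. c (k, j) * (deriv ^^ k) (H j) 0)" for j
      proof -
        have "diffop (q $ j) (H j) 0 = (\<Sum>k\<le>n. coeff (q $ j) k * (deriv ^^ k) (H j) 0)"
          unfolding diffop_def by (rule sum.mono_neutral_left) (use dq[of j] in \<open>auto simp: coeff_eq_0\<close>)
        also have "\<dots> = (\<Sum>k\<le>n. if k < n then c (k, j) * (deriv ^^ k) (H j) 0 else 0)"
          by (rule sum.cong) (auto simp: cq)
        finally show ?thesis unfolding ex .
      qed
      then show ?thesis using s by simp
    qed
    then show "(\<Sum>p\<in>{..<n} \<times> UNIV. c p * (deriv ^^ fst p) (H (snd p)) 0) = 0"
      by (subst (asm) sum.swap) (simp add: sum.cartesian_product split_def)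
  qed simp
  then obtain x0 where x0: "\<And>k j. k < n \<Longrightarrow> (C ** matpow A k) $ j \<bullet> x0 = (deriv ^^ k) (H j) 0" by fastforce
  define g where "g j t = (C *v (expm A t *v x0)) $ j" for j t
  have g: "smooth (g j)" for j unfolding g_def[abs_def] by (rule free_response_smooth)
  have "H j t = g j t" for j t
  proof -
    define z where "z t = 1 * H j t + (-1) * g j t" for t
    have dz: "(deriv ^^ k) z = (\<lambda>t. 1 * (deriv ^^ k) (H j) t + (-1) * (deriv ^^ k) (g j) t)" for k
      unfolding z_def[abs_def] by (rule deriv_pow_cmult_add[OF H(1) g])
    have "z t = 0"
    proof (rule smooth_ode_unique[OF a(1), where z = z and t = t])
      show "smooth z" unfolding z_def[abs_def] by (intro smooth_add smooth_cmult H g)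
      have "diffop a (g j) s = 0" for s unfolding g_def[abs_def] diffop_free_response a(2) by simp
      then show "diffop a z s = 0" for s
        using ode[of j s] unfolding diffop_def dz by (simp add: algebra_simps sum_subtractf)
      show "(deriv ^^ k) z 0 = 0" if "k < degree a" for k
        using x0[of k j] that unfolding dz g_def[abs_def] free_response_deriv_pow
        by (simp add: n_def expm_0 matrix_vector_mul_component)
    qed
    then show ?thesis by (simp add: z_def)
  qed
  then have "AE t in lborel. \<forall>j. y t $ j = (C *v (expm A t *v x0)) $ j"
    using H(2) by (simp add: AE_all_countable g_def)
  then have "AE t in lborel. y t = C *v (expm A t *v x0)" by eventually_elim (simp add: vec_eq_iff)
  then show ?thesis by blast
qed

text \<open>For a solution (u, y), subtract from y the output of some trajectory with the same
  input. The difference is annihilated by the rows of \<open>Q\<close>, hence by all annihilators,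
  and so is a free response.\<close>

theorem kernel_representation:
  fixes A :: "real^'d^'d" and B :: "real^'n^'d" and C :: "real^'d^'m" and D :: "real^'n^'m"
  assumes gen: "generates Q (annihilators A C)" and K: "kernel_form A B C D P Q Y"
  shows "ext_beh A B C D = {(u, y). L2loc u \<and> L2loc y \<and> poly_diff_eq P Q u y}"
proof (intro equalityI subsetI)
  fix p assume "p \<in> ext_beh A B C D"
  then obtain u y x where p: "p = (u, y)" and y: "L2loc y" and tr: "ctraj A B x u"
    and ae: "AE t in lborel. y t = C *v x t + D *v u t"
    unfolding ext_beh_def using Bs_iff[of _ _ _ A B C D] by blast
  note l = ctraj_L2loc[OF tr]
  have "wk q (\<lambda>t. y t $ j) \<phi> = wk q (\<lambda>t. (C *v x t + D *v u t) $ j) \<phi>" if "test_fun \<phi>" for q j \<phi>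
    by (rule wk_AE_cong[OF that locint_component[OF y] locint_component[OF l(3)]]) (use ae in \<open>auto elim: eventually_mono\<close>)
  then have "poly_diff_eq P Q u y"
    using kernel_form_ctraj[OF K tr] unfolding poly_diff_eq_iff[OF l(1) y] poly_diff_eq_iff[OF l(1,3)] by simp
  then show "p \<in> {(u, y). L2loc u \<and> L2loc y \<and> poly_diff_eq P Q u y}" using p y l(1) by simp
next
  fix p assume "p \<in> {(u, y). L2loc u \<and> L2loc y \<and> poly_diff_eq P Q u y}"
  then obtain u y where p: "p = (u, y)" and u: "L2loc u" and y: "L2loc y" and eq: "poly_diff_eq P Q u y" by blast
  obtain x where tr: "ctraj A B x u" using ctraj_exists[OF u] by blast
  note l = ctraj_L2loc[OF tr]
  define z where "z t = y t - (C *v x t + D *v u t)" for t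
  have zl: "L2loc z" unfolding z_def[abs_def] by (intro L2loc_diff y l)
  have zQ: "(\<Sum>j\<in>UNIV. wk (Q $ i $ j) (\<lambda>t. z t $ j) \<phi>) = 0" if phi: "test_fun \<phi>" for i \<phi>
    using eq kernel_form_ctraj[OF K tr] phi unfolding poly_diff_eq_iff[OF u y] poly_diff_eq_iff[OF u l(3)] z_def
      wk_vec_diff[OF phi y l(3)] by simp
  have "(\<Sum>j\<in>UNIV. wk (q $ j) (\<lambda>t. z t $ j) \<phi>) = 0" if qa: "q \<in> annihilators A C" and phi: "test_fun \<phi>" for q \<phi>
  proof -
    obtain c where c: "q = (\<Sum>i\<in>UNIV. c i *s Q $ i)" by (rule generatesD(2)[OF gen qa])
    have "wk (q $ j) (\<lambda>t. z t $ j) \<phi> = (\<Sum>i\<in>UNIV. wk (Q $ i $ j) (\<lambda>t. z t $ j) (adj_op (c i) \<phi>))" for j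
      unfolding c sum_component vector_smult_component wk_sum[OF phi locint_component[OF zl]]
    proof (rule sum.cong[OF refl])
      fix i
      \<comment> \<open>In this order \<open>wk_mult\<close> lets the factor \<open>c i\<close> act
        on the test function.\<close>
      have "c i * Q $ i $ j = Q $ i $ j * c i" by (rule mult.commute)
      then show "wk (c i * Q $ i $ j) (\<lambda>t. z t $ j) \<phi> = wk (Q $ i $ j) (\<lambda>t. z t $ j) (adj_op (c i) \<phi>)"
        by (simp only: wk_mult[OF phi])
    qed
    then have "(\<Sum>j\<in>UNIV. wk (q $ j) (\<lambda>t. z t $ j) \<phi>)
      = (\<Sum>i\<in>UNIV. \<Sum>j\<in>UNIV. wk (Q $ i $ j) (\<lambda>t. z t $ j) (adj_op (c i) \<phi>))"
      by (simp only:) (rule sum.swap)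
    then show ?thesis using zQ[OF test_fun_adj_op[OF phi]] by simp
  qed
  then obtain x0 where x0: "AE t in lborel. z t = C *v (expm A t *v x0)"
    using annihilated_is_free_response[OF zl] by blast
  have "ctraj A B (\<lambda>t. x t + expm A t *v x0) u"
    using ctraj_linear(1)[OF tr free_ctraj] by simp
  moreover have "AE t in lborel. y t = C *v (x t + expm A t *v x0) + D *v u t"
    using x0 by eventually_elim (simp add: z_def matrix_vector_right_distrib algebra_simps)
  ultimately show "p \<in> ext_beh A B C D" unfolding ext_beh_def p using y Bs_iff[of u y _ A B C D] by blast
qed

section \<open>The dual system\<close>

definition cre :: "complex^'k \<Rightarrow> real^'k" where "cre v = (\<chi> i. Re (v $ i))"
definition cim :: "complex^'k \<Rightarrow> real^'k" where "cim v = (\<chi> i. Im (v $ i))"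

lemma cre_component [simp]: "cre v $ i = Re (v $ i)" and cim_component [simp]: "cim v $ i = Im (v $ i)"
  by (simp_all add: cre_def cim_def)

lemma cre_cim_zero: "v = 0 \<longleftrightarrow> cre v = 0 \<and> cim v = 0"
  by (auto simp: vec_eq_iff complex_eq_iff)

lemma norm_cre_cim: "(norm v)\<^sup>2 = (norm (cre v))\<^sup>2 + (norm (cim v))\<^sup>2" for v :: "complex^'k"
proof -
  have "(norm v)\<^sup>2 = (\<Sum>i\<in>UNIV. (cmod (v $ i))\<^sup>2)" by (simp add: norm_vec_def L2_set_def sum_nonneg)
  moreover have "(norm x)\<^sup>2 = (\<Sum>i\<in>UNIV. (x $ i)\<^sup>2)" for x :: "real^'k"
    unfolding power2_norm_eq_inner inner_vec_def by (simp add: power2_eq_square)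
  ultimately show ?thesis by (simp add: cmod_power2 sum.distrib)
qed

lemma cre_cim_mult:
  "cre (cmat M *v v) = M *v cre v" "cim (cmat M *v v) = M *v cim v"
  by (simp_all add: vec_eq_iff matrix_vector_mult_def)

lemma cre_cim_row:
  "cre (w v* cmat M) = transpose M *v cre w" "cim (w v* cmat M) = transpose M *v cim w"
  by (simp_all add: vec_eq_iff vector_matrix_mult_def)

lemma cre_cim_add: "cre (v + w) = cre v + cre w" "cim (v + w) = cim v + cim w"
  by (simp_all add: vec_eq_iff)

lemma cre_cim_scale:
  "cre (s *s v) = Re s *\<^sub>R cre v - Im s *\<^sub>R cim v" "cim (s *s v) = Re s *\<^sub>R cim v + Im s *\<^sub>R cre v"
  by (simp_all add: vec_eq_iff)

definition herm :: "real^'k^'k \<Rightarrow> complex^'k \<Rightarrow> real" where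
  "herm T v = cre v \<bullet> (T *v cre v) + cim v \<bullet> (T *v cim v)"

lemma herm_scale:
  assumes "sym_mat T"
  shows "cre v \<bullet> (T *v cre (s *s v)) + cim v \<bullet> (T *v cim (s *s v)) = Re s * herm T v"
proof -
  have "cim v \<bullet> (T *v cre v) = cre v \<bullet> (T *v cim v)" using sym_mat_inner[OF assms, of "cim v" "cre v"] by (simp add: inner_commute)
  then show ?thesis
    by (simp add: cre_cim_scale herm_def matrix_vector_mult_diff_distrib matrix_vector_right_distrib matrix_vector_mult_scaleR
        inner_diff_right inner_add_right algebra_simps)
qed

lemma psd_herm_zero:
  assumes "psd N"
  shows "herm N v = 0 \<longleftrightarrow> cmat N *v v = 0"
proof -
  have "0 \<le> x \<bullet> (N *v x)" for x using assms by (simp add: psd_def)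
  from this[of "cre v"] this[of "cim v"] show ?thesis
    unfolding herm_def cre_cim_zero[of "cmat N *v v"] cre_cim_mult psd_ker_iff[OF assms, symmetric] by auto
qed

definition pos_def :: "real^'k^'k \<Rightarrow> bool" where
  "pos_def X \<longleftrightarrow> sym_mat X \<and> (\<forall>x. x \<noteq> 0 \<longrightarrow> 0 < x \<bullet> (X *v x))"

lemma pos_def_psd: "pos_def X \<Longrightarrow> psd X"
  unfolding pos_def_def psd_def by (metis inner_zero_left less_eq_real_def)

lemma pos_def_herm: "pos_def T \<Longrightarrow> herm T v = 0 \<Longrightarrow> v = 0"
  using pos_def_psd[of T] unfolding pos_def_def psd_def herm_def cre_cim_zero[of v]
  by (metis add_nonneg_eq_0_iff less_irrefl)

text \<open>The witness is the inverse of X.\<close>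
lemma dual_dissipative:
  fixes A X :: "real^'d^'d" and B :: "real^'n^'d" and C :: "real^'d^'m" and D :: "real^'n^'m"
  assumes X: "pos_def X" and d: "dissipative A B C D X"
  shows "\<exists>T. pos_def T \<and> dissipative (transpose A) (transpose C) (transpose B) (transpose D) T"
proof -
  have sX: "sym_mat X" using X by (simp add: pos_def_def)
  have "x = 0" if "X *v x = 0" for x using X that unfolding pos_def_def by (metis inner_zero_right less_irrefl)
  then obtain T where T: "T ** X = mat 1" using matrix_left_invertible_ker[of X] by blast
  then have XT: "X ** T = mat 1" using matrix_left_right_inverse by blast
  have "transpose (T ** X) = mat 1" unfolding T by (simp add: transpose_mat)
  then have "X ** transpose T = mat 1" using sX by (simp add: matrix_transpose_mul sym_mat_def)
  then have "T = transpose T" by (metis T matrix_mul_assoc matrix_mul_lid matrix_mul_rid)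
  then have sT: "sym_mat T" by (simp add: sym_mat_def)
  have XTx: "X *v (T *v x) = x" for x using XT by (simp add: matrix_vector_mul_assoc)
  have "0 < x \<bullet> (T *v x)" if "x \<noteq> 0" for x
  proof -
    have "T *v x \<noteq> 0" using XTx[of x] that by auto
    then have "0 < (T *v x) \<bullet> (X *v (T *v x))" using X by (simp add: pos_def_def)
    then show ?thesis unfolding XTx by (simp add: inner_commute)
  qed
  then have "pos_def T" using sT by (simp add: pos_def_def)
  moreover have "dissipative (transpose A) (transpose C) (transpose B) (transpose D) T"
    unfolding dissipative_def
  proof (intro allI)
    fix \<eta> q
    \<comment> \<open>The primal inequality is used at the state T \<eta>, with the dual output fed
      back as primal input \<open>u\<close>.\<close>
    define x where "x = T *v \<eta>"
    define u where "u = transpose B *v \<eta> + transpose D *v q"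
    have 1: "x \<bullet> (X *v z) = z \<bullet> \<eta>" for z unfolding x_def sym_mat_inner[OF sX] XTx by (simp add: inner_commute)
    have 2: "\<eta> \<bullet> (T *v z) = x \<bullet> z" for z unfolding x_def sym_mat_inner[OF sT] ..
    have f1: "2 * ((A *v x + B *v u) \<bullet> \<eta>) + (norm (C *v x + D *v u))\<^sup>2 \<le> (norm u)\<^sup>2"
      using d[unfolded dissipative_def, rule_format, of x u] unfolding 1 .
    have f2: "(A *v x + B *v u) \<bullet> \<eta> = x \<bullet> (transpose A *v \<eta>) + u \<bullet> (transpose B *v \<eta>)"
      unfolding inner_add_left inner_matrix_transpose ..
    \<comment> \<open>Completing the square, |y - q|^2 >= 0, replaces the output norm by a pairing
      with q.\<close>
    have f3: "2 * ((C *v x + D *v u) \<bullet> q) - (norm q)\<^sup>2 \<le> (norm (C *v x + D *v u))\<^sup>2"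
    proof -
      define y where "y = C *v x + D *v u"
      have "0 \<le> (y - q) \<bullet> (y - q)" by simp
      then have "0 \<le> y \<bullet> y - 2 * (y \<bullet> q) + q \<bullet> q"
        unfolding inner_diff_left inner_diff_right inner_commute[of q y] by simp
      then show ?thesis unfolding y_def[symmetric] power2_norm_eq_inner by linarith
    qed
    have f4: "(C *v x + D *v u) \<bullet> q = x \<bullet> (transpose C *v q) + u \<bullet> (transpose D *v q)"
      unfolding inner_add_left inner_matrix_transpose ..
    have f5: "u \<bullet> (transpose B *v \<eta>) + u \<bullet> (transpose D *v q) = (norm u)\<^sup>2"
      unfolding power2_norm_eq_inner by (subst (3) u_def) (rule inner_add_right[symmetric])
    have "2 * (x \<bullet> (transpose A *v \<eta>) + x \<bullet> (transpose C *v q)) + (norm u)\<^sup>2 \<le> (norm q)\<^sup>2"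
      using f1 f3 unfolding f2 f4 f5[symmetric] by argo
    then have "2 * (x \<bullet> (transpose A *v \<eta> + transpose C *v q)) + (norm u)\<^sup>2 \<le> (norm q)\<^sup>2"
      unfolding inner_add_right .
    then show "2 * (\<eta> \<bullet> (T *v (transpose A *v \<eta> + transpose C *v q))) + (norm (transpose B *v \<eta> + transpose D *v q))\<^sup>2 \<le> (norm q)\<^sup>2"
      unfolding 2 u_def .
  qed
  ultimately show ?thesis by blast
qed

definition join :: "'c^'d \<Rightarrow> 'c^'m \<Rightarrow> 'c^('d + 'm)" where
  "join x q = (\<chi> i. case i of Inl a \<Rightarrow> x $ a | Inr b \<Rightarrow> q $ b)"

lemma cre_cim_join: "cre (join x q) = join (cre x) (cre q)" "cim (join x q) = join (cim x) (cim q)"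
  by (auto simp: vec_eq_iff join_def split: sum.split)

lemma Lambda_join:
  assumes "sym_mat X"
  shows "join x u \<bullet> (Lambda A B C D X *v join x u) =
    (norm u)\<^sup>2 - (norm (C *v x + D *v u))\<^sup>2 - 2 * (x \<bullet> (X *v (A *v x + B *v u)))"
  unfolding Lambda_form[OF assms] by (simp add: join_def)

lemma row_mat: "x v* mat s = s *s x" for x :: "complex^'d"
  by (simp add: vec_eq_iff vector_matrix_mult_def mat_def mult_delta_right mult.commute)

text \<open>At frequency s the rows w Y(s), w Q(s) and w P(s) are state, input and output of an
  exponential solution of the dual system.\<close>

lemma kernel_form_row:
  fixes w :: "complex^'m" and A :: "real^'d^'d"
  assumes K: "kernel_form A B C D P Q Y"
  shows "w v* evalC Y s v* cmat A + w v* evalC Q s v* cmat C = s *s (w v* evalC Y s)"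
    and "w v* evalC P s = w v* evalC Y s v* cmat B + w v* evalC Q s v* cmat D"
proof -
  have "w v* evalC Q s v* cmat C = w v* evalC Y s v* (mat s - cmat A)"
    unfolding vector_matrix_mul_assoc kernel_form_eval(1)[OF K] ..
  then show "w v* evalC Y s v* cmat A + w v* evalC Q s v* cmat C = s *s (w v* evalC Y s)"
    by (simp add: vector_matrix_mult_diff_rdistrib row_mat)
  show "w v* evalC P s = w v* evalC Y s v* cmat B + w v* evalC Q s v* cmat D"
    unfolding kernel_form_eval(2)[OF K] vector_matrix_mult_add_rdistrib vector_matrix_mul_assoc ..
qed

text \<open>The dual dissipation balance along that exponential solution: the storage grows at the
  rate 2 Re s times its T-form, and the supplied power is the gap.\<close>

lemma gap_dual_form:
  fixes A T :: "real^'d^'d" and w :: "complex^'m"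
  assumes K: "kernel_form A B C D P Q Y" and T: "sym_mat T"
  defines "N \<equiv> Lambda (transpose A) (transpose C) (transpose B) (transpose D) T"
  shows "herm N (join (w v* evalC Y s) (w v* evalC Q s)) = gap P Q s w - 2 * Re s * herm T (w v* evalC Y s)"
proof -
  let ?e = "w v* evalC Y s" and ?q = "w v* evalC Q s"
  have 1: "transpose A *v cre ?e + transpose C *v cre ?q = cre (s *s ?e)"
      "transpose A *v cim ?e + transpose C *v cim ?q = cim (s *s ?e)"
    unfolding kernel_form_row(1)[OF K, symmetric] cre_cim_add cre_cim_row by simp_all
  have 2: "transpose B *v cre ?e + transpose D *v cre ?q = cre (w v* evalC P s)"
      "transpose B *v cim ?e + transpose D *v cim ?q = cim (w v* evalC P s)"
    unfolding kernel_form_row(2)[OF K] cre_cim_add cre_cim_row by simp_all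
  show ?thesis
    unfolding herm_def[of N] unfolding N_def cre_cim_join Lambda_join[OF T] 1 2 gap_def norm_cre_cim
    using herm_scale[OF T, of ?e s] by (simp add: algebra_simps)
qed

text \<open>\<open>f\<close> stands for the real and for the imaginary part, so that one argument
  serves both.\<close>

lemma map_poly_part_mult:
  fixes f :: "complex \<Rightarrow> real"
  assumes f: "f 0 = 0" "\<And>x y. f (x + y) = f x + f y" "\<And>x r. f (x * of_real r) = f x * r"
  shows "map_poly f (p * cpoly r) = map_poly f p * r"
proof (rule poly_eqI)
  fix n
  have s: "f (sum g S) = (\<Sum>i\<in>S. f (g i))" for g and S :: "nat set"
    by (induction S rule: infinite_finite_induct) (auto simp: f)
  show "coeff (map_poly f (p * cpoly r)) n = coeff (map_poly f p * r) n"
    by (simp add: coeff_mult coeff_map_poly f s)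
qed

lemma map_poly_part_add:
  fixes f :: "complex \<Rightarrow> real"
  assumes "f 0 = 0" "\<And>x y. f (x + y) = f x + f y"
  shows "map_poly f (p + q) = map_poly f p + map_poly f q"
  by (rule poly_eqI) (simp add: coeff_map_poly assms)

lemma map_poly_part_sum:
  fixes f :: "complex \<Rightarrow> real"
  assumes "f 0 = 0" "\<And>x y. f (x + y) = f x + f y"
  shows "map_poly f (sum g S) = (\<Sum>i\<in>S. map_poly f (g i))"
  by (induction S rule: infinite_finite_induct) (auto simp: map_poly_part_add[OF assms])

lemma complex_poly_parts: "p = cpoly (map_poly Re p) + [:\<i>:] * cpoly (map_poly Im p)"
  by (rule poly_eqI) (simp add: coeff_map_poly complex_eq_iff)

lemma part_annihilators:
  fixes f :: "complex \<Rightarrow> real" and q :: "complex poly^'m"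
  assumes f: "f 0 = 0" "\<And>x y. f (x + y) = f x + f y" "\<And>x r. f (x * of_real r) = f x * r"
    and e: "\<And>l. (\<Sum>j\<in>UNIV. q $ j * cpoly [:C $ j $ l:]) + (\<Sum>k\<in>UNIV. y $ k * cpoly [:A $ k $ l:]) = y $ l * cpoly [:0, 1:]"
  shows "(\<chi> j. map_poly f (q $ j)) \<in> annihilators A C"
proof -
  note ps = map_poly_part_sum[of f, OF f(1,2)] map_poly_part_add[of f, OF f(1,2)] map_poly_part_mult[of f, OF f]
  have "(\<Sum>j\<in>UNIV. map_poly f (q $ j) * [:C $ j $ l:]) + (\<Sum>k\<in>UNIV. map_poly f (y $ k) * [:A $ k $ l:])
    = map_poly f (y $ l) * [:0, 1:]" for l
    using arg_cong[OF e[of l], of "map_poly f"] unfolding ps .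
  then have "free_quotient A C (\<chi> j. map_poly f (q $ j)) (\<chi> k. map_poly f (y $ k))"
    unfolding free_quotient_def vec_lambda_beta by (simp only: mult.commute[of "[:0, 1:]"] eq_diff_eq simp_thms)
  then show ?thesis unfolding annihilators_def by blast
qed

text \<open>A nonzero polynomial multiple a of each coordinate vector lies in the module, so a I = H
  Q and Q(t) is invertible wherever a(t) is nonzero; multiplying \<open>d i\<close> by a covers the
  roots of a.\<close>

lemma generators_independent:
  fixes A :: "real^'d^'d" and C :: "real^'d^'m" and d :: "'m \<Rightarrow> complex poly"
  assumes gen: "generates Q (annihilators A C)" and z: "\<And>j. (\<Sum>i\<in>UNIV. d i * cpoly (Q $ i $ j)) = 0"
  shows "d i = 0"
proof -
  obtain a where a: "a \<noteq> 0" "peval a A = 0" using annihilating_polynomial by blast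
  have "\<forall>j. \<exists>c. axis j a = (\<Sum>i\<in>UNIV. c i *s Q $ i)"
    using generatesD(2)[OF gen annihilators_axis[OF a(2)]] by metis
  from choice[OF this] obtain H where H: "\<And>j. axis j a = (\<Sum>i\<in>UNIV. H j i *s Q $ i)" by blast
  have "poly (d i * cpoly a) t = 0" for t
  proof (cases "poly (cpoly a) t = 0")
    case False
    define \<alpha> where "\<alpha> = poly (cpoly a) t"
    have "(\<chi> j i. poly (cpoly (H j i)) t / \<alpha>) ** evalC Q t = mat 1"
    proof -
      have "(\<Sum>i\<in>UNIV. poly (cpoly (H j i)) t / \<alpha> * poly (cpoly (Q $ i $ k)) t) = (if j = k then 1 else 0)" for j k
      proof -
        have "(\<Sum>i\<in>UNIV. H j i * Q $ i $ k) = (if j = k then a else 0)"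
          using arg_cong[OF H[of j], of "\<lambda>v. v $ k"] by (auto simp: axis_def split: if_splits)
        then have "poly (cpoly (\<Sum>i\<in>UNIV. H j i * Q $ i $ k)) t = (if j = k then \<alpha> else 0)" by (simp add: \<alpha>_def)
        then have "(\<Sum>i\<in>UNIV. poly (cpoly (H j i)) t * poly (cpoly (Q $ i $ k)) t) = (if j = k then \<alpha> else 0)"
          by (simp add: cpoly_sum cpoly_mult poly_sum)
        then have "(\<Sum>i\<in>UNIV. poly (cpoly (H j i)) t * poly (cpoly (Q $ i $ k)) t) / \<alpha> = (if j = k then 1 else 0)"
          using False by (simp add: \<alpha>_def)
        then show ?thesis by (simp add: sum_divide_distrib)
      qed
      then show ?thesis by (simp add: vec_eq_iff matrix_matrix_mult_def mat_def)
    qed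
    then have inv: "evalC Q t ** (\<chi> j i. poly (cpoly (H j i)) t / \<alpha>) = mat 1" using matrix_left_right_inverse by blast
    define v where "v = (\<chi> i. poly (d i) t)"
    have "(v v* evalC Q t) $ j = 0" for j
      using arg_cong[OF z[of j], of "\<lambda>p. poly p t"] by (simp add: v_def vector_matrix_mult_def poly_sum mult.commute)
    then have "v v* evalC Q t = 0" by (simp add: vec_eq_iff)
    then have "v v* (evalC Q t ** (\<chi> j i. poly (cpoly (H j i)) t / \<alpha>)) = 0" by (simp flip: vector_matrix_mul_assoc)
    then have "v = 0" unfolding inv by simp
    then show ?thesis by (simp add: v_def vec_eq_iff)
  qed simp
  then have "d i * cpoly a = 0" by (rule poly_all_0_iff_0[THEN iffD1, OF allI])
  moreover have "cpoly a \<noteq> 0" using a(1) by (simp add: map_poly_eq_0_iff)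
  ultimately show ?thesis by simp
qed

text \<open>If w Y and w Q vanish at s, their quotients by the linear factor still satisfy the
  annihilator equation, so real and imaginary parts are combinations of the rows of
  \<open>Q\<close>. By independence w is the linear factor times a polynomial, and evaluation at s
  gives w = 0.\<close>

lemma generators_full_rank:
  fixes A :: "real^'d^'d" and C :: "real^'d^'m" and w :: "complex^'m"
  assumes gen: "generates Q (annihilators A C)" and K: "kernel_form A B C D P Q Y"
    and wY: "w v* evalC Y s = 0" and wQ: "w v* evalC Q s = 0"
  shows "w = 0"
proof -
  define qv where "qv = (\<chi> j. \<Sum>i\<in>UNIV. [:w $ i:] * cpoly (Q $ i $ j))"
  define yv where "yv = (\<chi> l. \<Sum>i\<in>UNIV. [:w $ i:] * cpoly (Y $ i $ l))"
  have "poly (qv $ j) s = 0" for j using arg_cong[OF wQ, of "\<lambda>v. v $ j"]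
    by (simp add: qv_def poly_sum vector_matrix_mult_def mult.commute)
  then obtain q where q: "qv = [:-s, 1:] *s q" by (rule poly_vec_divide)
  have "poly (yv $ j) s = 0" for j using arg_cong[OF wY, of "\<lambda>v. v $ j"]
    by (simp add: yv_def poly_sum vector_matrix_mult_def mult.commute)
  then obtain y where y: "yv = [:-s, 1:] *s y" by (rule poly_vec_divide)
  have e: "(\<Sum>j\<in>UNIV. q $ j * cpoly [:C $ j $ l:]) + (\<Sum>k\<in>UNIV. y $ k * cpoly [:A $ k $ l:]) = y $ l * cpoly [:0, 1:]" for l
  proof -
    have "(\<Sum>j\<in>UNIV. Q $ i $ j * [:C $ j $ l:]) + (\<Sum>k\<in>UNIV. Y $ i $ k * [:A $ k $ l:]) = Y $ i $ l * [:0, 1:]" for i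
      using K unfolding kernel_form_def free_quotient_def by (simp add: mult.commute)
    then have i: "(\<Sum>j\<in>UNIV. cpoly (Q $ i $ j) * cpoly [:C $ j $ l:]) + (\<Sum>k\<in>UNIV. cpoly (Y $ i $ k) * cpoly [:A $ k $ l:])
      = cpoly (Y $ i $ l) * cpoly [:0, 1:]" for i
      by (simp only: cpoly_sum[symmetric] cpoly_mult[symmetric] cpoly_add[symmetric])
    have "(\<Sum>j\<in>UNIV. qv $ j * cpoly [:C $ j $ l:]) + (\<Sum>k\<in>UNIV. yv $ k * cpoly [:A $ k $ l:])
      = (\<Sum>i\<in>UNIV. [:w $ i:] * ((\<Sum>j\<in>UNIV. cpoly (Q $ i $ j) * cpoly [:C $ j $ l:])
        + (\<Sum>k\<in>UNIV. cpoly (Y $ i $ k) * cpoly [:A $ k $ l:])))"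
      unfolding qv_def yv_def vec_lambda_beta sum_distrib_right distrib_left sum.distrib sum_distrib_left mult.assoc
      by (intro arg_cong2[of _ _ _ _ "(+)"] sum.swap)
    also have "\<dots> = yv $ l * cpoly [:0, 1:]"
      unfolding i yv_def vec_lambda_beta sum_distrib_right mult.assoc ..
    finally have "[:-s, 1:] * ((\<Sum>j\<in>UNIV. q $ j * cpoly [:C $ j $ l:]) + (\<Sum>k\<in>UNIV. y $ k * cpoly [:A $ k $ l:]))
      = [:-s, 1:] * (y $ l * cpoly [:0, 1:])"
      unfolding q y vector_smult_component distrib_left sum_distrib_left mult.assoc .
    then show ?thesis by (rule mult_left_cancel[THEN iffD1, rotated]) simp
  qed
  have "(\<chi> j. map_poly Re (q $ j)) \<in> annihilators A C" by (rule part_annihilators[OF _ _ _ e]) simp_all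
  then obtain g where g: "(\<chi> j. map_poly Re (q $ j)) = (\<Sum>i\<in>UNIV. g i *s Q $ i)" by (rule generatesD(2)[OF gen])
  have "(\<chi> j. map_poly Im (q $ j)) \<in> annihilators A C" by (rule part_annihilators[OF _ _ _ e]) simp_all
  then obtain h where h: "(\<chi> j. map_poly Im (q $ j)) = (\<Sum>i\<in>UNIV. h i *s Q $ i)" by (rule generatesD(2)[OF gen])
  define \<gamma> where "\<gamma> i = cpoly (g i) + [:\<i>:] * cpoly (h i)" for i
  have qj: "q $ j = (\<Sum>i\<in>UNIV. \<gamma> i * cpoly (Q $ i $ j))" for j
  proof -
    have "map_poly Re (q $ j) = (\<Sum>i\<in>UNIV. g i * Q $ i $ j)" "map_poly Im (q $ j) = (\<Sum>i\<in>UNIV. h i * Q $ i $ j)"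
      using arg_cong[OF g, of "\<lambda>v. v $ j"] arg_cong[OF h, of "\<lambda>v. v $ j"] by simp_all
    then have "q $ j = cpoly (\<Sum>i\<in>UNIV. g i * Q $ i $ j) + [:\<i>:] * cpoly (\<Sum>i\<in>UNIV. h i * Q $ i $ j)"
      using complex_poly_parts[of "q $ j"] by simp
    then show ?thesis by (simp only: \<gamma>_def cpoly_sum cpoly_mult distrib_right sum.distrib sum_distrib_left mult.assoc)
  qed
  have "(\<Sum>i\<in>UNIV. ([:w $ i:] - [:-s, 1:] * \<gamma> i) * cpoly (Q $ i $ j)) = 0" for j
  proof -
    have "qv $ j = [:-s, 1:] * q $ j" unfolding q by simp
    then show ?thesis unfolding qv_def vec_lambda_beta qj
      by (simp only: left_diff_distrib sum_subtractf sum_distrib_left mult.assoc diff_self)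
  qed
  from generators_independent[OF gen this] have "[:w $ i:] = [:-s, 1:] * \<gamma> i" for i by (simp only: right_minus_eq)
  from arg_cong[OF this, of "\<lambda>p. poly p s"] have "w $ i = 0" for i by simp
  then show ?thesis by (simp add: vec_eq_iff)
qed

lemma poly_zero_imag_axis:
  assumes "\<And>x::real. poly p (\<i> * of_real x) = 0"
  shows "p = (0 :: complex poly)"
proof (rule ccontr)
  assume "p \<noteq> 0"
  then have "finite {x. poly p x = 0}" by (rule poly_roots_finite)
  moreover have "range (\<lambda>x::real. \<i> * of_real x) \<subseteq> {x. poly p x = 0}" using assms by auto
  ultimately have "finite (range (\<lambda>x::real. \<i> * complex_of_real x))" by (rule rev_finite_subset)
  moreover have "inj (\<lambda>x::real. \<i> * complex_of_real x)" by (rule injI) simp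
  ultimately have "finite (UNIV :: real set)" by (rule finite_imageD)
  then show False by (simp add: infinite_UNIV_char_0)
qed

lemma gap_Phi_zero:
  fixes p :: "real poly^'m" and P :: "real poly^'n^'m"
  assumes "p v* Phi P Q = 0"
  shows "gap P Q (\<i> * of_real x) (evalCv p (\<i> * of_real x)) = 0"
proof -
  let ?s = "\<i> * complex_of_real x"
  let ?v = "evalCv p ?s"
  have z: "(\<Sum>i\<in>UNIV. ?v $ i * poly (cpoly (Phi P Q $ i $ j)) ?s) = 0" for j
  proof -
    have "(\<Sum>i\<in>UNIV. p $ i * Phi P Q $ i $ j) = 0"
      using arg_cong[OF assms, of "\<lambda>v. v $ j"] by (simp add: vector_matrix_mult_def mult.commute)
    then have "poly (cpoly (\<Sum>i\<in>UNIV. p $ i * Phi P Q $ i $ j)) ?s = 0" by simp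
    then show ?thesis by (simp add: cpoly_sum cpoly_mult poly_sum evalCv_def)
  qed
  have "complex_of_real (gap P Q ?s ?v)
    = (\<Sum>i\<in>UNIV. \<Sum>j\<in>UNIV. ?v $ i * poly (cpoly (Phi P Q $ i $ j)) ?s * cnj (?v $ j))"
    unfolding gap_def of_real_diff norm2_vec_complex vecmult_cnj_sum Phi_eval
    by (simp only: left_diff_distrib right_diff_distrib sum_subtractf)
  also have "\<dots> = (\<Sum>j\<in>UNIV. (\<Sum>i\<in>UNIV. ?v $ i * poly (cpoly (Phi P Q $ i $ j)) ?s) * cnj (?v $ j))"
    by (subst sum.swap) (simp only: sum_distrib_right)
  also have "\<dots> = 0" unfolding z by simp
  finally show ?thesis by simp
qed

text \<open>Nonnegativity of the gap is read off from \<open>gap_dual_form\<close>. For the rank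
  condition, w Q(s) = 0 puts w Y(s) into the left kernel of s minus the reduced matrix, which has no
  eigenvalue in the closed right half-plane. For condition (c), p Phi = 0 makes N times the dual
  motion vanish on the imaginary axis, hence identically; in the left half-plane the balance then
  forces p Y(s) = 0. Both end with \<open>generators_full_rank\<close>.\<close>

theorem generators_bounded_real:
  fixes A :: "real^'d^'d" and B :: "real^'n^'d" and C :: "real^'d^'m" and D :: "real^'n^'m"
  assumes gen: "generates Q (annihilators A C)" and K: "kernel_form A B C D P Q Y"
    and R: "unobs_proj A C R" and X: "pos_def X" and d: "dissipative (reduced R A) (R ** B) C D X"
  shows "bounded_real_pair P Q"
proof -
  note K' = kernel_form_reduced[OF R K]
  obtain T where T: "pos_def T" "dissipative (transpose (reduced R A)) (transpose C) (transpose (R ** B)) (transpose D) T"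
    using dual_dissipative[OF X d] by blast
  have sT: "sym_mat T" using T(1) by (simp add: pos_def_def)
  define N where "N = Lambda (transpose (reduced R A)) (transpose C) (transpose (R ** B)) (transpose D) T"
  have N: "psd N" unfolding N_def psd_Lambda_iff[OF sT] by (rule T(2))
  note gf = gap_dual_form[OF K' sT, folded N_def]
  have h0: "0 \<le> herm M v" if "psd M" for M :: "real^'k^'k" and v using that by (simp add: psd_def herm_def)
  have a: "gap P Q s w \<ge> 0" if "0 \<le> Re s" for s w
  proof -
    have "0 \<le> 2 * Re s * herm T (w v* evalC Y s)" using that h0[OF pos_def_psd[OF T(1)]] by simp
    then show ?thesis using gf[of w s] h0[OF N, of "join (w v* evalC Y s) (w v* evalC Q s)"] by linarith
  qed
  have b: "w = 0" if s: "0 \<le> Re s" and wP: "w v* evalC P s = 0" and wQ: "w v* evalC Q s = 0" for s w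
  proof -
    let ?M = "mat s - cmat (reduced R A)"
    have right: "v = 0" if "?M *v v = 0" for v
    proof (rule ccontr)
      assume v: "v \<noteq> 0"
      have "mat s *v v = s *s v"
        by (simp add: vec_eq_iff matrix_vector_mult_def mat_def mult_delta_left)
      then have ev: "cmat (reduced R A) *v v = s *s v" using that by (simp add: matrix_vector_mult_diff_rdistrib)
      have "2 * (cre v \<bullet> (X *v (reduced R A *v cre v))) + (norm (C *v cre v))\<^sup>2 \<le> 0"
        "2 * (cim v \<bullet> (X *v (reduced R A *v cim v))) + (norm (C *v cim v))\<^sup>2 \<le> 0"
        using dissipative_free[OF d] by blast+
      moreover have "cre v \<bullet> (X *v (reduced R A *v cre v)) + cim v \<bullet> (X *v (reduced R A *v cim v)) = Re s * herm X v"
      proof -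
        have "reduced R A *v cre v = cre (s *s v)" "reduced R A *v cim v = cim (s *s v)"
          unfolding ev[symmetric] cre_cim_mult by simp_all
        moreover have "sym_mat X" using X by (simp add: pos_def_def)
        ultimately show ?thesis using herm_scale[of X v s] by simp
      qed
      moreover have "0 \<le> Re s * herm X v" using s h0[OF pos_def_psd[OF X]] by simp
      ultimately have "(norm (C *v cre v))\<^sup>2 + (norm (C *v cim v))\<^sup>2 \<le> 0" by linarith
      then have "(norm (cmat C *v v))\<^sup>2 \<le> 0" unfolding norm_cre_cim cre_cim_mult .
      then have "cmat C *v v = 0" by simp
      moreover have "s \<noteq> -1" using s by auto
      ultimately show False using reduced_eigenvector[OF R ev v] by blast
    qed
    have "(w v* evalC Y s) v* ?M = 0"
      using kernel_form_row(1)[OF K', of w s] wQ by (simp add: vector_matrix_mult_diff_rdistrib row_mat)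
    then have tr: "transpose ?M *v (w v* evalC Y s) = 0" by simp
    have "w v* evalC Y s = 0"
      by (rule right_injective_of_left[OF _ tr]) (use right in \<open>simp add: vector_transpose_matrix\<close>)
    then show ?thesis using generators_full_rank[OF gen K _ wQ] by blast
  qed
  have c: "evalCv p s = 0" if p: "p v* Phi P Q = 0"
    and wP: "evalCv p s v* evalC P s = 0" and wQ: "evalCv p s v* evalC Q s = 0" for p s
  proof (cases "0 \<le> Re s")
    case True
    then show ?thesis using b wP wQ by blast
  next
    case False
    define \<zeta> where "\<zeta> z = join (evalCv p z v* evalC Y z) (evalCv p z v* evalC Q z)" for z
    \<comment> \<open>The polynomial vector with values \<open>\<zeta>\<close>, through which
      vanishing extends from the imaginary axis to all points.\<close>
    define Z where "Z = join (\<chi> a. \<Sum>k\<in>UNIV. p $ k * Y $ k $ a) (\<chi> a. \<Sum>k\<in>UNIV. p $ k * Q $ k $ a)"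
    have Z: "\<zeta> z $ k = poly (cpoly (Z $ k)) z" for z k
      by (cases k) (simp_all add: \<zeta>_def Z_def join_def evalCv_def vector_matrix_mult_def cpoly_sum cpoly_mult poly_sum mult.commute)
    have "cpoly (\<Sum>k\<in>UNIV. [:N $ i $ k:] * Z $ k) = 0" for i
    proof (rule poly_zero_imag_axis)
      fix x :: real
      have "herm N (\<zeta> (\<i> * of_real x)) = 0" unfolding \<zeta>_def gf gap_Phi_zero[OF p] by simp
      then have "cmat N *v \<zeta> (\<i> * of_real x) = 0" unfolding psd_herm_zero[OF N] .
      from arg_cong[OF this, of "\<lambda>v. v $ i"]
      show "poly (cpoly (\<Sum>k\<in>UNIV. [:N $ i $ k:] * Z $ k)) (\<i> * of_real x) = 0"
        by (simp only: matrix_vector_mult_def vec_lambda_beta Z cpoly_sum cpoly_mult cpoly_const poly_sum poly_mult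
            cmat_component zero_index) simp
    qed
    then have "poly (cpoly (\<Sum>k\<in>UNIV. [:N $ i $ k:] * Z $ k)) s = 0" for i by simp
    then have "(cmat N *v \<zeta> s) $ i = 0" for i
      by (simp only: matrix_vector_mult_def vec_lambda_beta Z cpoly_sum cpoly_mult cpoly_const poly_sum poly_mult
            cmat_component) simp
    then have "cmat N *v \<zeta> s = 0" by (simp add: vec_eq_iff)
    then have "herm N (\<zeta> s) = 0" unfolding psd_herm_zero[OF N] .
    moreover have "gap P Q s (evalCv p s) = 0" using wP wQ by (simp add: gap_def)
    ultimately have "Re s * herm T (evalCv p s v* evalC Y s) = 0" unfolding \<zeta>_def gf by simp
    then have "herm T (evalCv p s v* evalC Y s) = 0" using False by auto
    then have "evalCv p s v* evalC Y s = 0" by (rule pos_def_herm[OF T(1)])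
    then show ?thesis using generators_full_rank[OF gen K _ wQ] by blast
  qed
  show ?thesis unfolding bounded_real_pair_def full_row_rank_PmQ_iff
  proof (intro conjI allI impI)
    show "cpsd (evalC Q s ** transpose (evalC Q (cnj s)) - evalC P s ** transpose (evalC P (cnj s)))" if "0 \<le> Re s" for s
      by (rule gap_cpsd) (rule a[OF that])
    show "w = 0" if "0 \<le> Re s" "w v* evalC P s = 0" "w v* evalC Q s = 0" for s w using b that by blast
    show "evalCv p s = 0" if p: "p v* (Q ** pstar Q - P ** pstar P) = 0 \<and> evalCv p s v* evalC (PmQ P Q) s = 0" for p s
    proof (rule c)
      show "p v* Phi P Q = 0" using p by (simp add: Phi_def)
      have "(evalCv p s v* evalC (PmQ P Q) s) $ k = 0" for k using p by simp
      from this[of "Inl _"] this[of "Inr _"]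
      show "evalCv p s v* evalC P s = 0" "evalCv p s v* evalC Q s = 0"
        by (simp_all add: vec_eq_iff vector_matrix_mult_def PmQ_def cpoly_minus sum_negf)
    qed
  qed
qed

text \<open>\<open>Xm\<close> is definite only on the observable quotient. The reduced system has a
  positive definite storage function instead, whose inverse serves the dual system.\<close>

theorem dissipative_behaviour:
  fixes A :: "real^'d^'d" and B :: "real^'n^'d" and C :: "real^'d^'m" and D :: "real^'n^'m"
  assumes Xm: "psd Xm" "dissipative A B C D Xm" and ker: "\<And>z. (\<forall>k. C *v (matpow A k *v z) = 0) \<Longrightarrow> Xm *v z = 0"
  shows "\<exists>(P::real poly^'n^'m) (Q::real poly^'m^'m). bounded_real_pair P Q \<and>
    ext_beh A B C D = {(u, y). L2loc u \<and> L2loc y \<and> poly_diff_eq P Q u y}"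
proof -
  obtain R where R: "unobs_proj A C R" using unobs_proj_exists by blast
  note RD = unobs_projD[OF R]
  define E where "E = mat 1 - R"
  have E: "E *v x = x - R *v x" for x by (simp add: E_def mat_minus_vec)
  \<comment> \<open>The added square is definite on the unobservable part, where
    \<open>reduced R A\<close> acts as -1 and dissipates it.\<close>
  define X where "X = Xm + transpose E ** E"
  have X: "x \<bullet> (X *v y) = x \<bullet> (Xm *v y) + (E *v x) \<bullet> (E *v y)" for x y
    by (simp add: X_def matrix_vector_mult_add_rdistrib inner_add_right inner_matrix_transpose matrix_vector_mul_assoc)
  have sm: "sym_mat Xm" using Xm(1) by (simp add: psd_def)
  have XmE: "Xm *v (R *v x) = Xm *v x" for x
  proof -
    have "R *v (R *v x - x) = 0" by (simp add: matrix_vector_mult_diff_distrib RD(1))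
    then have "Xm *v (R *v x - x) = 0" using ker RD(2) by blast
    then show ?thesis by (simp add: matrix_vector_mult_diff_distrib)
  qed
  have "pos_def X" unfolding pos_def_def
  proof (intro conjI allI impI)
    have "transpose (transpose E ** E) = transpose E ** E" by (simp add: matrix_transpose_mul)
    then show "sym_mat X" using sm by (simp add: sym_mat_def X_def vec_eq_iff)
    fix x :: "real^'d" assume x: "x \<noteq> 0"
    have nn: "0 \<le> x \<bullet> (Xm *v x)" "0 \<le> (E *v x) \<bullet> (E *v x)" using Xm(1) by (simp_all add: psd_def)
    have "x \<bullet> (X *v x) \<noteq> 0"
    proof
      assume "x \<bullet> (X *v x) = 0"
      then have z: "x \<bullet> (Xm *v x) = 0" "(E *v x) \<bullet> (E *v x) = 0" using nn unfolding X by linarith+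
      then have "x = R *v x" by (simp add: E)
      moreover have "Xm *v x = 0" using z(1) psd_ker_iff[OF Xm(1)] by blast
      then have "C *v (matpow A k *v x) = 0" for k by (rule dissipative_ker_unobservable[OF sm dissipative_free[OF Xm(2)]])
      then have "R *v x = 0" using RD(2) by blast
      ultimately show False using x by simp
    qed
    then show "0 < x \<bullet> (X *v x)" using nn unfolding X by linarith
  qed
  moreover have "dissipative (reduced R A) (R ** B) C D X" unfolding dissipative_def
  proof (intro allI)
    fix x u
    have r: "reduced R A *v x + (R ** B) *v u = R *v (A *v x + B *v u) - E *v x"
      by (simp add: reduced_def E_def matrix_vector_mult_diff_rdistrib matrix_vector_right_distrib flip: matrix_vector_mul_assoc)
    have "Xm *v (E *v x) = 0" by (simp add: E matrix_vector_mult_diff_distrib XmE)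
    moreover have "E *v (R *v z) = 0" and "E *v (E *v z) = E *v z" for z by (simp_all add: E matrix_vector_mult_diff_distrib RD(1))
    ultimately have "x \<bullet> (X *v (reduced R A *v x + (R ** B) *v u)) = x \<bullet> (Xm *v (A *v x + B *v u)) - (E *v x) \<bullet> (E *v x)"
      unfolding r X by (simp add: matrix_vector_mult_diff_distrib XmE)
    moreover have "0 \<le> (E *v x) \<bullet> (E *v x)" by simp
    ultimately show "2 * (x \<bullet> (X *v (reduced R A *v x + (R ** B) *v u))) + (norm (C *v x + D *v u))\<^sup>2 \<le> (norm u)\<^sup>2"
      using Xm(2)[unfolded dissipative_def, rule_format, of x u] by linarith
  qed
  moreover obtain Q where gen: "generates Q (annihilators A C)"
  proof -
    have "\<exists>q::'m \<Rightarrow> real poly^'m. (\<forall>j\<in>UNIV. q j \<in> annihilators A C) \<and> (\<forall>v\<in>annihilators A C. \<exists>c. v = (\<Sum>j\<in>UNIV. c j *s q j))"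
      by (rule submodule_generators[OF submodule_annihilators]) simp
    then obtain q :: "'m \<Rightarrow> real poly^'m" where "(\<forall>j\<in>UNIV. q j \<in> annihilators A C) \<and> (\<forall>v\<in>annihilators A C. \<exists>c. v = (\<Sum>j\<in>UNIV. c j *s q j))" ..
    then have "generates (\<chi> j. q j) (annihilators A C)" by (simp add: generates_def)
    then show thesis by (rule that)
  qed
  moreover obtain P Y where K: "kernel_form A B C D P Q Y"
  proof -
    have "\<forall>i. \<exists>y. free_quotient A C (Q $ i) y" using generatesD(1)[OF gen] unfolding annihilators_def by blast
    from choice[OF this] obtain y where "\<And>i. free_quotient A C (Q $ i) (y i)" by blast
    then have "kernel_form A B C D (\<chi> i. input_row B D (y i) (Q $ i)) Q (\<chi> i. y i)" by (simp add: kernel_form_def)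
    then show thesis by (rule that)
  qed
  ultimately have "bounded_real_pair P Q" using generators_bounded_real[OF gen K R] by blast
  then show ?thesis using kernel_representation[OF gen K] by blast
qed

section \<open>Equivalence of the four conditions\<close>

lemma avail_storage_finite_iff:
  "avail_storage A B C D t0 x0 < \<infinity> \<longleftrightarrow> bdd_above (costs A B C D t0 x0)"
proof
  assume "avail_storage A B C D t0 x0 < \<infinity>"
  then obtain r where r: "avail_storage A B C D t0 x0 \<le> ereal r"
    by (metis ereal_less_eq(1) less_ereal.simps(3) less_imp_le not_le ereal_cases)
  show "bdd_above (costs A B C D t0 x0)"
  proof (rule bdd_aboveI)
    fix c assume "c \<in> costs A B C D t0 x0"
    then have "ereal c \<le> avail_storage A B C D t0 x0" unfolding avail_storage_costs by (rule SUP_upper)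
    from order_trans[OF this r] show "c \<le> r" by simp
  qed
next
  assume "bdd_above (costs A B C D t0 x0)"
  then obtain r where "\<And>c. c \<in> costs A B C D t0 x0 \<Longrightarrow> c \<le> r" unfolding bdd_above_def by blast
  then have "avail_storage A B C D t0 x0 \<le> ereal r" unfolding avail_storage_costs by (intro SUP_least) simp
  then show "avail_storage A B C D t0 x0 < \<infinity>" by (rule le_less_trans) simp
qed

lemma costs_zero: "0 \<in> costs A B C D t0 x0" for B :: "real^'n^'d"
proof -
  have "L2loc (\<lambda>_. 0 :: real^'n)" by (simp add: L2loc_continuous)
  from ctraj_exists[OF this, of t0 x0 A B] obtain x where "x t0 = x0" "ctraj A B x (\<lambda>_. 0)" by blast
  moreover have "(LINT t:{t0..t0}|lborel. surplus C D x (\<lambda>_. 0) t) = 0"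
    using set_borel_integral_eq_integral(2)[OF surplus_integrable(1)[OF calculation(2), of t0 t0]] by simp
  ultimately show ?thesis unfolding costs_def
    by (intro CollectI exI[of _ t0] exI[of _ x] exI[of _ "\<lambda>_. 0"]) simp
qed

lemma avail_storage_eq:
  assumes bdd: "bdd_above (costs A B C D t0 x0)"
  shows "avail_storage A B C D t0 x0 = ereal (Sup (costs A B C D t0 x0))"
proof -
  have "0 \<le> avail_storage A B C D t0 x0"
    using SUP_upper[OF costs_zero, of ereal A B C D t0 x0] unfolding avail_storage_costs by (simp add: zero_ereal_def)
  moreover have "avail_storage A B C D t0 x0 < \<infinity>" using bdd unfolding avail_storage_finite_iff .
  ultimately have "\<bar>SUP c\<in>costs A B C D t0 x0. ereal c\<bar> \<noteq> \<infinity>" unfolding avail_storage_costs by auto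
  from ereal_Sup[OF this] show ?thesis unfolding avail_storage_costs ..
qed

text \<open>A free motion starting in an unobservable state is invisible at the output, so it can be
  subtracted from any trajectory without changing the cost.\<close>
lemma costs_unobservable:
  fixes A :: "real^'d^'d" and B :: "real^'n^'d" and C :: "real^'d^'m" and D :: "real^'n^'m"
  assumes z: "\<And>k. C *v (matpow A k *v z) = 0"
  shows "costs A B C D t0 z \<subseteq> costs A B C D t0 0"
proof
  fix c assume "c \<in> costs A B C D t0 z"
  then obtain t1 x u where t: "t0 \<le> t1" and tr: "ctraj A B x u" and x: "x t0 = z"
    and c: "c = (LINT t:{t0..t1}|lborel. surplus C D x u t)" unfolding costs_def by blast
  have "L2loc (\<lambda>_. 0 :: real^'n)" by (simp add: L2loc_continuous)
  from ctraj_exists[OF this] obtain f where f: "f t0 = z" "ctraj A B f (\<lambda>_. 0)" by blast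
  obtain R where R: "unobs_proj A C R" using unobs_proj_exists by blast
  note RD = unobs_projD[OF R]
  have "antideriv f (\<lambda>t. A *v f t)" using f(2) by (simp add: ctraj_def)
  from antideriv_bounded_linear[OF this matrix_vector_mul_bounded_linear[of R]]
  have "antideriv (\<lambda>t. R *v f t) (\<lambda>t. (R ** A) *v (R *v f t))"
    by (simp add: RD(5) flip: matrix_vector_mul_assoc)
  moreover have "R *v f t0 = 0" using z RD(2) f(1) by simp
  ultimately have "R *v f t = 0" for t by (rule linear_ode_unique)
  then have Cf: "C *v f t = 0" for t using RD(4)[of "f t"] by simp
  have "ctraj A B (\<lambda>t. x t - f t) u" using ctraj_linear(2)[OF tr f(2)] by simp
  moreover have "surplus C D (\<lambda>t. x t - f t) u = surplus C D x u"
    by (simp add: surplus_def[abs_def] matrix_vector_mult_diff_distrib Cf)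
  ultimately show "c \<in> costs A B C D t0 0" unfolding costs_def using t x f(1) c by (intro CollectI exI[of _ t1] exI[of _ "\<lambda>t. x t - f t"] exI[of _ u]) simp
qed

text \<open>Costs from an unobservable state are among those from 0, whose supremum is 0; conversely
  the kernel of a dissipative form is unobservable. Minimality is
  \<open>dissipation_bound\<close>.\<close>

theorem available_storage_quadratic:
  fixes A :: "real^'d^'d" and B :: "real^'n^'d" and C :: "real^'d^'m" and D :: "real^'n^'m"
  assumes fin: "\<And>x0. avail_storage A B C D t0 x0 < \<infinity>"
  shows "\<exists>Xm. psd Xm \<and> dissipative A B C D Xm \<and> (\<forall>z. Vo A C *v z = 0 \<longleftrightarrow> Xm *v z = 0) \<and>
    (\<forall>X. psd X \<and> dissipative A B C D X \<longrightarrow> psd (X - Xm)) \<and>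
    (\<forall>x0. avail_storage A B C D t0 x0 = ereal (x0 \<bullet> (Xm *v x0)))"
proof -
  have bdd: "bdd_above (costs A B C D t0 x0)" for x0 using fin unfolding avail_storage_finite_iff .
  obtain Xm where Xm: "sym_mat Xm" "psd Xm" "dissipative A B C D Xm" "\<And>x. Sup (costs A B C D t0 x) = x \<bullet> (Xm *v x)"
    using storage_quadratic[OF bdd] by blast
  have "Vo A C *v z = 0 \<longleftrightarrow> Xm *v z = 0" for z
  proof
    assume "Vo A C *v z = 0"
    then have "costs A B C D t0 z \<subseteq> costs A B C D t0 0" unfolding Vo_ker_iff by (intro costs_unobservable) blast
    then have "Sup (costs A B C D t0 z) \<le> Sup (costs A B C D t0 0)"
      using costs_zero bdd by (intro cSup_subset_mono) blast+
    then have "z \<bullet> (Xm *v z) \<le> 0" unfolding Xm(4) by simp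
    moreover have "0 \<le> z \<bullet> (Xm *v z)" using Xm(2) by (simp add: psd_def)
    ultimately show "Xm *v z = 0" using psd_ker_iff[OF Xm(2), of z] by simp
  next
    assume "Xm *v z = 0"
    from dissipative_ker_unobservable[OF Xm(1) dissipative_free[OF Xm(3)] this]
    show "Vo A C *v z = 0" unfolding Vo_ker_iff by blast
  qed
  moreover have "psd (X - Xm)" if X: "psd X" "dissipative A B C D X" for X
  proof -
    have sX: "sym_mat X" using X by (simp add: psd_def)
    then have "sym_mat (X - Xm)" using Xm(1) by (simp add: sym_mat_def vec_eq_iff)
    moreover have "z \<bullet> (Xm *v z) \<le> z \<bullet> (X *v z)" for z unfolding Xm(4)[symmetric]
    proof (rule cSup_least)
      show "costs A B C D t0 z \<noteq> {}" using costs_zero by blast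
      show "c \<le> z \<bullet> (X *v z)" if "c \<in> costs A B C D t0 z" for c
        using that dissipation_bound[OF sX X] unfolding costs_def by auto
    qed
    ultimately show ?thesis by (simp add: psd_def matrix_vector_mult_diff_rdistrib inner_diff_right)
  qed
  moreover have "avail_storage A B C D t0 x0 = ereal (x0 \<bullet> (Xm *v x0))" for x0
    unfolding avail_storage_eq[OF bdd] Xm(4) ..
  ultimately show ?thesis using Xm(2,3) by blast
qed

lemma dissipative_storage_finite:
  assumes X: "psd X" "dissipative A B C D X"
  shows "avail_storage A B C D t0 x0 < \<infinity>"
proof -
  have sX: "sym_mat X" using X by (simp add: psd_def)
  have "c \<le> x0 \<bullet> (X *v x0)" if "c \<in> costs A B C D t0 x0" for c
    using that dissipation_bound[OF sX X] unfolding costs_def by auto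
  then show ?thesis unfolding avail_storage_finite_iff by (rule bdd_aboveI)
qed

theorem theorem20:
  fixes A :: "real^'d^'d" and B :: "real^'n^'d" and C :: "real^'d^'m" and D :: "real^'n^'m"
    and t0 :: real
  defines "S \<equiv> avail_storage A B C D t0"
      and "Xminus \<equiv> (\<lambda>Xm. sym_mat Xm \<and> psd Xm \<and> psd (Lambda A B C D Xm) \<and>
              (\<forall>z. Vo A C *v z = 0 \<longleftrightarrow> Xm *v z = 0) \<and>
              (\<forall>X. sym_mat X \<and> psd X \<and> psd (Lambda A B C D X) \<longrightarrow> psd (X - Xm)))"
  shows "(((\<forall>x0. S x0 < \<infinity>) \<longleftrightarrow>
            (\<exists>(P::real poly^'n^'m) (Q::real poly^'m^'m). bounded_real_pair P Q \<and>
               ext_beh A B C D = {(u, y). L2loc u \<and> L2loc y \<and> poly_diff_eq P Q u y})) \<and>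
         ((\<forall>x0. S x0 < \<infinity>) \<longleftrightarrow>
            (\<exists>X. sym_mat X \<and> psd X \<and> psd (Lambda A B C D X))) \<and>
         ((\<forall>x0. S x0 < \<infinity>) \<longleftrightarrow>
            (\<exists>Xm. Xminus Xm \<and> (\<forall>x0. S x0 = ereal (x0 \<bullet> (Xm *v x0)))))) \<and>
         (observable C A \<and> (\<forall>x0. S x0 < \<infinity>) \<longrightarrow>
            (\<forall>c\<in>spec A. Re c < 0) \<and>
            (\<forall>Xm. Xminus Xm \<and> (\<forall>x0. S x0 = ereal (x0 \<bullet> (Xm *v x0))) \<longrightarrow>
               (\<forall>X. sym_mat X \<and> psd (Lambda A B C D X) \<longrightarrow> psd (X - Xm))))"
proof -
  have LM: "sym_mat X \<and> psd X \<and> psd (Lambda A B C D X) \<longleftrightarrow> psd X \<and> dissipative A B C D X" for X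
    using psd_Lambda_iff[of X A B C D] unfolding psd_def by blast
  have Xm: "Xminus Xm \<longleftrightarrow> psd Xm \<and> dissipative A B C D Xm \<and> (\<forall>z. Vo A C *v z = 0 \<longleftrightarrow> Xm *v z = 0) \<and>
    (\<forall>X. psd X \<and> dissipative A B C D X \<longrightarrow> psd (X - Xm))" for Xm
    unfolding Xminus_def LM using LM[of Xm] by blast
  \<comment> \<open>The minimal solution closes the cycle: finiteness yields it, and any solution
    yields finiteness.\<close>
  have c14: "\<exists>Xm. Xminus Xm \<and> (\<forall>x0. S x0 = ereal (x0 \<bullet> (Xm *v x0)))" if "\<forall>x0. S x0 < \<infinity>"
  proof -
    from that have "\<And>x0. avail_storage A B C D t0 x0 < \<infinity>" by (simp add: S_def)
    from available_storage_quadratic[OF this] show ?thesis unfolding Xm S_def by (simp only: conj_assoc)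
  qed
  have c31: "\<forall>x0. S x0 < \<infinity>" if "psd X" "dissipative A B C D X" for X
    unfolding S_def using dissipative_storage_finite[OF that] by blast
  have c2: "(\<forall>x0. S x0 < \<infinity>) \<longleftrightarrow> (\<exists>(P::real poly^'n^'m) (Q::real poly^'m^'m). bounded_real_pair P Q \<and>
    ext_beh A B C D = {(u, y). L2loc u \<and> L2loc y \<and> poly_diff_eq P Q u y})"
  proof
    assume "\<forall>x0. S x0 < \<infinity>"
    then obtain Xm where m: "Xminus Xm" using c14 by blast
    show "\<exists>(P::real poly^'n^'m) (Q::real poly^'m^'m). bounded_real_pair P Q \<and>
      ext_beh A B C D = {(u, y). L2loc u \<and> L2loc y \<and> poly_diff_eq P Q u y}"
    proof (rule dissipative_behaviour)
      show "psd Xm" "dissipative A B C D Xm" using m unfolding Xm by blast+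
      show "Xm *v z = 0" if "\<forall>k. C *v (matpow A k *v z) = 0" for z
        using m that unfolding Xm Vo_ker_iff by blast
    qed
  next
    assume "\<exists>(P::real poly^'n^'m) (Q::real poly^'m^'m). bounded_real_pair P Q \<and>
      ext_beh A B C D = {(u, y). L2loc u \<and> L2loc y \<and> poly_diff_eq P Q u y}"
    then obtain P :: "real poly^'n^'m" and Q :: "real poly^'m^'m" where br: "bounded_real_pair P Q"
      and beh: "ext_beh A B C D = {(u, y). L2loc u \<and> L2loc y \<and> poly_diff_eq P Q u y}" by (elim exE conjE)
    have "poly_diff_eq P Q u (\<lambda>t. C *v x t + D *v u t)" if tr: "ctraj A B x u" for x u
    proof -
      have "(u, (\<lambda>t. C *v x t + D *v u t), x) \<in> Bs A B C D"
        unfolding Bs_iff using tr ctraj_L2loc(3)[OF tr] by simp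
      then have "(u, (\<lambda>t. C *v x t + D *v u t)) \<in> ext_beh A B C D" unfolding ext_beh_def by blast
      then show ?thesis unfolding beh by simp
    qed
    from behaviour_dissipative[OF br this] show "\<forall>x0. S x0 < \<infinity>" using c31 by blast
  qed
  have c3: "(\<forall>x0. S x0 < \<infinity>) \<longleftrightarrow> (\<exists>X. sym_mat X \<and> psd X \<and> psd (Lambda A B C D X))"
    unfolding LM using c14 c31 unfolding Xm by blast
  have c4: "(\<forall>x0. S x0 < \<infinity>) \<longleftrightarrow> (\<exists>Xm. Xminus Xm \<and> (\<forall>x0. S x0 = ereal (x0 \<bullet> (Xm *v x0))))"
    using c14 by (auto simp del: Xm)
  have obs: "(\<forall>c\<in>spec A. Re c < 0) \<and> (\<forall>Xm. Xminus Xm \<and> (\<forall>x0. S x0 = ereal (x0 \<bullet> (Xm *v x0))) \<longrightarrow>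
      (\<forall>X. sym_mat X \<and> psd (Lambda A B C D X) \<longrightarrow> psd (X - Xm)))"
    if ob: "observable C A" and fin: "\<forall>x0. S x0 < \<infinity>"
  proof (intro conjI ballI allI impI)
    obtain Xm where m: "psd Xm" "dissipative A B C D Xm" using c14[OF fin] unfolding Xm by blast
    show "Re c < 0" if "c \<in> spec A" for c
      using that observable_spec[OF ob m(1) dissipative_free[OF m(2)]] unfolding spec_def by blast
    fix X1 X assume X1: "Xminus X1 \<and> (\<forall>x0. S x0 = ereal (x0 \<bullet> (X1 *v x0)))" and X: "sym_mat X \<and> psd (Lambda A B C D X)"
    then have d: "sym_mat X" "dissipative A B C D X" using psd_Lambda_iff[of X A B C D] by blast+
    \<comment> \<open>Observability makes every solution of the matrix inequality semidefinite, so
      minimality among semidefinite solutions applies.\<close>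
    then have "psd X" using observable_dissipative_psd[OF ob m] by blast
    then show "psd (X - X1)" using X1 d unfolding Xm by blast
  qed
  show ?thesis using c2 c3 c4 obs by blast
qed

end
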